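(* (Inversion formula) Let $\mathcal{R}\subset\mathbb{R}^N\setminus\{0\}$ be a reduced root system and $k$ a non-negative multiplicity function on $\mathcal{R}$. 1) Let $r$ be any positive integer. Suppose $2\langle k\rangle+N>2-\frac1r$. Then $\mathcal{F}_{k,\frac1r}$ is an involutive unitary operator on $L^2(\mathbb{R}^N,\vartheta_{k,\frac1r}(x)dx)$. Namely, the inversion formula is given by $(\mathcal{F}_{k,\frac1r})^{-1}=\mathcal{F}_{k,\frac1r}$. 2) Let $r$ be any non-negative integer. Suppose $2\langle k\rangle+N>2-\frac{2}{2r+1}$. Then $\mathcal{F}_{k,\frac{2}{2r+1}}$ is a unitary operator of order four on $L^2(\mathbb{R}^N,\vartheta_{k,\frac{2}{2r+1}}(x)dx)$. The inversion formula is given as $$(\mathcal{F}_{k,\frac{2}{2r+1}}^{-1}f)(x)=(\mathcal{F}_{k,\frac{2}{2r+1}}f)(-x).$$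
   Context: Let $N\ge1$, $\langle\cdot,\cdot\rangle$ the standard inner product on $\mathbb{R}^N$, $\|x\|=\langle x,x\rangle^{1/2}$, $r_\alpha(x)=x-2\frac{\langle\alpha,x\rangle}{\|\alpha\|^2}\alpha$. A (reduced) root system is a finite set $\mathcal{R}\subset\mathbb{R}^N\setminus\{0\}$ with $r_\alpha(\mathcal{R})=\mathcal{R}$ and $\mathcal{R}\cap\mathbb{R}\alpha=\{\pm\alpha\}$ for all $\alpha\in\mathcal{R}$. $\mathfrak{C}$ is the finite Coxeter group generated by $\{r_\alpha\}$, $\mathcal{R}^+$ a positive subsystem. A multiplicity function is a $\mathfrak{C}$-invariant function $k=(k_\alpha)$ on $\mathcal{R}$; non-negative means all $k_\alpha\ge0$; $\langle k\rangle=\sum_{\alpha\in\mathcal{R}^+}k_\alpha$. Dunkl operators: $T_\xi(k)f(x)=\partial_\xi f(x)+\sum_{\alpha\in\mathcal{R}^+}k_\alpha\langle\alpha,\xi\rangle\frac{f(x)-f(r_\alpha x)}{\langle\alpha,x\rangle}$; Dunkl Laplacian $\Delta_k=\sum_{j=1}^NT_{\xi_j}(k)^2$ for an orthonormal basis $(\xi_j)$. For $a>0$, $\vartheta_{k,a}(x)=\|x\|^{a-2}\prod_{\alpha\in\mathcal{R}}|\langle\alpha,x\rangle|^{k_\alpha}$. Let $\mathcal{H}_k^m(\mathbb{R}^N)$ be the homogeneous polynomials $p$ of degree $m$ with $\Delta_kp=0$, $\lambda_{k,a,m}=\frac{2m+2\langle k\rangle+N-2}{a}$, $L_\ell^{(\lambda)}$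 the Laguerre polynomials. For $a>0$ with $a+2\langle k\rangle+N-2>0$, the operator $\|x\|^{2-a}\Delta_k-\|x\|^a$ is essentially self-adjoint on $L^2(\mathbb{R}^N,\vartheta_{k,a}(x)dx)$ with domain the span of the functions $p(x)L_\ell^{(\lambda_{k,a,m})}(\frac2a\|x\|^a)e^{-\|x\|^a/a}$ ($\ell,m\in\mathbb{N}$, $p\in\mathcal{H}_k^m(\mathbb{R}^N)$), and $\mathcal{F}_{k,a}=e^{i\frac\pi2\left(\frac{2\langle k\rangle+N+a-2}{a}\right)}\exp\big(\frac{\pi i}{2a}(\|x\|^{2-a}\Delta_k-\|x\|^a)\big)$ by functional calculus of its closure. *)

theory Defs
  imports "HOL-Analysis.Analysis"
begin

section \<open>Root systems and multiplicity functions\<close>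

text \<open>The space \<open>\<real>\<^sup>N\<close> is \<^typ>\<open>real ^ 'n\<close>, with \<open>N = CARD('n)\<close>.\<close>

definition root_reflection :: "real ^ 'n \<Rightarrow> real ^ 'n \<Rightarrow> real ^ 'n" where
  "root_reflection \<alpha> x = x - (2 * (\<alpha> \<bullet> x) / (norm \<alpha>)\<^sup>2) *\<^sub>R \<alpha>"

definition reduced_root_system :: "(real ^ 'n) set \<Rightarrow> bool" where
  "reduced_root_system R \<longleftrightarrow>
     finite R \<and> 0 \<notin> R \<and>
     (\<forall>\<alpha>\<in>R. root_reflection \<alpha> ` R = R \<and> R \<inter> range (\<lambda>c. c *\<^sub>R \<alpha>) = {\<alpha>, - \<alpha>})"

text \<open>Reflections are involutions, so the monoid they generate is already a group.\<close>

inductive_set coxeter_group :: "(real ^ 'n) set \<Rightarrow> (real ^ 'n \<Rightarrow> real ^ 'n) set"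
  for R :: "(real ^ 'n) set" where
  one: "id \<in> coxeter_group R"
| step: "\<alpha> \<in> R \<Longrightarrow> w \<in> coxeter_group R \<Longrightarrow> root_reflection \<alpha> \<circ> w \<in> coxeter_group R"

definition positive_subsystem :: "(real ^ 'n) set \<Rightarrow> (real ^ 'n) set \<Rightarrow> bool" where
  "positive_subsystem R P \<longleftrightarrow>
     (\<exists>v. (\<forall>\<alpha>\<in>R. \<alpha> \<bullet> v \<noteq> 0) \<and> P = {\<alpha> \<in> R. \<alpha> \<bullet> v > 0})"

text \<open>Only the values of \<open>k\<close> on \<open>R\<close> are ever used.\<close>

definition multiplicity_function :: "(real ^ 'n) set \<Rightarrow> (real ^ 'n \<Rightarrow> real) \<Rightarrow> bool" where
  "multiplicity_function R k \<longleftrightarrow> (\<forall>w\<in>coxeter_group R. \<forall>\<alpha>\<in>R. k (w \<alpha>) = k \<alpha>)"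

definition mult_index :: "(real ^ 'n) set \<Rightarrow> (real ^ 'n \<Rightarrow> real) \<Rightarrow> real" where
  "mult_index P k = (\<Sum>\<alpha>\<in>P. k \<alpha>)"


section \<open>Dunkl operators\<close>

definition dir_deriv :: "real ^ 'n \<Rightarrow> (real ^ 'n \<Rightarrow> complex) \<Rightarrow> real ^ 'n \<Rightarrow> complex" where
  "dir_deriv \<xi> f x = vector_derivative (\<lambda>t. f (x + t *\<^sub>R \<xi>)) (at 0)"

text \<open>On the hyperplane \<open>\<alpha> \<bullet> x = 0\<close> the difference quotient has a removable singularity
  for smooth \<open>f\<close>; the first branch is the value of its continuous extension.\<close>

definition reflection_quotient ::
    "real ^ 'n \<Rightarrow> (real ^ 'n \<Rightarrow> complex) \<Rightarrow> real ^ 'n \<Rightarrow> complex" where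
  "reflection_quotient \<alpha> f x =
     (if \<alpha> \<bullet> x = 0 then complex_of_real (2 / (norm \<alpha>)\<^sup>2) * dir_deriv \<alpha> f x
      else (f x - f (root_reflection \<alpha> x)) / complex_of_real (\<alpha> \<bullet> x))"

definition dunkl_op ::
    "(real ^ 'n) set \<Rightarrow> (real ^ 'n \<Rightarrow> real) \<Rightarrow> real ^ 'n \<Rightarrow> (real ^ 'n \<Rightarrow> complex) \<Rightarrow> real ^ 'n \<Rightarrow> complex"
  where
  "dunkl_op P k \<xi> f x =
     dir_deriv \<xi> f x + (\<Sum>\<alpha>\<in>P. complex_of_real (k \<alpha> * (\<alpha> \<bullet> \<xi>)) * reflection_quotient \<alpha> f x)"

definition dunkl_laplacian ::
    "(real ^ 'n) set \<Rightarrow> (real ^ 'n \<Rightarrow> real) \<Rightarrow> (real ^ 'n \<Rightarrow> complex) \<Rightarrow> real ^ 'n \<Rightarrow> complex" where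
  "dunkl_laplacian P k f x = (\<Sum>\<xi>\<in>Basis. dunkl_op P k \<xi> (dunkl_op P k \<xi> f) x)"

definition homogeneous_poly :: "nat \<Rightarrow> (real ^ 'n \<Rightarrow> complex) \<Rightarrow> bool" where
  "homogeneous_poly m p \<longleftrightarrow>
     (\<exists>c. \<forall>x. p x = (\<Sum>\<beta> | sum \<beta> (UNIV :: 'n set) = m.
                        c \<beta> * complex_of_real (\<Prod>i\<in>UNIV. (x $ i) ^ \<beta> i)))"

definition dunkl_harmonics ::
    "(real ^ 'n) set \<Rightarrow> (real ^ 'n \<Rightarrow> real) \<Rightarrow> nat \<Rightarrow> (real ^ 'n \<Rightarrow> complex) set" where
  "dunkl_harmonics P k m = {p. homogeneous_poly m p \<and> (\<forall>x. dunkl_laplacian P k p x = 0)}"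


section \<open>The space \<open>L\<^sup>2\<close>\<close>

text \<open>Elements of \<open>L\<^sup>2\<close> are handled through representatives: \<open>l2 M\<close> is the set of
  square-integrable functions and \<open>l2_eq M\<close> is equality of their classes.\<close>

definition l2 :: "'a measure \<Rightarrow> ('a \<Rightarrow> complex) set" where
  "l2 M = {f \<in> borel_measurable M. integrable M (\<lambda>x. (cmod (f x))\<^sup>2)}"

definition l2_eq :: "'a measure \<Rightarrow> ('a \<Rightarrow> complex) \<Rightarrow> ('a \<Rightarrow> complex) \<Rightarrow> bool" where
  "l2_eq M f g \<longleftrightarrow> (AE x in M. f x = g x)"

definition l2_inner :: "'a measure \<Rightarrow> ('a \<Rightarrow> complex) \<Rightarrow> ('a \<Rightarrow> complex) \<Rightarrow> complex" where
  "l2_inner M f g = (\<integral>x. f x * cnj (g x) \<partial>M)"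

definition l2_norm :: "'a measure \<Rightarrow> ('a \<Rightarrow> complex) \<Rightarrow> real" where
  "l2_norm M f = sqrt (\<integral>x. (cmod (f x))\<^sup>2 \<partial>M)"

text \<open>Everywhere defined linear operators; the second clause says that the operator
  descends to classes.\<close>

definition l2_operator :: "'a measure \<Rightarrow> (('a \<Rightarrow> complex) \<Rightarrow> 'a \<Rightarrow> complex) \<Rightarrow> bool" where
  "l2_operator M U \<longleftrightarrow>
     (\<forall>f\<in>l2 M. U f \<in> l2 M) \<and>
     (\<forall>f\<in>l2 M. \<forall>g\<in>l2 M. l2_eq M f g \<longrightarrow> l2_eq M (U f) (U g)) \<and>
     (\<forall>f\<in>l2 M. \<forall>g\<in>l2 M. \<forall>c d.
        l2_eq M (U (\<lambda>x. c * f x + d * g x)) (\<lambda>x. c * U f x + d * U g x))"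

definition l2_unitary :: "'a measure \<Rightarrow> (('a \<Rightarrow> complex) \<Rightarrow> 'a \<Rightarrow> complex) \<Rightarrow> bool" where
  "l2_unitary M U \<longleftrightarrow>
     l2_operator M U \<and>
     (\<forall>f\<in>l2 M. \<forall>g\<in>l2 M. l2_inner M (U f) (U g) = l2_inner M f g) \<and>
     (\<forall>g\<in>l2 M. \<exists>f\<in>l2 M. l2_eq M (U f) g)"

text \<open>Inverse of a bijective operator; the value is determined up to \<open>l2_eq M\<close>.\<close>

definition l2_inverse ::
    "'a measure \<Rightarrow> (('a \<Rightarrow> complex) \<Rightarrow> 'a \<Rightarrow> complex) \<Rightarrow> ('a \<Rightarrow> complex) \<Rightarrow> 'a \<Rightarrow> complex" where
  "l2_inverse M U g = (SOME f. f \<in> l2 M \<and> l2_eq M (U f) g)"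

definition l2_is_identity :: "'a measure \<Rightarrow> (('a \<Rightarrow> complex) \<Rightarrow> 'a \<Rightarrow> complex) \<Rightarrow> bool" where
  "l2_is_identity M U \<longleftrightarrow> (\<forall>f\<in>l2 M. l2_eq M (U f) f)"

definition l2_has_order :: "'a measure \<Rightarrow> (('a \<Rightarrow> complex) \<Rightarrow> 'a \<Rightarrow> complex) \<Rightarrow> nat \<Rightarrow> bool" where
  "l2_has_order M U n \<longleftrightarrow>
     0 < n \<and> l2_is_identity M (U ^^ n) \<and> (\<forall>j. 0 < j \<and> j < n \<longrightarrow> \<not> l2_is_identity M (U ^^ j))"


section \<open>Functional calculus of unbounded operators\<close>

text \<open>An unbounded operator is represented by its graph. The closure below is the closure in
  the product of the two \<open>L\<^sup>2\<close> spaces, and is therefore saturated under \<open>l2_eq M\<close>.\<close>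

type_synonym 'a op_graph = "(('a \<Rightarrow> complex) \<times> ('a \<Rightarrow> complex)) set"

definition l2_closure :: "'a measure \<Rightarrow> 'a op_graph \<Rightarrow> 'a op_graph" where
  "l2_closure M T =
     {(f, g). f \<in> l2 M \<and> g \<in> l2 M \<and>
        (\<forall>\<epsilon>>0. \<exists>(f', g')\<in>T. f' \<in> l2 M \<and> g' \<in> l2 M \<and>
           l2_norm M (\<lambda>x. f x - f' x) < \<epsilon> \<and> l2_norm M (\<lambda>x. g x - g' x) < \<epsilon>)}"

text \<open>Projection-valued measures on the Borel sets of the real line.\<close>

definition projection_valued_measure ::
    "'a measure \<Rightarrow> (real set \<Rightarrow> ('a \<Rightarrow> complex) \<Rightarrow> 'a \<Rightarrow> complex) \<Rightarrow> bool" where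
  "projection_valued_measure M E \<longleftrightarrow>
     (\<forall>B\<in>sets borel. l2_operator M (E B) \<and>
        (\<forall>f\<in>l2 M. l2_eq M (E B (E B f)) (E B f)) \<and>
        (\<forall>f\<in>l2 M. \<forall>g\<in>l2 M. l2_inner M (E B f) g = l2_inner M f (E B g))) \<and>
     (\<forall>f\<in>l2 M. l2_eq M (E {} f) (\<lambda>x. 0)) \<and>
     (\<forall>f\<in>l2 M. l2_eq M (E UNIV f) f) \<and>
     (\<forall>A\<in>sets borel. \<forall>B\<in>sets borel. \<forall>f\<in>l2 M. l2_eq M (E A (E B f)) (E (A \<inter> B) f)) \<and>
     (\<forall>B :: nat \<Rightarrow> real set. range B \<subseteq> sets borel \<longrightarrow> disjoint_family B \<longrightarrow>
        (\<forall>f\<in>l2 M. (\<lambda>n. l2_norm M (\<lambda>x. (\<Sum>i<n. E (B i) f x) - E (\<Union>i. B i) f x)) \<longlonglongrightarrow> 0))"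

text \<open>The scalar measure \<open>B \<mapsto> \<langle>E(B) f, f\<rangle>\<close>.\<close>

definition scalar_spectral_measure ::
    "'a measure \<Rightarrow> (real set \<Rightarrow> ('a \<Rightarrow> complex) \<Rightarrow> 'a \<Rightarrow> complex) \<Rightarrow> ('a \<Rightarrow> complex) \<Rightarrow> real measure"
  where
  "scalar_spectral_measure M E f =
     measure_of UNIV (sets borel) (\<lambda>B. ennreal (Re (l2_inner M (E B f) f)))"

text \<open>\<open>E\<close> is the spectral measure of the operator with graph \<open>T\<close>, i.e. \<open>T = \<integral> t dE(t)\<close>: the domain
  is \<open>{f. \<integral> t\<^sup>2 d\<langle>E(t) f, f\<rangle> < \<infinity>}\<close> and \<open>\<langle>T f, f\<rangle> = \<integral> t d\<langle>E(t) f, f\<rangle>\<close> there (which determines \<open>T f\<close> by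
  polarization, the scalars being complex). For a linear operator \<open>T\<close> (with graph
  saturated under \<open>l2_eq M\<close>), the spectral theorem says that such an \<open>E\<close> exists exactly when
  \<open>T\<close> is self-adjoint, and that it is unique up to \<open>l2_eq M\<close>.\<close>

definition spectral_measure_of ::
    "'a measure \<Rightarrow> 'a op_graph \<Rightarrow> (real set \<Rightarrow> ('a \<Rightarrow> complex) \<Rightarrow> 'a \<Rightarrow> complex) \<Rightarrow> bool" where
  "spectral_measure_of M T E \<longleftrightarrow>
     projection_valued_measure M E \<and>
     Domain T = {f \<in> l2 M. integrable (scalar_spectral_measure M E f) (\<lambda>t. t\<^sup>2)} \<and>
     (\<forall>(f, g)\<in>T. l2_inner M g f =
        complex_of_real (\<integral>t. t \<partial>scalar_spectral_measure M E f))"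

text \<open>For bounded Borel \<open>\<phi>\<close>, the operator \<open>\<phi>(T) = \<integral> \<phi>(t) dE(t)\<close>. The representatives of the
  values are arbitrary, hence the choice operator.\<close>

definition functional_calculus ::
    "'a measure \<Rightarrow> 'a op_graph \<Rightarrow> (real \<Rightarrow> complex) \<Rightarrow> ('a \<Rightarrow> complex) \<Rightarrow> 'a \<Rightarrow> complex" where
  "functional_calculus M T \<phi> =
     (SOME U. \<exists>E. spectral_measure_of M T E \<and> l2_operator M U \<and>
        (\<forall>f\<in>l2 M. l2_inner M (U f) f = (\<integral>t. \<phi> t \<partial>scalar_spectral_measure M E f)))"


section \<open>The generalized Fourier transform \<open>\<F>\<^bsub>k,a\<^esub>\<close>\<close>

text \<open>Since \<open>0 powr 0 = 0\<close>, the weight may deviate from the usual convention on a Lebesgue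
  null set (the origin and the root hyperplanes), which does not affect the measure.\<close>

definition dunkl_weight :: "(real ^ 'n) set \<Rightarrow> (real ^ 'n \<Rightarrow> real) \<Rightarrow> real \<Rightarrow> real ^ 'n \<Rightarrow> real" where
  "dunkl_weight R k a x = norm x powr (a - 2) * (\<Prod>\<alpha>\<in>R. \<bar>\<alpha> \<bullet> x\<bar> powr k \<alpha>)"

definition dunkl_measure ::
    "(real ^ 'n) set \<Rightarrow> (real ^ 'n \<Rightarrow> real) \<Rightarrow> real \<Rightarrow> (real ^ 'n) measure" where
  "dunkl_measure R k a = density lborel (\<lambda>x. ennreal (dunkl_weight R k a x))"

definition laguerre :: "nat \<Rightarrow> real \<Rightarrow> real \<Rightarrow> real" where
  "laguerre l s t = (\<Sum>j\<le>l. (-1) ^ j * ((s + real l) gchoose (l - j)) * t ^ j / fact j)"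

definition lambda_kam :: "(real ^ 'n) set \<Rightarrow> (real ^ 'n \<Rightarrow> real) \<Rightarrow> real \<Rightarrow> nat \<Rightarrow> real" where
  "lambda_kam P k a m = (2 * real m + 2 * mult_index P k + real CARD('n) - 2) / a"

definition laguerre_functions ::
    "(real ^ 'n) set \<Rightarrow> (real ^ 'n \<Rightarrow> real) \<Rightarrow> real \<Rightarrow> (real ^ 'n \<Rightarrow> complex) set" where
  "laguerre_functions P k a =
     {(\<lambda>x. p x * complex_of_real
          (laguerre l (lambda_kam P k a m) (2 / a * norm x powr a) * exp (- (norm x powr a) / a)))
      | p l m. p \<in> dunkl_harmonics P k m}"

definition complex_span :: "('a \<Rightarrow> complex) set \<Rightarrow> ('a \<Rightarrow> complex) set" where
  "complex_span S = {f. \<exists>B c. finite B \<and> B \<subseteq> S \<and> f = (\<lambda>x. \<Sum>g\<in>B. c g * g x)}"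

definition dunkl_hamiltonian ::
    "(real ^ 'n) set \<Rightarrow> (real ^ 'n \<Rightarrow> real) \<Rightarrow> real \<Rightarrow> (real ^ 'n \<Rightarrow> complex) \<Rightarrow> real ^ 'n \<Rightarrow> complex" where
  "dunkl_hamiltonian P k a f x =
     complex_of_real (norm x powr (2 - a)) * dunkl_laplacian P k f x
     - complex_of_real (norm x powr a) * f x"

definition hamiltonian_graph ::
    "(real ^ 'n) set \<Rightarrow> (real ^ 'n \<Rightarrow> real) \<Rightarrow> real \<Rightarrow> (real ^ 'n) op_graph" where
  "hamiltonian_graph P k a =
     {(f, dunkl_hamiltonian P k a f) | f. f \<in> complex_span (laguerre_functions P k a)}"

definition ka_fourier ::
    "(real ^ 'n) set \<Rightarrow> (real ^ 'n) set \<Rightarrow> (real ^ 'n \<Rightarrow> real) \<Rightarrow> real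
      \<Rightarrow> (real ^ 'n \<Rightarrow> complex) \<Rightarrow> real ^ 'n \<Rightarrow> complex" where
  "ka_fourier R P k a f x =
     exp (\<i> * complex_of_real (pi / 2 * ((2 * mult_index P k + real CARD('n) + a - 2) / a))) *
     functional_calculus (dunkl_measure R k a)
       (l2_closure (dunkl_measure R k a) (hamiltonian_graph P k a))
       (\<lambda>t. exp (\<i> * complex_of_real (pi / (2 * a) * t))) f x"

end

theory Submission
  imports Defs "HOL-Computational_Algebra.Polynomial"
begin

text \<open>The operator \<open>H = |x|\<^bsup>2-a\<^esup>\<Delta>\<^sub>k - |x|\<^bsup>a\<^esup>\<close> is diagonal: the function attached to \<open>l\<close> and to a Dunkl
  harmonic of degree \<open>m\<close> is an eigenfunction for \<open>-a (2l + \<lambda>\<^sub>m + 1)\<close>, where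
  \<open>\<lambda>\<^sub>m = (2m + 2K + N - 2) / a\<close> and \<open>K\<close> is the sum of \<open>k\<close> over the positive roots. The exponential
  of \<open>\<pi>\<i>/(2a)\<close> times this eigenvalue, multiplied by the normalising phase, is
  \<open>exp (- \<pi>\<i> (l + m/a))\<close>: the constants \<open>K\<close> and \<open>N\<close> cancel. In both parts \<open>2/a\<close> is an integer
  \<open>N0\<close>, so this is \<open>(-\<i>)\<^bsup>2l + N0 m\<^esup>\<close>, whose square is \<open>(-1)\<^bsup>N0 m\<^esup>\<close>. If \<open>N0\<close> is even (\<open>a = 1/r\<close>) the
  square of the transform is the identity; if \<open>N0\<close> is odd (\<open>a = 2/(2r+1)\<close>) the square multiplies
  the components of degree \<open>m\<close> by \<open>(-1)\<^bsup>m\<^esup>\<close>, and this is the map \<open>f \<mapsto> f(-x)\<close>. The latter is not the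
  identity, because odd functions exist, hence the order is four.

  Four ingredients turn this computation into a proof.

  Abstract part. Let \<open>e\<close> be an orthogonal family that is total in \<open>L\<^sup>2\<close>. An operator that multiplies
  the \<open>j\<close>-th coefficient by a real number \<open>\<mu> j\<close>, and whose domain contains the finite combinations of
  the \<open>e j\<close>, has the maximal diagonal operator as its closure (\<open>l2_closure_diag\<close>). The functional
  calculus is a choice among all pairs of a spectral measure and an operator representing \<open>\<phi>\<close>; such a pair exists, since the
  coefficientwise projections form a spectral measure, and every such pair multiplies the \<open>j\<close>-th
  coefficient by \<open>\<phi> (\<mu> j)\<close> (\<open>functional_calculus_diag\<close>).

  Eigenfunctions. The product rule for \<open>\<Delta>\<^sub>k\<close> with a radial factor (\<open>dunkl_laplacian_radial\<close>) reduces the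
  eigenvalue equation to the Laguerre differential equation.

  Orthogonality. Homogeneity splits every integral into a radial integral and a constant that depends
  on the two polynomials only (\<open>radial_integral\<close>); hence for harmonics of different degrees it suffices
  to show that the constant vanishes for one radial function. This is done for the Gaussian, where
  integration by parts with a smoothed weight yields the adjoint of a Dunkl operator
  (\<open>gaussian_dunkl\<close>, \<open>gpair_harmonics_orthogonal\<close>). For equal degrees the radial integral is the
  orthogonality relation of Laguerre polynomials.

  Totality. If \<open>f\<close> is orthogonal to all eigenfunctions, then by the decomposition of polynomials into
  harmonics (\<open>harmonic_decomposition\<close>) it is orthogonal to all polynomials times
  \<open>exp (-|x|\<^bsup>a\<^esup>/a)\<close>; here \<open>|x|\<^sup>2\<close> has to be a polynomial in \<open>|x|\<^bsup>a\<^esup>\<close>, which is the integrality of \<open>2/a\<close>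
  again. The exponential series replaces \<open>1/a\<close> by every positive number, and the Weierstrass theorem
  on the bounded image of \<open>x \<mapsto> (exp (-|x|\<^bsup>a\<^esup>) x, exp (-|x|\<^bsup>a\<^esup>))\<close> then gives \<open>f = 0\<close>
  (\<open>annihilates_imp_zero\<close>).\<close>

section \<open>Square-integrable functions\<close>

lemma borel_measurable_cnj [measurable]: "cnj \<in> borel_measurable borel"
  by (intro borel_measurable_continuous_onI continuous_intros)

lemma l2D: "f \<in> l2 M \<Longrightarrow> f \<in> borel_measurable M" "f \<in> l2 M \<Longrightarrow> integrable M (\<lambda>x. (cmod (f x))\<^sup>2)"
  by (auto simp: l2_def)

lemma l2I: "f \<in> borel_measurable M \<Longrightarrow> integrable M (\<lambda>x. (cmod (f x))\<^sup>2) \<Longrightarrow> f \<in> l2 M"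
  by (auto simp: l2_def)

lemma l2_bound:
  assumes "f \<in> borel_measurable M" "integrable M h" "AE x in M. (cmod (f x))\<^sup>2 \<le> h x"
  shows "f \<in> l2 M"
  by (rule l2I[OF assms(1)], rule Bochner_Integration.integrable_bound[OF assms(2)])
     (use assms in \<open>auto elim!: eventually_mono\<close>)

lemma l2_prod_integrable:
  assumes "f \<in> l2 M" "g \<in> l2 M"
  shows "integrable M (\<lambda>x. f x * g x)" "integrable M (\<lambda>x. f x * cnj (g x))"
proof -
  note [measurable] = l2D(1)[OF assms(1)] l2D(1)[OF assms(2)]
  have i: "integrable M (\<lambda>x. (cmod (f x))\<^sup>2 + (cmod (g x))\<^sup>2)"
    using l2D(2)[OF assms(1)] l2D(2)[OF assms(2)] by auto
  have b: "cmod (f x) * cmod (g x) \<le> (cmod (f x))\<^sup>2 + (cmod (g x))\<^sup>2" for x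
  proof -
    have "2 * (cmod (f x) * cmod (g x)) \<le> (cmod (f x))\<^sup>2 + (cmod (g x))\<^sup>2"
      using sum_squares_bound[of "cmod (f x)" "cmod (g x)"] by (simp add: mult.assoc)
    moreover have "0 \<le> cmod (f x) * cmod (g x)" by simp
    ultimately show ?thesis by linarith
  qed
  show "integrable M (\<lambda>x. f x * g x)" "integrable M (\<lambda>x. f x * cnj (g x))"
    by (rule Bochner_Integration.integrable_bound[OF i]; use b in \<open>auto simp: norm_mult\<close>)+
qed

lemma l2_add: assumes "f \<in> l2 M" "g \<in> l2 M" shows "(\<lambda>x. f x + g x) \<in> l2 M"
proof (rule l2_bound[where h="\<lambda>x. 2 * (cmod (f x))\<^sup>2 + 2 * (cmod (g x))\<^sup>2"])
  show "AE x in M. (cmod (f x + g x))\<^sup>2 \<le> 2 * (cmod (f x))\<^sup>2 + 2 * (cmod (g x))\<^sup>2"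
  proof (rule AE_I2)
    fix x
    have "(cmod (f x + g x))\<^sup>2 \<le> (cmod (f x) + cmod (g x))\<^sup>2"
      by (intro power_mono norm_triangle_ineq) auto
    then show "(cmod (f x + g x))\<^sup>2 \<le> 2 * (cmod (f x))\<^sup>2 + 2 * (cmod (g x))\<^sup>2"
      using sum_squares_bound[of "cmod (f x)" "cmod (g x)"] unfolding power2_sum by linarith
  qed
qed (use assms in \<open>auto simp: l2_def\<close>)

lemma l2_scale: assumes "f \<in> l2 M" shows "(\<lambda>x. c * f x) \<in> l2 M"
  using assms by (auto simp: l2_def norm_mult power_mult_distrib)

lemma l2_zero: "(\<lambda>x. 0) \<in> l2 M"
  by (auto simp: l2_def)

lemma l2_diff: assumes "f \<in> l2 M" "g \<in> l2 M" shows "(\<lambda>x. f x - g x) \<in> l2 M"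
  using l2_add[OF assms(1) l2_scale[OF assms(2), of "-1"]] by simp

lemma l2_sum: assumes "\<And>i. i \<in> I \<Longrightarrow> f i \<in> l2 M" shows "(\<lambda>x. \<Sum>i\<in>I. f i x) \<in> l2 M"
  using assms by (induction I rule: infinite_finite_induct) (auto intro: l2_zero l2_add)

lemma l2_cong_AE: assumes "f \<in> l2 M" "AE x in M. f x = g x" "g \<in> borel_measurable M" shows "g \<in> l2 M"
  by (rule l2_bound[OF assms(3) l2D(2)[OF assms(1)]]) (use assms(2) in \<open>auto elim!: eventually_mono\<close>)

lemma l2_inner_add_left:
  assumes "f \<in> l2 M" "g \<in> l2 M" "h \<in> l2 M"
  shows "l2_inner M (\<lambda>x. f x + g x) h = l2_inner M f h + l2_inner M g h"
  unfolding l2_inner_def distrib_right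
  by (rule Bochner_Integration.integral_add) (intro l2_prod_integrable assms)+

lemma l2_inner_scale_left: "l2_inner M (\<lambda>x. c * f x) h = c * l2_inner M f h"
  unfolding l2_inner_def mult.assoc by simp

lemma l2_inner_commute: "l2_inner M g f = cnj (l2_inner M f g)"
  unfolding l2_inner_def by (subst Bochner_Integration.integral_cnj[symmetric]) (simp add: mult.commute)

lemma l2_inner_zero_commute: "l2_inner M f g = 0 \<Longrightarrow> l2_inner M g f = 0"
  using l2_inner_commute[of M g f] by simp

lemma l2_inner_add_right:
  assumes "f \<in> l2 M" "g \<in> l2 M" "h \<in> l2 M"
  shows "l2_inner M h (\<lambda>x. f x + g x) = l2_inner M h f + l2_inner M h g"
  using l2_inner_add_left[OF assms] l2_inner_commute by (metis complex_cnj_add)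

lemma l2_inner_scale_right: "l2_inner M h (\<lambda>x. c * f x) = cnj c * l2_inner M h f"
  using l2_inner_scale_left l2_inner_commute by (metis complex_cnj_mult)

lemma l2_inner_zero: "l2_inner M (\<lambda>x. 0) h = 0" "l2_inner M h (\<lambda>x. 0) = 0"
  by (auto simp: l2_inner_def)

lemma l2_inner_diff_left:
  assumes "f \<in> l2 M" "g \<in> l2 M" "h \<in> l2 M"
  shows "l2_inner M (\<lambda>x. f x - g x) h = l2_inner M f h - l2_inner M g h"
  using l2_inner_add_left[OF assms(1) l2_scale[OF assms(2), of "-1"] assms(3)]
    l2_inner_scale_left[of M "-1" g h] by simp

lemma l2_inner_diff_right:
  assumes "f \<in> l2 M" "g \<in> l2 M" "h \<in> l2 M"
  shows "l2_inner M h (\<lambda>x. f x - g x) = l2_inner M h f - l2_inner M h g"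
  using l2_inner_diff_left[OF assms] l2_inner_commute by (metis complex_cnj_diff)

lemma l2_inner_sum_left:
  assumes "\<And>i. i \<in> I \<Longrightarrow> f i \<in> l2 M" "h \<in> l2 M"
  shows "l2_inner M (\<lambda>x. \<Sum>i\<in>I. c i * f i x) h = (\<Sum>i\<in>I. c i * l2_inner M (f i) h)"
  using assms(1)
proof (induction I rule: infinite_finite_induct)
  case (insert i I)
  then show ?case
    by (simp add: l2_inner_add_left[OF l2_scale l2_sum assms(2)] l2_scale l2_inner_scale_left)
qed (auto simp: l2_inner_zero)

lemma l2_inner_cong_AE:
  assumes "l2_eq M f f'" "l2_eq M g g'" "f \<in> l2 M" "f' \<in> l2 M" "g \<in> l2 M" "g' \<in> l2 M"
  shows "l2_inner M f g = l2_inner M f' g'"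
proof -
  note [measurable] = assms(3-6)[THEN l2D(1)]
  show ?thesis unfolding l2_inner_def
    by (rule integral_cong_AE) (use assms(1,2) in \<open>auto simp: l2_eq_def\<close>)
qed

lemma l2_inner_self: "l2_inner M f f = complex_of_real ((l2_norm M f)\<^sup>2)"
proof -
  have "(\<integral>x. complex_of_real ((cmod (f x))\<^sup>2) \<partial>M) = complex_of_real (\<integral>x. (cmod (f x))\<^sup>2 \<partial>M)"
    by (rule integral_complex_of_real)
  then show ?thesis
    unfolding l2_inner_def l2_norm_def by (simp add: complex_norm_square[symmetric] integral_nonneg_AE)
qed

lemma l2_norm_sq: "(l2_norm M f)\<^sup>2 = (\<integral>x. (cmod (f x))\<^sup>2 \<partial>M)"
  unfolding l2_norm_def by (simp add: integral_nonneg_AE)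

lemma l2_norm_nonneg [simp]: "0 \<le> l2_norm M f"
  unfolding l2_norm_def by (simp add: integral_nonneg_AE)

lemma l2_norm_eq_0: assumes "f \<in> l2 M" shows "l2_norm M f = 0 \<longleftrightarrow> l2_eq M f (\<lambda>x. 0)"
  using integral_nonneg_eq_0_iff_AE[OF l2D(2)[OF assms]] unfolding l2_norm_def l2_eq_def by simp

lemma l2_norm_scale: "l2_norm M (\<lambda>x. c * f x) = cmod c * l2_norm M f"
  unfolding l2_norm_def by (simp add: norm_mult power_mult_distrib real_sqrt_mult)

lemma l2_norm_diff_commute: "l2_norm M (\<lambda>x. f x - g x) = l2_norm M (\<lambda>x. g x - f x)"
  unfolding l2_norm_def by (simp add: norm_minus_commute)

lemma l2_norm_add_sq:
  assumes "f \<in> l2 M" "g \<in> l2 M"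
  shows "(l2_norm M (\<lambda>x. f x + g x))\<^sup>2 = (l2_norm M f)\<^sup>2 + 2 * Re (l2_inner M f g) + (l2_norm M g)\<^sup>2"
proof -
  have "complex_of_real ((l2_norm M (\<lambda>x. f x + g x))\<^sup>2) =
     l2_inner M f f + l2_inner M f g + (cnj (l2_inner M f g) + l2_inner M g g)"
    unfolding l2_inner_self[symmetric]
    by (simp add: l2_inner_add_left l2_inner_add_right assms l2_add l2_inner_commute[of M g f])
  from arg_cong[OF this, of Re] show ?thesis by (simp add: l2_inner_self)
qed

lemma l2_cauchy_schwarz:
  assumes "f \<in> l2 M" "g \<in> l2 M"
  shows "cmod (l2_inner M f g) \<le> l2_norm M f * l2_norm M g"
proof (cases "l2_norm M g = 0")
  case True
  then have "l2_eq M g (\<lambda>x. 0)" using l2_norm_eq_0[OF assms(2)] by simp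
  then have "l2_inner M f g = l2_inner M f (\<lambda>x. 0)"
    by (intro l2_inner_cong_AE assms l2_zero) (auto simp: l2_eq_def)
  then show ?thesis by (simp add: l2_inner_zero True)
next
  case False
  define t where "t = - l2_inner M f g / complex_of_real ((l2_norm M g)\<^sup>2)"
  have *: "Re (cnj t * l2_inner M f g) = - (cmod (l2_inner M f g))\<^sup>2 / (l2_norm M g)\<^sup>2"
  proof -
    have "cnj t * l2_inner M f g = - (l2_inner M f g * cnj (l2_inner M f g)) / complex_of_real ((l2_norm M g)\<^sup>2)"
      unfolding t_def by simp
    also have "\<dots> = complex_of_real (- (cmod (l2_inner M f g))\<^sup>2 / (l2_norm M g)\<^sup>2)"
      by (simp add: complex_norm_square[symmetric])
    finally show ?thesis by (metis Re_complex_of_real)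
  qed
  have "0 \<le> (l2_norm M (\<lambda>x. f x + t * g x))\<^sup>2" by simp
  also have "\<dots> = (l2_norm M f)\<^sup>2 + 2 * Re (cnj t * l2_inner M f g) + (cmod t * l2_norm M g)\<^sup>2"
    by (simp add: l2_norm_add_sq assms l2_scale l2_inner_scale_right l2_norm_scale)
  also have "(cmod t * l2_norm M g)\<^sup>2 = (cmod (l2_inner M f g))\<^sup>2 / (l2_norm M g)\<^sup>2"
    unfolding t_def using False by (simp add: norm_divide norm_power power2_eq_square norm_mult)
  finally have "(cmod (l2_inner M f g))\<^sup>2 / (l2_norm M g)\<^sup>2 \<le> (l2_norm M f)\<^sup>2" unfolding * by linarith
  then have "(cmod (l2_inner M f g))\<^sup>2 \<le> (l2_norm M f * l2_norm M g)\<^sup>2"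
    using False by (simp add: field_simps power_mult_distrib)
  then show ?thesis by (rule power2_le_imp_le) simp
qed

lemma l2_norm_triangle:
  assumes "f \<in> l2 M" "g \<in> l2 M"
  shows "l2_norm M (\<lambda>x. f x + g x) \<le> l2_norm M f + l2_norm M g"
proof (rule power2_le_imp_le)
  have "Re (l2_inner M f g) \<le> l2_norm M f * l2_norm M g"
    using l2_cauchy_schwarz[OF assms] complex_Re_le_cmod order_trans by blast
  then show "(l2_norm M (\<lambda>x. f x + g x))\<^sup>2 \<le> (l2_norm M f + l2_norm M g)\<^sup>2"
    unfolding l2_norm_add_sq[OF assms] power2_sum by linarith
qed simp

lemma l2_inner_tendsto:
  assumes "\<And>n. F n \<in> l2 M" "f \<in> l2 M" "g \<in> l2 M" "(\<lambda>n. l2_norm M (\<lambda>x. F n x - f x)) \<longlonglongrightarrow> 0"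
  shows "(\<lambda>n. l2_inner M (F n) g) \<longlonglongrightarrow> l2_inner M f g"
proof -
  have "(\<lambda>n. l2_inner M (F n) g - l2_inner M f g) \<longlonglongrightarrow> 0"
  proof (rule Lim_null_comparison)
    show "eventually (\<lambda>n. cmod (l2_inner M (F n) g - l2_inner M f g) \<le> l2_norm M (\<lambda>x. F n x - f x) * l2_norm M g) sequentially"
      using l2_cauchy_schwarz[OF l2_diff[OF assms(1,2)] assms(3)]
      by (auto simp: l2_inner_diff_left[OF assms(1-3)])
    show "(\<lambda>n. l2_norm M (\<lambda>x. F n x - f x) * l2_norm M g) \<longlonglongrightarrow> 0"
      using tendsto_mult_right[OF assms(4), of "l2_norm M g"] by simp
  qed
  then show ?thesis by (rule LIM_zero_cancel)
qed

lemma complex_span_sum: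
  assumes "finite I" "\<And>i. i \<in> I \<Longrightarrow> f i \<in> S"
  shows "(\<lambda>x. \<Sum>i\<in>I. c i * f i x) \<in> complex_span S"
proof -
  have "(\<Sum>i\<in>I. c i * f i x) = (\<Sum>g\<in>f ` I. (\<Sum>i\<in>{i\<in>I. f i = g}. c i) * g x)" for x
    by (subst sum.image_gen[OF assms(1), of _ f]) (auto intro!: sum.cong simp: sum_distrib_right)
  then have "(\<lambda>x. \<Sum>i\<in>I. c i * f i x) = (\<lambda>x. \<Sum>g\<in>f ` I. (\<Sum>i\<in>{i\<in>I. f i = g}. c i) * g x)" by (rule ext)
  then show ?thesis unfolding complex_span_def using assms
    by (auto intro!: exI[of _ "f ` I"] exI[of _ "\<lambda>g. \<Sum>i\<in>{i\<in>I. f i = g}. c i"])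
qed

section \<open>Completeness\<close>

text \<open>Fast convergence of the differences gives convergence almost everywhere; Fatou's lemma then
  transfers the estimates to the pointwise limit.\<close>

lemma l2_complete_fast:
  assumes s: "\<And>n. s n \<in> l2 M"
    and fast: "\<And>n m. n \<le> m \<Longrightarrow> (l2_norm M (\<lambda>x. s m x - s n x))\<^sup>2 \<le> (1/4) ^ n"
  shows "\<exists>f\<in>l2 M. \<forall>n. (l2_norm M (\<lambda>x. f x - s n x))\<^sup>2 \<le> (1/4) ^ n"
proof -
  note [measurable] = s[THEN l2D(1)]
  define d where "d k x = cmod (s (Suc k) x - s k x)" for k x
  have dm[measurable]: "d k \<in> borel_measurable M" for k unfolding d_def by measurable
  have nn: "(\<integral>\<^sup>+x. ennreal ((cmod (s m x - s n x))\<^sup>2) \<partial>M) \<le> ennreal ((1/4) ^ n)" if "n \<le> m" for m n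
  proof -
    have "(\<integral>\<^sup>+x. ennreal ((cmod (s m x - s n x))\<^sup>2) \<partial>M) = ennreal (\<integral>x. (cmod (s m x - s n x))\<^sup>2 \<partial>M)"
      by (rule nn_integral_eq_integral) (use l2D(2)[OF l2_diff[OF s s]] in auto)
    then show ?thesis using fast[OF that] by (simp add: l2_norm_sq ennreal_leI)
  qed
  (* The factor 2^k keeps the sum integrable, and it makes the sum of the d k itself finite by
     2 * d <= 2^(-k) + 2^k * d^2. *)
  have "(\<integral>\<^sup>+x. (\<Sum>k. ennreal (2 ^ k * (d k x)\<^sup>2)) \<partial>M) = (\<Sum>k. \<integral>\<^sup>+x. ennreal (2 ^ k * (d k x)\<^sup>2) \<partial>M)"
    by (rule nn_integral_suminf) measurable
  also have "\<dots> \<le> (\<Sum>k. ennreal ((1/2) ^ k))"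
  proof (intro suminf_le)
    fix k
    have "(\<integral>\<^sup>+x. ennreal (2 ^ k * (d k x)\<^sup>2) \<partial>M) = ennreal (2 ^ k) * (\<integral>\<^sup>+x. ennreal ((d k x)\<^sup>2) \<partial>M)"
      by (subst nn_integral_cmult[symmetric]) (auto simp: ennreal_mult)
    also have "\<dots> \<le> ennreal (2 ^ k) * ennreal ((1/4) ^ k)"
      unfolding d_def by (intro mult_left_mono nn) auto
    also have "\<dots> = ennreal ((1/2) ^ k)"
      by (subst ennreal_mult[symmetric]) (auto simp: power_mult_distrib[symmetric])
    finally show "(\<integral>\<^sup>+x. ennreal (2 ^ k * (d k x)\<^sup>2) \<partial>M) \<le> ennreal ((1/2) ^ k)" .
  qed auto
  also have "\<dots> < \<infinity>"
    by (subst suminf_ennreal_eq[OF _ geometric_sums]) auto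
  finally have "AE x in M. (\<Sum>k. ennreal (2 ^ k * (d k x)\<^sup>2)) \<noteq> \<infinity>"
    by (intro nn_integral_noteq_infinite) auto
  then have conv: "AE x in M. convergent (\<lambda>n. s n x)"
  proof (rule eventually_mono)
    fix x assume "(\<Sum>k. ennreal (2 ^ k * (d k x)\<^sup>2)) \<noteq> \<infinity>"
    then have "summable (\<lambda>k. 2 ^ k * (d k x)\<^sup>2)"
      by (intro summable_suminf_not_top) auto
    then have "summable (\<lambda>k. (1/2) ^ k + 2 ^ k * (d k x)\<^sup>2)"
      by (intro summable_add summable_geometric) auto
    moreover have "norm (d k x) \<le> (1/2) ^ k + 2 ^ k * (d k x)\<^sup>2" for k
    proof -
      have "0 \<le> 2 ^ k * (d k x - (1/2) ^ k)\<^sup>2" by simp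
      also have "\<dots> = 2 ^ k * (d k x)\<^sup>2 + (1/2)^k - 2 * d k x"
        by (simp add: power2_eq_square algebra_simps power_one_over)
      moreover have "0 \<le> d k x" by (simp add: d_def)
      ultimately show ?thesis by simp
    qed
    ultimately have "summable (\<lambda>k. d k x)"
      by (rule summable_comparison_test'[where N=0])
    then have "summable (\<lambda>k. s (Suc k) x - s k x)"
      unfolding d_def by (rule summable_norm_cancel)
    then have "convergent (\<lambda>n. \<Sum>k<n. s (Suc k) x - s k x)"
      by (simp add: summable_iff_convergent)
    then have "convergent (\<lambda>n. s n x - s 0 x)"
      by (simp add: sum_lessThan_telescope[of "\<lambda>n. s n x"])
    then have "convergent (\<lambda>n. (s n x - s 0 x) + s 0 x)"
      by (intro convergent_add convergent_const)
    then show "convergent (\<lambda>n. s n x)" by simp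
  qed
  define f where "f x = lim (\<lambda>n. s n x)" for x
  have f[measurable]: "f \<in> borel_measurable M" unfolding f_def by measurable
  have lim: "AE x in M. (\<lambda>n. s n x) \<longlonglongrightarrow> f x"
    using conv unfolding f_def by eventually_elim (simp add: convergent_LIMSEQ_iff)
  have key: "(\<integral>\<^sup>+x. ennreal ((cmod (f x - s n x))\<^sup>2) \<partial>M) \<le> ennreal ((1/4) ^ n)" for n
  proof -
    have "(\<integral>\<^sup>+x. ennreal ((cmod (f x - s n x))\<^sup>2) \<partial>M)
        = (\<integral>\<^sup>+x. liminf (\<lambda>m. ennreal ((cmod (s m x - s n x))\<^sup>2)) \<partial>M)"
    proof (rule nn_integral_cong_AE, use lim in eventually_elim)
      fix x assume "(\<lambda>n. s n x) \<longlonglongrightarrow> f x"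
      then have "(\<lambda>m. ennreal ((cmod (s m x - s n x))\<^sup>2)) \<longlonglongrightarrow> ennreal ((cmod (f x - s n x))\<^sup>2)"
        by (intro tendsto_ennrealI tendsto_intros)
      then show "ennreal ((cmod (f x - s n x))\<^sup>2) = liminf (\<lambda>m. ennreal ((cmod (s m x - s n x))\<^sup>2))"
        by (rule lim_imp_Liminf[OF sequentially_bot, symmetric])
    qed
    also have "\<dots> \<le> liminf (\<lambda>m. \<integral>\<^sup>+x. ennreal ((cmod (s m x - s n x))\<^sup>2) \<partial>M)"
      by (rule nn_integral_liminf) measurable
    also have "\<dots> \<le> ennreal ((1/4) ^ n)"
    proof (rule Liminf_le)
      show "eventually (\<lambda>m. (\<integral>\<^sup>+x. ennreal ((cmod (s m x - s n x))\<^sup>2) \<partial>M) \<le> ennreal ((1/4) ^ n)) sequentially"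
        using eventually_ge_at_top[of n] by eventually_elim (rule nn)
    qed simp
    finally show ?thesis .
  qed
  have i: "(\<lambda>x. f x - s n x) \<in> l2 M" for n
  proof (rule l2I)
    show "integrable M (\<lambda>x. (cmod (f x - s n x))\<^sup>2)"
      by (rule integrableI_bounded) (auto intro: le_less_trans[OF key])
  qed measurable
  have "f \<in> l2 M" using l2_add[OF i[of 0] s[of 0]] by simp
  moreover have "(l2_norm M (\<lambda>x. f x - s n x))\<^sup>2 \<le> (1/4) ^ n" for n
  proof -
    have "ennreal (\<integral>x. (cmod (f x - s n x))\<^sup>2 \<partial>M) = (\<integral>\<^sup>+x. ennreal ((cmod (f x - s n x))\<^sup>2) \<partial>M)"
      by (rule nn_integral_eq_integral[symmetric]) (use l2D(2)[OF i] in auto)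
    also note key
    finally show ?thesis by (simp add: l2_norm_sq)
  qed
  ultimately show ?thesis by blast
qed

lemma l2_complete:
  assumes s: "\<And>n. s n \<in> l2 M"
    and cauchy: "\<And>\<epsilon>. \<epsilon> > 0 \<Longrightarrow> \<exists>N. \<forall>n\<ge>N. \<forall>m\<ge>n. (l2_norm M (\<lambda>x. s m x - s n x))\<^sup>2 \<le> \<epsilon>"
  shows "\<exists>f\<in>l2 M. (\<lambda>n. l2_norm M (\<lambda>x. s n x - f x)) \<longlonglongrightarrow> 0"
proof -
  have "\<forall>k::nat. \<exists>N. \<forall>n\<ge>N. \<forall>m\<ge>n. (l2_norm M (\<lambda>x. s m x - s n x))\<^sup>2 \<le> (1/4) ^ k"
    using cauchy by auto
  then obtain N where N: "\<And>k n m. N k \<le> n \<Longrightarrow> n \<le> m \<Longrightarrow> (l2_norm M (\<lambda>x. s m x - s n x))\<^sup>2 \<le> (1/4) ^ k"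
    by metis
  (* Partial sums dominate the N k and are monotone, as a subsequence requires. *)
  define r where "r k = (\<Sum>i\<le>k. N i)" for k
  have rm: "r k \<le> r j" if "k \<le> j" for k j unfolding r_def using that by (intro sum_mono2) auto
  have rN: "N k \<le> r k" for k unfolding r_def by (rule member_le_sum) auto
  have "\<exists>f\<in>l2 M. \<forall>n. (l2_norm M (\<lambda>x. f x - s (r n) x))\<^sup>2 \<le> (1/4) ^ n"
    by (rule l2_complete_fast) (use s N rN rm in auto)
  then obtain f where f: "f \<in> l2 M" "\<And>n. (l2_norm M (\<lambda>x. f x - s (r n) x))\<^sup>2 \<le> (1/4) ^ n" by auto
  have "(\<lambda>n. l2_norm M (\<lambda>x. s n x - f x)) \<longlonglongrightarrow> 0"
  proof (rule LIMSEQ_I)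
    fix e :: real assume "e > 0"
    obtain k where k: "(1/2::real) ^ k < e / 2"
      using real_arch_pow_inv[of "e/2" "1/2"] \<open>e > 0\<close> by auto
    show "\<exists>n0. \<forall>n\<ge>n0. norm (l2_norm M (\<lambda>x. s n x - f x) - 0) < e"
    proof (intro exI allI impI)
      fix n assume n: "r k \<le> n"
      have sq: "(1/4::real) ^ k = ((1/2) ^ k)\<^sup>2" by (simp add: power2_eq_square flip: power_mult_distrib)
      have a: "l2_norm M (\<lambda>x. s n x - s (r k) x) \<le> (1/2) ^ k"
        by (rule power2_le_imp_le) (use N[OF rN n] in \<open>auto simp: sq\<close>)
      have b: "l2_norm M (\<lambda>x. s (r k) x - f x) \<le> (1/2) ^ k"
        by (subst l2_norm_diff_commute, rule power2_le_imp_le) (use f(2)[of k] in \<open>auto simp: sq\<close>)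
      have "l2_norm M (\<lambda>x. s n x - f x) \<le> l2_norm M (\<lambda>x. s n x - s (r k) x) + l2_norm M (\<lambda>x. s (r k) x - f x)"
        using l2_norm_triangle[OF l2_diff[OF s[of n] s[of "r k"]] l2_diff[OF s[of "r k"] f(1)]] by simp
      then show "norm (l2_norm M (\<lambda>x. s n x - f x) - 0) < e" using a b k by simp
    qed
  qed
  then show ?thesis using f(1) by blast
qed

section \<open>Expansions in an orthogonal system\<close>

text \<open>Members of the system may vanish in \<open>L\<^sup>2\<close>: the system will come from orthogonalising an
  enumerated total family in which linear dependences are allowed.\<close>

locale l2_system =
  fixes M :: "'a measure" and e :: "nat \<Rightarrow> 'a \<Rightarrow> complex"
  assumes e_l2: "\<And>j. e j \<in> l2 M"
    and e_orth: "\<And>i j. i \<noteq> j \<Longrightarrow> l2_inner M (e i) (e j) = 0"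
    and e_norm: "\<And>j. l2_inner M (e j) (e j) \<in> {0, 1}"
    and e_total: "\<And>f. f \<in> l2 M \<Longrightarrow> (\<And>j. l2_inner M f (e j) = 0) \<Longrightarrow> l2_eq M f (\<lambda>x. 0)"
begin

abbreviation coef :: "('a \<Rightarrow> complex) \<Rightarrow> nat \<Rightarrow> complex" where
  "coef f j \<equiv> l2_inner M f (e j)"

text \<open>By this the multipliers attached to vanishing members have no influence on an operator.\<close>

lemma coef_null: "l2_inner M (e j) (e j) = 0 \<Longrightarrow> f \<in> l2 M \<Longrightarrow> coef f j = 0"
proof -
  assume "l2_inner M (e j) (e j) = 0" "f \<in> l2 M"
  then have "l2_norm M (e j) = 0" by (simp add: l2_inner_self)
  then show "coef f j = 0" using l2_cauchy_schwarz[OF \<open>f \<in> l2 M\<close> e_l2, of j] by simp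
qed

lemma coef_e: "f \<in> l2 M \<Longrightarrow> coef f j * l2_inner M (e j) (e j) = coef f j"
  using e_norm[of j] coef_null[of j f] by auto

lemma coef_eqI:
  assumes "f \<in> l2 M" "g \<in> l2 M" "\<And>j. coef f j = coef g j"
  shows "l2_eq M f g"
proof -
  have "l2_eq M (\<lambda>x. f x - g x) (\<lambda>x. 0)"
    by (rule e_total) (auto simp: l2_diff l2_inner_diff_left assms e_l2)
  then show ?thesis by (simp add: l2_eq_def)
qed

lemma coef_cong: "l2_eq M f g \<Longrightarrow> f \<in> l2 M \<Longrightarrow> g \<in> l2 M \<Longrightarrow> coef f j = coef g j"
  by (rule l2_inner_cong_AE) (auto simp: e_l2 l2_eq_def)

lemma comb_l2: "finite I \<Longrightarrow> (\<lambda>x. \<Sum>j\<in>I. c j * e j x) \<in> l2 M"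
  by (intro l2_sum l2_scale e_l2)

lemma comb_inner:
  assumes "finite I" "g \<in> l2 M"
  shows "l2_inner M (\<lambda>x. \<Sum>j\<in>I. c j * e j x) g = (\<Sum>j\<in>I. c j * cnj (l2_inner M g (e j)))"
  by (subst l2_inner_sum_left[OF e_l2 assms(2)]) (auto simp: l2_inner_commute[of M "e _" g])

lemma comb_coef:
  assumes "finite I"
  shows "coef (\<lambda>x. \<Sum>j\<in>I. c j * e j x) i = (if i \<in> I then c i * l2_inner M (e i) (e i) else 0)"
proof -
  have "coef (\<lambda>x. \<Sum>j\<in>I. c j * e j x) i = (\<Sum>j\<in>I. c j * l2_inner M (e j) (e i))"
    by (rule l2_inner_sum_left[OF e_l2 e_l2])
  also have "\<dots> = (\<Sum>j\<in>I. if j = i then c i * l2_inner M (e i) (e i) else 0)"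
    by (rule sum.cong) (auto simp: e_orth)
  finally show ?thesis using assms by simp
qed

lemma comb_norm:
  assumes "finite I"
  shows "(l2_norm M (\<lambda>x. \<Sum>j\<in>I. c j * e j x))\<^sup>2 \<le> (\<Sum>j\<in>I. (cmod (c j))\<^sup>2)"
proof -
  let ?s = "\<lambda>x. \<Sum>j\<in>I. c j * e j x"
  have "complex_of_real ((l2_norm M ?s)\<^sup>2) = (\<Sum>j\<in>I. c j * cnj (coef ?s j))"
    unfolding l2_inner_self[symmetric] by (rule comb_inner[OF assms comb_l2[OF assms]])
  also have "\<dots> = (\<Sum>j\<in>I. complex_of_real ((cmod (c j))\<^sup>2 * Re (l2_inner M (e j) (e j))))"
  proof (rule sum.cong)
    fix j assume "j \<in> I"
    then show "c j * cnj (coef ?s j) = complex_of_real ((cmod (c j))\<^sup>2 * Re (l2_inner M (e j) (e j)))"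
      using e_norm[of j] by (auto simp: comb_coef[OF assms] complex_norm_square[symmetric])
  qed simp
  finally have "(l2_norm M ?s)\<^sup>2 = (\<Sum>j\<in>I. (cmod (c j))\<^sup>2 * Re (l2_inner M (e j) (e j)))"
    unfolding of_real_sum[symmetric] of_real_eq_iff .
  also have "\<dots> \<le> (\<Sum>j\<in>I. (cmod (c j))\<^sup>2)"
  proof (rule sum_mono)
    fix j show "(cmod (c j))\<^sup>2 * Re (l2_inner M (e j) (e j)) \<le> (cmod (c j))\<^sup>2"
      using e_norm[of j] by auto
  qed
  finally show ?thesis .
qed

lemma bessel:
  assumes "f \<in> l2 M"
  shows "summable (\<lambda>j. (cmod (coef f j))\<^sup>2)"
proof (rule summableI_nonneg_bounded)
  fix n
  let ?s = "\<lambda>x. \<Sum>j<n. coef f j * e j x"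
  let ?S = "\<Sum>j<n. (cmod (coef f j))\<^sup>2"
  have "0 \<le> (l2_norm M (\<lambda>x. f x + (-1) * ?s x))\<^sup>2" by simp
  also have "\<dots> = (l2_norm M f)\<^sup>2 + 2 * Re (l2_inner M f (\<lambda>x. (-1) * ?s x)) + (l2_norm M (\<lambda>x. (-1) * ?s x))\<^sup>2"
    by (rule l2_norm_add_sq) (intro assms l2_scale comb_l2 finite_lessThan)+
  also have "l2_inner M f (\<lambda>x. (-1) * ?s x) = - complex_of_real ?S"
  proof -
    have "l2_inner M ?s f = (\<Sum>j<n. coef f j * cnj (coef f j))" by (rule comb_inner[OF _ assms]) simp
    also have "\<dots> = complex_of_real ?S" by (simp add: complex_norm_square[symmetric])
    finally show ?thesis by (simp only: l2_inner_scale_right l2_inner_commute[of M f ?s]) simp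
  qed
  also have "(l2_norm M (\<lambda>x. (-1) * ?s x))\<^sup>2 \<le> ?S"
    by (simp only: l2_norm_scale, simp, rule comb_norm, simp)
  finally show "?S \<le> (l2_norm M f)\<^sup>2" by simp
qed simp

text \<open>The factor \<open>l2_inner M (e j) (e j)\<close>, which is \<open>0\<close> or \<open>1\<close>, discards the prescribed values at
  vanishing members.\<close>

lemma riesz_fischer:
  assumes c: "summable (\<lambda>j. (cmod (c j))\<^sup>2)"
  shows "\<exists>f\<in>l2 M. (\<forall>j. coef f j = c j * l2_inner M (e j) (e j)) \<and>
     (\<lambda>n. l2_norm M (\<lambda>x. (\<Sum>j<n. c j * e j x) - f x)) \<longlonglongrightarrow> 0"
proof -
  let ?s = "\<lambda>n x. \<Sum>j<n. c j * e j x"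
  have "\<exists>f\<in>l2 M. (\<lambda>n. l2_norm M (\<lambda>x. ?s n x - f x)) \<longlonglongrightarrow> 0"
  proof (rule l2_complete)
    fix \<epsilon> :: real assume "\<epsilon> > 0"
    then obtain N where N: "\<And>m n. N \<le> m \<Longrightarrow> norm (\<Sum>j=m..<n. (cmod (c j))\<^sup>2) < \<epsilon>"
      using c unfolding summable_Cauchy by blast
    show "\<exists>N. \<forall>n\<ge>N. \<forall>m\<ge>n. (l2_norm M (\<lambda>x. ?s m x - ?s n x))\<^sup>2 \<le> \<epsilon>"
    proof (intro exI allI impI)
      fix n m assume nm: "N \<le> n" "n \<le> m"
      have "(\<lambda>x. ?s m x - ?s n x) = (\<lambda>x. \<Sum>j=n..<m. c j * e j x)"
        using nm(2) by (auto simp: atLeast0LessThan[symmetric] sum_diff_nat_ivl)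
      then have "(l2_norm M (\<lambda>x. ?s m x - ?s n x))\<^sup>2 \<le> (\<Sum>j=n..<m. (cmod (c j))\<^sup>2)"
        using comb_norm[of "{n..<m}" c] by simp
      then show "(l2_norm M (\<lambda>x. ?s m x - ?s n x))\<^sup>2 \<le> \<epsilon>" using N[OF nm(1), of m] by simp
    qed
  qed (simp add: comb_l2)
  then obtain f where f: "f \<in> l2 M" "(\<lambda>n. l2_norm M (\<lambda>x. ?s n x - f x)) \<longlonglongrightarrow> 0" by auto
  have "coef f j = c j * l2_inner M (e j) (e j)" for j
  proof -
    have "(\<lambda>n. coef (?s n) j) \<longlonglongrightarrow> coef f j"
      by (rule l2_inner_tendsto[OF _ f(1) e_l2 f(2)]) (simp add: comb_l2)
    moreover have "(\<lambda>n. coef (?s n) j) \<longlonglongrightarrow> c j * l2_inner M (e j) (e j)"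
      by (rule tendsto_eventually, rule eventually_mono[OF eventually_gt_at_top[of j]]) (simp add: comb_coef)
    ultimately show ?thesis using LIMSEQ_unique by blast
  qed
  then show ?thesis using f by blast
qed

lemma expansion:
  assumes "f \<in> l2 M"
  shows "(\<lambda>n. l2_norm M (\<lambda>x. (\<Sum>j<n. coef f j * e j x) - f x)) \<longlonglongrightarrow> 0"
proof -
  obtain g where g: "g \<in> l2 M" "\<And>j. coef g j = coef f j * l2_inner M (e j) (e j)"
    "(\<lambda>n. l2_norm M (\<lambda>x. (\<Sum>j<n. coef f j * e j x) - g x)) \<longlonglongrightarrow> 0"
    using riesz_fischer[OF bessel[OF assms]] by auto
  have eq: "l2_eq M g f" by (rule coef_eqI) (use g assms coef_e in auto)
  have "l2_norm M (\<lambda>x. (\<Sum>j<n. coef f j * e j x) - g x) = l2_norm M (\<lambda>x. (\<Sum>j<n. coef f j * e j x) - f x)" for n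
  proof -
    have m: "(\<lambda>x. \<Sum>j<n. coef f j * e j x) \<in> l2 M" by (simp add: comb_l2)
    note [measurable] = l2D(1)[OF l2_diff[OF m g(1)]] l2D(1)[OF l2_diff[OF m assms]]
    show ?thesis unfolding l2_norm_def
      by (rule arg_cong[of _ _ sqrt], rule integral_cong_AE) (use eq in \<open>auto simp: l2_eq_def elim: eventually_mono\<close>)
  qed
  then show ?thesis using g(3) by simp
qed

lemma parseval:
  assumes "f \<in> l2 M" "g \<in> l2 M"
  shows "(\<lambda>j. coef f j * cnj (coef g j)) sums l2_inner M f g"
proof -
  have "(\<lambda>n. l2_inner M (\<lambda>x. \<Sum>j<n. coef f j * e j x) g) \<longlonglongrightarrow> l2_inner M f g"
    by (rule l2_inner_tendsto[OF _ assms expansion[OF assms(1)]]) (simp add: comb_l2)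
  then show ?thesis unfolding sums_def by (simp add: comb_inner assms)
qed

lemma parseval_norm:
  assumes "f \<in> l2 M"
  shows "(\<lambda>j. (cmod (coef f j))\<^sup>2) sums ((l2_norm M f)\<^sup>2)"
proof -
  have "(\<lambda>j. complex_of_real ((cmod (coef f j))\<^sup>2)) sums complex_of_real ((l2_norm M f)\<^sup>2)"
    using parseval[OF assms assms] by (simp add: l2_inner_self complex_norm_square[symmetric])
  then show ?thesis unfolding sums_of_real_iff .
qed

text \<open>The coefficients determine the value up to equality almost everywhere, hence the choice.\<close>

definition diag :: "(nat \<Rightarrow> complex) \<Rightarrow> ('a \<Rightarrow> complex) \<Rightarrow> 'a \<Rightarrow> complex" where
  "diag b f = (SOME g. g \<in> l2 M \<and> (\<forall>j. coef g j = b j * coef f j))"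

lemma diag_ex:
  assumes f: "f \<in> l2 M" and b: "summable (\<lambda>j. (cmod (b j * coef f j))\<^sup>2)"
  shows "\<exists>g\<in>l2 M. \<forall>j. coef g j = b j * coef f j"
  using riesz_fischer[OF b] coef_e[OF f] by (metis mult.assoc)

lemma bounded_summable:
  assumes "f \<in> l2 M" "\<And>j. cmod (b j) \<le> 1"
  shows "summable (\<lambda>j. (cmod (b j * coef f j))\<^sup>2)"
proof (rule summable_comparison_test'[OF bessel[OF assms(1)], of 0])
  fix j :: nat
  show "norm ((cmod (b j * coef f j))\<^sup>2) \<le> (cmod (coef f j))\<^sup>2"
    using assms(2)[of j] by (auto simp: norm_mult power_mult_distrib intro!: mult_left_le_one_le power_le_one)
qed

lemma diag:
  assumes "f \<in> l2 M" "\<And>j. cmod (b j) \<le> 1"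
  shows "diag b f \<in> l2 M" "coef (diag b f) j = b j * coef f j"
proof -
  have "\<exists>g\<in>l2 M. \<forall>j. coef g j = b j * coef f j"
    by (rule diag_ex[OF assms(1) bounded_summable[OF assms(1)]]) (rule assms(2))
  then have "\<exists>g. g \<in> l2 M \<and> (\<forall>j. coef g j = b j * coef f j)" by blast
  from someI_ex[OF this] show "diag b f \<in> l2 M" "coef (diag b f) j = b j * coef f j"
    unfolding diag_def by blast+
qed

lemma coefwise_operator:
  assumes "\<And>f. f \<in> l2 M \<Longrightarrow> U f \<in> l2 M"
    and "\<And>f j. f \<in> l2 M \<Longrightarrow> coef (U f) j = b j * coef f j"
  shows "l2_operator M U"
  unfolding l2_operator_def
proof (intro conjI ballI allI impI)
  fix f g assume "f \<in> l2 M" "g \<in> l2 M" "l2_eq M f g"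
  then show "l2_eq M (U f) (U g)" by (intro coef_eqI) (auto simp: assms coef_cong[of f g])
next
  fix f g c d assume fg: "f \<in> l2 M" "g \<in> l2 M"
  show "l2_eq M (U (\<lambda>x. c * f x + d * g x)) (\<lambda>x. c * U f x + d * U g x)"
    by (rule coef_eqI)
       (auto simp: assms l2_add l2_scale fg l2_inner_add_left l2_inner_scale_left e_l2 algebra_simps)
qed (use assms in auto)

lemma diag_operator: "(\<And>j. cmod (b j) \<le> 1) \<Longrightarrow> l2_operator M (diag b)"
  by (rule coefwise_operator[where b=b]) (auto simp: diag)

end

section \<open>Projection-valued measures\<close>

lemma sets_scalar_spectral_measure [simp, measurable_cong]:
  "sets (scalar_spectral_measure M E f) = sets borel"
proof -
  have "sets (scalar_spectral_measure M E f) = sigma_sets UNIV (sets borel)"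
    unfolding scalar_spectral_measure_def by (rule sets_measure_of) simp
  also have "\<dots> = sets borel" by (rule sets.sigma_sets_eq[of "borel :: real measure", unfolded space_borel])
  finally show ?thesis .
qed

lemma space_scalar_spectral_measure [simp]: "space (scalar_spectral_measure M E f) = UNIV"
  using sets_eq_imp_space_eq[OF sets_scalar_spectral_measure] by simp

lemma scalar_spectral_measure_eqI:
  assumes "sets N = sets borel"
    and "\<And>B. B \<in> sets borel \<Longrightarrow> emeasure N B = ennreal (Re (l2_inner M (E B f) f))"
  shows "scalar_spectral_measure M E f = N"
proof -
  have sp: "space N = UNIV" using sets_eq_imp_space_eq[OF assms(1)] by simp
  have "scalar_spectral_measure M E f = measure_of UNIV (sets borel) (emeasure N)"
    unfolding scalar_spectral_measure_def
  proof (rule measure_of_eq)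
    fix X :: "real set" assume "X \<in> sigma_sets UNIV (sets borel)"
    then have "X \<in> sets borel"
      by (simp only: sets.sigma_sets_eq[of "borel :: real measure", unfolded space_borel])
    then show "ennreal (Re (l2_inner M (E X f) f)) = emeasure N X" by (rule assms(2)[symmetric])
  qed simp
  also have "\<dots> = N" using measure_of_of_measure[of N] unfolding assms(1) sp .
  finally show ?thesis .
qed

text \<open>A trigonometric polynomial of degree one that is constant on the unit circle is constant.
  Applied to \<open>w \<mapsto> \<langle>T (f + w g), f + w g\<rangle>\<close> it isolates the mixed terms of a form that is known on the
  diagonal only.\<close>

lemma unimodular_twist_constant:
  assumes "\<And>w. cmod w = 1 \<Longrightarrow> K = L + cnj w * X + w * Y"
  shows "X = 0" "Y = 0"
proof -
  have 1: "K = L + X + Y" using assms[of 1] by simp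
  have 2: "K = L - X - Y" using assms[of "-1"] by simp
  have 3: "K = L + \<i> * (Y - X)" using assms[of "\<i>"] by (simp add: algebra_simps)
  show "X = 0" "Y = 0" using 1 2 3 by (auto simp: complex_eq_iff)
qed

locale l2_pvm =
  fixes M :: "'a measure" and E :: "real set \<Rightarrow> ('a \<Rightarrow> complex) \<Rightarrow> 'a \<Rightarrow> complex"
  assumes pvm: "projection_valued_measure M E"
begin

lemma E_operator: "B \<in> sets borel \<Longrightarrow> l2_operator M (E B)"
  using conjunct1[OF pvm[unfolded projection_valued_measure_def]] by simp

lemma E_l2 [simp]: "B \<in> sets borel \<Longrightarrow> f \<in> l2 M \<Longrightarrow> E B f \<in> l2 M"
  using E_operator unfolding l2_operator_def by simp

lemma E_linear: "B \<in> sets borel \<Longrightarrow> f \<in> l2 M \<Longrightarrow> g \<in> l2 M \<Longrightarrow>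
    l2_eq M (E B (\<lambda>x. c * f x + d * g x)) (\<lambda>x. c * E B f x + d * E B g x)"
  using E_operator unfolding l2_operator_def by simp

lemma E_adj: "B \<in> sets borel \<Longrightarrow> f \<in> l2 M \<Longrightarrow> g \<in> l2 M \<Longrightarrow> l2_inner M (E B f) g = l2_inner M f (E B g)"
  using conjunct1[OF pvm[unfolded projection_valued_measure_def]] by simp

lemma E_empty: "f \<in> l2 M \<Longrightarrow> l2_eq M (E {} f) (\<lambda>x. 0)"
  using pvm[unfolded projection_valued_measure_def, THEN conjunct2, THEN conjunct1] by simp

lemma E_UNIV: "f \<in> l2 M \<Longrightarrow> l2_eq M (E UNIV f) f"
  using pvm[unfolded projection_valued_measure_def, THEN conjunct2, THEN conjunct2, THEN conjunct1] by simp

lemma E_int: "A \<in> sets borel \<Longrightarrow> B \<in> sets borel \<Longrightarrow> f \<in> l2 M \<Longrightarrow> l2_eq M (E A (E B f)) (E (A \<inter> B) f)"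
  using pvm[unfolded projection_valued_measure_def, THEN conjunct2, THEN conjunct2, THEN conjunct2, THEN conjunct1] by simp

lemma E_sums: "range A \<subseteq> sets borel \<Longrightarrow> disjoint_family A \<Longrightarrow> f \<in> l2 M \<Longrightarrow>
    (\<lambda>n. l2_norm M (\<lambda>x. (\<Sum>i<n. E (A i) f x) - E (\<Union>i. A i) f x)) \<longlonglongrightarrow> 0" for A :: "nat \<Rightarrow> real set"
  using pvm[unfolded projection_valued_measure_def, THEN conjunct2, THEN conjunct2, THEN conjunct2, THEN conjunct2] by simp

lemma E_inner:
  assumes "A \<in> sets borel" "B \<in> sets borel" "f \<in> l2 M" "g \<in> l2 M"
  shows "l2_inner M (E A f) (E B g) = l2_inner M (E (A \<inter> B) f) g"
proof -
  have "l2_inner M (E A f) (E B g) = l2_inner M (E B (E A f)) g" by (simp add: E_adj assms)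
  also have "\<dots> = l2_inner M (E (A \<inter> B) f) g"
    by (rule l2_inner_cong_AE) (use E_int[OF assms(2,1,3)] in \<open>auto simp: assms Int_commute l2_eq_def sets.Int intro!: E_l2\<close>)
  finally show ?thesis .
qed

lemma E_inner_self:
  assumes "B \<in> sets borel" "f \<in> l2 M"
  shows "l2_inner M (E B f) f = complex_of_real ((l2_norm M (E B f))\<^sup>2)"
  using E_inner[OF assms(1,1,2,2)] by (simp add: l2_inner_self)

lemma norm_cong: "l2_eq M f g \<Longrightarrow> f \<in> l2 M \<Longrightarrow> g \<in> l2 M \<Longrightarrow> l2_norm M f = l2_norm M g"
proof -
  assume a: "l2_eq M f g" "f \<in> l2 M" "g \<in> l2 M"
  have "l2_inner M f f = l2_inner M g g" by (rule l2_inner_cong_AE) (use a in auto)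
  then have "(l2_norm M f)\<^sup>2 = (l2_norm M g)\<^sup>2" unfolding l2_inner_self of_real_eq_iff .
  then show ?thesis by simp
qed

text \<open>The set function in the definition of \<open>scalar_spectral_measure\<close> is a measure because strong
  additivity of \<open>E\<close> implies additivity of each \<open>\<langle>E(B) f, f\<rangle>\<close>.\<close>

lemma emeasure_scalar:
  assumes f: "f \<in> l2 M" and B: "B \<in> sets borel"
  shows "emeasure (scalar_spectral_measure M E f) B = ennreal ((l2_norm M (E B f))\<^sup>2)"
proof -
  have "emeasure (scalar_spectral_measure M E f) B = ennreal (Re (l2_inner M (E B f) f))"
  proof (rule emeasure_measure_of[OF scalar_spectral_measure_def])
    show "positive (sets (scalar_spectral_measure M E f)) (\<lambda>B. ennreal (Re (l2_inner M (E B f) f)))"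
      using l2_inner_cong_AE[OF E_empty[OF f], of f f] f
      by (auto simp: positive_def l2_inner_zero l2_zero l2_eq_def)
    show "countably_additive (sets (scalar_spectral_measure M E f)) (\<lambda>B. ennreal (Re (l2_inner M (E B f) f)))"
      unfolding countably_additive_def
    proof (intro allI impI)
      fix A :: "nat \<Rightarrow> real set"
      assume A: "range A \<subseteq> sets (scalar_spectral_measure M E f)" "disjoint_family A"
        "\<Union> (range A) \<in> sets (scalar_spectral_measure M E f)"
      then have Ab: "\<And>i. A i \<in> sets borel" "\<Union> (range A) \<in> sets borel" by auto
      have "(\<lambda>n. l2_norm M (\<lambda>x. (\<Sum>i<n. E (A i) f x) - E (\<Union>i. A i) f x)) \<longlonglongrightarrow> 0"
        using A(1,2) f by (intro E_sums) auto
      then have "(\<lambda>n. l2_inner M (\<lambda>x. \<Sum>i<n. E (A i) f x) f) \<longlonglongrightarrow> l2_inner M (E (\<Union>i. A i) f) f"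
        by (intro l2_inner_tendsto l2_sum) (use Ab f in auto)
      moreover have "l2_inner M (\<lambda>x. \<Sum>i<n. E (A i) f x) f = (\<Sum>i<n. l2_inner M (E (A i) f) f)" for n
        using l2_inner_sum_left[of "{..<n}" "\<lambda>i. E (A i) f" M f "\<lambda>_. 1"] f Ab by simp
      ultimately have "(\<lambda>i. l2_inner M (E (A i) f) f) sums l2_inner M (E (\<Union>i. A i) f) f"
        by (simp add: sums_def)
      then have "(\<lambda>i. Re (l2_inner M (E (A i) f) f)) sums Re (l2_inner M (E (\<Union>i. A i) f) f)"
        by (rule sums_Re)
      then show "(\<Sum>i. ennreal (Re (l2_inner M (E (A i) f) f))) = ennreal (Re (l2_inner M (E (\<Union>i. A i) f) f))"
        by (intro suminf_ennreal_eq) (auto simp: E_inner_self Ab f)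
    qed
  qed (use B in auto)
  then show ?thesis by (simp add: E_inner_self assms)
qed

lemma finite_scalar: "f \<in> l2 M \<Longrightarrow> finite_measure (scalar_spectral_measure M E f)"
  by (rule finite_measureI) (simp add: emeasure_scalar)

text \<open>The defect \<open>h\<close> of the asserted decomposition is killed by \<open>E B\<close> and by \<open>E (-B)\<close>, so its scalar
  measure vanishes, and the total mass of that measure is the squared norm of \<open>h\<close>.\<close>

lemma E_compl:
  assumes f: "f \<in> l2 M" and B: "B \<in> sets borel"
  shows "l2_eq M f (\<lambda>x. E B f x + E (-B) f x)"
proof -
  have B': "-B \<in> sets borel" using B by auto
  define h where "h = (\<lambda>x. f x - (E B f x + E (-B) f x))"
  have h: "h \<in> l2 M" unfolding h_def by (intro l2_diff l2_add E_l2 f B B')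
  interpret finite_measure "scalar_spectral_measure M E h" by (rule finite_scalar[OF h])
  have z: "l2_norm M (E D h) = 0" if D: "D \<in> {B, -B}" for D
  proof -
    have D': "D \<in> sets borel" "-D \<in> sets borel" using D B by auto
    have "l2_inner M (E D h) (E D h) = l2_inner M (E D h) h" by (simp add: E_inner D' h)
    also have "\<dots> = l2_inner M (E D h) f - (l2_inner M (E D h) (E D f) + l2_inner M (E D h) (E (-D) f))"
      unfolding h_def using D by (auto simp: l2_inner_diff_right l2_inner_add_right f B B' l2_add l2_diff)
    also have "l2_inner M (E D h) (E D f) = l2_inner M (E D h) f" by (simp add: E_inner D' h f)
    also have "l2_inner M (E D h) (E (-D) f) = l2_inner M (E {} h) f" by (simp add: E_inner D' h f)
    also have "\<dots> = l2_inner M (\<lambda>x. 0) f"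
      by (rule l2_inner_cong_AE[OF E_empty[OF h]]) (auto simp: l2_eq_def h f l2_zero)
    finally show ?thesis by (simp add: l2_inner_zero l2_inner_self)
  qed
  have "emeasure (scalar_spectral_measure M E h) (B \<union> -B) =
      emeasure (scalar_spectral_measure M E h) B + emeasure (scalar_spectral_measure M E h) (-B)"
    by (rule plus_emeasure[symmetric]) (use B B' in auto)
  then have "(l2_norm M (E UNIV h))\<^sup>2 = 0"
    using z by (simp add: emeasure_scalar h B B')
  then have "l2_norm M h = 0" using norm_cong[OF E_UNIV[OF h]] h by simp
  then have "l2_eq M h (\<lambda>x. 0)" using l2_norm_eq_0[OF h] by simp
  then show ?thesis unfolding h_def l2_eq_def by simp
qed

lemma E_norm_comb:
  assumes "A \<in> sets borel" "f \<in> l2 M" "g \<in> l2 M" "cmod w = 1" "l2_inner M (E A f) g = 0"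
  shows "(l2_norm M (E A (\<lambda>x. f x + w * g x)))\<^sup>2 = (l2_norm M (E A f))\<^sup>2 + (l2_norm M (E A g))\<^sup>2"
proof -
  have "l2_norm M (E A (\<lambda>x. f x + w * g x)) = l2_norm M (\<lambda>x. E A f x + w * E A g x)"
    using E_linear[OF assms(1-3), of 1 w] assms by (intro norm_cong) (auto intro!: E_l2 l2_add l2_scale)
  then have "(l2_norm M (E A (\<lambda>x. f x + w * g x)))\<^sup>2 = (l2_norm M (E A f))\<^sup>2
      + 2 * Re (cnj w * l2_inner M (E A f) (E A g)) + (cmod w * l2_norm M (E A g))\<^sup>2"
    by (simp add: l2_norm_add_sq l2_scale assms l2_inner_scale_right l2_norm_scale)
  then show ?thesis by (simp add: E_inner assms)
qed

text \<open>Spectral measures cannot see relative phases: twisting one of the two components by a unimodular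
  number does not change \<open>\<langle>E(A) f, f\<rangle>\<close>, since the components remain orthogonal under every \<open>E A\<close>.\<close>

lemma E_twist:
  assumes f: "f \<in> l2 M" and B: "B \<in> sets borel" and w: "cmod w = 1"
  shows "scalar_spectral_measure M E (\<lambda>x. E B f x + w * E (-B) f x) = scalar_spectral_measure M E f"
proof (rule measure_eqI)
  have B': "-B \<in> sets borel" using B by auto
  fix A assume "A \<in> sets (scalar_spectral_measure M E (\<lambda>x. E B f x + w * E (-B) f x))"
  then have A: "A \<in> sets borel" by simp
  have "(l2_norm M (E A (\<lambda>x. E B f x + w * E (-B) f x)))\<^sup>2
      = (l2_norm M (E A (E B f)))\<^sup>2 + (l2_norm M (E A (E (-B) f)))\<^sup>2"
  proof (rule E_norm_comb)
    have "l2_inner M (E A (E B f)) (E (-B) f) = l2_inner M (E (A \<inter> B) f) (E (-B) f)"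
      by (rule l2_inner_cong_AE[OF E_int]) (use A B B' f in \<open>auto simp: l2_eq_def\<close>)
    also have "\<dots> = l2_inner M (E {} f) f"
      by (subst E_inner) (use A B B' f in \<open>auto simp: Int_assoc\<close>)
    also have "\<dots> = l2_inner M (\<lambda>x. 0) f"
      by (rule l2_inner_cong_AE[OF E_empty[OF f]]) (auto simp: l2_eq_def f l2_zero)
    finally show "l2_inner M (E A (E B f)) (E (-B) f) = 0" by (simp add: l2_inner_zero)
  qed (use A B B' f w in auto)
  also have "l2_norm M (E A (E B f)) = l2_norm M (E (A \<inter> B) f)"
    by (rule norm_cong[OF E_int]) (use A B f in auto)
  also have "l2_norm M (E A (E (-B) f)) = l2_norm M (E (A \<inter> -B) f)"
    by (rule norm_cong[OF E_int]) (use A B' f in auto)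
  finally have n: "(l2_norm M (E A (\<lambda>x. E B f x + w * E (-B) f x)))\<^sup>2 =
     (l2_norm M (E (A \<inter> B) f))\<^sup>2 + (l2_norm M (E (A \<inter> -B) f))\<^sup>2" .
  have "emeasure (scalar_spectral_measure M E f) ((A \<inter> B) \<union> (A \<inter> -B)) =
     emeasure (scalar_spectral_measure M E f) (A \<inter> B) + emeasure (scalar_spectral_measure M E f) (A \<inter> -B)"
    by (rule plus_emeasure[symmetric]) (use A B B' in auto)
  moreover have "(A \<inter> B) \<union> (A \<inter> -B) = A" by auto
  ultimately show "emeasure (scalar_spectral_measure M E (\<lambda>x. E B f x + w * E (-B) f x)) A
     = emeasure (scalar_spectral_measure M E f) A"
    using A B B' f by (simp add: emeasure_scalar l2_add l2_scale n ennreal_plus)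
qed simp

lemma E_restrict:
  assumes f: "f \<in> l2 M" and B: "B \<in> sets borel"
  shows "scalar_spectral_measure M E (E B f) = density (scalar_spectral_measure M E f) (indicator B)"
proof (rule measure_eqI)
  fix A assume "A \<in> sets (scalar_spectral_measure M E (E B f))"
  then have A: "A \<in> sets borel" by simp
  have "emeasure (density (scalar_spectral_measure M E f) (indicator B)) A =
     emeasure (scalar_spectral_measure M E f) (A \<inter> B)"
    using A B by (subst emeasure_density) (auto simp: indicator_inter_arith[symmetric] Int_commute nn_integral_indicator)
  then show "emeasure (scalar_spectral_measure M E (E B f)) A = emeasure (density (scalar_spectral_measure M E f) (indicator B)) A"
    using norm_cong[OF E_int[OF A B f]] A B f by (simp add: emeasure_scalar)
qed simp

end

section \<open>Spectral measures of diagonal operators\<close>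

context l2_system
begin

text \<open>The graph of the operator with multipliers \<open>\<mu>\<close> on its maximal domain.\<close>

definition diag_graph :: "(nat \<Rightarrow> real) \<Rightarrow> 'a op_graph" where
  "diag_graph \<mu> = {(f, g). f \<in> l2 M \<and> g \<in> l2 M \<and> (\<forall>j. coef g j = complex_of_real (\<mu> j) * coef f j)}"

lemma diag_graph_linear:
  assumes "(f, g) \<in> diag_graph \<mu>" "(f', g') \<in> diag_graph \<mu>"
  shows "((\<lambda>x. f x + w * f' x), (\<lambda>x. g x + w * g' x)) \<in> diag_graph \<mu>"
  using assms
  by (auto simp: diag_graph_def l2_add l2_scale l2_inner_add_left l2_inner_scale_left e_l2 algebra_simps)

text \<open>Let \<open>E\<close> be any spectral measure of the diagonal operator \<open>T\<close>. Both components of \<open>e i\<close> under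
  \<open>E B\<close> and \<open>E (-B)\<close> lie in the domain, and the value of the form of \<open>T\<close> at a phase-twisted sum of
  them is independent of the phase by \<open>E_twist\<close>. Hence the mixed terms vanish, and the integral of
  \<open>t\<close> over \<open>B\<close> is \<open>\<langle>T e i, E(B) e i\<rangle> = \<mu> i \<langle>e i, E(B) e i\<rangle>\<close>. So \<open>t - \<mu> i\<close> has integral \<open>0\<close> over every
  Borel set.\<close>

lemma spectral_measure_concentrated:
  assumes S: "spectral_measure_of M (diag_graph \<mu>) E"
  shows "AE t in scalar_spectral_measure M E (e i). t = \<mu> i"
proof -
  interpret l2_pvm M E by unfold_locales (use S in \<open>simp add: spectral_measure_of_def\<close>)
  have dom: "Domain (diag_graph \<mu>) = {f \<in> l2 M. integrable (scalar_spectral_measure M E f) (\<lambda>t. t\<^sup>2)}"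
    and val: "\<And>f g. (f, g) \<in> diag_graph \<mu> \<Longrightarrow> l2_inner M g f = complex_of_real (\<integral>t. t \<partial>scalar_spectral_measure M E f)"
    using S unfolding spectral_measure_of_def by auto
  let ?m = "scalar_spectral_measure M E (e i)"
  interpret m: finite_measure ?m by (rule finite_scalar[OF e_l2])
  have "coef (\<lambda>x. complex_of_real (\<mu> i) * e i x) j = complex_of_real (\<mu> j) * coef (e i) j" for j
    by (cases "i = j") (auto simp: l2_inner_scale_left e_orth)
  then have "(e i, \<lambda>x. complex_of_real (\<mu> i) * e i x) \<in> diag_graph \<mu>"
    by (auto simp: diag_graph_def e_l2 l2_scale)
  then have "e i \<in> Domain (diag_graph \<mu>)" by blast
  then have int2: "integrable ?m (\<lambda>t. t\<^sup>2)" unfolding dom by simp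
  have meas: "f \<in> borel_measurable ?m" if "f \<in> borel_measurable borel" for f :: "real \<Rightarrow> real"
    using that by (simp add: measurable_cong_sets[OF sets_scalar_spectral_measure refl])
  have int1: "integrable ?m (\<lambda>t. t)"
  proof (rule Bochner_Integration.integrable_bound[of _ "\<lambda>t. 1 + t\<^sup>2"])
    show "integrable ?m (\<lambda>t. 1 + t\<^sup>2)" using int2 by simp
    show "AE t in ?m. norm t \<le> norm (1 + t\<^sup>2)"
    proof (rule AE_I2)
      fix t :: real
      have "2 * \<bar>t\<bar> * 1 \<le> \<bar>t\<bar>\<^sup>2 + 1\<^sup>2" by (rule sum_squares_bound)
      moreover have "0 \<le> \<bar>t\<bar>" by simp
      ultimately have "\<bar>t\<bar> \<le> 1 + t\<^sup>2" by (simp add: power2_abs)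
      then show "norm t \<le> norm (1 + t\<^sup>2)" by simp
    qed
  qed (rule meas, simp)
  have key: "(\<integral>t\<in>B. t - \<mu> i \<partial>?m) = 0" if B: "B \<in> sets borel" for B
  proof -
    have B': "-B \<in> sets borel" using B by auto
    have memb: "E D (e i) \<in> Domain (diag_graph \<mu>)" if D: "D \<in> sets borel" for D
    proof -
      have "integrable (density ?m (\<lambda>x. ennreal (indicator D x))) (\<lambda>t. t\<^sup>2)"
        using D integrable_mult_indicator[OF _ int2, of D] by (subst integrable_density) (auto intro!: meas)
      then have "integrable (scalar_spectral_measure M E (E D (e i))) (\<lambda>t. t\<^sup>2)"
        unfolding E_restrict[OF e_l2 D] by (simp add: ennreal_indicator)
      then show ?thesis unfolding dom using D e_l2 by simp
    qed
    obtain c c' where c: "(E B (e i), c) \<in> diag_graph \<mu>" and c': "(E (-B) (e i), c') \<in> diag_graph \<mu>"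
      using memb[OF B] memb[OF B'] by blast
    have l2s[simp]: "E B (e i) \<in> l2 M" "E (-B) (e i) \<in> l2 M" "c \<in> l2 M" "c' \<in> l2 M"
      using c c' by (auto simp: diag_graph_def)
    let ?K = "complex_of_real (\<integral>t. t \<partial>?m)"
    let ?L = "l2_inner M c (E B (e i)) + l2_inner M c' (E (-B) (e i))"
    have tw: "?K = ?L + cnj w * l2_inner M c (E (-B) (e i)) + w * l2_inner M c' (E B (e i))"
      if w: "cmod w = 1" for w
    proof -
      have ww: "w * cnj w = 1" using w by (simp add: complex_norm_square[symmetric])
      have "l2_inner M (\<lambda>x. c x + w * c' x) (\<lambda>x. E B (e i) x + w * E (-B) (e i) x) = ?K"
        using val[OF diag_graph_linear[OF c c', of w]] unfolding E_twist[OF e_l2 B w] .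
      also have "l2_inner M (\<lambda>x. c x + w * c' x) (\<lambda>x. E B (e i) x + w * E (-B) (e i) x) =
        l2_inner M c (E B (e i)) + (w * cnj w) * l2_inner M c' (E (-B) (e i))
         + cnj w * l2_inner M c (E (-B) (e i)) + w * l2_inner M c' (E B (e i))"
        by (simp add: l2_inner_add_left l2_inner_add_right l2_inner_scale_left l2_inner_scale_right
            l2_add l2_scale algebra_simps)
      finally show ?thesis unfolding ww by (simp add: algebra_simps)
    qed
    have z: "l2_inner M c' (E B (e i)) = 0" by (rule unimodular_twist_constant(2)[OF tw])
    have sum_eq: "l2_eq M (\<lambda>x. c x + c' x) (\<lambda>x. complex_of_real (\<mu> i) * e i x)"
    proof (rule coef_eqI)
      fix j
      have "coef (\<lambda>x. c x + c' x) j = complex_of_real (\<mu> j) * coef (\<lambda>x. E B (e i) x + E (-B) (e i) x) j"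
        using c c' by (auto simp: diag_graph_def l2_inner_add_left e_l2 algebra_simps)
      also have "coef (\<lambda>x. E B (e i) x + E (-B) (e i) x) j = coef (e i) j"
        by (rule coef_cong[symmetric]) (auto simp: e_l2 E_compl B intro!: l2_add)
      finally show "coef (\<lambda>x. c x + c' x) j = coef (\<lambda>x. complex_of_real (\<mu> i) * e i x) j"
        by (cases "i = j") (auto simp: l2_inner_scale_left e_orth)
    qed (auto intro!: l2_add l2_scale e_l2)
    have "l2_inner M c (E B (e i)) = l2_inner M (\<lambda>x. c x + c' x) (E B (e i))"
      by (simp add: l2_inner_add_left z)
    also have "\<dots> = l2_inner M (\<lambda>x. complex_of_real (\<mu> i) * e i x) (E B (e i))"
      by (rule l2_inner_cong_AE[OF sum_eq]) (auto simp: l2_eq_def intro!: l2_add l2_scale e_l2)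
    also have "\<dots> = complex_of_real (\<mu> i) * l2_inner M (E B (e i)) (e i)"
      by (simp add: l2_inner_scale_left E_adj[OF B e_l2 e_l2])
    also have "\<dots> = complex_of_real (\<mu> i * measure ?m B)"
      using emeasure_scalar[OF e_l2 B, of i] by (simp add: E_inner_self[OF B e_l2] measure_def)
    finally have "complex_of_real (\<integral>t. t \<partial>scalar_spectral_measure M E (E B (e i))) = complex_of_real (\<mu> i * measure ?m B)"
      using val[OF c] by simp
    then have "(\<integral>t. t \<partial>density ?m (\<lambda>x. ennreal (indicator B x))) = \<mu> i * measure ?m B"
      unfolding of_real_eq_iff E_restrict[OF e_l2 B] by (simp add: ennreal_indicator)
    then have "(\<integral>t\<in>B. t \<partial>?m) = \<mu> i * measure ?m B"
      using B by (subst (asm) integral_density) (auto intro!: meas simp: set_lebesgue_integral_def)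
    moreover have "(\<integral>t\<in>B. t - \<mu> i \<partial>?m) = (\<integral>t\<in>B. t \<partial>?m) - (\<integral>t\<in>B. \<mu> i \<partial>?m)"
    proof (intro set_integral_diff)
      show "set_integrable ?m B (\<lambda>t. t)" using integrable_mult_indicator[OF _ int1, of B] B by (simp add: set_integrable_def)
      show "set_integrable ?m B (\<lambda>t. \<mu> i)" unfolding set_integrable_def
        by (rule integrable_mult_indicator) (use B in auto)
    qed
    moreover have "(\<integral>t\<in>B. \<mu> i \<partial>?m) = \<mu> i * measure ?m B"
      using B by (simp add: set_lebesgue_integral_def)
    ultimately show ?thesis by simp
  qed
  have "AE t in ?m. t - \<mu> i = 0"
    by (rule m.density_zero) (use int1 key in auto)
  then show ?thesis by simp
qed

lemma spectral_projection_eigenvector: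
  assumes S: "spectral_measure_of M (diag_graph \<mu>) E" and A: "A \<in> sets borel"
  shows "\<mu> i \<notin> A \<Longrightarrow> l2_eq M (E A (e i)) (\<lambda>x. 0)" "\<mu> i \<in> A \<Longrightarrow> l2_eq M (E A (e i)) (e i)"
proof -
  interpret l2_pvm M E by unfold_locales (use S in \<open>simp add: spectral_measure_of_def\<close>)
  have 1: "l2_eq M (E B (e i)) (\<lambda>x. 0)" if B: "B \<in> sets borel" "\<mu> i \<notin> B" for B
  proof -
    have "AE t in scalar_spectral_measure M E (e i). t \<notin> B"
      using spectral_measure_concentrated[OF S, of i] by eventually_elim (use B in auto)
    then have "emeasure (scalar_spectral_measure M E (e i)) B = 0"
      by (subst (asm) AE_iff_measurable[where N=B]) (use B in auto)
    then show ?thesis using emeasure_scalar[OF e_l2 B(1), of i] l2_norm_eq_0[OF E_l2[OF B(1) e_l2]] by simp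
  qed
  show "\<mu> i \<notin> A \<Longrightarrow> l2_eq M (E A (e i)) (\<lambda>x. 0)" using 1[OF A] .
  assume "\<mu> i \<in> A"
  then have "l2_eq M (E (-A) (e i)) (\<lambda>x. 0)" using A by (intro 1) auto
  then show "l2_eq M (E A (e i)) (e i)"
    using E_compl[OF e_l2 A, of i] unfolding l2_eq_def by eventually_elim simp
qed

text \<open>A representing operator \<open>U\<close> is constrained on the diagonal \<open>\<langle>U f, f\<rangle>\<close> only. If \<open>g\<close> is orthogonal
  to \<open>e i\<close>, then by \<open>spectral_projection_eigenvector\<close> the scalar measure of \<open>e i + w g\<close> does not depend
  on the unimodular number \<open>w\<close>; comparing the values of \<open>w\<close> gives \<open>\<langle>U g, e i\<rangle> = 0\<close>. Therefore the \<open>i\<close>-th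
  coefficient of \<open>U f\<close> comes from the component of \<open>f\<close> along \<open>e i\<close> alone.\<close>

theorem functional_calculus_unique:
  assumes S: "spectral_measure_of M (diag_graph \<mu>) E" and U: "l2_operator M U"
    and phi: "\<phi> \<in> borel_measurable borel"
    and UE: "\<And>f. f \<in> l2 M \<Longrightarrow> l2_inner M (U f) f = (\<integral>t. \<phi> t \<partial>scalar_spectral_measure M E f)"
    and f: "f \<in> l2 M"
  shows "coef (U f) i = \<phi> (\<mu> i) * coef f i"
proof (cases "coef (e i) i = 0")
  case True
  have "U f \<in> l2 M" using U f by (auto simp: l2_operator_def)
  then show ?thesis using coef_null[OF True] f by simp
next
  case False
  then have one: "coef (e i) i = 1" using e_norm[of i] by auto
  interpret l2_pvm M E by unfold_locales (use S in \<open>simp add: spectral_measure_of_def\<close>)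
  have Ul2: "h \<in> l2 M \<Longrightarrow> U h \<in> l2 M" for h using U by (auto simp: l2_operator_def)
  have Ulin: "h \<in> l2 M \<Longrightarrow> g \<in> l2 M \<Longrightarrow> l2_eq M (U (\<lambda>x. c * h x + d * g x)) (\<lambda>x. c * U h x + d * U g x)" for h g c d
    using U by (auto simp: l2_operator_def)
  have phim[measurable]: "\<phi> \<in> borel_measurable (scalar_spectral_measure M E h)" for h
    using phi by (simp add: measurable_cong_sets[OF sets_scalar_spectral_measure refl])
  let ?m = "scalar_spectral_measure M E (e i)"
  interpret m: finite_measure ?m by (rule finite_scalar[OF e_l2])
  have m1: "measure ?m UNIV = 1"
  proof -
    have "emeasure ?m UNIV = ennreal ((l2_norm M (E UNIV (e i)))\<^sup>2)" by (rule emeasure_scalar[OF e_l2]) simp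
    also have "l2_norm M (E UNIV (e i)) = l2_norm M (e i)" by (rule norm_cong[OF E_UNIV]) (auto simp: e_l2)
    also have "(l2_norm M (e i))\<^sup>2 = 1" using one unfolding l2_inner_self by (simp only: of_real_eq_1_iff)
    finally show ?thesis by (simp add: measure_def)
  qed
  have Ue: "l2_inner M (U (e i)) (e i) = \<phi> (\<mu> i)"
  proof -
    have "(\<integral>t. \<phi> t \<partial>?m) = (\<integral>t. \<phi> (\<mu> i) \<partial>?m)"
      by (rule integral_cong_AE) (use spectral_measure_concentrated[OF S, of i] in \<open>auto elim: eventually_mono\<close>)
    also have "\<dots> = \<phi> (\<mu> i)" using m1 by simp
    finally show ?thesis by (simp add: UE e_l2)
  qed
  have Ug: "coef (U g) i = 0" if g: "g \<in> l2 M" "coef g i = 0" for g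
  proof -
    have sm: "scalar_spectral_measure M E (\<lambda>x. e i x + w * g x) = scalar_spectral_measure M E (\<lambda>x. e i x + 1 * g x)"
      if w: "cmod w = 1" for w
    proof (rule measure_eqI)
      fix A assume "A \<in> sets (scalar_spectral_measure M E (\<lambda>x. e i x + w * g x))"
      then have A: "A \<in> sets borel" by simp
      have ge: "l2_inner M (e i) g = 0" using g(2) l2_inner_commute[of M "e i" g] by simp
      have "l2_inner M (E A (e i)) g = 0"
      proof (cases "\<mu> i \<in> A")
        case True
        then have "l2_inner M (E A (e i)) g = l2_inner M (e i) g"
          by (intro l2_inner_cong_AE spectral_projection_eigenvector[OF S A]) (auto simp: l2_eq_def e_l2 g A)
        then show ?thesis using ge by simp
      next
        case False
        then have "l2_inner M (E A (e i)) g = l2_inner M (\<lambda>x. 0) g"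
          by (intro l2_inner_cong_AE spectral_projection_eigenvector[OF S A]) (auto simp: l2_eq_def e_l2 g A l2_zero)
        then show ?thesis by (simp add: l2_inner_zero)
      qed
      then show "emeasure (scalar_spectral_measure M E (\<lambda>x. e i x + w * g x)) A =
         emeasure (scalar_spectral_measure M E (\<lambda>x. e i x + 1 * g x)) A"
        using E_norm_comb[OF A e_l2 g(1) w] E_norm_comb[OF A e_l2 g(1), of 1] A g
        by (simp add: emeasure_scalar l2_add l2_scale e_l2)
    qed simp
    let ?K = "\<integral>t. \<phi> t \<partial>scalar_spectral_measure M E (\<lambda>x. e i x + 1 * g x)"
    let ?L = "l2_inner M (U (e i)) (e i) + l2_inner M (U g) g"
    have tw: "?K = ?L + cnj w * l2_inner M (U (e i)) g + w * l2_inner M (U g) (e i)" if w: "cmod w = 1" for w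
    proof -
      have ww: "w * cnj w = 1" using w by (simp add: complex_norm_square[symmetric])
      have mem: "(\<lambda>x. e i x + w * g x) \<in> l2 M" by (intro l2_add l2_scale e_l2 g)
      have "?K = l2_inner M (U (\<lambda>x. e i x + w * g x)) (\<lambda>x. e i x + w * g x)"
        by (simp only: UE[OF mem] sm[OF w])
      also have "\<dots> = l2_inner M (\<lambda>x. U (e i) x + w * U g x) (\<lambda>x. e i x + w * g x)"
        using Ulin[OF e_l2 g(1), of 1 i w]
        by (intro l2_inner_cong_AE mem Ul2 l2_add l2_scale e_l2 g) (auto simp: l2_eq_def)
      also have "\<dots> = l2_inner M (U (e i)) (e i) + (w * cnj w) * l2_inner M (U g) g
         + cnj w * l2_inner M (U (e i)) g + w * l2_inner M (U g) (e i)"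
        by (simp add: l2_inner_add_left l2_inner_add_right l2_inner_scale_left l2_inner_scale_right
            l2_add l2_scale Ul2 e_l2 g algebra_simps)
      finally show ?thesis unfolding ww by simp
    qed
    show ?thesis by (rule unimodular_twist_constant(2)[OF tw])
  qed
  let ?c = "coef f i"
  define g where "g = (\<lambda>x. f x - ?c * e i x)"
  have g: "g \<in> l2 M" unfolding g_def by (intro l2_diff l2_scale f e_l2)
  have "coef g i = 0" unfolding g_def using one
    by (simp add: l2_inner_diff_left f l2_scale e_l2 l2_inner_scale_left)
  note Ugi = Ug[OF g this]
  have "(\<lambda>x. ?c * e i x + 1 * g x) = f" unfolding g_def by simp
  then have "l2_eq M (U f) (\<lambda>x. ?c * U (e i) x + 1 * U g x)" using Ulin[OF e_l2 g, of ?c i 1] by simp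
  then have "coef (U f) i = coef (\<lambda>x. ?c * U (e i) x + 1 * U g x) i"
    by (rule coef_cong) (auto intro!: l2_add l2_scale Ul2 e_l2 f g)
  also have "\<dots> = ?c * \<phi> (\<mu> i)"
    by (simp add: l2_inner_add_left l2_inner_scale_left l2_scale Ul2 e_l2 g Ugi Ue)
  finally show ?thesis by simp
qed

section \<open>Functional calculus of diagonal operators\<close>

text \<open>The point masses \<open>|coef f j|\<^sup>2\<close> at \<open>\<mu> j\<close>, which is the scalar measure of the coefficientwise
  projections.\<close>

definition weight_measure :: "(nat \<Rightarrow> real) \<Rightarrow> ('a \<Rightarrow> complex) \<Rightarrow> real measure" where
  "weight_measure \<mu> f = distr (density (count_space UNIV) (\<lambda>j. ennreal ((cmod (coef f j))\<^sup>2))) borel \<mu>"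

lemma weight_measure_integrable:
  fixes h :: "real \<Rightarrow> 'b::{banach, second_countable_topology}"
  assumes "h \<in> borel_measurable borel"
  shows "integrable (weight_measure \<mu> f) h \<longleftrightarrow> summable (\<lambda>j. (cmod (coef f j))\<^sup>2 * norm (h (\<mu> j)))"
  unfolding weight_measure_def using assms
  by (subst integrable_distr_eq) (auto simp: integrable_density integrable_count_space_nat_iff)

lemma weight_measure_sums:
  fixes h :: "real \<Rightarrow> 'b::{banach, second_countable_topology}"
  assumes "h \<in> borel_measurable borel" "integrable (weight_measure \<mu> f) h"
  shows "(\<lambda>j. (cmod (coef f j))\<^sup>2 *\<^sub>R h (\<mu> j)) sums (\<integral>t. h t \<partial>weight_measure \<mu> f)"
proof -
  have "integrable (count_space UNIV) (\<lambda>j. (cmod (coef f j))\<^sup>2 *\<^sub>R h (\<mu> j))"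
    using assms(2) unfolding weight_measure_integrable[OF assms(1)]
    by (simp add: integrable_count_space_nat_iff)
  from sums_integral_count_space_nat[OF this] show ?thesis
    unfolding weight_measure_def using assms(1)
    by (subst integral_distr) (auto simp: integral_density)
qed

definition diag_projection :: "(nat \<Rightarrow> real) \<Rightarrow> real set \<Rightarrow> ('a \<Rightarrow> complex) \<Rightarrow> 'a \<Rightarrow> complex" where
  "diag_projection \<mu> B = diag (\<lambda>j. indicator B (\<mu> j))"

lemma diag_projection:
  assumes "f \<in> l2 M"
  shows "diag_projection \<mu> B f \<in> l2 M" "coef (diag_projection \<mu> B f) j = indicator B (\<mu> j) * coef f j"
  unfolding diag_projection_def
  by (rule diag(1)[OF assms], simp add: indicator_def) (rule diag(2)[OF assms], simp add: indicator_def)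

lemma scalar_diag_projection:
  assumes f: "f \<in> l2 M"
  shows "scalar_spectral_measure M (diag_projection \<mu>) f = weight_measure \<mu> f"
proof (rule scalar_spectral_measure_eqI)
  fix B :: "real set" assume B: "B \<in> sets borel"
  have "(\<lambda>j. coef (diag_projection \<mu> B f) j * cnj (coef f j)) sums l2_inner M (diag_projection \<mu> B f) f"
    by (intro parseval diag_projection f)
  then have "(\<lambda>j. Re (coef (diag_projection \<mu> B f) j * cnj (coef f j))) sums Re (l2_inner M (diag_projection \<mu> B f) f)"
    by (rule sums_Re)
  also have "(\<lambda>j. Re (coef (diag_projection \<mu> B f) j * cnj (coef f j))) = (\<lambda>j. (cmod (coef f j))\<^sup>2 * indicator B (\<mu> j))"
  proof
    fix j show "Re (coef (diag_projection \<mu> B f) j * cnj (coef f j)) = (cmod (coef f j))\<^sup>2 * indicator B (\<mu> j)"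
      by (cases "\<mu> j \<in> B") (simp_all add: diag_projection f cmod_power2 flip: power2_eq_square)
  qed
  finally have s: "(\<lambda>j. (cmod (coef f j))\<^sup>2 * indicator B (\<mu> j)) sums Re (l2_inner M (diag_projection \<mu> B f) f)" .
  have "emeasure (weight_measure \<mu> f) B = (\<integral>\<^sup>+j. ennreal ((cmod (coef f j))\<^sup>2) * indicator (\<mu> -` B) j \<partial>count_space UNIV)"
    unfolding weight_measure_def using B by (simp add: emeasure_distr emeasure_density)
  also have "\<dots> = (\<Sum>j. ennreal ((cmod (coef f j))\<^sup>2 * indicator B (\<mu> j)))"
    by (subst nn_integral_count_space_nat) (auto intro!: suminf_cong simp: indicator_def)
  also have "\<dots> = ennreal (Re (l2_inner M (diag_projection \<mu> B f) f))"
    by (rule suminf_ennreal_eq[OF _ s]) auto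
  finally show "emeasure (weight_measure \<mu> f) B = ennreal (Re (l2_inner M (diag_projection \<mu> B f) f))" .
qed (simp add: weight_measure_def)

text \<open>Each coefficient of the remainder is eventually zero and is dominated by that of \<open>f\<close>, so its
  norm tends to zero by dominated convergence for series.\<close>

lemma diag_projection_sums:
  assumes f: "f \<in> l2 M" and B: "disjoint_family (B :: nat \<Rightarrow> real set)"
  shows "(\<lambda>n. l2_norm M (\<lambda>x. (\<Sum>i<n. diag_projection \<mu> (B i) f x) - diag_projection \<mu> (\<Union>i. B i) f x)) \<longlonglongrightarrow> 0"
proof -
  let ?h = "\<lambda>n x. (\<Sum>i<n. diag_projection \<mu> (B i) f x) - diag_projection \<mu> (\<Union>i. B i) f x"
  have hl2: "?h n \<in> l2 M" for n by (intro l2_diff l2_sum diag_projection f)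
  have coef_h: "coef (?h n) j = (indicator (\<Union>i<n. B i) (\<mu> j) - indicator (\<Union>i. B i) (\<mu> j)) * coef f j" for n j
  proof -
    have "coef (\<lambda>x. \<Sum>i<n. 1 * diag_projection \<mu> (B i) f x) j = (\<Sum>i<n. 1 * coef (diag_projection \<mu> (B i) f) j)"
      by (rule l2_inner_sum_left) (auto simp: diag_projection f e_l2)
    also have "\<dots> = (\<Sum>i<n. indicator (B i) (\<mu> j)) * coef f j" by (simp add: diag_projection f sum_distrib_right)
    also have "(\<Sum>i<n. indicator (B i) (\<mu> j)) = (indicator (\<Union>i<n. B i) (\<mu> j) :: complex)"
      by (rule indicator_UN_disjoint[symmetric]) (use B in \<open>auto simp: disjoint_family_on_def\<close>)
    finally show ?thesis
      by (simp add: l2_inner_diff_left l2_sum diag_projection f e_l2 algebra_simps)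
  qed
  have "(\<lambda>n. \<Sum>j. (cmod (coef (?h n) j))\<^sup>2) \<longlonglongrightarrow> (\<Sum>j. 0)"
  proof (rule tannerys_theorem[THEN conjunct2, THEN conjunct2])
    show "(\<lambda>n. (cmod (coef (?h n) j))\<^sup>2) \<longlonglongrightarrow> 0" for j
    proof (cases "\<mu> j \<in> (\<Union>i. B i)")
      case True
      then obtain i where i: "\<mu> j \<in> B i" by auto
      show ?thesis
        by (rule tendsto_eventually, rule eventually_mono[OF eventually_gt_at_top[of i]])
           (use i in \<open>auto simp: coef_h indicator_def\<close>)
    next
      case False
      then show ?thesis by (auto simp: coef_h indicator_def)
    qed
    show "\<forall>\<^sub>F (k, n) in at_top \<times>\<^sub>F sequentially. norm ((cmod (coef (?h n) k))\<^sup>2) \<le> (cmod (coef f k))\<^sup>2"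
      by (rule always_eventually) (auto simp: coef_h norm_mult indicator_def)
  qed (auto intro: bessel f)
  then have "(\<lambda>n. (l2_norm M (?h n))\<^sup>2) \<longlonglongrightarrow> 0"
    using sums_unique[OF parseval_norm[OF hl2]] by simp
  then have "(\<lambda>n. sqrt ((l2_norm M (?h n))\<^sup>2)) \<longlonglongrightarrow> sqrt 0" by (rule tendsto_real_sqrt)
  then show ?thesis by simp
qed

lemma diag_projection_pvm: "projection_valued_measure M (diag_projection \<mu>)"
  unfolding projection_valued_measure_def
proof (intro conjI ballI allI impI)
  fix B :: "real set"
  show "l2_operator M (diag_projection \<mu> B)"
    unfolding diag_projection_def by (rule diag_operator) (auto simp: indicator_def)
  fix f assume f: "f \<in> l2 M"
  show "l2_eq M (diag_projection \<mu> B (diag_projection \<mu> B f)) (diag_projection \<mu> B f)"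
    by (rule coef_eqI) (auto simp: diag_projection f indicator_def)
  fix g assume g: "g \<in> l2 M"
  have "(\<lambda>j. coef (diag_projection \<mu> B f) j * cnj (coef g j)) sums l2_inner M (diag_projection \<mu> B f) g"
    by (intro parseval diag_projection f g)
  moreover have "(\<lambda>j. coef f j * cnj (coef (diag_projection \<mu> B g) j)) sums l2_inner M f (diag_projection \<mu> B g)"
    by (intro parseval diag_projection f g)
  moreover have "coef (diag_projection \<mu> B f) j * cnj (coef g j) = coef f j * cnj (coef (diag_projection \<mu> B g) j)" for j
    by (auto simp: diag_projection f g indicator_def)
  ultimately show "l2_inner M (diag_projection \<mu> B f) g = l2_inner M f (diag_projection \<mu> B g)"
    using sums_unique2 by auto
next
  fix f assume f: "f \<in> l2 M"
  show "l2_eq M (diag_projection \<mu> {} f) (\<lambda>x. 0)"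
    by (rule coef_eqI) (auto simp: diag_projection f l2_zero l2_inner_zero)
  show "l2_eq M (diag_projection \<mu> UNIV f) f"
    by (rule coef_eqI) (auto simp: diag_projection f)
next
  fix A B :: "real set" and f assume f: "f \<in> l2 M"
  show "l2_eq M (diag_projection \<mu> A (diag_projection \<mu> B f)) (diag_projection \<mu> (A \<inter> B) f)"
    by (rule coef_eqI) (auto simp: diag_projection f indicator_def)
next
  fix B :: "nat \<Rightarrow> real set" and f assume "disjoint_family B" "f \<in> l2 M"
  then show "(\<lambda>n. l2_norm M (\<lambda>x. (\<Sum>i<n. diag_projection \<mu> (B i) f x) - diag_projection \<mu> (\<Union>i. B i) f x)) \<longlonglongrightarrow> 0"
    by (intro diag_projection_sums)
qed

lemma diag_projection_spectral: "spectral_measure_of M (diag_graph \<mu>) (diag_projection \<mu>)"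
  unfolding spectral_measure_of_def
proof (intro conjI)
  have "integrable (weight_measure \<mu> f) (\<lambda>t. t\<^sup>2) \<longleftrightarrow> summable (\<lambda>j. (cmod (complex_of_real (\<mu> j) * coef f j))\<^sup>2)" for f
    by (subst weight_measure_integrable) (auto simp: norm_mult power_mult_distrib mult.commute)
  note int = this
  show "Domain (diag_graph \<mu>) = {f \<in> l2 M. integrable (scalar_spectral_measure M (diag_projection \<mu>) f) (\<lambda>t. t\<^sup>2)}"
  proof (intro set_eqI iffI)
    fix f assume "f \<in> Domain (diag_graph \<mu>)"
    then obtain g where g: "f \<in> l2 M" "g \<in> l2 M" "\<And>j. coef g j = complex_of_real (\<mu> j) * coef f j"
      by (auto simp: diag_graph_def)
    show "f \<in> {f \<in> l2 M. integrable (scalar_spectral_measure M (diag_projection \<mu>) f) (\<lambda>t. t\<^sup>2)}"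
      using bessel[OF g(2)] g(1) by (simp add: scalar_diag_projection int g(3))
  next
    fix f assume "f \<in> {f \<in> l2 M. integrable (scalar_spectral_measure M (diag_projection \<mu>) f) (\<lambda>t. t\<^sup>2)}"
    then have f: "f \<in> l2 M" "summable (\<lambda>j. (cmod (complex_of_real (\<mu> j) * coef f j))\<^sup>2)"
      by (auto simp: scalar_diag_projection int)
    from diag_ex[OF this] show "f \<in> Domain (diag_graph \<mu>)" using f(1) by (auto simp: diag_graph_def)
  qed
  show "\<forall>(f, g)\<in>diag_graph \<mu>. l2_inner M g f = complex_of_real (\<integral>t. t \<partial>scalar_spectral_measure M (diag_projection \<mu>) f)"
  proof safe
    fix f g assume "(f, g) \<in> diag_graph \<mu>"
    then have fg: "f \<in> l2 M" "g \<in> l2 M" "\<And>j. coef g j = complex_of_real (\<mu> j) * coef f j"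
      by (auto simp: diag_graph_def)
    have eq: "coef g j * cnj (coef f j) = complex_of_real ((cmod (coef f j))\<^sup>2 * \<mu> j)" for j
      by (simp add: fg(3) complex_norm_square[symmetric] mult.assoc del: of_real_power)
    have "summable (\<lambda>j. norm (coef g j * cnj (coef f j)))"
    proof (rule summable_comparison_test'[where N=0])
      show "summable (\<lambda>j. (cmod (coef g j))\<^sup>2 + (cmod (coef f j))\<^sup>2)"
        by (intro summable_add bessel fg)
      fix j
      have "2 * (cmod (coef g j) * cmod (coef f j)) \<le> (cmod (coef g j))\<^sup>2 + (cmod (coef f j))\<^sup>2"
        using sum_squares_bound[of "cmod (coef g j)" "cmod (coef f j)"] by (simp add: mult.assoc)
      moreover have "0 \<le> cmod (coef g j) * cmod (coef f j)" by simp
      ultimately have "cmod (coef g j) * cmod (coef f j) \<le> (cmod (coef g j))\<^sup>2 + (cmod (coef f j))\<^sup>2" by linarith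
      then show "norm (norm (coef g j * cnj (coef f j))) \<le> (cmod (coef g j))\<^sup>2 + (cmod (coef f j))\<^sup>2"
        by (simp add: norm_mult)
    qed
    then have i: "integrable (weight_measure \<mu> f) (\<lambda>t. t)"
      by (subst weight_measure_integrable) (simp_all add: eq abs_mult del: of_real_mult)
    have "(\<lambda>j. complex_of_real ((cmod (coef f j))\<^sup>2 * \<mu> j)) sums complex_of_real (\<integral>t. t \<partial>weight_measure \<mu> f)"
      using weight_measure_sums[OF _ i] by (intro sums_of_real) simp
    then show "l2_inner M g f = complex_of_real (\<integral>t. t \<partial>scalar_spectral_measure M (diag_projection \<mu>) f)"
      unfolding scalar_diag_projection[OF fg(1)] using parseval[OF fg(2,1)] sums_unique2 by (simp only: eq)
  qed
qed (rule diag_projection_pvm)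

text \<open>Existence comes from the coefficientwise projections and uniqueness from
  \<open>functional_calculus_unique\<close>; together they make the outcome of the choice computable.\<close>

theorem functional_calculus_diag:
  fixes \<mu> :: "nat \<Rightarrow> real"
  assumes phi: "\<phi> \<in> borel_measurable borel" "\<And>t. cmod (\<phi> t) \<le> 1"
  defines "U \<equiv> functional_calculus M (diag_graph \<mu>) \<phi>"
  shows "l2_operator M U" "\<And>f j. f \<in> l2 M \<Longrightarrow> coef (U f) j = \<phi> (\<mu> j) * coef f j"
proof -
  let ?P = "\<lambda>U. \<exists>E. spectral_measure_of M (diag_graph \<mu>) E \<and> l2_operator M U \<and>
        (\<forall>f\<in>l2 M. l2_inner M (U f) f = (\<integral>t. \<phi> t \<partial>scalar_spectral_measure M E f))"
  let ?D = "diag (\<lambda>j. \<phi> (\<mu> j))"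
  have "?P ?D"
  proof (intro exI conjI ballI)
    show "l2_operator M ?D" by (rule diag_operator) (rule phi(2))
    fix f assume f: "f \<in> l2 M"
    have "summable (\<lambda>j. (cmod (coef f j))\<^sup>2 * norm (\<phi> (\<mu> j)))"
      by (rule summable_comparison_test'[OF bessel[OF f], of 0])
         (auto intro!: mult_left_le simp: phi(2))
    then have i: "integrable (weight_measure \<mu> f) \<phi>" by (simp add: weight_measure_integrable phi(1))
    have "(\<lambda>j. coef (?D f) j * cnj (coef f j)) sums l2_inner M (?D f) f"
      by (intro parseval diag f phi(2))
    moreover have "coef (?D f) j * cnj (coef f j) = (cmod (coef f j))\<^sup>2 *\<^sub>R \<phi> (\<mu> j)" for j
      by (simp add: diag f phi(2) scaleR_conv_of_real complex_norm_square mult.commute mult.left_commute del: of_real_power)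
    ultimately show "l2_inner M (?D f) f = (\<integral>t. \<phi> t \<partial>scalar_spectral_measure M (diag_projection \<mu>) f)"
      unfolding scalar_diag_projection[OF f] using weight_measure_sums[OF phi(1) i] sums_unique2 by auto
  qed (rule diag_projection_spectral)
  then have "?P U" unfolding U_def functional_calculus_def by (rule someI[of ?P])
  then obtain E where E: "spectral_measure_of M (diag_graph \<mu>) E" "l2_operator M U"
    "\<And>f. f \<in> l2 M \<Longrightarrow> l2_inner M (U f) f = (\<integral>t. \<phi> t \<partial>scalar_spectral_measure M E f)" by blast
  show "l2_operator M U" by fact
  show "\<And>f j. f \<in> l2 M \<Longrightarrow> coef (U f) j = \<phi> (\<mu> j) * coef f j"
    by (rule functional_calculus_unique[OF E(1,2) phi(1) E(3)])
qed

text \<open>Essential self-adjointness in concrete form. One inclusion holds because coefficients are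
  continuous, the other because partial sums of the expansions of \<open>f\<close> and of \<open>T f\<close> converge
  simultaneously.\<close>

lemma l2_closure_diag:
  assumes G1: "\<And>v g j. (v, g) \<in> G \<Longrightarrow> v \<in> l2 M \<Longrightarrow> g \<in> l2 M \<Longrightarrow> coef g j = complex_of_real (\<mu> j) * coef v j"
    and G2: "\<And>n c. \<exists>g. ((\<lambda>x. \<Sum>j<n. c j * e j x), g) \<in> G \<and> g \<in> l2 M \<and>
               l2_eq M g (\<lambda>x. \<Sum>j<n. complex_of_real (\<mu> j) * c j * e j x)"
  shows "l2_closure M G = diag_graph \<mu>"
proof (intro set_eqI iffI)
  fix p assume "p \<in> l2_closure M G"
  then obtain f g where p: "p = (f, g)" "f \<in> l2 M" "g \<in> l2 M" and
    cl: "\<And>\<epsilon>. \<epsilon> > 0 \<Longrightarrow> \<exists>(f', g')\<in>G. f' \<in> l2 M \<and> g' \<in> l2 M \<and>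
           l2_norm M (\<lambda>x. f x - f' x) < \<epsilon> \<and> l2_norm M (\<lambda>x. g x - g' x) < \<epsilon>"
    unfolding l2_closure_def by auto
  have "\<exists>q. \<forall>n. q n \<in> G \<and> fst (q n) \<in> l2 M \<and> snd (q n) \<in> l2 M \<and>
      l2_norm M (\<lambda>x. f x - fst (q n) x) < 1 / (1 + real n) \<and> l2_norm M (\<lambda>x. g x - snd (q n) x) < 1 / (1 + real n)"
  proof (rule choice, rule allI)
    fix n :: nat
    have "0 < 1 / (1 + real n)" by simp
    from cl[OF this] obtain q where "q \<in> G"
      "case q of (f', g') \<Rightarrow> f' \<in> l2 M \<and> g' \<in> l2 M \<and>
           l2_norm M (\<lambda>x. f x - f' x) < 1 / (1 + real n) \<and> l2_norm M (\<lambda>x. g x - g' x) < 1 / (1 + real n)" ..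
    then show "\<exists>q. q \<in> G \<and> fst q \<in> l2 M \<and> snd q \<in> l2 M \<and>
      l2_norm M (\<lambda>x. f x - fst q x) < 1 / (1 + real n) \<and> l2_norm M (\<lambda>x. g x - snd q x) < 1 / (1 + real n)"
      by (intro exI[of _ q]) (simp add: case_prod_beta)
  qed
  then obtain q where q: "\<And>n. q n \<in> G" "\<And>n. fst (q n) \<in> l2 M" "\<And>n. snd (q n) \<in> l2 M"
      "\<And>n. l2_norm M (\<lambda>x. f x - fst (q n) x) < 1 / (1 + real n)"
      "\<And>n. l2_norm M (\<lambda>x. g x - snd (q n) x) < 1 / (1 + real n)" by blast
  have lim: "(\<lambda>n. 1 / (1 + real n)) \<longlonglongrightarrow> 0"
    using LIMSEQ_inverse_real_of_nat by (simp add: inverse_eq_divide add.commute)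
  have "(\<lambda>n. l2_norm M (\<lambda>x. fst (q n) x - f x)) \<longlonglongrightarrow> 0"
    by (rule tendsto_sandwich[OF _ _ tendsto_const lim])
       (use q(4) in \<open>auto simp: l2_norm_diff_commute[of M "fst _"] intro!: always_eventually less_imp_le\<close>)
  then have 1: "(\<lambda>n. coef (fst (q n)) j) \<longlonglongrightarrow> coef f j" for j by (intro l2_inner_tendsto q p e_l2)
  have "(\<lambda>n. l2_norm M (\<lambda>x. snd (q n) x - g x)) \<longlonglongrightarrow> 0"
    by (rule tendsto_sandwich[OF _ _ tendsto_const lim])
       (use q(5) in \<open>auto simp: l2_norm_diff_commute[of M "snd _"] intro!: always_eventually less_imp_le\<close>)
  then have 2: "(\<lambda>n. coef (snd (q n)) j) \<longlonglongrightarrow> coef g j" for j by (intro l2_inner_tendsto q p e_l2)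
  have "coef (snd (q n)) j = complex_of_real (\<mu> j) * coef (fst (q n)) j" for n j
    by (rule G1[of "fst (q n)" "snd (q n)"]) (use q(1-3)[of n] in auto)
  then have "(\<lambda>n. coef (snd (q n)) j) \<longlonglongrightarrow> complex_of_real (\<mu> j) * coef f j" for j
    using tendsto_mult_left[OF 1[of j], of "complex_of_real (\<mu> j)"] by simp
  then have "coef g j = complex_of_real (\<mu> j) * coef f j" for j using 2 LIMSEQ_unique by blast
  then show "p \<in> diag_graph \<mu>" using p by (simp add: diag_graph_def)
next
  fix p assume "p \<in> diag_graph \<mu>"
  then obtain f g where p: "p = (f, g)" "f \<in> l2 M" "g \<in> l2 M" and c: "\<And>j. coef g j = complex_of_real (\<mu> j) * coef f j"
    unfolding diag_graph_def by blast
  have "\<exists>(f', g')\<in>G. f' \<in> l2 M \<and> g' \<in> l2 M \<and>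
           l2_norm M (\<lambda>x. f x - f' x) < \<epsilon> \<and> l2_norm M (\<lambda>x. g x - g' x) < \<epsilon>" if "\<epsilon> > 0" for \<epsilon>
  proof -
    have "eventually (\<lambda>n. l2_norm M (\<lambda>x. (\<Sum>j<n. coef f j * e j x) - f x) < \<epsilon>) sequentially"
      "eventually (\<lambda>n. l2_norm M (\<lambda>x. (\<Sum>j<n. coef g j * e j x) - g x) < \<epsilon>) sequentially"
      using order_tendstoD(2)[OF expansion[OF p(2)] that] order_tendstoD(2)[OF expansion[OF p(3)] that] by simp_all
    then have "eventually (\<lambda>n. l2_norm M (\<lambda>x. (\<Sum>j<n. coef f j * e j x) - f x) < \<epsilon> \<and>
       l2_norm M (\<lambda>x. (\<Sum>j<n. coef g j * e j x) - g x) < \<epsilon>) sequentially" by (rule eventually_conj)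
    then obtain n where n: "l2_norm M (\<lambda>x. (\<Sum>j<n. coef f j * e j x) - f x) < \<epsilon>"
       "l2_norm M (\<lambda>x. (\<Sum>j<n. coef g j * e j x) - g x) < \<epsilon>"
      unfolding eventually_sequentially by blast
    obtain g' where g': "((\<lambda>x. \<Sum>j<n. coef f j * e j x), g') \<in> G" "g' \<in> l2 M"
      "l2_eq M g' (\<lambda>x. \<Sum>j<n. complex_of_real (\<mu> j) * coef f j * e j x)"
      using G2[where n=n and c="coef f"] by blast
    have "l2_norm M (\<lambda>x. g x - g' x) = l2_norm M (\<lambda>x. g x - (\<Sum>j<n. coef g j * e j x))"
    proof -
      have m: "(\<lambda>x. \<Sum>j<n. coef g j * e j x) \<in> l2 M" by (simp add: comb_l2)
      note [measurable] = l2D(1)[OF l2_diff[OF p(3) m]] l2D(1)[OF l2_diff[OF p(3) g'(2)]]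
      have "AE x in M. g' x = (\<Sum>j<n. coef g j * e j x)" using g'(3) by (simp add: l2_eq_def c)
      then show ?thesis unfolding l2_norm_def
        by (intro arg_cong[of _ _ sqrt] integral_cong_AE) (auto elim: eventually_mono)
    qed
    then show ?thesis
      using g'(1,2) n comb_l2[of "{..<n}" "coef f"]
      by (intro bexI[OF _ g'(1)]) (auto simp: l2_norm_diff_commute[of M f] l2_norm_diff_commute[of M g])
  qed
  then show "p \<in> l2_closure M G" unfolding l2_closure_def using p by blast
qed

section \<open>Unitary diagonal operators\<close>

text \<open>The hypotheses speak of coefficients only, since the operators in question are determined only
  up to equality almost everywhere.\<close>

lemma diag_unitary:
  assumes F_l2: "\<And>f. f \<in> l2 M \<Longrightarrow> F f \<in> l2 M"
    and F_coef: "\<And>f j. f \<in> l2 M \<Longrightarrow> coef (F f) j = \<omega> j * coef f j"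
    and om: "\<And>j. cmod (\<omega> j) = 1"
  shows "l2_unitary M F"
    and "g \<in> l2 M \<Longrightarrow> l2_inverse M F g \<in> l2 M"
    and "g \<in> l2 M \<Longrightarrow> coef (l2_inverse M F g) j = cnj (\<omega> j) * coef g j"
proof -
  have oo: "cnj (\<omega> j) * \<omega> j = 1" for j using om[of j] by (simp add: complex_norm_square[symmetric] mult.commute)
  have surj: "\<exists>f. f \<in> l2 M \<and> l2_eq M (F f) g" if g: "g \<in> l2 M" for g
  proof (intro exI conjI)
    have le: "cmod (cnj (\<omega> j)) \<le> 1" for j using om by simp
    show d: "diag (\<lambda>j. cnj (\<omega> j)) g \<in> l2 M" by (rule diag(1)[OF g le])
    show "l2_eq M (F (diag (\<lambda>j. cnj (\<omega> j)) g)) g"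
      by (rule coef_eqI) (use F_l2[OF d] F_coef[OF d] diag(2)[OF g le] g oo in \<open>auto simp: mult.commute mult.left_commute\<close>)
  qed
  show "l2_unitary M F"
    unfolding l2_unitary_def
  proof (intro conjI ballI)
    show "l2_operator M F" by (rule coefwise_operator[OF F_l2 F_coef])
    fix f g assume fg: "f \<in> l2 M" "g \<in> l2 M"
    have "coef (F f) j * cnj (coef (F g) j) = coef f j * cnj (coef g j)" for j
      using oo[of j] by (simp add: F_coef fg) (simp add: mult_ac)
    then show "l2_inner M (F f) (F g) = l2_inner M f g"
      using parseval[OF F_l2[OF fg(1)] F_l2[OF fg(2)]] parseval[OF fg] sums_unique2 by simp
  next
    fix g assume "g \<in> l2 M"
    then show "\<exists>f\<in>l2 M. l2_eq M (F f) g" using surj by blast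
  qed
  assume g: "g \<in> l2 M"
  from someI_ex[OF surj[OF g]] have h: "l2_inverse M F g \<in> l2 M" "l2_eq M (F (l2_inverse M F g)) g"
    unfolding l2_inverse_def by auto
  show "l2_inverse M F g \<in> l2 M" by fact
  have "\<omega> j * coef (l2_inverse M F g) j = coef g j"
    using coef_cong[OF h(2) F_l2[OF h(1)] g, of j] F_coef[OF h(1)] by simp
  then show "coef (l2_inverse M F g) j = cnj (\<omega> j) * coef g j"
    using oo[of j] by (metis mult.assoc mult_1)
qed

lemma diag_power:
  assumes F_l2: "\<And>f. f \<in> l2 M \<Longrightarrow> F f \<in> l2 M"
    and F_coef: "\<And>f j. f \<in> l2 M \<Longrightarrow> coef (F f) j = \<omega> j * coef f j"
    and f: "f \<in> l2 M"
  shows "(F ^^ n) f \<in> l2 M \<and> (\<forall>j. coef ((F ^^ n) f) j = \<omega> j ^ n * coef f j)"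
  by (induction n) (auto simp: f F_l2 F_coef)

lemma diag_identity_iff:
  assumes F_l2: "\<And>f. f \<in> l2 M \<Longrightarrow> F f \<in> l2 M"
    and F_coef: "\<And>f j. f \<in> l2 M \<Longrightarrow> coef (F f) j = \<omega> j * coef f j"
  shows "l2_is_identity M (F ^^ n) \<longleftrightarrow> (\<forall>f\<in>l2 M. \<forall>j. \<omega> j ^ n * coef f j = coef f j)"
proof
  assume "l2_is_identity M (F ^^ n)"
  then show "\<forall>f\<in>l2 M. \<forall>j. \<omega> j ^ n * coef f j = coef f j"
    unfolding l2_is_identity_def
  proof (intro ballI allI)
    fix f j assume id: "\<forall>f\<in>l2 M. l2_eq M ((F ^^ n) f) f" and f: "f \<in> l2 M"
    note p = diag_power[where F=F and \<omega>=\<omega>, OF F_l2 F_coef f, of n]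
    have "coef ((F ^^ n) f) j = coef f j" by (rule coef_cong) (use id f p in blast)+
    then show "\<omega> j ^ n * coef f j = coef f j" using p by simp
  qed
next
  assume *: "\<forall>f\<in>l2 M. \<forall>j. \<omega> j ^ n * coef f j = coef f j"
  show "l2_is_identity M (F ^^ n)"
    unfolding l2_is_identity_def
  proof
    fix f assume f: "f \<in> l2 M"
    show "l2_eq M ((F ^^ n) f) f"
      by (rule coef_eqI) (use diag_power[where F=F and \<omega>=\<omega>, OF F_l2 F_coef f, of n] * f in auto)
  qed
qed

end

section \<open>Graded orthogonalisation\<close>

text \<open>The inverse of a zero norm is zero. Hence a vector that depends on its predecessors produces the
  zero function, and linearly dependent enumerations are allowed.\<close>

fun gram_schmidt :: "'a measure \<Rightarrow> (nat \<Rightarrow> 'a \<Rightarrow> complex) \<Rightarrow> nat \<Rightarrow> 'a \<Rightarrow> complex" where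
  "gram_schmidt M z n =
     (let u = (\<lambda>x. z n x - (\<Sum>i<n. l2_inner M (z n) (gram_schmidt M z i) * gram_schmidt M z i x))
      in (\<lambda>x. complex_of_real (inverse (l2_norm M u)) * u x))"

declare gram_schmidt.simps [simp del]

text \<open>Orthogonalisation respects a grading by mutually orthogonal subspaces: projections onto earlier
  vectors of other classes are zero, so every output stays in the class of its input. In the
  application the classes are eigenspaces.\<close>

lemma graded_gram_schmidt:
  fixes S :: "'c \<Rightarrow> ('a \<Rightarrow> complex) set" and z :: "nat \<Rightarrow> 'a \<Rightarrow> complex"
  assumes S_l2: "\<And>c. S c \<subseteq> l2 M"
    and S_zero: "\<And>c. (\<lambda>x. 0) \<in> S c"
    and S_comb: "\<And>c f g a b. f \<in> S c \<Longrightarrow> g \<in> S c \<Longrightarrow> (\<lambda>x. a * f x + b * g x) \<in> S c"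
    and S_orth: "\<And>c c' f g. c \<noteq> c' \<Longrightarrow> f \<in> S c \<Longrightarrow> g \<in> S c' \<Longrightarrow> l2_inner M f g = 0"
    and z: "\<And>n. z n \<in> S (cl n)"
  defines "e \<equiv> gram_schmidt M z"
  shows "\<And>n. e n \<in> S (cl n)"
    and "\<And>i j. i \<noteq> j \<Longrightarrow> l2_inner M (e i) (e j) = 0"
    and "\<And>j. l2_inner M (e j) (e j) \<in> {0, 1}"
    and "\<And>f n. f \<in> l2 M \<Longrightarrow> (\<And>j. l2_inner M f (e j) = 0) \<Longrightarrow> l2_inner M f (z n) = 0"
proof -
  define u where "u n = (\<lambda>x. z n x - (\<Sum>i<n. l2_inner M (z n) (e i) * e i x))" for n
  have e_eq: "e n = (\<lambda>x. complex_of_real (inverse (l2_norm M (u n))) * u n x)" for n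
    unfolding e_def u_def by (subst gram_schmidt.simps) (simp add: Let_def)
  have S_sum: "(\<lambda>x. \<Sum>i\<in>I. a i * f i x) \<in> S c" if "\<And>i. i \<in> I \<Longrightarrow> a i = 0 \<or> f i \<in> S c" "finite I" for I :: "nat set" and a f c
    using that(2,1)
  proof (induction I)
    case (insert i I)
    have "(\<lambda>x. \<Sum>i\<in>I. a i * f i x) \<in> S c" using insert by auto
    then show ?case
      using insert.hyps insert.prems[of i] S_comb[of "\<lambda>x. \<Sum>i\<in>I. a i * f i x" c "f i" 1 "a i"]
      by (auto simp: add.commute)
  qed (simp add: S_zero)
  have main: "e n \<in> S (cl n) \<and> (\<forall>i<n. l2_inner M (e n) (e i) = 0) \<and> l2_inner M (e n) (e n) \<in> {0, 1}" for n
  proof (induction n rule: less_induct)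
    case (less n)
    have eS: "\<And>i. i < n \<Longrightarrow> e i \<in> S (cl i)" and eo: "\<And>i j. i < n \<Longrightarrow> j < i \<Longrightarrow> l2_inner M (e i) (e j) = 0"
      and en: "\<And>i. i < n \<Longrightarrow> l2_inner M (e i) (e i) \<in> {0, 1}" using less by auto
    have el2: "e i \<in> l2 M" if "i < n" for i using eS[OF that] S_l2 by blast
    have zl2: "z n \<in> l2 M" using z S_l2 by blast
    have "(\<lambda>x. \<Sum>i<n. l2_inner M (z n) (e i) * e i x) \<in> S (cl n)"
    proof (rule S_sum)
      fix i assume "i \<in> {..<n}"
      then show "l2_inner M (z n) (e i) = 0 \<or> e i \<in> S (cl n)"
        using S_orth[OF _ z eS, of n i] eS[of i] by (cases "cl i = cl n") auto
    qed simp
    then have uS: "u n \<in> S (cl n)" unfolding u_def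
      using S_comb[OF z, of "\<lambda>x. \<Sum>i<n. l2_inner M (z n) (e i) * e i x" n 1 "-1"] by simp
    then have ul2: "u n \<in> l2 M" using S_l2 by blast
    have "e n \<in> S (cl n)" unfolding e_eq using S_comb[OF uS S_zero, of _ 0] by simp
    moreover have "l2_inner M (u n) (e j) = 0" if j: "j < n" for j
    proof -
      have "l2_inner M (\<lambda>x. \<Sum>i<n. l2_inner M (z n) (e i) * e i x) (e j) = (\<Sum>i<n. l2_inner M (z n) (e i) * l2_inner M (e i) (e j))"
        by (rule l2_inner_sum_left) (use el2 j in auto)
      also have "\<dots> = (\<Sum>i<n. if i = j then l2_inner M (z n) (e j) * l2_inner M (e j) (e j) else 0)"
      proof (rule sum.cong)
        fix i assume "i \<in> {..<n}"
        then show "l2_inner M (z n) (e i) * l2_inner M (e i) (e j) = (if i = j then l2_inner M (z n) (e j) * l2_inner M (e j) (e j) else 0)"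
          using eo[of i j] eo[of j i] j l2_inner_commute[of M "e i" "e j"] by (cases i j rule: linorder_cases) auto
      qed simp
      also have "\<dots> = l2_inner M (z n) (e j) * l2_inner M (e j) (e j)" using j by simp
      also have "\<dots> = l2_inner M (z n) (e j)"
      proof (cases "l2_inner M (e j) (e j) = 0")
        case True
        then have "l2_norm M (e j) = 0" by (simp add: l2_inner_self)
        then show ?thesis using l2_cauchy_schwarz[OF zl2 el2[OF j]] by simp
      qed (use en[OF j] in auto)
      finally have "l2_inner M (\<lambda>x. \<Sum>i<n. l2_inner M (z n) (e i) * e i x) (e j) = l2_inner M (z n) (e j)" .
      then show ?thesis unfolding u_def
        by (subst l2_inner_diff_left) (auto intro!: zl2 l2_sum l2_scale el2 j)
    qed
    then have "\<forall>i<n. l2_inner M (e n) (e i) = 0" unfolding e_eq[of n] by (simp add: l2_inner_scale_left)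
    moreover have "l2_inner M (e n) (e n) \<in> {0, 1}"
    proof (cases "l2_norm M (u n) = 0")
      case True
      then show ?thesis by (simp add: e_eq l2_inner_zero)
    next
      case False
      then show ?thesis unfolding e_eq
        by (simp add: l2_inner_scale_left l2_inner_scale_right l2_inner_self power2_eq_square) (simp add: field_simps)
    qed
    ultimately show ?case by blast
  qed
  show "e n \<in> S (cl n)" for n using main by blast
  show "l2_inner M (e i) (e j) = 0" if "i \<noteq> j" for i j
    using main[of i] main[of j] that l2_inner_commute[of M "e i" "e j"] by (cases i j rule: linorder_cases) auto
  show "l2_inner M (e j) (e j) \<in> {0, 1}" for j using main by blast
  fix f n assume f: "f \<in> l2 M" "\<And>j. l2_inner M f (e j) = 0"
  have el2: "e i \<in> l2 M" for i using main[of i] S_l2 by blast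
  have zl2: "z n \<in> l2 M" using z S_l2 by blast
  have ul2: "u n \<in> l2 M" unfolding u_def by (intro l2_diff l2_sum l2_scale el2 zl2)
  have "l2_inner M f (u n) = 0"
  proof (cases "l2_norm M (u n) = 0")
    case True
    then show ?thesis using l2_cauchy_schwarz[OF f(1) ul2] by simp
  next
    case False
    then show ?thesis using f(2)[of n] unfolding e_eq by (simp add: l2_inner_scale_right)
  qed
  moreover have "l2_inner M f (\<lambda>x. \<Sum>i<n. l2_inner M (z n) (e i) * e i x) = 0"
  proof -
    have "l2_inner M (\<lambda>x. \<Sum>i<n. l2_inner M (z n) (e i) * e i x) f = (\<Sum>i<n. l2_inner M (z n) (e i) * l2_inner M (e i) f)"
      by (rule l2_inner_sum_left) (use el2 f in auto)
    also have "\<dots> = 0" using f(2) l2_inner_commute[of M "e _" f] by simp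
    finally show ?thesis using l2_inner_commute[of M f] by (metis complex_cnj_zero)
  qed
  moreover have "l2_inner M f (u n) = l2_inner M f (z n) - l2_inner M f (\<lambda>x. \<Sum>i<n. l2_inner M (z n) (e i) * e i x)"
    unfolding u_def by (rule l2_inner_diff_right) (auto intro!: zl2 l2_sum l2_scale el2 f)
  ultimately show "l2_inner M f (z n) = 0" by simp
qed

section \<open>Homogeneous polynomials\<close>

text \<open>Generation by linear forms instead of coefficient families: closure of homogeneous polynomials
  under differentiation, reflection and difference quotients becomes a rule induction.\<close>

inductive hpoly :: "nat \<Rightarrow> (real ^ 'n \<Rightarrow> complex) \<Rightarrow> bool" where
  hpoly_const: "hpoly 0 (\<lambda>x. c)"
| hpoly_add: "hpoly m p \<Longrightarrow> hpoly m q \<Longrightarrow> hpoly m (\<lambda>x. p x + q x)"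
| hpoly_linear: "hpoly m p \<Longrightarrow> hpoly (Suc m) (\<lambda>x. complex_of_real (x \<bullet> \<xi>) * p x)"

lemma hpoly_zero: "hpoly m (\<lambda>x. 0)"
proof (induction m)
  case (Suc m)
  from hpoly_linear[OF Suc] show ?case by simp
qed (rule hpoly_const)

lemma hpoly_scale: "hpoly m p \<Longrightarrow> hpoly m (\<lambda>x. c * p x)"
proof (induction rule: hpoly.induct)
  case (hpoly_linear m p \<xi>)
  from hpoly.hpoly_linear[OF hpoly_linear.IH, of \<xi>] show ?case by (simp add: algebra_simps)
qed (auto simp: distrib_left intro: hpoly.intros)

lemma hpoly_sum: "(\<And>i. i \<in> I \<Longrightarrow> hpoly m (p i)) \<Longrightarrow> hpoly m (\<lambda>x. \<Sum>i\<in>I. p i x)"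
  by (induction I rule: infinite_finite_induct) (auto intro: hpoly_zero hpoly_add)

lemma hpoly_mult: "hpoly m p \<Longrightarrow> hpoly n q \<Longrightarrow> hpoly (m + n) (\<lambda>x. p x * q x)"
proof (induction rule: hpoly.induct)
  case (hpoly_const c)
  then show ?case by (simp add: hpoly_scale)
next
  case (hpoly_add m p p')
  then show ?case by (simp add: distrib_right hpoly.hpoly_add)
next
  case (hpoly_linear m p \<xi>)
  then show ?case using hpoly.hpoly_linear[of "m + n" "\<lambda>x. p x * q x" \<xi>] by (simp add: mult.assoc)
qed

lemma hpoly_cnj: "hpoly m p \<Longrightarrow> hpoly m (\<lambda>x. cnj (p x))"
  by (induction rule: hpoly.induct) (auto intro: hpoly.intros)

lemma hpoly_homogeneous: "hpoly m p \<Longrightarrow> p (c *\<^sub>R x) = complex_of_real (c ^ m) * p x"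
  by (induction rule: hpoly.induct) (auto simp: algebra_simps)

lemma hpoly_continuous: "hpoly m p \<Longrightarrow> continuous_on S p"
  by (induction rule: hpoly.induct) (auto intro!: continuous_intros)

lemma hpoly_measurable: "hpoly m p \<Longrightarrow> p \<in> borel_measurable borel"
  using hpoly_continuous[of m p UNIV] by (rule borel_measurable_continuous_onI)

lemma hpoly_normsq: "hpoly m p \<Longrightarrow> hpoly (m + 2) (\<lambda>x. complex_of_real ((norm x)\<^sup>2) * p x)"
proof -
  assume p: "hpoly m p"
  have "hpoly (m + 2) (\<lambda>x. \<Sum>\<xi>\<in>Basis. complex_of_real (x \<bullet> \<xi>) * (complex_of_real (x \<bullet> \<xi>) * p x))"
    using hpoly_linear[OF hpoly_linear[OF p]] by (intro hpoly_sum) simp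
  also have "(\<lambda>x. \<Sum>\<xi>\<in>Basis. complex_of_real (x \<bullet> \<xi>) * (complex_of_real (x \<bullet> \<xi>) * p x))
     = (\<lambda>x. complex_of_real ((norm x)\<^sup>2) * p x)"
    by (simp add: power2_norm_eq_inner euclidean_inner[of x x for x] sum_distrib_right mult.assoc)
  finally show ?thesis .
qed

lemma hpoly_normpow: "hpoly m p \<Longrightarrow> hpoly (m + 2 * j) (\<lambda>x. complex_of_real (norm x ^ (2 * j)) * p x)"
proof (induction j)
  case (Suc j)
  from hpoly_normsq[OF Suc.IH[OF Suc.prems]] show ?case
    by (simp add: power_add power2_eq_square mult.assoc)
qed simp

lemma finite_multiindices: "finite {\<beta> :: 'n::finite \<Rightarrow> nat. sum \<beta> UNIV = m}"
proof (rule finite_subset)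
  show "{\<beta> :: 'n \<Rightarrow> nat. sum \<beta> UNIV = m} \<subseteq> PiE UNIV (\<lambda>_. {..m})"
    by (auto intro!: member_le_sum[of _ UNIV, simplified])
  show "finite (PiE (UNIV :: 'n set) (\<lambda>_. {..m}))" by (intro finite_PiE) auto
qed

definition monomial :: "('n::finite \<Rightarrow> nat) \<Rightarrow> real ^ 'n \<Rightarrow> complex" where
  "monomial \<beta> x = complex_of_real (\<Prod>i\<in>UNIV. (x $ i) ^ \<beta> i)"

lemma hpoly_monomial:
  fixes \<beta> :: "'n::finite \<Rightarrow> nat"
  shows "hpoly (sum \<beta> UNIV) (monomial \<beta>)"
proof -
  have 1: "hpoly n (\<lambda>x. complex_of_real ((x $ i) ^ n))" for i :: 'n and n
  proof (induction n)
    case 0 show ?case by (simp add: hpoly_const)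
  next
    case (Suc n)
    from hpoly_linear[OF Suc.IH, of "axis i 1"] show ?case by (simp add: inner_axis)
  qed
  have "hpoly (sum \<beta> I) (\<lambda>x. complex_of_real (\<Prod>i\<in>I. (x $ i) ^ \<beta> i))" if "finite I" for I
    using that
  proof (induction I)
    case empty show ?case by (simp add: hpoly_const)
  next
    case (insert i I)
    from hpoly_mult[OF 1[where n="\<beta> i" and i=i] insert.IH] insert.hyps show ?case by simp
  qed
  from this[of UNIV] show ?thesis unfolding monomial_def[abs_def] by simp
qed

lemma homogeneous_poly_iff_hpoly:
  fixes p :: "real ^ 'n \<Rightarrow> complex"
  shows "homogeneous_poly m p \<longleftrightarrow> hpoly m p"
proof
  assume "homogeneous_poly m p"
  then obtain c where c: "\<And>x. p x = (\<Sum>\<beta> | sum \<beta> UNIV = m. c \<beta> * monomial \<beta> x)"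
    unfolding homogeneous_poly_def monomial_def by blast
  have "hpoly m (\<lambda>x. \<Sum>\<beta> | sum \<beta> UNIV = m. c \<beta> * monomial \<beta> x)"
    by (intro hpoly_sum hpoly_scale) (use hpoly_monomial in auto)
  also have "(\<lambda>x. \<Sum>\<beta> | sum \<beta> UNIV = m. c \<beta> * monomial \<beta> x) = p" by (rule ext) (rule c[symmetric])
  finally show "hpoly m p" .
next
  assume "hpoly m p"
  have add: "homogeneous_poly m (\<lambda>x. p x + q x)" if pq: "homogeneous_poly m p" "homogeneous_poly m q"
    for m and p q :: "real ^ 'n \<Rightarrow> complex"
  proof -
    obtain c where c: "\<And>x. p x = (\<Sum>\<beta> | sum \<beta> UNIV = m. c \<beta> * complex_of_real (\<Prod>i\<in>UNIV. (x $ i) ^ \<beta> i))"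
      using pq(1) unfolding homogeneous_poly_def by blast
    obtain d where d: "\<And>x. q x = (\<Sum>\<beta> | sum \<beta> UNIV = m. d \<beta> * complex_of_real (\<Prod>i\<in>UNIV. (x $ i) ^ \<beta> i))"
      using pq(2) unfolding homogeneous_poly_def by blast
    show ?thesis unfolding homogeneous_poly_def
      by (intro exI[of _ "\<lambda>\<beta>. c \<beta> + d \<beta>"]) (simp only: c d distrib_right sum.distrib, simp)
  qed
  have zero: "homogeneous_poly m (\<lambda>x. 0)" for m
    unfolding homogeneous_poly_def by (intro exI[of _ "\<lambda>_. 0"]) simp
  have coord: "homogeneous_poly (Suc m) (\<lambda>x. a * complex_of_real (x $ i) * p x)"
    if p: "homogeneous_poly m p" for m i a and p :: "real ^ 'n \<Rightarrow> complex"
  proof -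
    obtain c where c: "\<And>x. p x = (\<Sum>\<beta> | sum \<beta> UNIV = m. c \<beta> * monomial \<beta> x)"
      using p unfolding homogeneous_poly_def monomial_def by blast
    define up where "up \<beta> = \<beta>(i := Suc (\<beta> i))" for \<beta> :: "'n \<Rightarrow> nat"
    define dn where "dn \<beta> = \<beta>(i := \<beta> i - 1)" for \<beta> :: "'n \<Rightarrow> nat"
    have dn_up: "dn (up \<beta>) = \<beta>" for \<beta> by (simp add: dn_def up_def)
    have up_dn: "0 < \<beta> i \<Longrightarrow> up (dn \<beta>) = \<beta>" for \<beta> by (auto simp: dn_def up_def)
    have sum_up: "sum (up \<beta>) UNIV = Suc (sum \<beta> UNIV)" for \<beta>
      by (simp add: up_def sum.remove[of UNIV i])
    have mon_up: "monomial (up \<beta>) x = complex_of_real (x $ i) * monomial \<beta> x" for \<beta> x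
      by (simp add: monomial_def up_def prod.remove[of UNIV i])
    have "a * complex_of_real (x $ i) * p x
       = (\<Sum>\<beta> | sum \<beta> UNIV = Suc m. (if 0 < \<beta> i then a * c (dn \<beta>) else 0) * monomial \<beta> x)" for x
    proof -
      have "(\<Sum>\<beta> | sum \<beta> UNIV = Suc m. (if 0 < \<beta> i then a * c (dn \<beta>) else 0) * monomial \<beta> x)
         = (\<Sum>\<beta> | sum \<beta> UNIV = Suc m \<and> 0 < \<beta> i. a * c (dn \<beta>) * monomial \<beta> x)"
        by (rule sum.mono_neutral_cong_right) (auto simp: finite_multiindices)
      also have "\<dots> = (\<Sum>\<beta> | sum \<beta> UNIV = m. a * c \<beta> * (complex_of_real (x $ i) * monomial \<beta> x))"
      proof (rule sum.reindex_bij_witness[of _ up dn])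
        fix \<beta> assume "\<beta> \<in> {\<beta>. sum \<beta> UNIV = Suc m \<and> 0 < \<beta> i}"
        then have b: "sum \<beta> UNIV = Suc m" "0 < \<beta> i" by auto
        show "up (dn \<beta>) = \<beta>" by (rule up_dn) (rule b(2))
        show "dn \<beta> \<in> {\<beta>. sum \<beta> UNIV = m}" using sum_up[of "dn \<beta>"] b by (simp add: up_dn)
        show "a * c (dn \<beta>) * (complex_of_real (x $ i) * monomial (dn \<beta>) x) = a * c (dn \<beta>) * monomial \<beta> x"
          using mon_up[of "dn \<beta>" x] b by (simp add: up_dn)
      next
        fix \<beta> assume "\<beta> \<in> {\<beta> :: 'n \<Rightarrow> nat. sum \<beta> UNIV = m}"
        then show "up \<beta> \<in> {\<beta>. sum \<beta> UNIV = Suc m \<and> 0 < \<beta> i}" using sum_up[of \<beta>] by (auto simp: up_def)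
      qed (rule dn_up)
      also have "\<dots> = a * complex_of_real (x $ i) * p x"
        unfolding c by (simp add: sum_distrib_left mult_ac)
      finally show ?thesis by simp
    qed
    then show ?thesis unfolding homogeneous_poly_def monomial_def
      by (intro exI[of _ "\<lambda>\<beta>. if 0 < \<beta> i then a * c (dn \<beta>) else 0"]) simp
  qed
  show "homogeneous_poly m p" using \<open>hpoly m p\<close>
  proof (induction rule: hpoly.induct)
    case (hpoly_const c)
    have "{\<beta> :: 'n \<Rightarrow> nat. sum \<beta> UNIV = 0} = {\<lambda>_. 0}" by auto
    then show ?case unfolding homogeneous_poly_def by (intro exI[of _ "\<lambda>_. c"]) simp
  next
    case (hpoly_add m p q) then show ?case by (simp add: add)
  next
    case (hpoly_linear m p \<xi>)
    have "homogeneous_poly (Suc m) (\<lambda>x. \<Sum>i\<in>I. complex_of_real (\<xi> $ i) * complex_of_real (x $ i) * p x)" if "finite I" for I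
      using that by (induction I) (auto simp: zero intro!: add coord hpoly_linear.IH)
    from this[of UNIV] show ?case
      by (simp add: inner_vec_def sum_distrib_left sum_distrib_right mult_ac)
  qed
qed

section \<open>Dunkl operators on polynomials\<close>

lemma root_reflection_inner: "\<alpha> \<bullet> root_reflection \<alpha> x = - (\<alpha> \<bullet> x)"
  by (cases "\<alpha> = 0") (auto simp: root_reflection_def inner_diff_right power2_norm_eq_inner)

lemma root_reflection_inner_eq: "root_reflection \<alpha> x \<bullet> y = x \<bullet> y - 2 * (\<alpha> \<bullet> x) * (\<alpha> \<bullet> y) / (norm \<alpha>)\<^sup>2"
  by (simp add: root_reflection_def inner_diff_left)

lemma root_reflection_self_adjoint: "root_reflection \<alpha> x \<bullet> y = x \<bullet> root_reflection \<alpha> y"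
  by (simp add: root_reflection_def inner_diff_left inner_diff_right inner_commute mult_ac)

lemma root_reflection_involution [simp]: "root_reflection \<alpha> (root_reflection \<alpha> x) = x"
proof -
  have "root_reflection \<alpha> (root_reflection \<alpha> x) = root_reflection \<alpha> x - (2 * - (\<alpha> \<bullet> x) / (norm \<alpha>)\<^sup>2) *\<^sub>R \<alpha>"
    unfolding root_reflection_inner[symmetric] by (rule root_reflection_def)
  then show ?thesis by (simp add: root_reflection_def)
qed

lemma norm_root_reflection [simp]: "norm (root_reflection \<alpha> x) = norm x"
  by (simp add: norm_eq_sqrt_inner root_reflection_self_adjoint)

lemma root_reflection_eq_0 [simp]: "root_reflection \<alpha> x = 0 \<longleftrightarrow> x = 0"
  by (metis norm_eq_zero norm_root_reflection)

lemma root_reflection_fixed: "\<alpha> \<bullet> x = 0 \<Longrightarrow> root_reflection \<alpha> x = x"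
  by (simp add: root_reflection_def)

lemma linear_root_reflection: "linear (root_reflection \<alpha>)"
  by (rule linearI) (auto simp: root_reflection_def inner_add_right algebra_simps add_divide_distrib)

lemma hpoly_reflection: "hpoly m p \<Longrightarrow> hpoly m (\<lambda>x. p (root_reflection \<alpha> x))"
proof (induction rule: hpoly.induct)
  case (hpoly_linear m p \<xi>)
  from hpoly.hpoly_linear[OF hpoly_linear.IH, of "root_reflection \<alpha> \<xi>"]
  show ?case by (simp add: root_reflection_self_adjoint)
qed (auto intro: hpoly.intros)

lemma dir_deriv_eq:
  assumes "(f has_derivative f') (at x)"
  shows "dir_deriv \<xi> f x = f' \<xi>"
proof -
  have g: "((\<lambda>t. x + t *\<^sub>R \<xi>) has_derivative (\<lambda>t. t *\<^sub>R \<xi>)) (at 0)"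
    by (auto intro!: derivative_eq_intros)
  have "((\<lambda>t. f (x + t *\<^sub>R \<xi>)) has_derivative (\<lambda>t. f' (t *\<^sub>R \<xi>))) (at 0)"
    by (rule has_derivative_compose[OF g]) (use assms in simp)
  moreover have "f' (t *\<^sub>R \<xi>) = t *\<^sub>R f' \<xi>" for t
    using has_derivative_linear[OF assms] by (simp add: linear_cmul)
  ultimately have "((\<lambda>t. f (x + t *\<^sub>R \<xi>)) has_vector_derivative f' \<xi>) (at 0)"
    by (simp add: has_vector_derivative_def)
  then show ?thesis unfolding dir_deriv_def by (rule vector_derivative_at)
qed

lemma dir_deriv_has_derivative:
  "f differentiable (at x) \<Longrightarrow> (f has_derivative (\<lambda>\<xi>. dir_deriv \<xi> f x)) (at x)"
  unfolding differentiable_def by (auto simp: dir_deriv_eq)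

text \<open>Polynomials of degree one less, where below degree \<open>0\<close> there is only the zero function.\<close>

definition lower :: "nat \<Rightarrow> (real ^ 'n \<Rightarrow> complex) \<Rightarrow> bool" where
  "lower m p = (case m of 0 \<Rightarrow> p = (\<lambda>x. 0) | Suc k \<Rightarrow> hpoly k p)"

lemma lower_hpoly: "lower m p \<Longrightarrow> hpoly (m - 1) p"
  by (cases m) (auto simp: lower_def hpoly_zero)

lemma lower_zero: "lower m (\<lambda>x. 0)"
  by (cases m) (auto simp: lower_def hpoly_zero)

lemma lower_add: "lower m p \<Longrightarrow> lower m q \<Longrightarrow> lower m (\<lambda>x. p x + q x)"
  by (cases m) (auto simp: lower_def hpoly_add)

lemma lower_scale: "lower m p \<Longrightarrow> lower m (\<lambda>x. c * p x)"
  by (cases m) (auto simp: lower_def hpoly_scale)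

lemma lower_sum: "(\<And>i. i \<in> I \<Longrightarrow> lower m (p i)) \<Longrightarrow> lower m (\<lambda>x. \<Sum>i\<in>I. p i x)"
  by (induction I rule: infinite_finite_induct) (auto intro: lower_zero lower_add)

lemma lower_linear: "lower m p \<Longrightarrow> hpoly m (\<lambda>x. complex_of_real (x \<bullet> \<xi>) * p x)"
  using hpoly_linear[of "m - 1" p \<xi>] by (cases m) (auto simp: lower_def hpoly_zero)

lemma linear_form_has_derivative:
  "((\<lambda>x. complex_of_real (x \<bullet> \<xi>)) has_derivative (\<lambda>h. complex_of_real (h \<bullet> \<xi>))) (at x)"
  by (auto intro!: derivative_eq_intros)

lemma hpoly_differentiable: "hpoly m p \<Longrightarrow> p differentiable (at x)"
proof (induction rule: hpoly.induct)
  case (hpoly_linear m p \<xi>)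
  then show ?case
    using linear_form_has_derivative[of \<xi> x] by (intro differentiable_mult) (auto simp: differentiable_def)
qed auto

lemma dir_deriv_add:
  "f differentiable (at x) \<Longrightarrow> g differentiable (at x) \<Longrightarrow>
    dir_deriv \<eta> (\<lambda>x. f x + g x) x = dir_deriv \<eta> f x + dir_deriv \<eta> g x"
  by (rule dir_deriv_eq) (intro has_derivative_add dir_deriv_has_derivative)

lemma dir_deriv_mult:
  "f differentiable (at x) \<Longrightarrow> g differentiable (at x) \<Longrightarrow>
    dir_deriv \<eta> (\<lambda>x. f x * g x) x = f x * dir_deriv \<eta> g x + dir_deriv \<eta> f x * g x"
  by (rule dir_deriv_eq) (intro has_derivative_mult dir_deriv_has_derivative)

lemma dir_deriv_const [simp]: "dir_deriv \<eta> (\<lambda>x. c) x = 0"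
  by (rule dir_deriv_eq) simp

lemma dir_deriv_scale:
  "f differentiable (at x) \<Longrightarrow> dir_deriv \<eta> (\<lambda>x. c * f x) x = c * dir_deriv \<eta> f x"
  using dir_deriv_mult[of "\<lambda>x. c" x f \<eta>] by simp

lemma differentiable_linear_form: "(\<lambda>x. complex_of_real (x \<bullet> \<xi>)) differentiable (at x)"
  using linear_form_has_derivative unfolding differentiable_def by blast

lemma dir_deriv_linear:
  "f differentiable (at x) \<Longrightarrow>
    dir_deriv \<eta> (\<lambda>x. complex_of_real (x \<bullet> \<xi>) * f x) x = complex_of_real (x \<bullet> \<xi>) * dir_deriv \<eta> f x + complex_of_real (\<eta> \<bullet> \<xi>) * f x"
  by (simp add: dir_deriv_mult differentiable_linear_form dir_deriv_eq[OF linear_form_has_derivative])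

lemma hpoly_dir_deriv: "hpoly m p \<Longrightarrow> lower m (dir_deriv \<eta> p)"
proof (induction rule: hpoly.induct)
  case (hpoly_const c)
  then show ?case by (simp add: lower_def fun_eq_iff)
next
  case (hpoly_add m p q)
  then have "dir_deriv \<eta> (\<lambda>x. p x + q x) = (\<lambda>x. dir_deriv \<eta> p x + dir_deriv \<eta> q x)"
    by (auto simp: fun_eq_iff dir_deriv_add hpoly_differentiable)
  then show ?case using hpoly_add by (simp add: lower_add)
next
  case (hpoly_linear m p \<xi>)
  then have "dir_deriv \<eta> (\<lambda>x. complex_of_real (x \<bullet> \<xi>) * p x) = (\<lambda>x. complex_of_real (x \<bullet> \<xi>) * dir_deriv \<eta> p x + complex_of_real (\<eta> \<bullet> \<xi>) * p x)"
    by (auto simp: fun_eq_iff dir_deriv_linear hpoly_differentiable)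
  then show ?case using hpoly_linear by (simp add: lower_def hpoly.hpoly_add lower_linear[unfolded lower_def] hpoly_scale)
qed

lemma euler_homogeneous: "hpoly m p \<Longrightarrow> dir_deriv x p x = of_nat m * p x"
proof (induction rule: hpoly.induct)
  case (hpoly_add m p q)
  then show ?case by (simp add: dir_deriv_add hpoly_differentiable distrib_left)
next
  case (hpoly_linear m p \<xi>)
  then show ?case by (simp add: dir_deriv_linear hpoly_differentiable) (simp add: algebra_simps)
qed simp

lemma sum_Basis_dir_deriv:
  assumes "f differentiable (at x)"
  shows "(\<Sum>\<xi>\<in>Basis. complex_of_real (v \<bullet> \<xi>) * dir_deriv \<xi> f x) = dir_deriv v f x"
proof -
  have lin: "linear (\<lambda>\<xi>. dir_deriv \<xi> f x)"
    by (rule has_derivative_linear[OF dir_deriv_has_derivative[OF assms]])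
  have "dir_deriv v f x = dir_deriv (\<Sum>\<xi>\<in>Basis. (v \<bullet> \<xi>) *\<^sub>R \<xi>) f x" by (simp add: euclidean_representation)
  also have "\<dots> = (\<Sum>\<xi>\<in>Basis. (v \<bullet> \<xi>) *\<^sub>R dir_deriv \<xi> f x)"
    by (simp add: linear_sum[OF lin] linear_cmul[OF lin])
  finally show ?thesis by (simp add: scaleR_conv_of_real)
qed

lemma reflection_quotient_add:
  "f differentiable (at x) \<Longrightarrow> g differentiable (at x) \<Longrightarrow>
   reflection_quotient \<alpha> (\<lambda>x. f x + g x) x = reflection_quotient \<alpha> f x + reflection_quotient \<alpha> g x"
  by (simp add: reflection_quotient_def dir_deriv_add algebra_simps add_divide_distrib diff_divide_distrib)

lemma reflection_quotient_scale:
  "f differentiable (at x) \<Longrightarrow>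
   reflection_quotient \<alpha> (\<lambda>x. c * f x) x = c * reflection_quotient \<alpha> f x"
  by (simp add: reflection_quotient_def dir_deriv_scale algebra_simps diff_divide_distrib)

text \<open>This product rule is the induction step for everything about difference quotients of polynomials.
  On the hyperplane it is the Leibniz rule at the removable singularity.\<close>

lemma reflection_quotient_linear:
  assumes "f differentiable (at x)"
  shows "reflection_quotient \<alpha> (\<lambda>x. complex_of_real (x \<bullet> \<xi>) * f x) x =
     complex_of_real (x \<bullet> \<xi>) * reflection_quotient \<alpha> f x
     + complex_of_real (2 * (\<alpha> \<bullet> \<xi>) / (norm \<alpha>)\<^sup>2) * f (root_reflection \<alpha> x)"
proof (cases "\<alpha> \<bullet> x = 0")
  case True
  then show ?thesis
    by (simp add: reflection_quotient_def dir_deriv_linear assms root_reflection_fixed)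
       (simp add: algebra_simps add_divide_distrib)
next
  case False
  have "complex_of_real (root_reflection \<alpha> x \<bullet> \<xi>) = complex_of_real (x \<bullet> \<xi>) - complex_of_real (\<alpha> \<bullet> x) * complex_of_real (2 * (\<alpha> \<bullet> \<xi>) / (norm \<alpha>)\<^sup>2)"
    by (simp add: root_reflection_inner_eq)
  then have "complex_of_real (x \<bullet> \<xi>) * f x - complex_of_real (root_reflection \<alpha> x \<bullet> \<xi>) * f (root_reflection \<alpha> x)
     = complex_of_real (x \<bullet> \<xi>) * (f x - f (root_reflection \<alpha> x)) + complex_of_real (\<alpha> \<bullet> x) * (complex_of_real (2 * (\<alpha> \<bullet> \<xi>) / (norm \<alpha>)\<^sup>2) * f (root_reflection \<alpha> x))"
    by (simp only:) (simp only: algebra_simps)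
  then show ?thesis using False unfolding reflection_quotient_def
    by (simp only: if_False add_divide_distrib) simp
qed

lemma reflection_quotient_times: "complex_of_real (\<alpha> \<bullet> x) * reflection_quotient \<alpha> f x = f x - f (root_reflection \<alpha> x)"
  by (simp add: reflection_quotient_def root_reflection_fixed)

lemma hpoly_reflection_quotient: "hpoly m p \<Longrightarrow> lower m (reflection_quotient \<alpha> p)"
proof (induction rule: hpoly.induct)
  case (hpoly_const c)
  then show ?case by (simp add: lower_def fun_eq_iff reflection_quotient_def)
next
  case (hpoly_add m p q)
  then have "reflection_quotient \<alpha> (\<lambda>x. p x + q x) = (\<lambda>x. reflection_quotient \<alpha> p x + reflection_quotient \<alpha> q x)"
    by (auto simp: fun_eq_iff reflection_quotient_add hpoly_differentiable)
  then show ?case using hpoly_add by (simp add: lower_add)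
next
  case (hpoly_linear m p \<xi>)
  then have "reflection_quotient \<alpha> (\<lambda>x. complex_of_real (x \<bullet> \<xi>) * p x) =
     (\<lambda>x. complex_of_real (x \<bullet> \<xi>) * reflection_quotient \<alpha> p x
     + complex_of_real (2 * (\<alpha> \<bullet> \<xi>) / (norm \<alpha>)\<^sup>2) * p (root_reflection \<alpha> x))"
    by (intro ext reflection_quotient_linear hpoly_differentiable)
  moreover have "hpoly m (\<lambda>x. complex_of_real (x \<bullet> \<xi>) * reflection_quotient \<alpha> p x
     + complex_of_real (2 * (\<alpha> \<bullet> \<xi>) / (norm \<alpha>)\<^sup>2) * p (root_reflection \<alpha> x))"
    by (intro hpoly_add lower_linear hpoly_scale hpoly_reflection hpoly_linear)
  ultimately show ?case by (simp only: lower_def nat.case)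
qed

lemma hpoly_dunkl_op: "hpoly m p \<Longrightarrow> lower m (dunkl_op P k \<xi> p)"
proof -
  assume p: "hpoly m p"
  have "lower m (\<lambda>x. dir_deriv \<xi> p x + (\<Sum>\<alpha>\<in>P. complex_of_real (k \<alpha> * (\<alpha> \<bullet> \<xi>)) * reflection_quotient \<alpha> p x))"
    by (intro lower_add lower_sum lower_scale hpoly_dir_deriv hpoly_reflection_quotient p)
  then show ?thesis unfolding dunkl_op_def[abs_def] .
qed

lemma dunkl_op_add:
  "f differentiable (at x) \<Longrightarrow> g differentiable (at x) \<Longrightarrow>
   dunkl_op P k \<xi> (\<lambda>x. f x + g x) x = dunkl_op P k \<xi> f x + dunkl_op P k \<xi> g x"
  by (simp add: dunkl_op_def dir_deriv_add reflection_quotient_add distrib_left sum.distrib)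

lemma dunkl_op_scale:
  "f differentiable (at x) \<Longrightarrow> dunkl_op P k \<xi> (\<lambda>x. c * f x) x = c * dunkl_op P k \<xi> f x"
  by (simp add: dunkl_op_def dir_deriv_scale reflection_quotient_scale distrib_left sum_distrib_left mult_ac)

lemma dunkl_op_cnj:
  assumes "f differentiable (at x)"
  shows "dunkl_op P k \<xi> (\<lambda>x. cnj (f x)) x = cnj (dunkl_op P k \<xi> f x)"
proof -
  have "dir_deriv \<eta> (\<lambda>x. cnj (f x)) x = cnj (dir_deriv \<eta> f x)" for \<eta>
    by (rule dir_deriv_eq) (intro bounded_linear.has_derivative[OF bounded_linear_cnj] dir_deriv_has_derivative assms)
  then show ?thesis by (simp add: dunkl_op_def reflection_quotient_def if_distrib cong: if_cong)
qed

lemma dunkl_op_cong_nonzero: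
  assumes "x \<noteq> 0" "\<And>y. y \<noteq> 0 \<Longrightarrow> f y = g y"
  shows "dunkl_op P k \<xi> f x = dunkl_op P k \<xi> g x"
proof -
  have "dir_deriv \<eta> f x = dir_deriv \<eta> g x" for \<eta>
  proof -
    have "open {t::real. x + t *\<^sub>R \<eta> \<noteq> 0}"
      by (intro open_Collect_neq continuous_intros)
    then have "eventually (\<lambda>t. x + t *\<^sub>R \<eta> \<noteq> 0) (nhds (0::real))"
      unfolding eventually_nhds using assms(1) by (intro exI[of _ "{t::real. x + t *\<^sub>R \<eta> \<noteq> 0}"]) auto
    then have "eventually (\<lambda>t. f (x + t *\<^sub>R \<eta>) = g (x + t *\<^sub>R \<eta>)) (nhds (0::real))"
      by (rule eventually_mono) (use assms(2) in auto)
    then show ?thesis unfolding dir_deriv_def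
      by (intro vector_derivative_cong_eq) auto
  qed
  moreover have "f x = g x" using assms by simp
  moreover have "f (root_reflection \<alpha> x) = g (root_reflection \<alpha> x)" for \<alpha> using assms by simp
  ultimately show ?thesis unfolding dunkl_op_def reflection_quotient_def by presburger
qed

section \<open>Radial factors\<close>

text \<open>\<open>h1\<close> is \<open>h'(r)/r\<close>. With this quotient the gradient of \<open>h(|x|)\<close> is \<open>h1(|x|) x\<close>, which avoids
  differentiating the norm separately.\<close>

definition radial_pair :: "(real \<Rightarrow> real) \<Rightarrow> (real \<Rightarrow> real) \<Rightarrow> bool" where
  "radial_pair h h1 \<longleftrightarrow> (\<forall>r>0. (h has_real_derivative r * h1 r) (at r))"

lemma radial_has_derivative:
  assumes "radial_pair h h1" "x \<noteq> (0 :: real ^ 'n)"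
  shows "((\<lambda>x. complex_of_real (h (norm x))) has_derivative (\<lambda>\<eta>. complex_of_real (h1 (norm x) * (x \<bullet> \<eta>)))) (at x)"
proof -
  have n: "(norm has_derivative (\<lambda>\<eta>. \<eta> \<bullet> sgn x)) (at x)"
    using has_derivative_norm[OF assms(2)] by (simp add: inner_commute)
  have "(h has_derivative (\<lambda>t. (norm x * h1 (norm x)) * t)) (at (norm x))"
    using assms by (auto simp: radial_pair_def has_field_derivative_def)
  from has_derivative_compose[OF n this]
  have "((\<lambda>x. h (norm x)) has_derivative (\<lambda>\<eta>. norm x * h1 (norm x) * (\<eta> \<bullet> sgn x))) (at x)" .
  moreover have "norm x * h1 (norm x) * (\<eta> \<bullet> sgn x) = h1 (norm x) * (x \<bullet> \<eta>)" for \<eta>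
    using assms(2) by (simp add: sgn_div_norm inner_commute field_simps)
  ultimately have "((\<lambda>x. h (norm x)) has_derivative (\<lambda>\<eta>. h1 (norm x) * (x \<bullet> \<eta>))) (at x)" by simp
  from bounded_linear.has_derivative[OF bounded_linear_of_real this] show ?thesis by simp
qed

lemma radial_differentiable:
  assumes "radial_pair h h1" "x \<noteq> (0 :: real ^ 'n)" "p differentiable (at x)"
  shows "(\<lambda>x. complex_of_real (h (norm x)) * p x) differentiable (at x)"
  using radial_has_derivative[OF assms(1,2)] assms(3) by (intro differentiable_mult) (auto simp: differentiable_def)

text \<open>Reflections preserve the norm, so a radial factor passes through the difference quotients and only
  the derivative sees it.\<close>

lemma dunkl_op_radial:
  assumes "radial_pair h h1" "x \<noteq> (0 :: real ^ 'n)" "p differentiable (at x)"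
  shows "dunkl_op P k \<xi> (\<lambda>x. complex_of_real (h (norm x)) * p x) x =
     complex_of_real (h (norm x)) * dunkl_op P k \<xi> p x + complex_of_real (h1 (norm x) * (x \<bullet> \<xi>)) * p x"
proof -
  have hd: "(\<lambda>x. complex_of_real (h (norm x))) differentiable (at x)"
    using radial_has_derivative[OF assms(1,2)] by (auto simp: differentiable_def)
  have d: "dir_deriv \<eta> (\<lambda>x. complex_of_real (h (norm x)) * p x) x =
     complex_of_real (h (norm x)) * dir_deriv \<eta> p x + complex_of_real (h1 (norm x) * (x \<bullet> \<eta>)) * p x" for \<eta>
    by (simp only: dir_deriv_mult[OF hd assms(3)] dir_deriv_eq[OF radial_has_derivative[OF assms(1,2)]])
  have q: "reflection_quotient \<alpha> (\<lambda>x. complex_of_real (h (norm x)) * p x) x = complex_of_real (h (norm x)) * reflection_quotient \<alpha> p x" for \<alpha>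
    by (simp add: reflection_quotient_def d inner_commute[of x \<alpha>] right_diff_distrib)
  show ?thesis unfolding dunkl_op_def d q by (simp add: distrib_left sum_distrib_left mult_ac)
qed

lemma sum_Basis_inner: "(\<Sum>\<xi>\<in>Basis. complex_of_real (x \<bullet> \<xi>) * complex_of_real (y \<bullet> \<xi>)) = complex_of_real (x \<bullet> y)"
  by (simp add: euclidean_inner[of x y])

lemma sum_coordinate_dunkl_op:
  fixes p :: "real ^ 'n \<Rightarrow> complex"
  assumes p: "hpoly m p"
  shows "(\<Sum>\<xi>\<in>Basis. complex_of_real (x \<bullet> \<xi>) * dunkl_op P k \<xi> p x)
     = of_nat m * p x + (\<Sum>\<alpha>\<in>P. complex_of_real (k \<alpha>) * (p x - p (root_reflection \<alpha> x)))"
proof -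
  have pd: "p differentiable (at x)" by (rule hpoly_differentiable[OF p])
  have T1: "complex_of_real (x \<bullet> \<xi>) * dunkl_op P k \<xi> p x = complex_of_real (x \<bullet> \<xi>) * dir_deriv \<xi> p x
     + (\<Sum>\<alpha>\<in>P. complex_of_real (k \<alpha>) * (complex_of_real (x \<bullet> \<xi>) * complex_of_real (\<alpha> \<bullet> \<xi>)) * reflection_quotient \<alpha> p x)" for \<xi>
    by (simp add: dunkl_op_def distrib_left sum_distrib_left mult_ac)
  have A: "(\<Sum>\<xi>\<in>Basis. \<Sum>\<alpha>\<in>P. complex_of_real (k \<alpha>) * (complex_of_real (x \<bullet> \<xi>) * complex_of_real (\<alpha> \<bullet> \<xi>)) * reflection_quotient \<alpha> p x)
     = (\<Sum>\<alpha>\<in>P. complex_of_real (k \<alpha>) * (p x - p (root_reflection \<alpha> x)))"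
  proof (subst sum.swap, rule sum.cong[OF refl])
    fix \<alpha>
    show "(\<Sum>\<xi>\<in>Basis. complex_of_real (k \<alpha>) * (complex_of_real (x \<bullet> \<xi>) * complex_of_real (\<alpha> \<bullet> \<xi>)) * reflection_quotient \<alpha> p x)
       = complex_of_real (k \<alpha>) * (p x - p (root_reflection \<alpha> x))"
      by (simp only: sum_distrib_right[symmetric] sum_distrib_left[symmetric] sum_Basis_inner
         reflection_quotient_times[symmetric] inner_commute[of x \<alpha>]) (simp only: mult.assoc)
  qed
  show ?thesis unfolding T1 sum.distrib A sum_Basis_dir_deriv[OF pd] euler_homogeneous[OF p] ..
qed

text \<open>Twice the sum of the \<open>\<langle>x,\<xi>\<rangle> T\<^sub>\<xi>\<close> plus the sum of their commutators: the terms with \<open>p(r\<^sub>\<alpha> x)\<close>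
  in the two sums cancel, and what remains of the reflections is the constant \<open>2K\<close>.\<close>

lemma dunkl_euler:
  fixes p :: "real ^ 'n \<Rightarrow> complex"
  assumes P: "0 \<notin> P" and p: "hpoly m p"
  shows "(\<Sum>\<xi>\<in>Basis. complex_of_real (x \<bullet> \<xi>) * dunkl_op P k \<xi> p x
            + dunkl_op P k \<xi> (\<lambda>y. complex_of_real (y \<bullet> \<xi>) * p y) x)
      = complex_of_real (2 * real m + real CARD('n) + 2 * mult_index P k) * p x"
proof -
  have pd: "p differentiable (at x)" by (rule hpoly_differentiable[OF p])
  have B: "(\<Sum>\<xi>\<in>Basis. \<Sum>\<alpha>\<in>P. complex_of_real (k \<alpha>) * (complex_of_real (\<alpha> \<bullet> \<xi>) * complex_of_real (\<alpha> \<bullet> \<xi>)) *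
        (complex_of_real (2 / (norm \<alpha>)\<^sup>2) * p (root_reflection \<alpha> x)))
     = (\<Sum>\<alpha>\<in>P. complex_of_real (k \<alpha>) * (2 * p (root_reflection \<alpha> x)))"
  proof (subst sum.swap, rule sum.cong[OF refl])
    fix \<alpha> assume "\<alpha> \<in> P"
    then have "norm \<alpha> \<noteq> 0" using P by auto
    then show "(\<Sum>\<xi>\<in>Basis. complex_of_real (k \<alpha>) * (complex_of_real (\<alpha> \<bullet> \<xi>) * complex_of_real (\<alpha> \<bullet> \<xi>)) *
        (complex_of_real (2 / (norm \<alpha>)\<^sup>2) * p (root_reflection \<alpha> x)))
       = complex_of_real (k \<alpha>) * (2 * p (root_reflection \<alpha> x))"
      by (simp only: sum_distrib_right[symmetric] sum_distrib_left[symmetric] sum_Basis_inner)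
         (simp add: power2_norm_eq_inner[symmetric])
  qed
  have C: "(\<Sum>\<xi>\<in>(Basis :: (real ^ 'n) set). complex_of_real (\<xi> \<bullet> \<xi>) * p x) = of_nat CARD('n) * p x"
    by (simp add: inner_Basis)
  have T: "dunkl_op P k \<xi> (\<lambda>y. complex_of_real (y \<bullet> \<xi>) * p y) x = complex_of_real (x \<bullet> \<xi>) * dunkl_op P k \<xi> p x
     + complex_of_real (\<xi> \<bullet> \<xi>) * p x
     + (\<Sum>\<alpha>\<in>P. complex_of_real (k \<alpha>) * (complex_of_real (\<alpha> \<bullet> \<xi>) * complex_of_real (\<alpha> \<bullet> \<xi>)) *
        (complex_of_real (2 / (norm \<alpha>)\<^sup>2) * p (root_reflection \<alpha> x)))" for \<xi>
    unfolding dunkl_op_def dir_deriv_linear[OF pd] reflection_quotient_linear[OF pd]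
    by (simp add: distrib_left sum.distrib sum_distrib_left mult_ac)
  have "(\<Sum>\<xi>\<in>Basis. complex_of_real (x \<bullet> \<xi>) * dunkl_op P k \<xi> p x
            + dunkl_op P k \<xi> (\<lambda>y. complex_of_real (y \<bullet> \<xi>) * p y) x)
     = 2 * (of_nat m * p x) + of_nat CARD('n) * p x
       + (2 * (\<Sum>\<alpha>\<in>P. complex_of_real (k \<alpha>) * (p x - p (root_reflection \<alpha> x)))
       + (\<Sum>\<alpha>\<in>P. complex_of_real (k \<alpha>) * (2 * p (root_reflection \<alpha> x))))"
    unfolding T sum.distrib sum_coordinate_dunkl_op[OF p] B C by (simp add: algebra_simps)
  also have "2 * (\<Sum>\<alpha>\<in>P. complex_of_real (k \<alpha>) * (p x - p (root_reflection \<alpha> x)))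
       + (\<Sum>\<alpha>\<in>P. complex_of_real (k \<alpha>) * (2 * p (root_reflection \<alpha> x))) = (\<Sum>\<alpha>\<in>P. complex_of_real (k \<alpha>)) * (2 * p x)"
    unfolding sum_distrib_left sum_distrib_right sum.distrib[symmetric] by (simp add: algebra_simps)
  finally show ?thesis by (simp add: mult_index_def algebra_simps)
qed

text \<open>As for the Euclidean Laplacian in dimension \<open>N + 2K\<close>, with \<open>h1\<close> and \<open>h2\<close> the iterated quotients
  \<open>h'/r\<close> and \<open>h1'/r\<close>.\<close>

lemma dunkl_laplacian_radial:
  fixes p :: "real ^ 'n \<Rightarrow> complex"
  assumes P: "0 \<notin> P" and p: "hpoly m p" and h: "radial_pair h h1" "radial_pair h1 h2" and x: "x \<noteq> 0"
  shows "dunkl_laplacian P k (\<lambda>x. complex_of_real (h (norm x)) * p x) x =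
    complex_of_real (h (norm x)) * dunkl_laplacian P k p x
    + complex_of_real (h1 (norm x) * (2 * real m + real CARD('n) + 2 * mult_index P k) + (norm x)\<^sup>2 * h2 (norm x)) * p x"
proof -
  let ?T = "\<lambda>\<xi>. dunkl_op P k \<xi>"
  have pd: "p differentiable (at y)" for y by (rule hpoly_differentiable[OF p])
  have Tpd: "?T \<xi> p differentiable (at y)" for \<xi> y
    using hpoly_differentiable[OF lower_hpoly[OF hpoly_dunkl_op[OF p]]] .
  have xpd: "(\<lambda>y. complex_of_real (y \<bullet> \<xi>) * p y) differentiable (at y)" for \<xi> y
    by (rule hpoly_differentiable[OF hpoly_linear[OF p]])
  have TT: "?T \<xi> (?T \<xi> (\<lambda>x. complex_of_real (h (norm x)) * p x)) x =
      complex_of_real (h (norm x)) * ?T \<xi> (?T \<xi> p) x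
      + complex_of_real (h1 (norm x)) * (complex_of_real (x \<bullet> \<xi>) * ?T \<xi> p x + ?T \<xi> (\<lambda>y. complex_of_real (y \<bullet> \<xi>) * p y) x)
      + complex_of_real (h2 (norm x)) * (complex_of_real (x \<bullet> \<xi>) * complex_of_real (x \<bullet> \<xi>)) * p x" for \<xi>
  proof -
    have "?T \<xi> (?T \<xi> (\<lambda>x. complex_of_real (h (norm x)) * p x)) x =
        ?T \<xi> (\<lambda>y. complex_of_real (h (norm y)) * ?T \<xi> p y + complex_of_real (h1 (norm y)) * (complex_of_real (y \<bullet> \<xi>) * p y)) x"
      by (rule dunkl_op_cong_nonzero[OF x]) (simp add: dunkl_op_radial[OF h(1) _ pd] mult.assoc)
    also have "\<dots> = ?T \<xi> (\<lambda>y. complex_of_real (h (norm y)) * ?T \<xi> p y) x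
        + ?T \<xi> (\<lambda>y. complex_of_real (h1 (norm y)) * (complex_of_real (y \<bullet> \<xi>) * p y)) x"
      by (intro dunkl_op_add radial_differentiable[OF h(1) x Tpd] radial_differentiable[OF h(2) x xpd])
    finally show ?thesis
      unfolding dunkl_op_radial[OF h(1) x Tpd] dunkl_op_radial[OF h(2) x xpd] by (simp add: algebra_simps)
  qed
  define b where "b \<xi> = complex_of_real (x \<bullet> \<xi>) * ?T \<xi> p x + ?T \<xi> (\<lambda>y. complex_of_real (y \<bullet> \<xi>) * p y) x" for \<xi>
  have b: "(\<Sum>\<xi>\<in>Basis. b \<xi>) = complex_of_real (2 * real m + real CARD('n) + 2 * mult_index P k) * p x"
    unfolding b_def by (rule dunkl_euler[OF P p])
  have "dunkl_laplacian P k (\<lambda>x. complex_of_real (h (norm x)) * p x) x =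
     complex_of_real (h (norm x)) * dunkl_laplacian P k p x + complex_of_real (h1 (norm x)) * (\<Sum>\<xi>\<in>Basis. b \<xi>)
     + complex_of_real (h2 (norm x)) * complex_of_real (x \<bullet> x) * p x"
    unfolding dunkl_laplacian_def TT b_def[symmetric]
    by (simp only: sum.distrib sum_distrib_left[symmetric] sum_distrib_right[symmetric] sum_Basis_inner)
  then show ?thesis unfolding b by (simp add: power2_norm_eq_inner algebra_simps)
qed

lemma hpoly_dunkl_laplacian: "hpoly m p \<Longrightarrow> hpoly (m - 2) (dunkl_laplacian P k p)"
proof -
  assume p: "hpoly m p"
  have "hpoly (m - 2) (dunkl_op P k \<xi> (dunkl_op P k \<xi> p))" for \<xi>
    using lower_hpoly[OF hpoly_dunkl_op[OF lower_hpoly[OF hpoly_dunkl_op[OF p]]]]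
    by (simp add: numeral_2_eq_2)
  then have "hpoly (m - 2) (\<lambda>x. \<Sum>\<xi>\<in>Basis. dunkl_op P k \<xi> (dunkl_op P k \<xi> p) x)" by (intro hpoly_sum)
  then show ?thesis unfolding dunkl_laplacian_def[abs_def] .
qed

lemma dunkl_op_zero:
  fixes P :: "(real ^ 'a) set"
  shows "dunkl_op P k \<xi> (\<lambda>x. 0) = (\<lambda>x. 0)"
proof -
  have "reflection_quotient \<alpha> (\<lambda>x. 0) x = 0" for \<alpha> x :: "real ^ 'a" by (simp add: reflection_quotient_def)
  then show ?thesis by (simp add: dunkl_op_def fun_eq_iff)
qed

lemma dunkl_laplacian_low_degree: "hpoly m p \<Longrightarrow> m < 2 \<Longrightarrow> dunkl_laplacian P k p x = 0"
proof -
  assume p: "hpoly m p" "m < 2"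
  have "dunkl_op P k \<xi> (dunkl_op P k \<xi> p) = (\<lambda>x. 0)" for \<xi>
  proof (cases m)
    case 0
    then have "dunkl_op P k \<xi> p = (\<lambda>x. 0)" using hpoly_dunkl_op[OF p(1), of P k \<xi>] by (simp add: lower_def)
    then show ?thesis by (simp add: dunkl_op_zero)
  next
    case (Suc n)
    then have "hpoly 0 (dunkl_op P k \<xi> p)" using hpoly_dunkl_op[OF p(1), of P k \<xi>] p(2) by (simp add: lower_def)
    from hpoly_dunkl_op[OF this] show ?thesis by (simp add: lower_def)
  qed
  then show ?thesis by (simp add: dunkl_laplacian_def)
qed

lemma dunkl_laplacian_add:
  assumes "hpoly m p" "hpoly n q"
  shows "dunkl_laplacian P k (\<lambda>x. p x + q x) x = dunkl_laplacian P k p x + dunkl_laplacian P k q x"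
proof -
  have *: "dunkl_op P k \<xi> (\<lambda>x. p x + q x) = (\<lambda>x. dunkl_op P k \<xi> p x + dunkl_op P k \<xi> q x)" for \<xi>
    by (rule ext) (intro dunkl_op_add hpoly_differentiable[OF assms(1)] hpoly_differentiable[OF assms(2)])
  show ?thesis unfolding dunkl_laplacian_def * sum.distrib[symmetric]
    by (rule sum.cong[OF refl])
       (rule dunkl_op_add[OF hpoly_differentiable[OF lower_hpoly[OF hpoly_dunkl_op[OF assms(1)]]]
          hpoly_differentiable[OF lower_hpoly[OF hpoly_dunkl_op[OF assms(2)]]]])
qed

lemma dunkl_laplacian_scale:
  assumes "hpoly m p"
  shows "dunkl_laplacian P k (\<lambda>x. c * p x) x = c * dunkl_laplacian P k p x"
proof -
  have *: "dunkl_op P k \<xi> (\<lambda>x. c * p x) = (\<lambda>x. c * dunkl_op P k \<xi> p x)" for \<xi>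
    by (rule ext) (intro dunkl_op_scale hpoly_differentiable[OF assms(1)])
  show ?thesis unfolding dunkl_laplacian_def * sum_distrib_left
    by (rule sum.cong[OF refl])
       (rule dunkl_op_scale[OF hpoly_differentiable[OF lower_hpoly[OF hpoly_dunkl_op[OF assms]]]])
qed

lemma dunkl_laplacian_sum:
  assumes "finite I" "\<And>i. i \<in> I \<Longrightarrow> hpoly m (p i)"
  shows "dunkl_laplacian P k (\<lambda>x. \<Sum>i\<in>I. p i x) x = (\<Sum>i\<in>I. dunkl_laplacian P k (p i) x)"
  using assms
proof (induction I)
  case empty
  have "dunkl_laplacian P k (\<lambda>x. 0) x = 0" by (simp add: dunkl_laplacian_def dunkl_op_zero)
  then show ?case by simp
next
  case (insert i I)
  have "hpoly m (\<lambda>x. \<Sum>i\<in>I. p i x)" by (intro hpoly_sum insert.prems) simp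
  from dunkl_laplacian_add[OF insert.prems[OF insertI1] this] insert show ?case by simp
qed

lemma dunkl_laplacian_cnj:
  assumes "hpoly m p"
  shows "dunkl_laplacian P k (\<lambda>x. cnj (p x)) x = cnj (dunkl_laplacian P k p x)"
proof -
  have *: "dunkl_op P k \<xi> (\<lambda>x. cnj (p x)) = (\<lambda>x. cnj (dunkl_op P k \<xi> p x))" for \<xi>
    by (rule ext) (intro dunkl_op_cnj hpoly_differentiable[OF assms(1)])
  show ?thesis unfolding dunkl_laplacian_def * cnj_sum
    by (rule sum.cong[OF refl])
       (rule dunkl_op_cnj[OF hpoly_differentiable[OF lower_hpoly[OF hpoly_dunkl_op[OF assms]]]])
qed

lemma dunkl_harmonics_iff: "p \<in> dunkl_harmonics P k m \<longleftrightarrow> hpoly m p \<and> (\<forall>x. dunkl_laplacian P k p x = 0)"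
  by (simp add: dunkl_harmonics_def homogeneous_poly_iff_hpoly)

lemma dunkl_harmonics_comb:
  assumes "p \<in> dunkl_harmonics P k m" "q \<in> dunkl_harmonics P k m"
  shows "(\<lambda>x. a * p x + b * q x) \<in> dunkl_harmonics P k m"
  using assms by (auto simp: dunkl_harmonics_iff hpoly_add hpoly_scale dunkl_laplacian_scale
      dunkl_laplacian_add[OF hpoly_scale hpoly_scale])

lemma dunkl_harmonics_zero: "(\<lambda>x. 0) \<in> dunkl_harmonics P k m"
  by (simp add: dunkl_harmonics_iff hpoly_zero dunkl_laplacian_def dunkl_op_zero)

lemma dunkl_harmonics_cnj: "p \<in> dunkl_harmonics P k m \<Longrightarrow> (\<lambda>x. cnj (p x)) \<in> dunkl_harmonics P k m"
  by (auto simp: dunkl_harmonics_iff hpoly_cnj dunkl_laplacian_cnj)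

lemma continuous_eq_nonzero:
  fixes f g :: "real ^ 'n \<Rightarrow> complex"
  assumes "continuous_on UNIV f" "continuous_on UNIV g" "\<And>x. x \<noteq> 0 \<Longrightarrow> f x = g x"
  shows "f x = g x"
proof -
  have cl: "closure (- {0 :: real ^ 'n}) = UNIV" by (simp add: closure_complement)
  have "f x - g x = 0"
    by (rule continuous_constant_on_closure[of "- {0}" "\<lambda>x. f x - g x"])
       (use assms in \<open>auto simp: cl intro!: continuous_intros\<close>)
  then show ?thesis by simp
qed

section \<open>Decomposition of polynomials into Dunkl harmonics\<close>

lemma radial_pair_power: "radial_pair (\<lambda>r. r ^ (2 * Suc j)) (\<lambda>r. real (2 * Suc j) * r ^ (2 * j))"
  unfolding radial_pair_def
proof (intro allI impI)
  fix r :: real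
  have "2 * Suc j - Suc 0 = Suc (2 * j)" by simp
  then show "((\<lambda>r. r ^ (2 * Suc j)) has_real_derivative r * (real (2 * Suc j) * r ^ (2 * j))) (at r)"
    using DERIV_pow[of "2 * Suc j" r UNIV] by (simp only: power_Suc mult_ac)
qed

lemma radial_pair_cmult: "radial_pair h h1 \<Longrightarrow> radial_pair (\<lambda>r. c * h r) (\<lambda>r. c * h1 r)"
  unfolding radial_pair_def
proof (intro allI impI)
  fix r :: real assume "\<forall>r>0. (h has_real_derivative r * h1 r) (at r)" "r > 0"
  then have "((\<lambda>r. c * h r) has_real_derivative c * (r * h1 r)) (at r)" by (intro DERIV_cmult) auto
  then show "((\<lambda>r. c * h r) has_real_derivative r * (c * h1 r)) (at r)" by (simp add: mult_ac)
qed

lemma radial_pair_power': "\<exists>h2. radial_pair (\<lambda>r. c * r ^ (2 * j)) h2 \<and> (\<forall>r>0. r\<^sup>2 * h2 r = c * real (2 * j) * r ^ (2 * j))"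
proof (cases j)
  case 0
  then show ?thesis by (intro exI[of _ "\<lambda>_. 0"]) (auto simp: radial_pair_def)
next
  case (Suc i)
  have "radial_pair (\<lambda>r. c * r ^ (2 * j)) (\<lambda>r. c * (real (2 * j) * r ^ (2 * i)))"
    unfolding Suc by (rule radial_pair_cmult[OF radial_pair_power])
  moreover have "r\<^sup>2 * (c * (real (2 * j) * r ^ (2 * i))) = c * real (2 * j) * r ^ (2 * j)" for r :: real
  proof -
    have "r ^ (2 * j) = r\<^sup>2 * r ^ (2 * i)" by (simp add: Suc power2_eq_square)
    then show ?thesis by (simp only: mult_ac)
  qed
  ultimately show ?thesis by blast
qed

text \<open>Away from the origin this is \<open>dunkl_laplacian_radial\<close>; both sides are polynomials, so it extends by
  continuity.\<close>

lemma dunkl_laplacian_normpow_harmonic: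
  fixes p :: "real ^ 'n \<Rightarrow> complex"
  assumes P: "0 \<notin> P" and p: "p \<in> dunkl_harmonics P k m"
  shows "dunkl_laplacian P k (\<lambda>x. complex_of_real (norm x ^ (2 * Suc j)) * p x) x =
    complex_of_real (real (2 * Suc j) * (2 * real m + real CARD('n) + 2 * mult_index P k + real (2 * j))) *
      (complex_of_real (norm x ^ (2 * j)) * p x)"
proof -
  have hp: "hpoly m p" and lap: "\<And>x. dunkl_laplacian P k p x = 0" using p by (auto simp: dunkl_harmonics_iff)
  obtain h2 where h2: "radial_pair (\<lambda>r. real (2 * Suc j) * r ^ (2 * j)) h2"
    "\<And>r. r > 0 \<Longrightarrow> r\<^sup>2 * h2 r = real (2 * Suc j) * real (2 * j) * r ^ (2 * j)"
    using radial_pair_power'[of "real (2 * Suc j)" j] by blast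
  show ?thesis
  proof (rule continuous_eq_nonzero[of "\<lambda>x. dunkl_laplacian P k (\<lambda>x. complex_of_real (norm x ^ (2 * Suc j)) * p x) x"])
    show "continuous_on UNIV (dunkl_laplacian P k (\<lambda>x. complex_of_real (norm x ^ (2 * Suc j)) * p x))"
      by (rule hpoly_continuous[OF hpoly_dunkl_laplacian[OF hpoly_normpow[OF hp]]])
    show "continuous_on UNIV (\<lambda>x. complex_of_real (real (2 * Suc j) * (2 * real m + real CARD('n) + 2 * mult_index P k + real (2 * j))) *
      (complex_of_real (norm x ^ (2 * j)) * p x))"
      by (intro continuous_intros hpoly_continuous[OF hp])
    fix x :: "real ^ 'n" assume "x \<noteq> 0"
    then have nx: "norm x > 0" by simp
    have "dunkl_laplacian P k (\<lambda>x. complex_of_real (norm x ^ (2 * Suc j)) * p x) x =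
       complex_of_real (norm x ^ (2 * Suc j)) * dunkl_laplacian P k p x +
       complex_of_real (real (2 * Suc j) * norm x ^ (2 * j) * (2 * real m + real CARD('n) + 2 * mult_index P k)
         + (norm x)\<^sup>2 * h2 (norm x)) * p x"
      by (rule dunkl_laplacian_radial[OF P hp radial_pair_power h2(1) \<open>x \<noteq> 0\<close>])
    also have "real (2 * Suc j) * norm x ^ (2 * j) * (2 * real m + real CARD('n) + 2 * mult_index P k)
         + (norm x)\<^sup>2 * h2 (norm x)
       = real (2 * Suc j) * (2 * real m + real CARD('n) + 2 * mult_index P k + real (2 * j)) * norm x ^ (2 * j)"
      unfolding h2(2)[OF nx] by (simp only: distrib_left distrib_right mult_ac add_ac)
    finally show "dunkl_laplacian P k (\<lambda>x. complex_of_real (norm x ^ (2 * Suc j)) * p x) x =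
      complex_of_real (real (2 * Suc j) * (2 * real m + real CARD('n) + 2 * mult_index P k + real (2 * j))) *
      (complex_of_real (norm x ^ (2 * j)) * p x)"
      unfolding lap of_real_mult by (simp only: mult.assoc mult_zero_right add_0)
  qed
qed

text \<open>Induction on the degree: on the summands \<open>|x|\<^bsup>2j\<^esup> H\<close> of \<open>\<Delta>\<^sub>k p\<close> the Laplacian can be inverted
  explicitly, because the constant in \<open>dunkl_laplacian_normpow_harmonic\<close> is positive for \<open>K \<ge> 0\<close>.
  Subtracting such a preimage from \<open>p\<close> leaves a harmonic polynomial.\<close>

theorem harmonic_decomposition:
  fixes p :: "real ^ 'n \<Rightarrow> complex"
  assumes P: "0 \<notin> P" and K: "0 \<le> mult_index P k" and "hpoly m p"
  shows "\<exists>H. (\<forall>j. H j \<in> dunkl_harmonics P k (m - 2 * j)) \<and> (\<forall>j. m < 2 * j \<longrightarrow> H j = (\<lambda>x. 0)) \<and>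
     (\<forall>x. p x = (\<Sum>j\<le>m. complex_of_real (norm x ^ (2 * j)) * H j x))"
  using assms(3)
proof (induction m arbitrary: p rule: less_induct)
  case (less m)
  show ?case
  proof (cases "m < 2")
    case True
    have "(\<Sum>j\<le>m. complex_of_real (norm x ^ (2 * j)) * (if j = 0 then p else (\<lambda>x. 0)) x) = p x" for x
      by (subst sum.remove[of _ 0]) auto
    then show ?thesis using dunkl_laplacian_low_degree[OF less.prems True, of P k] less.prems
      by (intro exI[of _ "\<lambda>j. if j = 0 then p else (\<lambda>x. 0)"])
         (auto simp: dunkl_harmonics_iff dunkl_harmonics_zero[unfolded dunkl_harmonics_iff])
  next
    case False
    define n where "n = m - 2"
    have m: "m = Suc (Suc n)" using False by (simp add: n_def)
    have "hpoly n (dunkl_laplacian P k p)" using hpoly_dunkl_laplacian[OF less.prems] by (simp add: n_def)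
    from less.IH[OF _ this] m obtain H where H: "\<And>j. H j \<in> dunkl_harmonics P k (n - 2 * j)" "\<And>j. n < 2 * j \<Longrightarrow> H j = (\<lambda>x. 0)"
      "\<And>x. dunkl_laplacian P k p x = (\<Sum>j\<le>n. complex_of_real (norm x ^ (2 * j)) * H j x)"
      by auto
    define c where "c j = real (2 * Suc j) * (2 * real (n - 2 * j) + real CARD('n) + 2 * mult_index P k + real (2 * j))" for j
    have c: "c j \<noteq> 0" for j
    proof -
      have "0 < 2 * real (n - 2 * j) + real CARD('n) + 2 * mult_index P k + real (2 * j)"
        using K by (intro add_pos_nonneg add_nonneg_pos) auto
      then show ?thesis unfolding c_def by (simp del: of_nat_Suc)
    qed
    define G where "G j = (\<lambda>x. complex_of_real (1 / c j) * H j x + 0 * H j x)" for j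
    have G: "G j \<in> dunkl_harmonics P k (n - 2 * j)" for j unfolding G_def by (intro dunkl_harmonics_comb H)
    have Gz: "n < 2 * j \<Longrightarrow> G j = (\<lambda>x. 0)" for j by (simp add: G_def H(2))
    define F where "F j = (\<lambda>x. complex_of_real (norm x ^ (2 * Suc j)) * G j x)" for j
    have F: "hpoly m (F j)" for j
    proof (cases "n < 2 * j")
      case True
      then show ?thesis by (simp add: F_def Gz hpoly_zero)
    next
      case False
      then have "n - 2 * j + 2 * Suc j = m" by (simp add: m)
      then show ?thesis
        using hpoly_normpow[of "n - 2 * j" "G j" "Suc j"] G[of j] unfolding F_def dunkl_harmonics_iff by metis
    qed
    have lapF: "dunkl_laplacian P k (F j) x = complex_of_real (norm x ^ (2 * j)) * H j x" for j x
    proof -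
      have "dunkl_laplacian P k (F j) x = complex_of_real (c j) * (complex_of_real (norm x ^ (2 * j)) * G j x)"
        unfolding F_def c_def by (rule dunkl_laplacian_normpow_harmonic[OF P G])
      then show ?thesis using c[of j] by (simp add: G_def)
    qed
    define q where "q = (\<lambda>x. \<Sum>j\<le>n. F j x)"
    have q: "hpoly m q" unfolding q_def by (intro hpoly_sum F)
    have lapq: "dunkl_laplacian P k q x = dunkl_laplacian P k p x" for x
      unfolding q_def H(3) by (subst dunkl_laplacian_sum[where m=m]) (auto simp: F lapF)
    define r where "r = (\<lambda>x. p x + (-1) * q x)"
    have "dunkl_laplacian P k r x = 0" for x
      unfolding r_def dunkl_laplacian_add[OF less.prems hpoly_scale[OF q]] dunkl_laplacian_scale[OF q] lapq by simp
    then have r: "r \<in> dunkl_harmonics P k m"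
      unfolding dunkl_harmonics_iff r_def using hpoly_add[OF less.prems hpoly_scale[OF q]] by blast
    show ?thesis
    proof (intro exI[of _ "\<lambda>j. case j of 0 \<Rightarrow> r | Suc i \<Rightarrow> G i"] conjI allI impI)
      fix j show "(case j of 0 \<Rightarrow> r | Suc i \<Rightarrow> G i) \<in> dunkl_harmonics P k (m - 2 * j)"
        using r G by (auto simp: m split: nat.split)
      show "m < 2 * j \<Longrightarrow> (case j of 0 \<Rightarrow> r | Suc i \<Rightarrow> G i) = (\<lambda>x. 0)"
        using Gz by (auto simp: m split: nat.split)
    next
      fix x
      have "(\<Sum>j\<le>m. complex_of_real (norm x ^ (2 * j)) * (case j of 0 \<Rightarrow> r | Suc i \<Rightarrow> G i) x)
        = r x + (\<Sum>j\<le>Suc n. F j x)"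
        unfolding m by (subst sum.atMost_Suc_shift) (simp add: F_def)
      also have "(\<Sum>j\<le>Suc n. F j x) = q x" by (simp add: q_def F_def Gz)
      finally show "p x = (\<Sum>j\<le>m. complex_of_real (norm x ^ (2 * j)) * (case j of 0 \<Rightarrow> r | Suc i \<Rightarrow> G i) x)"
        by (simp add: r_def)
    qed
  qed
qed

section \<open>Laguerre polynomials\<close>

definition laguerre_poly :: "nat \<Rightarrow> real \<Rightarrow> real poly" where
  "laguerre_poly l s = (\<Sum>j\<le>l. monom ((-1) ^ j * ((s + real l) gchoose (l - j)) / fact j) j)"

lemma poly_laguerre_poly: "poly (laguerre_poly l s) t = laguerre l s t"
  by (simp add: laguerre_poly_def laguerre_def poly_sum poly_monom field_simps)

lemma coeff_laguerre_poly:
  "coeff (laguerre_poly l s) j = (if j \<le> l then (-1) ^ j * ((s + real l) gchoose (l - j)) / fact j else 0)"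
  by (simp add: laguerre_poly_def coeff_sum)

lemma laguerre_coeff_recurrence:
  "real (Suc j) * (s + 1 + real j) * coeff (laguerre_poly l s) (Suc j) = (real j - real l) * coeff (laguerre_poly l s) j"
proof (cases "j < l")
  case True
  define i where "i = l - Suc j"
  have i: "l - j = Suc i" "l - Suc j = i" "real l = real i + real j + 1" using True by (auto simp: i_def)
  have "(s + real l) * ((s + real l) gchoose i) = real i * ((s + real l) gchoose i) + real (Suc i) * ((s + real l) gchoose Suc i)"
    by (rule gbinomial_mult_1)
  then have g: "(s + 1 + real j) * ((s + real l) gchoose i) = (real l - real j) * ((s + real l) gchoose Suc i)"
    using i(3) by (simp add: algebra_simps)
  have c1: "real (Suc j) * coeff (laguerre_poly l s) (Suc j) = - ((-1) ^ j / fact j) * ((s + real l) gchoose i)"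
    using True by (simp add: coeff_laguerre_poly i field_simps del: of_nat_Suc)
  have c0: "coeff (laguerre_poly l s) j = ((-1) ^ j / fact j) * ((s + real l) gchoose Suc i)"
    using True by (simp add: coeff_laguerre_poly i)
  have "real (Suc j) * (s + 1 + real j) * coeff (laguerre_poly l s) (Suc j)
      = (s + 1 + real j) * (real (Suc j) * coeff (laguerre_poly l s) (Suc j))" by (simp only: mult_ac)
  also have "\<dots> = - ((-1) ^ j / fact j) * ((s + 1 + real j) * ((s + real l) gchoose i))"
    unfolding c1 by (simp only: mult_ac)
  also have "\<dots> = (real j - real l) * coeff (laguerre_poly l s) j"
    unfolding g c0 by (simp add: algebra_simps diff_divide_distrib)
  finally show ?thesis .
next
  case False
  then show ?thesis by (cases "j = l") (auto simp: coeff_laguerre_poly)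
qed

text \<open>The operator \<open>t f'' + (s + 1 - t) f'\<close>.\<close>

definition laguerre_op :: "real \<Rightarrow> real poly \<Rightarrow> real poly" where
  "laguerre_op s f = pCons 0 (pderiv (pderiv f)) + smult (s + 1) (pderiv f) - pCons 0 (pderiv f)"

lemma laguerre_op_laguerre: "laguerre_op s (laguerre_poly l s) = smult (- real l) (laguerre_poly l s)"
proof (rule poly_eqI)
  fix j
  have "coeff (laguerre_op s (laguerre_poly l s)) j =
    real (Suc j) * (s + 1 + real j) * coeff (laguerre_poly l s) (Suc j) - real j * coeff (laguerre_poly l s) j"
    by (cases j) (auto simp: laguerre_op_def coeff_pderiv coeff_pCons algebra_simps)
  then show "coeff (laguerre_op s (laguerre_poly l s)) j = coeff (smult (- real l) (laguerre_poly l s)) j"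
    unfolding laguerre_coeff_recurrence by (simp add: algebra_simps)
qed

lemma laguerre_ode:
  fixes s t :: real and l :: nat
  defines "A \<equiv> laguerre_poly l s"
  shows "t * poly (pderiv (pderiv A)) t + (s + 1 - t) * poly (pderiv A) t = - real l * poly A t"
  using arg_cong[OF laguerre_op_laguerre[of s l], of "\<lambda>f. poly f t"]
  unfolding A_def laguerre_op_def by (simp add: algebra_simps)

section \<open>Orthogonality of Laguerre polynomials\<close>

lemma gamma_moment:
  fixes s :: real
  assumes "s > -1"
  shows "has_bochner_integral lborel (\<lambda>t. indicator {0<..} t * (t powr s * exp (-t)) * t ^ n) (Gamma (s + 1 + real n))"
proof (rule has_bochner_integral_nn_integral)
  have pos: "0 < s + 1 + real n" using assms by linarith
  have "(\<integral>\<^sup>+t. ennreal (indicator {0<..} t * (t powr s * exp (-t)) * t ^ n) \<partial>lborel)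
     = (\<integral>\<^sup>+t. ennreal (indicator {0..} t * t powr (s + 1 + real n - 1) / exp t) \<partial>lborel)"
  proof (rule nn_integral_cong_AE, rule AE_mp[OF AE_lborel_singleton[of 0]], intro AE_I2 impI)
    fix t :: real assume "t \<noteq> 0"
    then show "ennreal (indicator {0<..} t * (t powr s * exp (-t)) * t ^ n) = ennreal (indicator {0..} t * t powr (s + 1 + real n - 1) / exp t)"
      by (cases "t > 0") (auto simp: indicator_def powr_add powr_realpow exp_minus field_simps)
  qed
  also have "\<dots> = ennreal (Gamma (s + 1 + real n))" by (rule Gamma_conv_nn_integral_real[OF pos, symmetric])
  finally show "(\<integral>\<^sup>+t. ennreal (indicator {0<..} t * (t powr s * exp (-t)) * t ^ n) \<partial>lborel) = ennreal (Gamma (s + 1 + real n))" .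
  show "0 \<le> Gamma (s + 1 + real n)" using Gamma_real_pos[OF pos] by simp
qed (auto simp: indicator_def)

text \<open>Integration against the weight \<open>t\<^bsup>s\<^esup> e\<^bsup>-t\<^esup>\<close> on the positive half-line, regarded as a linear functional
  on polynomials: integration by parts becomes the functional equation of the Gamma function.\<close>

definition gamma_functional :: "real \<Rightarrow> real poly \<Rightarrow> real" where
  "gamma_functional s f = (\<integral>t. indicator {0<..} t * (t powr s * exp (-t)) * poly f t \<partial>lborel)"

lemma gamma_functional_integrable:
  fixes f :: "real poly"
  assumes "s > -1"
  shows "integrable lborel (\<lambda>t. indicator {0<..} t * (t powr s * exp (-t)) * poly f t)"
proof -
  have "integrable lborel (\<lambda>t. \<Sum>i\<le>degree f. coeff f i * (indicator {0<..} t * (t powr s * exp (-t)) * t ^ i))"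
    by (intro Bochner_Integration.integrable_sum integrable_mult_right has_bochner_integral_iff[THEN iffD1, THEN conjunct1, OF gamma_moment[OF assms]])
  then show ?thesis by (simp add: poly_altdef sum_distrib_left mult_ac)
qed

lemma gamma_functional_add: "s > -1 \<Longrightarrow> gamma_functional s (f + g) = gamma_functional s f + gamma_functional s g"
  unfolding gamma_functional_def poly_add distrib_left
  by (intro Bochner_Integration.integral_add gamma_functional_integrable)

lemma gamma_functional_smult: "gamma_functional s (smult c f) = c * gamma_functional s f"
proof -
  have "gamma_functional s (smult c f) = (\<integral>t. c * (indicator {0<..} t * (t powr s * exp (-t)) * poly f t) \<partial>lborel)"
    unfolding gamma_functional_def poly_smult by (rule Bochner_Integration.integral_cong) (auto simp: mult_ac)
  then show ?thesis unfolding gamma_functional_def by simp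
qed

lemma gamma_functional_diff: "s > -1 \<Longrightarrow> gamma_functional s (f - g) = gamma_functional s f - gamma_functional s g"
  using gamma_functional_add[of s f "smult (-1) g"] gamma_functional_smult[of s "-1" g] by simp

lemma gamma_functional_monom: "s > -1 \<Longrightarrow> gamma_functional s (monom c n) = c * Gamma (s + 1 + real n)"
proof -
  assume s: "s > -1"
  have "gamma_functional s (monom 1 n) = Gamma (s + 1 + real n)"
    using has_bochner_integral_integral_eq[OF gamma_moment[OF s, of n]] by (simp add: gamma_functional_def poly_monom)
  then show ?thesis using gamma_functional_smult[of s c "monom 1 n"] by (simp add: smult_monom)
qed

lemma gamma_functional_by_parts:
  assumes "s > -1"
  shows "gamma_functional s (pCons 0 (pderiv f)) + (s + 1) * gamma_functional s f = gamma_functional s (pCons 0 f)"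
proof -
  define D where "D f = gamma_functional s (pCons 0 (pderiv f)) + (s + 1) * gamma_functional s f - gamma_functional s (pCons 0 f)" for f
  have add: "D (f + g) = D f + D g" for f g
  proof -
    have eq: "pCons 0 (pderiv (f + g)) = pCons 0 (pderiv f) + pCons 0 (pderiv g)" "pCons 0 (f + g) = pCons 0 f + pCons 0 g"
      by (simp_all add: pderiv_add)
    show ?thesis unfolding D_def eq gamma_functional_add[OF assms] distrib_left by simp
  qed
  have mon: "D (monom c n) = 0" for c n
  proof -
    have 1: "pCons 0 (pderiv (monom c n)) = monom (real n * c) n"
      by (cases n) (simp_all add: pderiv_monom flip: monom_Suc)
    have "s + 1 + real n \<notin> \<int>\<^sub>\<le>\<^sub>0" using assms nonpos_Ints_nonpos[of "s + 1 + real n"] by force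
    then have 2: "Gamma (s + 1 + real n + 1) = (s + 1 + real n) * Gamma (s + 1 + real n)" by (rule Gamma_plus1)
    show ?thesis unfolding D_def 1 monom_Suc[symmetric] gamma_functional_monom[OF assms]
      using 2 by (simp add: algebra_simps)
  qed
  have "D (\<Sum>i\<in>I. monom (coeff f i) i) = 0" if "finite I" for I
    using that by (induction I) (use mon[of 0 0] in \<open>auto simp: add mon\<close>)
  from this[of "{..degree f}"] have "D f = 0" by (simp add: poly_as_sum_of_monoms)
  then show ?thesis by (simp add: D_def)
qed

text \<open>The right-hand side is symmetric in \<open>f\<close> and \<open>g\<close>; eigenvectors of \<open>laguerre_op s\<close> for different
  eigenvalues are therefore orthogonal.\<close>

lemma laguerre_op_symmetric:
  assumes "s > -1"
  shows "gamma_functional s (laguerre_op s f * g) = - gamma_functional s (pCons 0 (pderiv f * pderiv g))"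
proof -
  have "laguerre_op s f * g = pCons 0 (pderiv (pderiv f * g)) + smult (s + 1) (pderiv f * g) - pCons 0 (pderiv f * g)
     - pCons 0 (pderiv f * pderiv g)"
    by (rule poly_eq_poly_eq_iff[THEN iffD1], rule ext)
       (simp add: laguerre_op_def pderiv_mult algebra_simps)
  then show ?thesis
    using gamma_functional_by_parts[OF assms, of "pderiv f * g"]
    by (simp add: gamma_functional_add[OF assms] gamma_functional_diff[OF assms] gamma_functional_smult)
qed

theorem laguerre_orthogonal:
  assumes "s > -1" "l \<noteq> m"
  shows "gamma_functional s (laguerre_poly l s * laguerre_poly m s) = 0"
proof -
  let ?L = "laguerre_poly l s" and ?M = "laguerre_poly m s"
  have "gamma_functional s (laguerre_op s ?L * ?M) = gamma_functional s (laguerre_op s ?M * ?L)"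
    unfolding laguerre_op_symmetric[OF assms(1)] by (simp add: mult.commute)
  then have "- real l * gamma_functional s (?L * ?M) = - real m * gamma_functional s (?L * ?M)"
    by (simp only: laguerre_op_laguerre mult_smult_left gamma_functional_smult mult.commute[of ?M ?L])
  then show ?thesis using assms(2) by simp
qed

section \<open>Integrals of homogeneous times radial functions\<close>

lemma nn_integral_scaleR:
  fixes f :: "real ^ 'n \<Rightarrow> ennreal"
  assumes [measurable]: "f \<in> borel_measurable borel" and c: "c > 0"
  shows "(\<integral>\<^sup>+x. f x \<partial>lborel) = ennreal (c ^ CARD('n)) * (\<integral>\<^sup>+x. f (c *\<^sub>R x) \<partial>lborel)"
proof -
  have "(\<integral>\<^sup>+x. f x \<partial>lborel) = (\<integral>\<^sup>+x. f x \<partial>density (distr lborel borel (\<lambda>x. 0 + c *\<^sub>R x)) (\<lambda>_. \<bar>c\<bar> ^ DIM(real ^ 'n)))"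
    using lborel_affine[of c "0 :: real ^ 'n"] c by simp
  also have "\<dots> = ennreal (c ^ CARD('n)) * (\<integral>\<^sup>+x. f (c *\<^sub>R x) \<partial>lborel)"
    using c by (simp add: nn_integral_density nn_integral_distr nn_integral_cmult)
  finally show ?thesis .
qed

text \<open>The density on the positive half-line whose distribution function is \<open>s\<^bsup>b\<^esup>\<close>.\<close>

definition power_density :: "real \<Rightarrow> real \<Rightarrow> real" where
  "power_density b s = indicator {0<..} s * (b * s powr (b - 1))"

lemma power_density_measurable [measurable]: "power_density b \<in> borel_measurable borel"
  unfolding power_density_def by measurable

lemma power_density_nonneg: "b > 0 \<Longrightarrow> 0 \<le> power_density b s"
  by (auto simp: power_density_def indicator_def)

lemma nn_integral_power_density:
  assumes "b > 0"
  shows "(\<integral>\<^sup>+t. ennreal (power_density b t) * indicator {..s} t \<partial>lborel) = ennreal (if s > 0 then s powr b else 0)"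
proof (cases "s > 0")
  case True
  have "((\<lambda>x. b * x powr (b - 1)) has_integral b * (s powr (b - 1 + 1) / (b - 1 + 1))) {0..s}"
    by (intro has_integral_mult_right has_integral_powr_from_0) (use assms True in auto)
  then have "(\<integral>\<^sup>+t. ennreal (b * t powr (b - 1)) * indicator {0..s} t \<partial>lborel) = ennreal (b * (s powr (b - 1 + 1) / (b - 1 + 1)))"
    by (rule nn_integral_has_integral_lebesgue'[rotated]) (use assms in auto)
  moreover have "(\<integral>\<^sup>+t. ennreal (power_density b t) * indicator {..s} t \<partial>lborel) = (\<integral>\<^sup>+t. ennreal (b * t powr (b - 1)) * indicator {0..s} t \<partial>lborel)"
    by (rule nn_integral_cong) (auto simp: power_density_def indicator_def)
  ultimately show ?thesis using True assms by simp
next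
  case False
  then have "(\<integral>\<^sup>+t. ennreal (power_density b t) * indicator {..s} t \<partial>lborel) = (\<integral>\<^sup>+t. 0 \<partial>(lborel :: real measure))"
    by (intro nn_integral_cong) (auto simp: power_density_def indicator_def)
  then show ?thesis using False by simp
qed

text \<open>The measure of a ball of radius \<open>\<rho>\<close> under a homogeneous density is a constant times a power of
  \<open>\<rho>\<close>; balls are the preimages of half-lines, which determine the image measure. The same constant
  serves all exponents \<open>a\<close>.\<close>

lemma radial_pushforward:
  fixes h :: "real ^ 'n \<Rightarrow> real"
  assumes hm[measurable]: "h \<in> borel_measurable borel" and nn: "\<And>x. 0 \<le> h x"
    and hom: "\<And>c x. c > 0 \<Longrightarrow> h (c *\<^sub>R x) = c powr d * h x"
    and bd: "\<And>x. norm x \<le> 1 \<Longrightarrow> h x \<le> B" and d: "0 \<le> d"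
  shows "\<exists>C\<ge>0. \<forall>a>0. distr (density lborel (\<lambda>x. ennreal (h x))) borel (\<lambda>x. norm x powr a)
      = density lborel (\<lambda>s. ennreal (C * power_density ((d + real CARD('n)) / a) s))"
proof -
  let ?I = "\<lambda>\<rho>. \<integral>\<^sup>+x. ennreal (h x) * indicator (cball 0 \<rho>) x \<partial>lborel"
  have "?I 1 \<le> (\<integral>\<^sup>+x. ennreal B * indicator (cball 0 1) x \<partial>(lborel :: (real ^ 'n) measure))"
    by (intro nn_integral_mono) (auto simp: indicator_def intro!: ennreal_leI bd)
  also have "\<dots> < \<infinity>"
    using emeasure_bounded_finite[OF bounded_cball, of "0 :: real ^ 'n" 1]
    by (simp add: nn_integral_cmult_indicator ennreal_mult_less_top)
  finally have fin: "?I 1 < \<infinity>" .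
  define C where "C = enn2real (?I 1)"
  have C: "?I 1 = ennreal C" "0 \<le> C" using fin by (auto simp: C_def less_top)
  have ball: "?I \<rho> = ennreal (\<rho> powr (d + real CARD('n)) * C)" if \<rho>: "\<rho> > 0" for \<rho>
  proof -
    have [measurable]: "cball (0 :: real ^ 'n) r \<in> sets borel" for r by simp
    have "?I \<rho> = ennreal (\<rho> ^ CARD('n)) * (\<integral>\<^sup>+x. ennreal (h (\<rho> *\<^sub>R x)) * indicator (cball 0 \<rho>) (\<rho> *\<^sub>R x) \<partial>lborel)"
      by (rule nn_integral_scaleR[OF _ \<rho>]) measurable
    also have "(\<integral>\<^sup>+x. ennreal (h (\<rho> *\<^sub>R x)) * indicator (cball 0 \<rho>) (\<rho> *\<^sub>R x) \<partial>lborel)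
       = (\<integral>\<^sup>+x. ennreal (\<rho> powr d) * (ennreal (h x) * indicator (cball 0 1) x) \<partial>lborel)"
      by (rule nn_integral_cong) (use \<rho> in \<open>auto simp: hom indicator_def ennreal_mult' mult.assoc nn\<close>)
    also have "\<dots> = ennreal (\<rho> powr d) * ?I 1" by (rule nn_integral_cmult) measurable
    finally show ?thesis using \<rho>
      by (simp add: C(1) ennreal_mult'[symmetric] C(2) powr_add powr_realpow mult_ac)
  qed
  have "distr (density lborel (\<lambda>x. ennreal (h x))) borel (\<lambda>x. norm x powr a)
      = density lborel (\<lambda>s. ennreal (C * power_density ((d + real CARD('n)) / a) s))" (is "?L = ?R") if a: "a > 0" for a
  proof (rule measure_eqI_generator_eq[where E="range (\<lambda>a::real. {..a})" and \<Omega>=UNIV and A="\<lambda>i. {..real i}"])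
    have b: "(d + real CARD('n)) / a > 0" using d a by (simp add: add_nonneg_pos)
    have em: "emeasure ?L {..s} = emeasure ?R {..s} \<and> emeasure ?L {..s} \<noteq> \<infinity>" for s
    proof -
      have [measurable]: "(\<lambda>x :: real ^ 'n. norm x powr a) -` {..s} \<in> sets borel"
        using measurable_sets[of "\<lambda>x :: real ^ 'n. norm x powr a" borel borel "{..s}"] by simp
      have L: "emeasure ?L {..s} = (\<integral>\<^sup>+x. ennreal (h x) * indicator {x. norm x powr a \<le> s} x \<partial>lborel)"
        by (subst emeasure_distr, measurable, subst emeasure_density) (auto intro!: nn_integral_cong simp: indicator_def)
      have "emeasure ?R {..s} = (\<integral>\<^sup>+t. ennreal C * (ennreal (power_density ((d + real CARD('n)) / a) t) * indicator {..s} t) \<partial>lborel)"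
        by (subst emeasure_density) (auto simp: ennreal_mult C(2) power_density_nonneg[OF b] mult.assoc)
      also have "\<dots> = ennreal (C * (if s > 0 then s powr ((d + real CARD('n)) / a) else 0))"
        by (subst nn_integral_cmult) (auto simp: nn_integral_power_density[OF b] ennreal_mult C(2))
      finally have R: "emeasure ?R {..s} = ennreal (C * (if s > 0 then s powr ((d + real CARD('n)) / a) else 0))" .
      have "(\<integral>\<^sup>+x. ennreal (h x) * indicator {x. norm x powr a \<le> s} x \<partial>lborel)
          = ennreal (C * (if s > 0 then s powr ((d + real CARD('n)) / a) else 0))"
      proof (cases "s > 0")
        case True
        have eq: "norm x powr a \<le> s \<longleftrightarrow> norm x \<le> s powr (1 / a)" for x :: "real ^ 'n"
        proof -
          have "norm x powr a \<le> s \<longleftrightarrow> norm x powr a \<le> (s powr (1 / a)) powr a"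
            using True a by (simp add: powr_powr)
          also have "\<dots> \<longleftrightarrow> norm x \<le> s powr (1 / a)"
            using a by (meson linorder_not_le norm_ge_zero powr_ge_zero powr_less_mono2 powr_mono2 less_imp_le)
          finally show ?thesis .
        qed
        have "(\<integral>\<^sup>+x. ennreal (h x) * indicator {x. norm x powr a \<le> s} x \<partial>lborel) = ?I (s powr (1 / a))"
          by (rule nn_integral_cong) (auto simp: indicator_def eq)
        also have "\<dots> = ennreal ((s powr (1 / a)) powr (d + real CARD('n)) * C)" by (rule ball) (use True in simp)
        finally show ?thesis using True by (simp add: powr_powr mult.commute)
      next
        case False
        have "AE x in lborel. ennreal (h x) * indicator {x. norm x powr a \<le> s} x = 0"
          using AE_lborel_singleton[of "0 :: real ^ 'n"]
        proof eventually_elim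
          fix x :: "real ^ 'n" assume "x \<noteq> 0"
          then have "norm x powr a > 0" by simp
          then have "\<not> norm x powr a \<le> s" using False by linarith
          then show "ennreal (h x) * indicator {x. norm x powr a \<le> s} x = 0" by (simp add: indicator_def)
        qed
        then have "(\<integral>\<^sup>+x. ennreal (h x) * indicator {x. norm x powr a \<le> s} x \<partial>lborel) = 0"
          by (subst nn_integral_0_iff_AE) auto
        then show ?thesis using False by simp
      qed
      then show ?thesis using L R by simp
    qed
    show "\<And>X. X \<in> range (\<lambda>a::real. {..a}) \<Longrightarrow> emeasure ?L X = emeasure ?R X" using em by auto
    show "\<And>i. emeasure ?L {..real i} \<noteq> \<infinity>" using em by blast
    show "Int_stable (range (\<lambda>a::real. {..a}))" by (auto simp: Int_stable_def)
    have "sets (borel :: real measure) = sigma_sets UNIV (range (\<lambda>a::real. {..a}))"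
      by (subst borel_eq_atMost) simp
    then show "sets ?L = sigma_sets UNIV (range (\<lambda>a::real. {..a}))" "sets ?R = sigma_sets UNIV (range (\<lambda>a::real. {..a}))" by simp_all
    show "(\<Union>i. {..real i}) = UNIV" using real_arch_simple by auto
  qed auto
  then show ?thesis using C(2) by blast
qed

lemma radial_integral_nonneg:
  fixes h :: "real ^ 'n \<Rightarrow> real"
  assumes hm[measurable]: "h \<in> borel_measurable borel" and nn: "\<And>x. 0 \<le> h x"
    and hom: "\<And>c x. c > 0 \<Longrightarrow> h (c *\<^sub>R x) = c powr d * h x"
    and bd: "\<And>x. norm x \<le> 1 \<Longrightarrow> h x \<le> B" and d: "0 \<le> d"
  shows "\<exists>C. \<forall>a>0. \<forall>G\<in>borel_measurable borel.
     integrable lborel (\<lambda>s. power_density ((d + real CARD('n)) / a) s * G s) \<longrightarrow>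
     has_bochner_integral lborel (\<lambda>x. h x * G (norm x powr a)) (C * (\<integral>s. power_density ((d + real CARD('n)) / a) s * G s \<partial>lborel))"
proof -
  obtain C where C: "C \<ge> 0" and eq: "\<And>a. a > 0 \<Longrightarrow> distr (density lborel (\<lambda>x. ennreal (h x))) borel (\<lambda>x. norm x powr a)
      = density lborel (\<lambda>s. ennreal (C * power_density ((d + real CARD('n)) / a) s))"
    using radial_pushforward[OF hm nn hom bd d] by blast
  have "has_bochner_integral lborel (\<lambda>x. h x * G (norm x powr a)) (C * (\<integral>s. power_density ((d + real CARD('n)) / a) s * G s \<partial>lborel))"
    if a: "a > 0" and G[measurable]: "G \<in> borel_measurable borel"
      and i: "integrable lborel (\<lambda>s. power_density ((d + real CARD('n)) / a) s * G s)" for a G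
  proof -
    let ?b = "(d + real CARD('n)) / a"
    have b: "?b > 0" using d a by (simp add: add_nonneg_pos)
    let ?M = "distr (density lborel (\<lambda>x. ennreal (h x))) borel (\<lambda>x. norm x powr a)"
    have nn2: "AE s in lborel. 0 \<le> C * power_density ?b s" using C power_density_nonneg[OF b] by simp
    have "integrable lborel (\<lambda>s. C * (power_density ?b s * G s))" using i by (rule integrable_mult_right)
    then have "integrable ?M G"
      unfolding eq[OF a] using nn2 by (subst integrable_density) (auto simp: mult.assoc)
    then have 1: "integrable lborel (\<lambda>x. h x * G (norm x powr a))"
      by (subst (asm) integrable_distr_eq) (auto simp: integrable_density nn)
    have "(\<integral>x. h x * G (norm x powr a) \<partial>lborel) = (\<integral>s. G s \<partial>?M)"
      by (subst integral_distr) (auto simp: integral_density nn)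
    also have "\<dots> = (\<integral>s. C * (power_density ?b s * G s) \<partial>lborel)"
      unfolding eq[OF a] using nn2 by (subst integral_density) (auto simp: mult.assoc)
    finally have "(\<integral>x. h x * G (norm x powr a) \<partial>lborel) = C * (\<integral>s. power_density ?b s * G s \<partial>lborel)" by simp
    then show ?thesis using has_bochner_integral_integrable[OF 1] by simp
  qed
  then show ?thesis by blast
qed

text \<open>The constant is independent of the exponent \<open>a\<close> and of the radial function \<open>G\<close>. Hence its
  vanishing can be tested with a single choice of the two, which will be a Gaussian.\<close>

theorem radial_integral:
  fixes h :: "real ^ 'n \<Rightarrow> complex"
  assumes hm[measurable]: "h \<in> borel_measurable borel"
    and hom: "\<And>c x. c > 0 \<Longrightarrow> h (c *\<^sub>R x) = complex_of_real (c powr d) * h x"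
    and bd: "\<And>x. norm x \<le> 1 \<Longrightarrow> cmod (h x) \<le> B" and d: "0 \<le> d"
  shows "\<exists>C. \<forall>a>0. \<forall>G\<in>borel_measurable borel.
     integrable lborel (\<lambda>s. power_density ((d + real CARD('n)) / a) s * G s) \<longrightarrow>
     has_bochner_integral lborel (\<lambda>x. h x * complex_of_real (G (norm x powr a)))
       (C * complex_of_real (\<integral>s. power_density ((d + real CARD('n)) / a) s * G s \<partial>lborel))"
proof -
  define rad where "rad v C \<longleftrightarrow> (\<forall>a>0. \<forall>G\<in>borel_measurable borel.
     integrable lborel (\<lambda>s. power_density ((d + real CARD('n)) / a) s * G s) \<longrightarrow>
     has_bochner_integral lborel (\<lambda>x. v x * G (norm x powr a)) (C * (\<integral>s. power_density ((d + real CARD('n)) / a) s * G s \<partial>lborel)))"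
    for v :: "real ^ 'n \<Rightarrow> real" and C
  have part: "\<exists>C. rad (\<lambda>x. max 0 (u (h x))) C"
    if um[measurable]: "u \<in> borel_measurable borel" and u: "\<And>r z. u (complex_of_real r * z) = r * u z" "\<And>z. u z \<le> cmod z" for u
    unfolding rad_def
  proof (rule radial_integral_nonneg[OF _ _ _ _ d])
    show "(\<lambda>x. max 0 (u (h x))) \<in> borel_measurable borel" by measurable
    show "max 0 (u (h (c *\<^sub>R x))) = c powr d * max 0 (u (h x))" if "c > 0" for c x
      using that by (simp add: hom u(1) max_mult_distrib_left)
    show "max 0 (u (h x)) \<le> max 0 B" if "norm x \<le> 1" for x using bd[OF that] u(2)[of "h x"] by auto
  qed simp
  have le: "Re z \<le> cmod z" "- Re z \<le> cmod z" "Im z \<le> cmod z" "- Im z \<le> cmod z" for z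
    using abs_Re_le_cmod[of z] abs_Im_le_cmod[of z] by linarith+
  obtain C1 where C1: "rad (\<lambda>x. max 0 (Re (h x))) C1" using part[of Re] le by auto
  obtain C2 where C2: "rad (\<lambda>x. max 0 (- Re (h x))) C2" using part[of "\<lambda>z. - Re z"] le by auto
  obtain C3 where C3: "rad (\<lambda>x. max 0 (Im (h x))) C3" using part[of Im] le by auto
  obtain C4 where C4: "rad (\<lambda>x. max 0 (- Im (h x))) C4" using part[of "\<lambda>z. - Im z"] le by auto
  have split: "h x * complex_of_real g =
      (complex_of_real (max 0 (Re (h x)) * g) - complex_of_real (max 0 (- Re (h x)) * g))
      + \<i> * (complex_of_real (max 0 (Im (h x)) * g) - complex_of_real (max 0 (- Im (h x)) * g))" for x g
    by (auto simp: complex_eq_iff max_def algebra_simps)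
  show ?thesis
  proof (intro exI[of _ "complex_of_real (C1 - C2) + \<i> * complex_of_real (C3 - C4)"] allI impI ballI)
    fix a :: real and G :: "real \<Rightarrow> real"
    assume H: "0 < a" "G \<in> borel_measurable borel" "integrable lborel (\<lambda>s. power_density ((d + real CARD('n)) / a) s * G s)"
    let ?J = "\<integral>s. power_density ((d + real CARD('n)) / a) s * G s \<partial>lborel"
    note cs = has_bochner_integral_of_real[OF C1[unfolded rad_def, rule_format, OF H], where 'a=complex]
      has_bochner_integral_of_real[OF C2[unfolded rad_def, rule_format, OF H], where 'a=complex]
      has_bochner_integral_of_real[OF C3[unfolded rad_def, rule_format, OF H], where 'a=complex]
      has_bochner_integral_of_real[OF C4[unfolded rad_def, rule_format, OF H], where 'a=complex]
    have "has_bochner_integral lborel (\<lambda>x. h x * complex_of_real (G (norm x powr a)))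
      ((complex_of_real (C1 * ?J) - complex_of_real (C2 * ?J)) + \<i> * (complex_of_real (C3 * ?J) - complex_of_real (C4 * ?J)))"
      unfolding split by (intro has_bochner_integral_add has_bochner_integral_diff has_bochner_integral_mult_right cs)
    then show "has_bochner_integral lborel (\<lambda>x. h x * complex_of_real (G (norm x powr a)))
       ((complex_of_real (C1 - C2) + \<i> * complex_of_real (C3 - C4)) * complex_of_real ?J)"
      by (simp add: algebra_simps)
  qed
qed

section \<open>Invariance of Lebesgue measure\<close>

lemma nn_integral_translate:
  fixes f :: "real ^ 'n \<Rightarrow> ennreal"
  assumes [measurable]: "f \<in> borel_measurable borel"
  shows "(\<integral>\<^sup>+x. f (a + x) \<partial>lborel) = (\<integral>\<^sup>+x. f x \<partial>lborel)"
proof -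
  have "(\<integral>\<^sup>+x. f x \<partial>lborel) = (\<integral>\<^sup>+x. f x \<partial>distr lborel borel ((+) a))" by (simp add: lborel_distr_plus)
  also have "\<dots> = (\<integral>\<^sup>+x. f (a + x) \<partial>lborel)" by (rule nn_integral_distr) auto
  finally show ?thesis by simp
qed

text \<open>Computing the integral of \<open>1\<^sub>B(y) 1\<^sub>A(r x + y)\<close> over both variables in two orders, for the unit
  ball \<open>B\<close>, uses only translation invariance, \<open>r (r x) = x\<close> and \<open>r B = B\<close>, and compares the measures of
  \<open>r\<^sup>-\<^sup>1 A\<close> and \<open>A\<close>.\<close>

lemma lborel_linear_isometry:
  fixes r :: "real ^ 'n \<Rightarrow> real ^ 'n"
  assumes lin: "linear r" and norm: "\<And>x. norm (r x) = norm x" and inv: "\<And>x. r (r x) = x"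
  shows "distr lborel borel r = lborel"
proof (rule measure_eqI)
  have rm[measurable]: "r \<in> borel_measurable borel"
    using linear_continuous_on[OF linear_conv_bounded_linear[THEN iffD1, OF lin]] by (rule borel_measurable_continuous_onI)
  fix A assume "A \<in> sets (distr lborel borel r)"
  then have [measurable]: "A \<in> sets borel" by simp
  let ?B = "ball (0 :: real ^ 'n) 1"
  have [measurable]: "?B \<in> sets borel" by simp
  let ?I = "\<lambda>x. indicator A x :: ennreal" and ?J = "\<lambda>y. indicator ?B y :: ennreal"
  have B: "emeasure lborel ?B \<noteq> 0" "emeasure lborel ?B \<noteq> \<infinity>"
  proof -
    have "\<not> negligible ?B" by (rule open_not_negligible) auto
    then show "emeasure lborel ?B \<noteq> 0"
      using null_setsI[of lborel ?B] null_sets_completionI[of ?B lborel] by (auto simp: negligible_iff_null_sets)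
    show "emeasure lborel ?B \<noteq> \<infinity>"
      using emeasure_bounded_finite[OF bounded_ball, of "0 :: real ^ 'n" 1] by simp
  qed
  have "emeasure lborel (r -` A) * emeasure lborel ?B = (\<integral>\<^sup>+y. ?J y * (\<integral>\<^sup>+x. ?I (r x) \<partial>lborel) \<partial>lborel)"
  proof -
    have "(\<integral>\<^sup>+x. ?I (r x) \<partial>lborel) = emeasure lborel (r -` A)"
    proof -
      have "(\<integral>\<^sup>+x. ?I (r x) \<partial>lborel) = (\<integral>\<^sup>+x. indicator (r -` A) x \<partial>lborel)"
        by (rule nn_integral_cong) (simp add: indicator_def)
      also have "\<dots> = emeasure lborel (r -` A)"
        by (rule nn_integral_indicator) (use measurable_sets[OF rm, of A] in simp)
      finally show ?thesis .
    qed
    then show ?thesis by (simp add: nn_integral_multc mult.commute)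
  qed
  also have "\<dots> = (\<integral>\<^sup>+y. (\<integral>\<^sup>+x. ?J y * ?I (r x + y) \<partial>lborel) \<partial>lborel)"
  proof (rule nn_integral_cong)
    fix y
    have "(\<integral>\<^sup>+x. ?I (r x) \<partial>lborel) = (\<integral>\<^sup>+x. ?I (r (r y + x)) \<partial>lborel)"
      by (rule nn_integral_translate[symmetric]) measurable
    also have "\<dots> = (\<integral>\<^sup>+x. ?I (r x + y) \<partial>lborel)" by (simp add: linear_add[OF lin] inv add.commute)
    finally show "?J y * (\<integral>\<^sup>+x. ?I (r x) \<partial>lborel) = (\<integral>\<^sup>+x. ?J y * ?I (r x + y) \<partial>lborel)"
      by (simp add: nn_integral_cmult)
  qed
  also have "\<dots> = (\<integral>\<^sup>+x. (\<integral>\<^sup>+y. ?J y * ?I (r x + y) \<partial>lborel) \<partial>lborel)"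
    by (rule lborel_pair.Fubini') measurable
  also have "\<dots> = (\<integral>\<^sup>+x. (\<integral>\<^sup>+y. ?J (y - r x) * ?I y \<partial>lborel) \<partial>lborel)"
  proof (rule nn_integral_cong)
    fix x
    have "(\<integral>\<^sup>+y. ?J (y - r x) * ?I y \<partial>lborel) = (\<integral>\<^sup>+y. ?J ((r x + y) - r x) * ?I (r x + y) \<partial>lborel)"
      by (rule nn_integral_translate[symmetric]) measurable
    then show "(\<integral>\<^sup>+y. ?J y * ?I (r x + y) \<partial>lborel) = (\<integral>\<^sup>+y. ?J (y - r x) * ?I y \<partial>lborel)" by simp
  qed
  also have "\<dots> = (\<integral>\<^sup>+y. (\<integral>\<^sup>+x. ?J (y - r x) * ?I y \<partial>lborel) \<partial>lborel)"
    by (rule lborel_pair.Fubini') measurable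
  also have "\<dots> = (\<integral>\<^sup>+y. emeasure lborel ?B * ?I y \<partial>lborel)"
  proof (rule nn_integral_cong)
    fix y
    have "norm (y - r x) = norm (x - r y)" for x
      using norm[of "y - r x"] by (simp add: linear_diff[OF lin] inv norm_minus_commute)
    then have "?J (y - r x) = ?J (- r y + x)" for x by (simp add: indicator_def)
    then have "(\<integral>\<^sup>+x. ?J (y - r x) * ?I y \<partial>lborel) = (\<integral>\<^sup>+x. ?J (- r y + x) \<partial>lborel) * ?I y"
      by (simp add: nn_integral_multc)
    also have "(\<integral>\<^sup>+x. ?J (- r y + x) \<partial>lborel) = (\<integral>\<^sup>+x. ?J x \<partial>lborel)" by (rule nn_integral_translate) measurable
    finally show "(\<integral>\<^sup>+x. ?J (y - r x) * ?I y \<partial>lborel) = emeasure lborel ?B * ?I y" by simp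
  qed
  also have "\<dots> = emeasure lborel A * emeasure lborel ?B" by (subst nn_integral_cmult) (auto simp: mult.commute)
  finally have "emeasure lborel (r -` A) = emeasure lborel A"
    using B ennreal_mult_divide_eq[of "emeasure lborel ?B"] by (metis infinity_ennreal_def)
  then show "emeasure (distr lborel borel r) A = emeasure lborel A" by (simp add: emeasure_distr)
qed simp

lemma lborel_root_reflection: "distr lborel borel (root_reflection \<alpha>) = lborel"
  by (rule lborel_linear_isometry) (auto intro: linear_root_reflection)

lemma root_reflection_measurable [measurable]: "root_reflection \<alpha> \<in> borel_measurable borel"
  using linear_continuous_on[OF linear_conv_bounded_linear[THEN iffD1, OF linear_root_reflection]]
  by (rule borel_measurable_continuous_onI)

lemma integral_root_reflection:
  fixes f :: "real ^ 'n \<Rightarrow> complex"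
  assumes [measurable]: "f \<in> borel_measurable borel"
  shows "(\<integral>x. f (root_reflection \<alpha> x) \<partial>lborel) = (\<integral>x. f x \<partial>lborel)"
  using integral_distr[of "root_reflection \<alpha>" lborel borel f] by (simp add: lborel_root_reflection)

lemma integrable_root_reflection:
  fixes f :: "real ^ 'n \<Rightarrow> complex"
  assumes [measurable]: "f \<in> borel_measurable borel" and "integrable lborel f"
  shows "integrable lborel (\<lambda>x. f (root_reflection \<alpha> x))"
  using integrable_distr_eq[of "root_reflection \<alpha>" lborel borel f] assms(2) by (simp add: lborel_root_reflection)

lemma integral_translate:
  fixes f :: "real ^ 'n \<Rightarrow> 'b::{banach, second_countable_topology}"
  assumes [measurable]: "f \<in> borel_measurable borel"
  shows "(\<integral>x. f (x + a) \<partial>lborel) = (\<integral>x. f x \<partial>lborel)"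
  using integral_distr[of "(+) a" lborel borel f] by (simp add: lborel_distr_plus add.commute)

lemma integrable_translate:
  fixes f :: "real ^ 'n \<Rightarrow> 'b::{banach, second_countable_topology}"
  assumes [measurable]: "f \<in> borel_measurable borel" and "integrable lborel f"
  shows "integrable lborel (\<lambda>x. f (x + a))"
  using integrable_distr_eq[of "(+) a" lborel borel f] assms(2) by (simp add: lborel_distr_plus add.commute)

text \<open>The integral of \<open>G\<close> along a unit segment in direction \<open>\<xi>\<close> is a difference of two translates of \<open>F\<close>.
  Averaging over the segment turns the integral of \<open>G\<close> into the integral of this difference, which is
  zero by translation invariance.\<close>

theorem integral_derivative_zero:
  fixes F G :: "real ^ 'n \<Rightarrow> complex"
  assumes der: "\<And>x. ((\<lambda>t. F (x + t *\<^sub>R \<xi>)) has_vector_derivative G x) (at 0)"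
    and cont: "continuous_on UNIV G" and Fm[measurable]: "F \<in> borel_measurable borel"
    and int: "integrable lborel F" "integrable lborel G"
  shows "(\<integral>x. G x \<partial>lborel) = 0"
proof -
  have Gm[measurable]: "G \<in> borel_measurable borel" using cont by (rule borel_measurable_continuous_onI)
  let ?f = "\<lambda>(t::real, x). indicator {0..1} t *\<^sub>R G (x + t *\<^sub>R \<xi>)"
  have ftc: "(\<integral>t. ?f (t, x) \<partial>lborel) = F (x + \<xi>) - F x" for x
  proof -
    have d: "((\<lambda>t. F (x + t *\<^sub>R \<xi>)) has_vector_derivative G (x + t *\<^sub>R \<xi>)) (at t)" for t
    proof -
      have g: "((\<lambda>u. u - t) has_vector_derivative 1) (at t)" by (auto intro!: derivative_eq_intros)
      have "((\<lambda>s. F (x + t *\<^sub>R \<xi> + s *\<^sub>R \<xi>)) has_vector_derivative G (x + t *\<^sub>R \<xi>)) (at (t - t))"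
        using der[of "x + t *\<^sub>R \<xi>"] by simp
      from vector_diff_chain_at[OF g this] show ?thesis by (simp add: o_def algebra_simps)
    qed
    have c: "continuous_on {0..1} (\<lambda>t::real. G (x + t *\<^sub>R \<xi>))"
      by (intro continuous_on_compose2[OF cont] continuous_intros) auto
    have i: "set_integrable lborel {0..1} (\<lambda>t::real. G (x + t *\<^sub>R \<xi>))"
      unfolding set_integrable_def using c by (intro borel_integrable_compact) auto
    have "((\<lambda>t. G (x + t *\<^sub>R \<xi>)) has_integral (F (x + 1 *\<^sub>R \<xi>) - F (x + 0 *\<^sub>R \<xi>))) {0..1}"
      by (rule fundamental_theorem_of_calculus) (auto intro: has_vector_derivative_at_within d)
    then have "integral {0..1} (\<lambda>t. G (x + t *\<^sub>R \<xi>)) = F (x + \<xi>) - F x" by (simp add: integral_unique)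
    then show ?thesis using set_borel_integral_eq_integral(2)[OF i] by (simp add: set_lebesgue_integral_def)
  qed
  have inner: "(\<integral>x. ?f (t, x) \<partial>lborel) = indicator {0..1} t *\<^sub>R (\<integral>x. G x \<partial>lborel)" for t
    by (simp add: integral_translate)
  have pint: "integrable (lborel \<Otimes>\<^sub>M lborel) ?f"
  proof (rule lborel_pair.Fubini_integrable)
    have "(\<integral>x. norm (?f (t, x)) \<partial>lborel) = indicator {0..1} t * (\<integral>x. norm (G x) \<partial>lborel)" for t
    proof -
      have "(\<integral>x. norm (?f (t, x)) \<partial>lborel) = (\<integral>x. indicator {0..1} t * norm (G (x + t *\<^sub>R \<xi>)) \<partial>lborel)" by simp
      also have "\<dots> = indicator {0..1} t * (\<integral>x. norm (G (x + t *\<^sub>R \<xi>)) \<partial>lborel)" by simp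
      also have "(\<integral>x. norm (G (x + t *\<^sub>R \<xi>)) \<partial>lborel) = (\<integral>x. norm (G x) \<partial>lborel)"
        by (rule integral_translate) measurable
      finally show ?thesis .
    qed
    moreover have "integrable lborel (\<lambda>t::real. indicator {0..1} t * (\<integral>x. norm (G x) \<partial>lborel))" by simp
    ultimately show "integrable lborel (\<lambda>t. \<integral>x. norm (?f (t, x)) \<partial>lborel)" by (simp only:)
    show "AE t in lborel. integrable lborel (\<lambda>x. ?f (t, x))"
      by (rule AE_I2) (simp add: integrable_translate int)
  qed measurable
  have "(\<integral>x. G x \<partial>lborel) = (\<integral>t. (\<integral>x. ?f (t, x) \<partial>lborel) \<partial>lborel)" unfolding inner by simp
  also have "\<dots> = (\<integral>x. (\<integral>t. ?f (t, x) \<partial>lborel) \<partial>lborel)"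
    using lborel_pair.Fubini_integral[of "\<lambda>t x. ?f (t, x)"] pint by simp
  also have "\<dots> = (\<integral>x. F (x + \<xi>) - F x \<partial>lborel)" unfolding ftc ..
  also have "\<dots> = 0" by (simp add: integral_translate integrable_translate int)
  finally show ?thesis .
qed

section \<open>Integrability against Gaussians\<close>

lemma AE_inner_nonzero:
  fixes \<alpha> :: "real ^ 'n"
  assumes "\<alpha> \<noteq> 0"
  shows "AE x in lborel. \<alpha> \<bullet> x \<noteq> 0"
proof -
  have "{x. \<alpha> \<bullet> x = 0} \<in> null_sets lebesgue"
    using negligible_hyperplane[of \<alpha> 0] assms by (simp add: negligible_iff_null_sets)
  moreover have "closed {x. \<alpha> \<bullet> x = 0}" by (rule closed_hyperplane)
  ultimately have "{x. \<alpha> \<bullet> x = 0} \<in> null_sets lborel"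
    by (subst (asm) null_sets_completion_iff) auto
  then show ?thesis by (rule AE_I') auto
qed

text \<open>Polynomial growth: closed under sums and products, and sufficient for integrability
  against a Gaussian.\<close>

definition tempered :: "(real ^ 'n \<Rightarrow> complex) \<Rightarrow> bool" where
  "tempered f \<longleftrightarrow> f \<in> borel_measurable borel \<and> (\<exists>C n. \<forall>x. cmod (f x) \<le> C * (1 + (norm x)\<^sup>2) ^ n)"

lemma temperedI:
  "f \<in> borel_measurable borel \<Longrightarrow> (\<And>x. cmod (f x) \<le> C * (1 + (norm x)\<^sup>2) ^ n) \<Longrightarrow> tempered f"
  unfolding tempered_def by blast

lemma tempered_measurable: "tempered f \<Longrightarrow> f \<in> borel_measurable borel"
  by (simp add: tempered_def)

lemma tempered_bound:
  assumes "tempered f"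
  obtains C n where "C \<ge> 0" "\<And>x. cmod (f x) \<le> C * (1 + (norm x)\<^sup>2) ^ n"
proof -
  obtain C n where *: "\<And>x. cmod (f x) \<le> C * (1 + (norm x)\<^sup>2) ^ n" using assms unfolding tempered_def by blast
  have "0 \<le> C" using order_trans[OF norm_ge_zero *[of 0]] by simp
  then show ?thesis using that * by blast
qed

lemma tempered_add: assumes "tempered f" "tempered g" shows "tempered (\<lambda>x. f x + g x)"
proof -
  obtain C n where f: "C \<ge> 0" "\<And>x. cmod (f x) \<le> C * (1 + (norm x)\<^sup>2) ^ n" using tempered_bound[OF assms(1)] by blast
  obtain D m where g: "D \<ge> 0" "\<And>x. cmod (g x) \<le> D * (1 + (norm x)\<^sup>2) ^ m" using tempered_bound[OF assms(2)] by blast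
  show ?thesis
  proof (rule temperedI[where C="C + D" and n="n + m"])
    show "(\<lambda>x. f x + g x) \<in> borel_measurable borel" using assms[THEN tempered_measurable] by simp
    fix x :: "real ^ 'a"
    have 1: "(1 + (norm x)\<^sup>2) ^ i \<le> (1 + (norm x)\<^sup>2) ^ (i + j)" for i j
      by (rule power_increasing) auto
    have "cmod (f x + g x) \<le> cmod (f x) + cmod (g x)" by (rule norm_triangle_ineq)
    also have "\<dots> \<le> C * (1 + (norm x)\<^sup>2) ^ (n + m) + D * (1 + (norm x)\<^sup>2) ^ (n + m)"
      using order_trans[OF f(2) mult_left_mono[OF 1[of n m] f(1)]]
        order_trans[OF g(2) mult_left_mono[OF 1[of m n] g(1)]] by (simp add: add.commute[of m n])
    finally show "cmod (f x + g x) \<le> (C + D) * (1 + (norm x)\<^sup>2) ^ (n + m)" by (simp add: algebra_simps)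
  qed
qed

lemma tempered_mult: assumes "tempered f" "tempered g" shows "tempered (\<lambda>x. f x * g x)"
proof -
  obtain C n where f: "C \<ge> 0" "\<And>x. cmod (f x) \<le> C * (1 + (norm x)\<^sup>2) ^ n" using tempered_bound[OF assms(1)] by blast
  obtain D m where g: "D \<ge> 0" "\<And>x. cmod (g x) \<le> D * (1 + (norm x)\<^sup>2) ^ m" using tempered_bound[OF assms(2)] by blast
  show ?thesis
  proof (rule temperedI[where C="C * D" and n="n + m"])
    show "(\<lambda>x. f x * g x) \<in> borel_measurable borel" using assms[THEN tempered_measurable] by simp
    fix x :: "real ^ 'a"
    have "cmod (f x * g x) \<le> (C * (1 + (norm x)\<^sup>2) ^ n) * (D * (1 + (norm x)\<^sup>2) ^ m)"
      unfolding norm_mult using f g by (intro mult_mono) auto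
    then show "cmod (f x * g x) \<le> C * D * (1 + (norm x)\<^sup>2) ^ (n + m)" by (simp add: power_add mult_ac)
  qed
qed

lemma tempered_cmod: "tempered f \<Longrightarrow> tempered (\<lambda>x. complex_of_real (cmod (f x)))"
  unfolding tempered_def by auto

lemma tempered_bounded:
  assumes "f \<in> borel_measurable borel" "\<And>x. cmod (f x) \<le> C" shows "tempered f"
  by (rule temperedI[of f C 0]) (use assms in auto)

lemma tempered_const: "tempered (\<lambda>x. c)" by (rule tempered_bounded) auto

lemma tempered_sum: "(\<And>i. i \<in> I \<Longrightarrow> tempered (f i)) \<Longrightarrow> tempered (\<lambda>x. \<Sum>i\<in>I. f i x)"
  by (induction I rule: infinite_finite_induct) (auto intro: tempered_const tempered_add)

lemma tempered_diff: "tempered f \<Longrightarrow> tempered g \<Longrightarrow> tempered (\<lambda>x. f x - g x)"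
  using tempered_add[of f "\<lambda>x. (-1) * g x"] tempered_mult[OF tempered_const[of "-1"], of g] by simp

lemma tempered_linear_form:
  fixes \<xi> :: "real ^ 'n"
  shows "tempered (\<lambda>x. complex_of_real (x \<bullet> \<xi>))"
proof (rule temperedI[of _ "norm \<xi>" 1])
  fix x :: "real ^ 'n"
  have "norm x \<le> 1 + (norm x)\<^sup>2"
  proof -
    have "2 * norm x * 1 \<le> (norm x)\<^sup>2 + 1\<^sup>2" by (rule sum_squares_bound)
    moreover have "0 \<le> norm x" by simp
    ultimately show ?thesis by (simp only: one_power2)
  qed
  then have "norm x * norm \<xi> \<le> (1 + (norm x)\<^sup>2) * norm \<xi>" by (intro mult_right_mono) auto
  then show "cmod (complex_of_real (x \<bullet> \<xi>)) \<le> norm \<xi> * (1 + (norm x)\<^sup>2) ^ 1"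
    using Cauchy_Schwarz_ineq2[of x \<xi>] by (simp add: mult.commute)
qed measurable

lemma tempered_hpoly: "hpoly m p \<Longrightarrow> tempered p"
  by (induction rule: hpoly.induct) (auto intro: tempered_const tempered_add tempered_mult tempered_linear_form)

lemma gaussian_integrable: "integrable lborel (\<lambda>x :: real ^ 'n. (1 + (norm x)\<^sup>2) ^ n * exp (- (norm x)\<^sup>2))"
proof -
  let ?G = "\<lambda>s::real. (1 + s) ^ n * exp (- s)" and ?b = "(0 + real CARD('n)) / 2"
  have "\<exists>C. \<forall>a>0. \<forall>G\<in>borel_measurable borel.
     integrable lborel (\<lambda>s. power_density ((0 + real CARD('n)) / a) s * G s) \<longrightarrow>
     has_bochner_integral lborel (\<lambda>x :: real ^ 'n. 1 * G (norm x powr a)) (C * (\<integral>s. power_density ((0 + real CARD('n)) / a) s * G s \<partial>lborel))"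
    by (rule radial_integral_nonneg[where B=1]) auto
  then obtain C where C: "\<And>a G. a > 0 \<Longrightarrow> G \<in> borel_measurable borel \<Longrightarrow>
     integrable lborel (\<lambda>s. power_density ((0 + real CARD('n)) / a) s * G s) \<Longrightarrow>
     has_bochner_integral lborel (\<lambda>x :: real ^ 'n. 1 * G (norm x powr a)) (C * (\<integral>s. power_density ((0 + real CARD('n)) / a) s * G s \<partial>lborel))"
    by blast
  have "integrable lborel (\<lambda>t. ?b * (indicator {0<..} t * (t powr (?b - 1) * exp (-t)) * poly ([:1, 1:] ^ n) t))"
    by (intro integrable_mult_right gamma_functional_integrable) simp
  then have "integrable lborel (\<lambda>s. power_density ?b s * ?G s)"
    by (simp add: power_density_def poly_power mult_ac)
  from C[OF _ _ this] have "integrable lborel (\<lambda>x :: real ^ 'n. ?G (norm x powr 2))"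
    by (auto simp: has_bochner_integral_iff)
  then show ?thesis by (simp add: powr_numeral)
qed

lemma tempered_gaussian_integrable:
  assumes "tempered f"
  shows "integrable lborel (\<lambda>x. f x * complex_of_real (exp (- (norm x)\<^sup>2)))"
proof -
  obtain C n where f: "\<And>x. cmod (f x) \<le> C * (1 + (norm x)\<^sup>2) ^ n" using tempered_bound[OF assms] by blast
  note [measurable] = tempered_measurable[OF assms]
  show ?thesis
  proof (rule Bochner_Integration.integrable_bound[OF integrable_mult_right[OF gaussian_integrable[of n], of C]])
    show "AE x in lborel. norm (f x * complex_of_real (exp (- (norm x)\<^sup>2))) \<le> norm (C * ((1 + (norm x)\<^sup>2) ^ n * exp (- (norm x)\<^sup>2)))"
    proof (rule AE_I2)
      fix x :: "real ^ 'a"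
      have "norm (f x * complex_of_real (exp (- (norm x)\<^sup>2))) = cmod (f x) * exp (- (norm x)\<^sup>2)" by (simp add: norm_mult)
      also have "\<dots> \<le> C * (1 + (norm x)\<^sup>2) ^ n * exp (- (norm x)\<^sup>2)" by (intro mult_right_mono f) auto
      finally show "norm (f x * complex_of_real (exp (- (norm x)\<^sup>2))) \<le> norm (C * ((1 + (norm x)\<^sup>2) ^ n * exp (- (norm x)\<^sup>2)))"
        by (simp add: mult.assoc)
    qed
  qed measurable
qed

section \<open>Root systems and their weights\<close>

locale dunkl_data =
  fixes R P :: "(real ^ 'n) set" and k :: "real ^ 'n \<Rightarrow> real"
  assumes root_system: "reduced_root_system R"
    and positive: "positive_subsystem R P"
    and mult: "multiplicity_function R k"
    and k_nonneg: "\<forall>\<alpha>\<in>R. 0 \<le> k \<alpha>"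
begin

lemma finite_R: "finite R" and zero_notin_R: "0 \<notin> R"
  using root_system by (auto simp: reduced_root_system_def)

lemma P_subset: "P \<subseteq> R" using positive by (auto simp: positive_subsystem_def)

lemma zero_notin_P: "0 \<notin> P" and finite_P: "finite P"
  using P_subset zero_notin_R finite_R finite_subset by auto

lemma reflection_R: "\<alpha> \<in> R \<Longrightarrow> root_reflection \<alpha> ` R = R"
  using root_system by (auto simp: reduced_root_system_def)

lemma neg_R: "\<alpha> \<in> R \<Longrightarrow> - \<alpha> \<in> R"
proof -
  assume "\<alpha> \<in> R"
  then have "R \<inter> range (\<lambda>c. c *\<^sub>R \<alpha>) = {\<alpha>, - \<alpha>}" using root_system unfolding reduced_root_system_def by blast
  then show "- \<alpha> \<in> R" by blast
qed

lemma k_reflection: "\<alpha> \<in> R \<Longrightarrow> \<beta> \<in> R \<Longrightarrow> k (root_reflection \<alpha> \<beta>) = k \<beta>"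
  using mult coxeter_group.step[OF _ coxeter_group.one, of \<alpha> R] by (auto simp: multiplicity_function_def)

lemma k_neg: "\<alpha> \<in> R \<Longrightarrow> k (- \<alpha>) = k \<alpha>"
proof -
  assume a: "\<alpha> \<in> R"
  then have "\<alpha> \<noteq> 0" using zero_notin_R by auto
  then have "root_reflection \<alpha> \<alpha> = - \<alpha>"
    by (simp add: root_reflection_def power2_norm_eq_inner scaleR_2 flip: scaleR_minus_left)
  then show "k (- \<alpha>) = k \<alpha>" using k_reflection[OF a a] by simp
qed

lemma sum_R: "(\<Sum>\<alpha>\<in>R. g \<alpha>) = (\<Sum>\<alpha>\<in>P. g \<alpha> + g (- \<alpha>))" for g :: "real ^ 'n \<Rightarrow> 'b::comm_monoid_add"
proof -
  obtain v where v: "\<And>\<alpha>. \<alpha> \<in> R \<Longrightarrow> \<alpha> \<bullet> v \<noteq> 0" "P = {\<alpha> \<in> R. \<alpha> \<bullet> v > 0}"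
    using positive by (auto simp: positive_subsystem_def)
  have R: "R = P \<union> uminus ` P"
  proof (intro set_eqI iffI)
    fix \<alpha> assume a: "\<alpha> \<in> R"
    show "\<alpha> \<in> P \<union> uminus ` P"
    proof (cases "\<alpha> \<bullet> v > 0")
      case False
      then have "- \<alpha> \<in> P" using v(1)[OF a] neg_R[OF a] by (auto simp: v(2))
      then show ?thesis by (metis UnI2 image_eqI minus_minus)
    qed (use a v in auto)
  qed (use v neg_R in auto)
  have disj: "P \<inter> uminus ` P = {}" using v by auto
  have "(\<Sum>\<alpha>\<in>R. g \<alpha>) = (\<Sum>\<alpha>\<in>P. g \<alpha>) + (\<Sum>\<alpha>\<in>uminus ` P. g \<alpha>)"
    by (subst R, rule sum.union_disjoint) (auto simp: finite_P disj)
  also have "(\<Sum>\<alpha>\<in>uminus ` P. g \<alpha>) = (\<Sum>\<alpha>\<in>P. g (- \<alpha>))" by (subst sum.reindex) auto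
  finally show ?thesis by (simp add: sum.distrib)
qed

abbreviation K :: real where "K \<equiv> mult_index P k"

lemma K_nonneg: "0 \<le> K"
  unfolding mult_index_def using k_nonneg P_subset by (auto intro!: sum_nonneg)

lemma sum_k: "(\<Sum>\<alpha>\<in>R. k \<alpha>) = 2 * K"
  unfolding sum_R mult_index_def sum_distrib_left using k_neg P_subset by (intro sum.cong) auto

lemma bij_reflection: "\<beta> \<in> R \<Longrightarrow> bij_betw (root_reflection \<beta>) R R"
  unfolding bij_betw_def using reflection_R by (auto intro: inj_on_inverseI[of _ "root_reflection \<beta>"])

definition weight :: "real ^ 'n \<Rightarrow> real" where
  "weight x = (\<Prod>\<alpha>\<in>R. \<bar>\<alpha> \<bullet> x\<bar> powr k \<alpha>)"

lemma weight_measurable [measurable]: "weight \<in> borel_measurable borel"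
  unfolding weight_def by measurable

lemma weight_nonneg: "0 \<le> weight x" unfolding weight_def by (intro prod_nonneg) auto

lemma weight_scale: "c > 0 \<Longrightarrow> weight (c *\<^sub>R x) = c powr (2 * K) * weight x"
proof -
  assume c: "c > 0"
  have "weight (c *\<^sub>R x) = (\<Prod>\<alpha>\<in>R. c powr k \<alpha> * \<bar>\<alpha> \<bullet> x\<bar> powr k \<alpha>)"
    unfolding weight_def using c by (intro prod.cong) (auto simp: abs_mult powr_mult)
  also have "\<dots> = c powr (\<Sum>\<alpha>\<in>R. k \<alpha>) * weight x"
    using c by (simp add: prod.distrib weight_def powr_sum finite_R)
  finally show ?thesis by (simp add: sum_k)
qed

lemma weight_minus: "weight (- x) = weight x" by (simp add: weight_def)

lemma weight_reflection: "\<beta> \<in> R \<Longrightarrow> weight (root_reflection \<beta> x) = weight x"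
proof -
  assume b: "\<beta> \<in> R"
  have "weight (root_reflection \<beta> x) = (\<Prod>\<alpha>\<in>R. \<bar>root_reflection \<beta> \<alpha> \<bullet> x\<bar> powr k (root_reflection \<beta> \<alpha>))"
    unfolding weight_def using b by (intro prod.cong) (auto simp: root_reflection_self_adjoint k_reflection)
  also have "\<dots> = weight x" unfolding weight_def
    by (rule prod.reindex_bij_betw[OF bij_reflection[OF b], of "\<lambda>\<alpha>. \<bar>\<alpha> \<bullet> x\<bar> powr k \<alpha>"])
  finally show ?thesis .
qed

text \<open>The weight with each \<open>|\<langle>\<alpha>,x\<rangle>|\<close> replaced by the square root of \<open>\<langle>\<alpha>,x\<rangle>\<^sup>2 + \<epsilon>\<close>. It is smooth and
  still invariant under the reflections, whereas the weight itself need not be differentiable on the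
  hyperplanes when some \<open>k \<alpha>\<close> is small.\<close>

definition reg_weight :: "real \<Rightarrow> real ^ 'n \<Rightarrow> real" where
  "reg_weight \<epsilon> x = exp (\<Sum>\<alpha>\<in>R. k \<alpha> / 2 * ln ((\<alpha> \<bullet> x)\<^sup>2 + \<epsilon>))"

lemma reg_weight_measurable [measurable]: "reg_weight \<epsilon> \<in> borel_measurable borel"
  unfolding reg_weight_def by measurable

lemma reg_weight_reflection: "\<beta> \<in> R \<Longrightarrow> reg_weight \<epsilon> (root_reflection \<beta> x) = reg_weight \<epsilon> x"
proof -
  assume b: "\<beta> \<in> R"
  have "(\<Sum>\<alpha>\<in>R. k \<alpha> / 2 * ln ((\<alpha> \<bullet> root_reflection \<beta> x)\<^sup>2 + \<epsilon>))
     = (\<Sum>\<alpha>\<in>R. k (root_reflection \<beta> \<alpha>) / 2 * ln ((root_reflection \<beta> \<alpha> \<bullet> x)\<^sup>2 + \<epsilon>))"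
    using b by (intro sum.cong) (auto simp: root_reflection_self_adjoint k_reflection)
  also have "\<dots> = (\<Sum>\<alpha>\<in>R. k \<alpha> / 2 * ln ((\<alpha> \<bullet> x)\<^sup>2 + \<epsilon>))"
    by (rule sum.reindex_bij_betw[OF bij_reflection[OF b], of "\<lambda>\<alpha>. k \<alpha> / 2 * ln ((\<alpha> \<bullet> x)\<^sup>2 + \<epsilon>)"])
  finally show ?thesis by (simp add: reg_weight_def)
qed

lemma reg_weight_bound: "\<exists>C n. \<forall>\<epsilon> x. 0 < \<epsilon> \<longrightarrow> \<epsilon> \<le> 1 \<longrightarrow> reg_weight \<epsilon> x \<le> C * (1 + (norm x)\<^sup>2) ^ n"
proof -
  define n where "n = nat \<lceil>K\<rceil>"
  have nK: "K \<le> real n" unfolding n_def using real_nat_ceiling_ge[of K] .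
  have "reg_weight \<epsilon> x \<le> exp (\<Sum>\<alpha>\<in>R. k \<alpha> / 2 * ln ((norm \<alpha>)\<^sup>2 + 1)) * (1 + (norm x)\<^sup>2) ^ n" if e: "0 < \<epsilon>" "\<epsilon> \<le> 1" for \<epsilon> x
  proof -
    have pos: "0 < 1 + (norm x)\<^sup>2" by (intro add_pos_nonneg) auto
    have "(\<Sum>\<alpha>\<in>R. k \<alpha> / 2 * ln ((\<alpha> \<bullet> x)\<^sup>2 + \<epsilon>)) \<le> (\<Sum>\<alpha>\<in>R. k \<alpha> / 2 * ln ((norm \<alpha>)\<^sup>2 + 1) + k \<alpha> / 2 * ln (1 + (norm x)\<^sup>2))"
    proof (rule sum_mono)
      fix \<alpha> assume a: "\<alpha> \<in> R"
      have "(\<alpha> \<bullet> x)\<^sup>2 \<le> (norm \<alpha>)\<^sup>2 * (norm x)\<^sup>2"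
        using Cauchy_Schwarz_ineq[of \<alpha> x] by (simp add: power2_norm_eq_inner)
      moreover have "((norm \<alpha>)\<^sup>2 + 1) * (1 + (norm x)\<^sup>2) = (norm \<alpha>)\<^sup>2 * (norm x)\<^sup>2 + (norm \<alpha>)\<^sup>2 + (norm x)\<^sup>2 + 1"
        by (simp add: algebra_simps)
      moreover have "0 \<le> (norm \<alpha>)\<^sup>2" "0 \<le> (norm x)\<^sup>2" by simp_all
      ultimately have "(\<alpha> \<bullet> x)\<^sup>2 + \<epsilon> \<le> ((norm \<alpha>)\<^sup>2 + 1) * (1 + (norm x)\<^sup>2)" using e by linarith
      then have "ln ((\<alpha> \<bullet> x)\<^sup>2 + \<epsilon>) \<le> ln (((norm \<alpha>)\<^sup>2 + 1) * (1 + (norm x)\<^sup>2))"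
        using e by (intro ln_mono) (auto intro: add_nonneg_pos)
      also have "\<dots> = ln ((norm \<alpha>)\<^sup>2 + 1) + ln (1 + (norm x)\<^sup>2)"
        using pos by (intro ln_mult_pos) (auto intro: add_nonneg_pos)
      finally show "k \<alpha> / 2 * ln ((\<alpha> \<bullet> x)\<^sup>2 + \<epsilon>) \<le> k \<alpha> / 2 * ln ((norm \<alpha>)\<^sup>2 + 1) + k \<alpha> / 2 * ln (1 + (norm x)\<^sup>2)"
        unfolding distrib_left[symmetric] using k_nonneg a by (intro mult_left_mono) auto
    qed
    also have "\<dots> = (\<Sum>\<alpha>\<in>R. k \<alpha> / 2 * ln ((norm \<alpha>)\<^sup>2 + 1)) + K * ln (1 + (norm x)\<^sup>2)"
      by (simp add: sum.distrib sum_distrib_right[symmetric] sum_divide_distrib[symmetric] sum_k)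
    also have "\<dots> \<le> (\<Sum>\<alpha>\<in>R. k \<alpha> / 2 * ln ((norm \<alpha>)\<^sup>2 + 1)) + real n * ln (1 + (norm x)\<^sup>2)"
      by (intro add_left_mono mult_right_mono nK) simp
    finally have "reg_weight \<epsilon> x \<le> exp ((\<Sum>\<alpha>\<in>R. k \<alpha> / 2 * ln ((norm \<alpha>)\<^sup>2 + 1)) + real n * ln (1 + (norm x)\<^sup>2))"
      by (simp add: reg_weight_def)
    also have "\<dots> = exp (\<Sum>\<alpha>\<in>R. k \<alpha> / 2 * ln ((norm \<alpha>)\<^sup>2 + 1)) * (1 + (norm x)\<^sup>2) ^ n"
      using pos by (simp add: exp_add exp_of_nat_mult)
    finally show ?thesis .
  qed
  then show ?thesis by blast
qed

lemma weight_le_reg: "weight x \<le> reg_weight 1 x"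
proof -
  have "weight x \<le> (\<Prod>\<alpha>\<in>R. exp (k \<alpha> / 2 * ln ((\<alpha> \<bullet> x)\<^sup>2 + 1)))"
    unfolding weight_def
  proof (rule prod_mono, rule conjI)
    fix \<alpha> assume a: "\<alpha> \<in> R"
    show "\<bar>\<alpha> \<bullet> x\<bar> powr k \<alpha> \<le> exp (k \<alpha> / 2 * ln ((\<alpha> \<bullet> x)\<^sup>2 + 1))"
    proof (cases "\<alpha> \<bullet> x = 0")
      case False
      have "2 * ln \<bar>\<alpha> \<bullet> x\<bar> = ln ((\<alpha> \<bullet> x)\<^sup>2)"
        using False ln_realpow[of "\<bar>\<alpha> \<bullet> x\<bar>" 2] by simp
      also have "\<dots> \<le> ln ((\<alpha> \<bullet> x)\<^sup>2 + 1)" using False by (intro ln_mono) auto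
      finally have "k \<alpha> * ln \<bar>\<alpha> \<bullet> x\<bar> \<le> k \<alpha> / 2 * ln ((\<alpha> \<bullet> x)\<^sup>2 + 1)"
        using mult_left_mono[of "2 * ln \<bar>\<alpha> \<bullet> x\<bar>" "ln ((\<alpha> \<bullet> x)\<^sup>2 + 1)" "k \<alpha> / 2"] k_nonneg a by simp
      then show ?thesis using False by (simp add: powr_def)
    qed simp
  qed simp
  then show ?thesis by (simp add: reg_weight_def exp_sum finite_R)
qed

lemma tempered_weight: "tempered (\<lambda>x. complex_of_real (weight x))"
proof -
  obtain C n where "\<And>\<epsilon> x. 0 < \<epsilon> \<Longrightarrow> \<epsilon> \<le> 1 \<Longrightarrow> reg_weight \<epsilon> x \<le> C * (1 + (norm x)\<^sup>2) ^ n" using reg_weight_bound by blast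
  from order_trans[OF weight_le_reg this[of 1]] show ?thesis
    by (intro temperedI[where C=C and n=n]) (auto simp: weight_nonneg)
qed

lemma tempered_reg_weight: "0 < \<epsilon> \<Longrightarrow> \<epsilon> \<le> 1 \<Longrightarrow> tempered (\<lambda>x. complex_of_real (reg_weight \<epsilon> x))"
proof -
  assume e: "0 < \<epsilon>" "\<epsilon> \<le> 1"
  obtain C n where "\<And>\<epsilon> x. 0 < \<epsilon> \<Longrightarrow> \<epsilon> \<le> 1 \<Longrightarrow> reg_weight \<epsilon> x \<le> C * (1 + (norm x)\<^sup>2) ^ n" using reg_weight_bound by blast
  from this[OF e] show ?thesis
    by (intro temperedI[where C=C and n=n]) (auto simp: reg_weight_def)
qed

lemma AE_regular: "AE x in lborel. \<forall>\<alpha>\<in>R. \<alpha> \<bullet> x \<noteq> 0"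
proof (rule AE_ball_countable'[OF _ countable_finite[OF finite_R]])
  fix \<alpha> assume "\<alpha> \<in> R"
  then have "\<alpha> \<noteq> 0" using zero_notin_R by auto
  then show "AE x in lborel. \<alpha> \<bullet> x \<noteq> 0" by (rule AE_inner_nonzero)
qed

lemma reg_weight_tendsto:
  assumes x: "\<forall>\<alpha>\<in>R. \<alpha> \<bullet> x \<noteq> 0" and e: "e \<longlonglongrightarrow> 0"
  shows "(\<lambda>n. reg_weight (e n) x) \<longlonglongrightarrow> weight x"
proof -
  have "(\<lambda>n. reg_weight (e n) x) \<longlonglongrightarrow> exp (\<Sum>\<alpha>\<in>R. k \<alpha> / 2 * ln ((\<alpha> \<bullet> x)\<^sup>2 + 0))"
    unfolding reg_weight_def by (intro tendsto_intros e) (use x in auto)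
  also have "exp (\<Sum>\<alpha>\<in>R. k \<alpha> / 2 * ln ((\<alpha> \<bullet> x)\<^sup>2 + 0)) = (\<Prod>\<alpha>\<in>R. exp (k \<alpha> / 2 * ln ((\<alpha> \<bullet> x)\<^sup>2)))"
    by (simp add: exp_sum finite_R)
  also have "\<dots> = weight x" unfolding weight_def
  proof (rule prod.cong[OF refl])
    fix \<alpha> assume "\<alpha> \<in> R"
    then have a: "\<alpha> \<bullet> x \<noteq> 0" using x by auto
    then have "ln ((\<alpha> \<bullet> x)\<^sup>2) = 2 * ln \<bar>\<alpha> \<bullet> x\<bar>" using ln_realpow[of "\<bar>\<alpha> \<bullet> x\<bar>" 2] by simp
    then show "exp (k \<alpha> / 2 * ln ((\<alpha> \<bullet> x)\<^sup>2)) = \<bar>\<alpha> \<bullet> x\<bar> powr k \<alpha>" using a by (simp add: powr_def)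
  qed
  finally show ?thesis .
qed

lemma reg_weight_derivative:
  assumes "\<epsilon> > 0"
  shows "((\<lambda>t. reg_weight \<epsilon> (x + t *\<^sub>R \<xi>)) has_real_derivative
     reg_weight \<epsilon> x * (\<Sum>\<alpha>\<in>R. k \<alpha> * (\<alpha> \<bullet> \<xi>) * ((\<alpha> \<bullet> x) / ((\<alpha> \<bullet> x)\<^sup>2 + \<epsilon>)))) (at 0)"
proof -
  have 1: "((\<lambda>t. k \<alpha> / 2 * ln ((\<alpha> \<bullet> (x + t *\<^sub>R \<xi>))\<^sup>2 + \<epsilon>)) has_real_derivative
      k \<alpha> * (\<alpha> \<bullet> \<xi>) * ((\<alpha> \<bullet> x) / ((\<alpha> \<bullet> x)\<^sup>2 + \<epsilon>))) (at 0)" for \<alpha>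
  proof -
    have p: "0 < (\<alpha> \<bullet> x)\<^sup>2 + \<epsilon>" using assms by (simp add: add_nonneg_pos)
    have q: "((\<lambda>t. (\<alpha> \<bullet> x + t * (\<alpha> \<bullet> \<xi>))\<^sup>2 + \<epsilon>) has_real_derivative 2 * (\<alpha> \<bullet> x) * (\<alpha> \<bullet> \<xi>)) (at 0)"
      by (auto intro!: derivative_eq_intros)
    have "((\<lambda>t. ln ((\<alpha> \<bullet> x + t * (\<alpha> \<bullet> \<xi>))\<^sup>2 + \<epsilon>)) has_real_derivative
        1 / ((\<alpha> \<bullet> x + 0 * (\<alpha> \<bullet> \<xi>))\<^sup>2 + \<epsilon>) * (2 * (\<alpha> \<bullet> x) * (\<alpha> \<bullet> \<xi>))) (at 0)"
      by (rule DERIV_chain2[OF DERIV_ln_divide q]) (use p in simp)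
    from DERIV_cmult[OF this, of "k \<alpha> / 2"]
    have "((\<lambda>t. k \<alpha> / 2 * ln ((\<alpha> \<bullet> x + t * (\<alpha> \<bullet> \<xi>))\<^sup>2 + \<epsilon>)) has_real_derivative
        k \<alpha> / 2 * (1 / ((\<alpha> \<bullet> x + 0 * (\<alpha> \<bullet> \<xi>))\<^sup>2 + \<epsilon>) * (2 * (\<alpha> \<bullet> x) * (\<alpha> \<bullet> \<xi>)))) (at 0)" .
    moreover have "k \<alpha> / 2 * (1 / ((\<alpha> \<bullet> x + 0 * (\<alpha> \<bullet> \<xi>))\<^sup>2 + \<epsilon>) * (2 * (\<alpha> \<bullet> x) * (\<alpha> \<bullet> \<xi>)))
        = k \<alpha> * (\<alpha> \<bullet> \<xi>) * ((\<alpha> \<bullet> x) / ((\<alpha> \<bullet> x)\<^sup>2 + \<epsilon>))" by simp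
    ultimately show ?thesis unfolding inner_add_right inner_scaleR_right by (simp only:)
  qed
  have "((\<lambda>t. \<Sum>\<alpha>\<in>R. k \<alpha> / 2 * ln ((\<alpha> \<bullet> (x + t *\<^sub>R \<xi>))\<^sup>2 + \<epsilon>)) has_real_derivative
      (\<Sum>\<alpha>\<in>R. k \<alpha> * (\<alpha> \<bullet> \<xi>) * ((\<alpha> \<bullet> x) / ((\<alpha> \<bullet> x)\<^sup>2 + \<epsilon>)))) (at 0)"
    by (intro DERIV_sum 1)
  from DERIV_fun_exp[OF this] show ?thesis by (simp add: reg_weight_def)
qed

section \<open>Gaussian integration by parts for Dunkl operators\<close>

definition gauss :: "(real ^ 'n \<Rightarrow> real) \<Rightarrow> real ^ 'n \<Rightarrow> complex" where
  "gauss v x = complex_of_real (v x) * complex_of_real (exp (- (norm x)\<^sup>2))"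

lemma gauss_integrable:
  assumes "tempered (\<lambda>x. complex_of_real (v x))" "tempered f"
  shows "integrable lborel (\<lambda>x. f x * gauss v x)"
  using tempered_gaussian_integrable[OF tempered_mult[OF assms(2,1)]]
  by (simp add: gauss_def mult.assoc)

text \<open>A smoothed version of \<open>1/\<langle>\<alpha>,x\<rangle>\<close>, odd under the reflection in \<open>\<alpha>\<close>. The logarithmic derivatives of
  the smoothed weight are combinations of these kernels.\<close>

definition odd_kernel :: "real \<Rightarrow> real ^ 'n \<Rightarrow> real ^ 'n \<Rightarrow> real" where
  "odd_kernel \<epsilon> \<alpha> x = (\<alpha> \<bullet> x) / ((\<alpha> \<bullet> x)\<^sup>2 + \<epsilon>)"

lemma tempered_odd_kernel:
  assumes e: "\<epsilon> > 0"
  shows "tempered (\<lambda>x. complex_of_real (odd_kernel \<epsilon> \<alpha> x))"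
proof -
  have "tempered (\<lambda>x. complex_of_real (1 / ((\<alpha> \<bullet> x)\<^sup>2 + \<epsilon>)))"
  proof (rule tempered_bounded)
    fix x
    have "1 / ((\<alpha> \<bullet> x)\<^sup>2 + \<epsilon>) \<le> 1 / \<epsilon>" using e by (intro divide_left_mono) (auto intro!: mult_pos_pos add_nonneg_pos)
    then show "cmod (complex_of_real (1 / ((\<alpha> \<bullet> x)\<^sup>2 + \<epsilon>))) \<le> 1 / \<epsilon>"
      using e by (simp only: norm_of_real) (simp add: add_nonneg_pos)
  qed measurable
  from tempered_mult[OF tempered_linear_form[of \<alpha>] this] show ?thesis
    by (simp add: odd_kernel_def inner_commute)
qed

lemma gaussian_by_parts_reg:
  assumes F: "hpoly m F" and e: "0 < \<epsilon>" "\<epsilon> \<le> 1"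
  shows "(\<integral>x. (dir_deriv \<xi> F x - 2 * (complex_of_real (x \<bullet> \<xi>) * F x)
      + (\<Sum>\<alpha>\<in>R. complex_of_real (k \<alpha> * (\<alpha> \<bullet> \<xi>)) * (F x * complex_of_real (odd_kernel \<epsilon> \<alpha> x)))) * gauss (reg_weight \<epsilon>) x \<partial>lborel) = 0"
proof (rule integral_derivative_zero[where F="\<lambda>x. F x * gauss (reg_weight \<epsilon>) x" and \<xi>=\<xi>])
  have dd: "hpoly (m - 1) (dir_deriv \<xi> F)" by (rule lower_hpoly[OF hpoly_dir_deriv[OF F]])
  have pos: "0 < (\<alpha> \<bullet> x)\<^sup>2 + \<epsilon>" for \<alpha> x :: "real ^ 'n" using e by (simp add: add_nonneg_pos)
  show "((\<lambda>t. F (x + t *\<^sub>R \<xi>) * gauss (reg_weight \<epsilon>) (x + t *\<^sub>R \<xi>)) has_vector_derivative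
     (dir_deriv \<xi> F x - 2 * (complex_of_real (x \<bullet> \<xi>) * F x)
      + (\<Sum>\<alpha>\<in>R. complex_of_real (k \<alpha> * (\<alpha> \<bullet> \<xi>)) * (F x * complex_of_real (odd_kernel \<epsilon> \<alpha> x)))) * gauss (reg_weight \<epsilon>) x) (at 0)" for x
  proof -
    have g: "((\<lambda>t. x + t *\<^sub>R \<xi>) has_derivative (\<lambda>t. t *\<^sub>R \<xi>)) (at (0::real))"
      by (auto intro!: derivative_eq_intros)
    have Fd: "(F has_derivative (\<lambda>\<eta>. dir_deriv \<eta> F x)) (at x)"
      by (rule dir_deriv_has_derivative[OF hpoly_differentiable[OF F]])
    have "((\<lambda>t. F (x + t *\<^sub>R \<xi>)) has_derivative (\<lambda>t. dir_deriv (t *\<^sub>R \<xi>) F x)) (at 0)"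
      by (rule has_derivative_compose[OF g]) (use Fd in simp)
    then have 1: "((\<lambda>t. F (x + t *\<^sub>R \<xi>)) has_vector_derivative dir_deriv \<xi> F x) (at 0)"
      using linear_cmul[OF has_derivative_linear[OF Fd]] by (simp add: has_vector_derivative_def)
    let ?L = "\<Sum>\<alpha>\<in>R. k \<alpha> * (\<alpha> \<bullet> \<xi>) * odd_kernel \<epsilon> \<alpha> x"
    have n: "((\<lambda>t. exp (- (norm (x + t *\<^sub>R \<xi>))\<^sup>2)) has_real_derivative exp (- (norm x)\<^sup>2) * (- 2 * (x \<bullet> \<xi>))) (at 0)"
      unfolding power2_norm_eq_inner inner_add_left inner_add_right inner_scaleR_left inner_scaleR_right
      by (auto intro!: derivative_eq_intros simp: inner_commute)
    have "((\<lambda>t. reg_weight \<epsilon> (x + t *\<^sub>R \<xi>) * exp (- (norm (x + t *\<^sub>R \<xi>))\<^sup>2)) has_real_derivative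
       (reg_weight \<epsilon> x * ?L) * exp (- (norm (x + 0 *\<^sub>R \<xi>))\<^sup>2) + (exp (- (norm x)\<^sup>2) * (- 2 * (x \<bullet> \<xi>))) * reg_weight \<epsilon> (x + 0 *\<^sub>R \<xi>)) (at 0)"
      unfolding odd_kernel_def by (rule DERIV_mult[OF reg_weight_derivative[OF e(1)] n])
    then have "((\<lambda>t. complex_of_real (reg_weight \<epsilon> (x + t *\<^sub>R \<xi>) * exp (- (norm (x + t *\<^sub>R \<xi>))\<^sup>2))) has_vector_derivative
       complex_of_real ((reg_weight \<epsilon> x * ?L) * exp (- (norm (x + 0 *\<^sub>R \<xi>))\<^sup>2) + (exp (- (norm x)\<^sup>2) * (- 2 * (x \<bullet> \<xi>))) * reg_weight \<epsilon> (x + 0 *\<^sub>R \<xi>))) (at 0)"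
      by (rule has_vector_derivative_of_real)
    from has_vector_derivative_mult[OF 1 this]
    have d: "((\<lambda>t. F (x + t *\<^sub>R \<xi>) * gauss (reg_weight \<epsilon>) (x + t *\<^sub>R \<xi>)) has_vector_derivative
      F x * complex_of_real ((reg_weight \<epsilon> x * ?L) * exp (- (norm x)\<^sup>2) + (exp (- (norm x)\<^sup>2) * (- 2 * (x \<bullet> \<xi>))) * reg_weight \<epsilon> x)
       + dir_deriv \<xi> F x * gauss (reg_weight \<epsilon>) x) (at 0)"
      by (simp add: gauss_def)
    have "F x * complex_of_real ((reg_weight \<epsilon> x * ?L) * exp (- (norm x)\<^sup>2) + (exp (- (norm x)\<^sup>2) * (- 2 * (x \<bullet> \<xi>))) * reg_weight \<epsilon> x)
       + dir_deriv \<xi> F x * gauss (reg_weight \<epsilon>) x =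
      (dir_deriv \<xi> F x - 2 * (complex_of_real (x \<bullet> \<xi>) * F x) + F x * complex_of_real ?L) * gauss (reg_weight \<epsilon>) x"
      by (simp add: gauss_def algebra_simps del: of_real_sum)
    also have "F x * complex_of_real ?L = (\<Sum>\<alpha>\<in>R. complex_of_real (k \<alpha> * (\<alpha> \<bullet> \<xi>)) * (F x * complex_of_real (odd_kernel \<epsilon> \<alpha> x)))"
      unfolding of_real_sum sum_distrib_left by (simp add: mult_ac)
    finally show ?thesis using d by simp
  qed
  show "continuous_on UNIV (\<lambda>x. (dir_deriv \<xi> F x - 2 * (complex_of_real (x \<bullet> \<xi>) * F x)
      + (\<Sum>\<alpha>\<in>R. complex_of_real (k \<alpha> * (\<alpha> \<bullet> \<xi>)) * (F x * complex_of_real (odd_kernel \<epsilon> \<alpha> x)))) * gauss (reg_weight \<epsilon>) x)"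
    unfolding gauss_def odd_kernel_def reg_weight_def
    by (intro continuous_intros hpoly_continuous[OF F] hpoly_continuous[OF dd]) (use pos in \<open>auto simp: less_imp_neq[symmetric]\<close>)
  have tF: "tempered F" by (rule tempered_hpoly[OF F])
  show "integrable lborel (\<lambda>x. F x * gauss (reg_weight \<epsilon>) x)"
    by (intro gauss_integrable tempered_reg_weight e tF)
  show "(\<lambda>x. F x * gauss (reg_weight \<epsilon>) x) \<in> borel_measurable borel"
    using hpoly_measurable[OF F] unfolding gauss_def by measurable
  show "integrable lborel (\<lambda>x. (dir_deriv \<xi> F x - 2 * (complex_of_real (x \<bullet> \<xi>) * F x)
      + (\<Sum>\<alpha>\<in>R. complex_of_real (k \<alpha> * (\<alpha> \<bullet> \<xi>)) * (F x * complex_of_real (odd_kernel \<epsilon> \<alpha> x)))) * gauss (reg_weight \<epsilon>) x)"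
    by (intro gauss_integrable tempered_reg_weight e tempered_add tempered_diff tempered_sum tempered_mult tempered_const
        tempered_linear_form tempered_odd_kernel tF tempered_hpoly[OF dd])
qed

text \<open>Symmetrising by the reflection turns the odd kernel into a difference quotient.\<close>

lemma reflect_odd:
  assumes a: "\<alpha> \<in> R" and F: "hpoly m F" and e: "0 < \<epsilon>" "\<epsilon> \<le> 1"
  shows "(\<integral>x. 2 * (F x * complex_of_real (odd_kernel \<epsilon> \<alpha> x)) * gauss (reg_weight \<epsilon>) x \<partial>lborel) =
     (\<integral>x. reflection_quotient \<alpha> F x * complex_of_real ((\<alpha> \<bullet> x) * odd_kernel \<epsilon> \<alpha> x) * gauss (reg_weight \<epsilon>) x \<partial>lborel)"
proof -
  let ?u = "\<lambda>x. F x * complex_of_real (odd_kernel \<epsilon> \<alpha> x) * gauss (reg_weight \<epsilon>) x"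
  have tF: "tempered F" by (rule tempered_hpoly[OF F])
  have ui: "integrable lborel ?u"
    by (intro gauss_integrable tempered_reg_weight e tempered_mult tempered_odd_kernel tF)
  have um: "?u \<in> borel_measurable borel" using ui by (simp add: integrable_iff_bounded)
  have "(\<integral>x. ?u x \<partial>lborel) + (\<integral>x. ?u x \<partial>lborel) = (\<integral>x. ?u x \<partial>lborel) + (\<integral>x. ?u (root_reflection \<alpha> x) \<partial>lborel)"
    by (simp only: integral_root_reflection[OF um])
  also have "\<dots> = (\<integral>x. ?u x + ?u (root_reflection \<alpha> x) \<partial>lborel)"
    by (rule Bochner_Integration.integral_add[symmetric]) (intro ui integrable_root_reflection um)+
  also have "\<dots> = (\<integral>x. reflection_quotient \<alpha> F x * complex_of_real ((\<alpha> \<bullet> x) * odd_kernel \<epsilon> \<alpha> x) * gauss (reg_weight \<epsilon>) x \<partial>lborel)"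
  proof (rule Bochner_Integration.integral_cong[OF refl])
    fix x
    have "odd_kernel \<epsilon> \<alpha> (root_reflection \<alpha> x) = - odd_kernel \<epsilon> \<alpha> x"
      by (simp add: odd_kernel_def root_reflection_inner)
    moreover have "gauss (reg_weight \<epsilon>) (root_reflection \<alpha> x) = gauss (reg_weight \<epsilon>) x"
      by (simp add: gauss_def reg_weight_reflection[OF a])
    ultimately have "?u x + ?u (root_reflection \<alpha> x) = (F x - F (root_reflection \<alpha> x)) * complex_of_real (odd_kernel \<epsilon> \<alpha> x) * gauss (reg_weight \<epsilon>) x"
      by (simp add: algebra_simps)
    then show "?u x + ?u (root_reflection \<alpha> x) = reflection_quotient \<alpha> F x * complex_of_real ((\<alpha> \<bullet> x) * odd_kernel \<epsilon> \<alpha> x) * gauss (reg_weight \<epsilon>) x"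
      unfolding reflection_quotient_times[symmetric] by (simp add: mult_ac)
  qed
  finally show ?thesis by (simp add: mult.assoc)
qed

text \<open>The derivative of the smoothed weight contributes one term for each root, and the roots \<open>\<alpha>\<close> and
  \<open>-\<alpha>\<close> contribute equally. By \<open>reflect_odd\<close> these terms become the reflection part of the Dunkl
  operator, smoothed by a factor that tends to \<open>1\<close>.\<close>

lemma gaussian_dunkl_reg:
  assumes F: "hpoly m F" and e: "0 < \<epsilon>" "\<epsilon> \<le> 1"
  shows "(\<integral>x. (dir_deriv \<xi> F x - 2 * (complex_of_real (x \<bullet> \<xi>) * F x)
      + (\<Sum>\<alpha>\<in>P. complex_of_real (k \<alpha> * (\<alpha> \<bullet> \<xi>)) * (reflection_quotient \<alpha> F x * complex_of_real ((\<alpha> \<bullet> x) * odd_kernel \<epsilon> \<alpha> x)))) * gauss (reg_weight \<epsilon>) x \<partial>lborel) = 0"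
proof -
  let ?g = "gauss (reg_weight \<epsilon>)"
  have tF: "tempered F" by (rule tempered_hpoly[OF F])
  have dd: "tempered (dir_deriv \<xi> F)" by (rule tempered_hpoly[OF lower_hpoly[OF hpoly_dir_deriv[OF F]]])
  have tQ: "tempered (reflection_quotient \<alpha> F)" for \<alpha> by (rule tempered_hpoly[OF lower_hpoly[OF hpoly_reflection_quotient[OF F]]])
  have tK: "tempered (\<lambda>x. complex_of_real ((\<alpha> \<bullet> x) * odd_kernel \<epsilon> \<alpha> x))" for \<alpha>
    using tempered_mult[OF tempered_linear_form[of \<alpha>] tempered_odd_kernel[OF e(1), of \<alpha>]] by (simp add: inner_commute)
  note gi = gauss_integrable[OF tempered_reg_weight[OF e]]
  let ?A = "\<lambda>x. dir_deriv \<xi> F x - 2 * (complex_of_real (x \<bullet> \<xi>) * F x)"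
  have tA: "tempered ?A" by (intro tempered_diff tempered_mult tempered_const tempered_linear_form tF dd)
  have sumR: "(\<Sum>\<alpha>\<in>R. complex_of_real (k \<alpha> * (\<alpha> \<bullet> \<xi>)) * (F x * complex_of_real (odd_kernel \<epsilon> \<alpha> x)))
     = (\<Sum>\<alpha>\<in>P. complex_of_real (k \<alpha> * (\<alpha> \<bullet> \<xi>)) * (2 * (F x * complex_of_real (odd_kernel \<epsilon> \<alpha> x))))" for x
    unfolding sum_R using k_neg P_subset
    by (intro sum.cong) (auto simp: odd_kernel_def)
  have sumint: "(\<integral>x. (?A x + (\<Sum>\<alpha>\<in>P. complex_of_real (k \<alpha> * (\<alpha> \<bullet> \<xi>)) * f \<alpha> x)) * ?g x \<partial>lborel)
     = (\<integral>x. ?A x * ?g x \<partial>lborel) + (\<Sum>\<alpha>\<in>P. complex_of_real (k \<alpha> * (\<alpha> \<bullet> \<xi>)) * (\<integral>x. f \<alpha> x * ?g x \<partial>lborel))"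
    if f: "\<And>\<alpha>. tempered (f \<alpha>)" for f
  proof -
    have "(\<integral>x. (?A x + (\<Sum>\<alpha>\<in>P. complex_of_real (k \<alpha> * (\<alpha> \<bullet> \<xi>)) * f \<alpha> x)) * ?g x \<partial>lborel)
       = (\<integral>x. ?A x * ?g x + (\<Sum>\<alpha>\<in>P. complex_of_real (k \<alpha> * (\<alpha> \<bullet> \<xi>)) * (f \<alpha> x * ?g x)) \<partial>lborel)"
      by (simp only: distrib_right sum_distrib_right mult.assoc)
    also have "\<dots> = (\<integral>x. ?A x * ?g x \<partial>lborel) + (\<integral>x. (\<Sum>\<alpha>\<in>P. complex_of_real (k \<alpha> * (\<alpha> \<bullet> \<xi>)) * (f \<alpha> x * ?g x)) \<partial>lborel)"
      by (intro Bochner_Integration.integral_add gi tA Bochner_Integration.integrable_sum integrable_mult_right f)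
    also have "(\<integral>x. (\<Sum>\<alpha>\<in>P. complex_of_real (k \<alpha> * (\<alpha> \<bullet> \<xi>)) * (f \<alpha> x * ?g x)) \<partial>lborel)
       = (\<Sum>\<alpha>\<in>P. \<integral>x. complex_of_real (k \<alpha> * (\<alpha> \<bullet> \<xi>)) * (f \<alpha> x * ?g x) \<partial>lborel)"
      by (intro Bochner_Integration.integral_sum integrable_mult_right gi f)
    finally show ?thesis by simp
  qed
  have t1: "tempered (\<lambda>x. 2 * (F x * complex_of_real (odd_kernel \<epsilon> \<alpha> x)))" for \<alpha>
    by (intro tempered_mult tempered_const tF tempered_odd_kernel e)
  have t2: "tempered (\<lambda>x. reflection_quotient \<alpha> F x * complex_of_real ((\<alpha> \<bullet> x) * odd_kernel \<epsilon> \<alpha> x))" for \<alpha>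
    by (intro tempered_mult tQ tK)
  have "(\<Sum>\<alpha>\<in>P. complex_of_real (k \<alpha> * (\<alpha> \<bullet> \<xi>)) * (\<integral>x. reflection_quotient \<alpha> F x * complex_of_real ((\<alpha> \<bullet> x) * odd_kernel \<epsilon> \<alpha> x) * ?g x \<partial>lborel))
     = (\<Sum>\<alpha>\<in>P. complex_of_real (k \<alpha> * (\<alpha> \<bullet> \<xi>)) * (\<integral>x. 2 * (F x * complex_of_real (odd_kernel \<epsilon> \<alpha> x)) * ?g x \<partial>lborel))"
    by (intro sum.cong refl arg_cong2[of _ _ _ _ "(*)"] reflect_odd[symmetric, OF _ F e]) (use P_subset in auto)
  then show ?thesis
    using gaussian_by_parts_reg[OF F e, of \<xi>] unfolding sumR sumint[OF t1] sumint[OF t2] by simp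
qed

text \<open>The limit \<open>\<epsilon> \<rightarrow> 0\<close> of \<open>gaussian_dunkl_reg\<close>. The majorant comes from the bound on the
  smoothed weights that is uniform in \<open>\<epsilon>\<close>.\<close>

theorem gaussian_dunkl:
  assumes F: "hpoly m F"
  shows "(\<integral>x. (dunkl_op P k \<xi> F x - 2 * (complex_of_real (x \<bullet> \<xi>) * F x)) * gauss weight x \<partial>lborel) = 0"
proof -
  let ?A = "\<lambda>x. dir_deriv \<xi> F x - 2 * (complex_of_real (x \<bullet> \<xi>) * F x)"
  let ?c = "\<lambda>\<alpha>. complex_of_real (k \<alpha> * (\<alpha> \<bullet> \<xi>))"
  define e where "e n = inverse (real (Suc n))" for n
  have e: "0 < e n" "e n \<le> 1" for n by (auto simp: e_def inverse_le_1_iff)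
  have elim: "e \<longlonglongrightarrow> 0" unfolding e_def by (rule LIMSEQ_inverse_real_of_nat)
  let ?s = "\<lambda>n x. (?A x + (\<Sum>\<alpha>\<in>P. ?c \<alpha> * (reflection_quotient \<alpha> F x * complex_of_real ((\<alpha> \<bullet> x) * odd_kernel (e n) \<alpha> x)))) * gauss (reg_weight (e n)) x"
  let ?l = "\<lambda>x. (?A x + (\<Sum>\<alpha>\<in>P. ?c \<alpha> * (reflection_quotient \<alpha> F x * complex_of_real 1))) * gauss weight x"
  have tF: "tempered F" by (rule tempered_hpoly[OF F])
  have dd: "tempered (dir_deriv \<xi> F)" by (rule tempered_hpoly[OF lower_hpoly[OF hpoly_dir_deriv[OF F]]])
  have tQ: "tempered (reflection_quotient \<alpha> F)" for \<alpha> by (rule tempered_hpoly[OF lower_hpoly[OF hpoly_reflection_quotient[OF F]]])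
  have tA: "tempered ?A" by (intro tempered_diff tempered_mult tempered_const tempered_linear_form tF dd)
  note [measurable] = tA[THEN tempered_measurable] tQ[THEN tempered_measurable]
  obtain C n where C: "\<And>\<epsilon> x. 0 < \<epsilon> \<Longrightarrow> \<epsilon> \<le> 1 \<Longrightarrow> reg_weight \<epsilon> x \<le> C * (1 + (norm x)\<^sup>2) ^ n" using reg_weight_bound by blast
  let ?W = "\<lambda>x. complex_of_real (cmod (?A x)) + (\<Sum>\<alpha>\<in>P. complex_of_real (cmod (?c \<alpha> * reflection_quotient \<alpha> F x)))"
  let ?w = "\<lambda>x. cmod (?W x * complex_of_real (C * (1 + (norm x)\<^sup>2) ^ n) * complex_of_real (exp (- (norm x)\<^sup>2)))"
  have "tempered (\<lambda>x :: real ^ 'n. complex_of_real (C * (1 + (norm x)\<^sup>2) ^ n))"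
  proof (rule temperedI[where C="\<bar>C\<bar>" and n=n])
    fix x :: "real ^ 'n"
    have "0 \<le> (1 + (norm x)\<^sup>2) ^ n" by simp
    then show "cmod (complex_of_real (C * (1 + (norm x)\<^sup>2) ^ n)) \<le> \<bar>C\<bar> * (1 + (norm x)\<^sup>2) ^ n"
      by (simp only: norm_of_real abs_mult abs_of_nonneg order_refl)
  qed measurable
  then have "integrable lborel (\<lambda>x. ?W x * complex_of_real (C * (1 + (norm x)\<^sup>2) ^ n) * complex_of_real (exp (- (norm x)\<^sup>2)))"
    by (intro tempered_gaussian_integrable tempered_mult tempered_add tempered_sum tempered_cmod tempered_const tA tQ)
  then have wi: "integrable lborel ?w" by (rule integrable_norm)
  have "(\<lambda>n. \<integral>x. ?s n x \<partial>lborel) \<longlonglongrightarrow> (\<integral>x. ?l x \<partial>lborel)"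
  proof (rule integral_dominated_convergence[OF _ _ wi])
    show "?l \<in> borel_measurable lborel" unfolding gauss_def by measurable
    show "?s i \<in> borel_measurable lborel" for i unfolding gauss_def odd_kernel_def by measurable
    show "AE x in lborel. (\<lambda>i. ?s i x) \<longlonglongrightarrow> ?l x"
      using AE_regular
    proof eventually_elim
      fix x assume x: "\<forall>\<alpha>\<in>R. \<alpha> \<bullet> x \<noteq> 0"
      have q: "(\<lambda>i. (\<alpha> \<bullet> x) * odd_kernel (e i) \<alpha> x) \<longlonglongrightarrow> 1" if "\<alpha> \<in> P" for \<alpha>
      proof -
        have a: "\<alpha> \<bullet> x \<noteq> 0" using x that P_subset by auto
        have "(\<lambda>i. (\<alpha> \<bullet> x) * odd_kernel (e i) \<alpha> x) \<longlonglongrightarrow> (\<alpha> \<bullet> x) * ((\<alpha> \<bullet> x) / ((\<alpha> \<bullet> x)\<^sup>2 + 0))"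
          unfolding odd_kernel_def by (intro tendsto_intros elim) (use a in auto)
        then show ?thesis using a by (simp add: power2_eq_square)
      qed
      show "(\<lambda>i. ?s i x) \<longlonglongrightarrow> ?l x"
        unfolding gauss_def by (intro tendsto_intros tendsto_of_real q reg_weight_tendsto x elim)
    qed
    show "AE x in lborel. norm (?s i x) \<le> ?w x" for i
    proof (rule AE_I2)
      fix x
      have "norm (?A x + (\<Sum>\<alpha>\<in>P. ?c \<alpha> * (reflection_quotient \<alpha> F x * complex_of_real ((\<alpha> \<bullet> x) * odd_kernel (e i) \<alpha> x))))
         \<le> cmod (?A x) + (\<Sum>\<alpha>\<in>P. cmod (?c \<alpha> * reflection_quotient \<alpha> F x))"
      proof (rule order_trans[OF norm_triangle_ineq], rule add_left_mono, rule order_trans[OF norm_sum], rule sum_mono)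
        fix \<alpha>
        have "\<bar>(\<alpha> \<bullet> x) * odd_kernel (e i) \<alpha> x\<bar> \<le> 1"
          using e[of i] unfolding odd_kernel_def by (simp add: abs_mult divide_le_eq_1 add_nonneg_pos flip: power2_eq_square abs_mult_self_eq)
        then have "cmod (?c \<alpha> * reflection_quotient \<alpha> F x) * \<bar>(\<alpha> \<bullet> x) * odd_kernel (e i) \<alpha> x\<bar> \<le> cmod (?c \<alpha> * reflection_quotient \<alpha> F x) * 1"
          by (rule mult_left_mono) simp
        moreover have "cmod (?c \<alpha> * (reflection_quotient \<alpha> F x * complex_of_real ((\<alpha> \<bullet> x) * odd_kernel (e i) \<alpha> x)))
           = cmod (?c \<alpha> * reflection_quotient \<alpha> F x) * \<bar>(\<alpha> \<bullet> x) * odd_kernel (e i) \<alpha> x\<bar>"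
          by (simp only: norm_mult norm_of_real mult.assoc)
        ultimately show "cmod (?c \<alpha> * (reflection_quotient \<alpha> F x * complex_of_real ((\<alpha> \<bullet> x) * odd_kernel (e i) \<alpha> x))) \<le> cmod (?c \<alpha> * reflection_quotient \<alpha> F x)"
          by simp
      qed
      also have "\<dots> = cmod (?W x)"
      proof -
        have "?W x = complex_of_real (cmod (?A x) + (\<Sum>\<alpha>\<in>P. cmod (?c \<alpha> * reflection_quotient \<alpha> F x)))" by simp
        then have "cmod (?W x) = \<bar>cmod (?A x) + (\<Sum>\<alpha>\<in>P. cmod (?c \<alpha> * reflection_quotient \<alpha> F x))\<bar>" by (simp only: norm_of_real)
        moreover have "0 \<le> cmod (?A x) + (\<Sum>\<alpha>\<in>P. cmod (?c \<alpha> * reflection_quotient \<alpha> F x))"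
          by (intro add_nonneg_nonneg sum_nonneg norm_ge_zero)
        ultimately show ?thesis by simp
      qed
      finally have 1: "norm (?A x + (\<Sum>\<alpha>\<in>P. ?c \<alpha> * (reflection_quotient \<alpha> F x * complex_of_real ((\<alpha> \<bullet> x) * odd_kernel (e i) \<alpha> x)))) \<le> cmod (?W x)" .
      have 2: "cmod (complex_of_real (reg_weight (e i) x)) \<le> cmod (complex_of_real (C * (1 + (norm x)\<^sup>2) ^ n))"
        using C[OF e, of i x] by (simp only: norm_of_real) (simp add: reg_weight_def)
      let ?B = "?A x + (\<Sum>\<alpha>\<in>P. ?c \<alpha> * (reflection_quotient \<alpha> F x * complex_of_real ((\<alpha> \<bullet> x) * odd_kernel (e i) \<alpha> x)))"
      have "norm (?s i x) = norm ?B * (cmod (complex_of_real (reg_weight (e i) x)) * cmod (complex_of_real (exp (- (norm x)\<^sup>2))))"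
        unfolding gauss_def by (subst norm_mult, subst norm_mult, rule refl)
      also have "\<dots> \<le> cmod (?W x) * (cmod (complex_of_real (C * (1 + (norm x)\<^sup>2) ^ n)) * cmod (complex_of_real (exp (- (norm x)\<^sup>2))))"
        by (intro mult_mono[OF 1] mult_right_mono[OF 2] mult_nonneg_nonneg norm_ge_zero)
      also have "\<dots> = ?w x" by (subst norm_mult, subst norm_mult, rule mult.assoc[symmetric])
      finally show "norm (?s i x) \<le> ?w x" .
    qed
  qed
  moreover have "(\<integral>x. ?s n x \<partial>lborel) = 0" for n by (rule gaussian_dunkl_reg[OF F e])
  ultimately have "(\<lambda>n::nat. 0) \<longlonglongrightarrow> (\<integral>x. ?l x \<partial>lborel)" by (simp only:)
  from LIMSEQ_unique[OF this tendsto_const] have "(\<integral>x. ?l x \<partial>lborel) = 0" .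
  then show ?thesis by (simp add: dunkl_op_def algebra_simps)
qed

text \<open>The difference quotient is not a derivation, but the defect in the Leibniz rule is
  \<open>(p(x) - p(r\<^sub>\<alpha> x)) (q(x) - q(r\<^sub>\<alpha> x)) / \<langle>\<alpha>,x\<rangle>\<close>, which is odd under \<open>r\<^sub>\<alpha>\<close> and integrates to zero.\<close>

lemma reflection_quotient_product:
  assumes a: "\<alpha> \<in> R" and p: "hpoly m p" and q: "hpoly n q"
  shows "(\<integral>x. reflection_quotient \<alpha> (\<lambda>x. p x * q x) x * gauss weight x \<partial>lborel) =
     (\<integral>x. (reflection_quotient \<alpha> p x * q x + p x * reflection_quotient \<alpha> q x) * gauss weight x \<partial>lborel)"
proof -
  let ?r = "root_reflection \<alpha>"
  define E where "E x = reflection_quotient \<alpha> p x * q x + p x * reflection_quotient \<alpha> q x - reflection_quotient \<alpha> (\<lambda>x. p x * q x) x" for x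
  have tp: "tempered p" "tempered q" using tempered_hpoly p q by auto
  have tQ: "tempered (reflection_quotient \<alpha> p)" "tempered (reflection_quotient \<alpha> q)" "tempered (reflection_quotient \<alpha> (\<lambda>x. p x * q x))"
    using tempered_hpoly[OF lower_hpoly[OF hpoly_reflection_quotient[OF p]]] tempered_hpoly[OF lower_hpoly[OF hpoly_reflection_quotient[OF q]]]
      tempered_hpoly[OF lower_hpoly[OF hpoly_reflection_quotient[OF hpoly_mult[OF p q]]]] by auto
  have tS: "tempered (\<lambda>x. reflection_quotient \<alpha> p x * q x + p x * reflection_quotient \<alpha> q x)"
    by (intro tempered_add tempered_mult tp tQ)
  have tE: "tempered E" unfolding E_def[abs_def] by (intro tempered_diff tS tQ)
  note gi = gauss_integrable[OF tempered_weight]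
  have Em: "(\<lambda>x. E x * gauss weight x) \<in> borel_measurable borel" using gi[OF tE] by (simp add: integrable_iff_bounded)
  have "(\<integral>x. E x * gauss weight x \<partial>lborel) = (\<integral>x. E (?r x) * gauss weight (?r x) \<partial>lborel)"
    by (rule integral_root_reflection[OF Em, symmetric])
  also have "\<dots> = (\<integral>x. - (E x * gauss weight x) \<partial>lborel)"
  proof (rule integral_cong_AE)
    show "(\<lambda>x. E (?r x) * gauss weight (?r x)) \<in> borel_measurable lborel"
      using measurable_compose[OF root_reflection_measurable Em] by simp
    show "(\<lambda>x. - (E x * gauss weight x)) \<in> borel_measurable lborel" using Em by simp
    show "AE x in lborel. E (?r x) * gauss weight (?r x) = - (E x * gauss weight x)"
      using AE_regular
    proof eventually_elim
      fix x assume "\<forall>\<alpha>\<in>R. \<alpha> \<bullet> x \<noteq> 0"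
      then have x: "\<alpha> \<bullet> x \<noteq> 0" using a by auto
      have gr: "gauss weight (?r x) = gauss weight x" by (simp add: gauss_def weight_reflection[OF a])
      have Ex: "E y = (p y - p (?r y)) * (q y - q (?r y)) / complex_of_real (\<alpha> \<bullet> y)" if "\<alpha> \<bullet> y \<noteq> 0" for y
        using that by (simp add: E_def reflection_quotient_def field_simps)
      have "\<alpha> \<bullet> ?r x \<noteq> 0" using x by (simp add: root_reflection_inner)
      from Ex[OF this] Ex[OF x] have "E (?r x) = - E x"
        by (simp add: root_reflection_inner algebra_simps)
      then show "E (?r x) * gauss weight (?r x) = - (E x * gauss weight x)" by (simp add: gr)
    qed
  qed
  finally have "(\<integral>x. E x * gauss weight x \<partial>lborel) = 0" by simp
  moreover have "(\<integral>x. E x * gauss weight x \<partial>lborel) =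
     (\<integral>x. (reflection_quotient \<alpha> p x * q x + p x * reflection_quotient \<alpha> q x) * gauss weight x \<partial>lborel)
     - (\<integral>x. reflection_quotient \<alpha> (\<lambda>x. p x * q x) x * gauss weight x \<partial>lborel)"
    unfolding E_def left_diff_distrib by (intro Bochner_Integration.integral_diff gi tS tQ)
  ultimately show ?thesis by simp
qed

section \<open>Orthogonality of Dunkl harmonics\<close>

text \<open>Bilinear, without a conjugate, so that it can be applied to arbitrary products of polynomials.\<close>

definition gpair :: "(real ^ 'n \<Rightarrow> complex) \<Rightarrow> (real ^ 'n \<Rightarrow> complex) \<Rightarrow> complex" where
  "gpair f g = (\<integral>x. (f x * g x) * gauss weight x \<partial>lborel)"

lemma gpair_integrable: "tempered f \<Longrightarrow> tempered g \<Longrightarrow> integrable lborel (\<lambda>x. (f x * g x) * gauss weight x)"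
  by (intro gauss_integrable tempered_weight tempered_mult)

lemma gpair_add_left: "tempered f \<Longrightarrow> tempered f' \<Longrightarrow> tempered g \<Longrightarrow> gpair (\<lambda>x. f x + f' x) g = gpair f g + gpair f' g"
  unfolding gpair_def distrib_right by (intro Bochner_Integration.integral_add gpair_integrable)

lemma gpair_scale_left: "gpair (\<lambda>x. c * f x) g = c * gpair f g"
  unfolding gpair_def mult.assoc by simp

lemma gpair_commute: "gpair f g = gpair g f"
  unfolding gpair_def by (simp only: mult.commute)

lemma gpair_sum_left:
  "(\<And>i. i \<in> I \<Longrightarrow> tempered (f i)) \<Longrightarrow> tempered g \<Longrightarrow> gpair (\<lambda>x. \<Sum>i\<in>I. f i x) g = (\<Sum>i\<in>I. gpair (f i) g)"
proof (induction I rule: infinite_finite_induct)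
  case (insert i I)
  then show ?case by (simp add: gpair_add_left tempered_sum)
qed (auto simp: gpair_def)

text \<open>In the Gaussian pairing the transpose of \<open>T\<^sub>\<xi>\<close> is multiplication by \<open>2\<langle>x,\<xi>\<rangle>\<close> minus
  \<open>T\<^sub>\<xi>\<close>.\<close>

lemma dunkl_skew:
  assumes p: "hpoly m p" and q: "hpoly n q"
  shows "gpair (dunkl_op P k \<xi> p) q + gpair p (dunkl_op P k \<xi> q) = 2 * gpair (\<lambda>x. complex_of_real (x \<bullet> \<xi>) * p x) q"
proof -
  let ?c = "\<lambda>\<alpha>. complex_of_real (k \<alpha> * (\<alpha> \<bullet> \<xi>))"
  let ?F = "\<lambda>x. p x * q x" and ?g = "gauss weight"
  note F = hpoly_mult[OF p q]
  have tp: "tempered p" "tempered q" using tempered_hpoly p q by auto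
  note gi = gauss_integrable[OF tempered_weight]
  have tT: "tempered (dunkl_op P k \<xi> p)" "tempered (dunkl_op P k \<xi> q)" "tempered (dunkl_op P k \<xi> ?F)"
    using tempered_hpoly[OF lower_hpoly[OF hpoly_dunkl_op]] p q F by blast+
  have tQ: "tempered (reflection_quotient \<alpha> p)" "tempered (reflection_quotient \<alpha> q)" "tempered (reflection_quotient \<alpha> ?F)" for \<alpha>
    using tempered_hpoly[OF lower_hpoly[OF hpoly_reflection_quotient]] p q F by blast+
  let ?S = "\<lambda>\<alpha> x. reflection_quotient \<alpha> p x * q x + p x * reflection_quotient \<alpha> q x"
  have tS: "tempered (?S \<alpha>)" for \<alpha> by (intro tempered_add tempered_mult tp tQ)
  have eq: "dunkl_op P k \<xi> p x * q x + p x * dunkl_op P k \<xi> q x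
     = dunkl_op P k \<xi> ?F x + (\<Sum>\<alpha>\<in>P. ?c \<alpha> * (?S \<alpha> x - reflection_quotient \<alpha> ?F x))" for x
  proof -
    have "dir_deriv \<xi> ?F x = p x * dir_deriv \<xi> q x + dir_deriv \<xi> p x * q x"
      by (intro dir_deriv_mult hpoly_differentiable[OF p] hpoly_differentiable[OF q])
    then show ?thesis
      unfolding dunkl_op_def
      by (simp only: right_diff_distrib sum_subtractf distrib_left distrib_right sum.distrib sum_distrib_left sum_distrib_right mult_ac add_ac)
         (simp add: algebra_simps)
  qed
  have "gpair (dunkl_op P k \<xi> p) q + gpair p (dunkl_op P k \<xi> q)
     = (\<integral>x. (dunkl_op P k \<xi> p x * q x) * ?g x + (p x * dunkl_op P k \<xi> q x) * ?g x \<partial>lborel)"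
    unfolding gpair_def by (intro Bochner_Integration.integral_add[symmetric] gpair_integrable tp tT)
  also have "\<dots> = (\<integral>x. dunkl_op P k \<xi> ?F x * ?g x + (\<Sum>\<alpha>\<in>P. ?c \<alpha> * (?S \<alpha> x * ?g x - reflection_quotient \<alpha> ?F x * ?g x)) \<partial>lborel)"
    unfolding distrib_right[symmetric] eq by (simp only: distrib_right sum_distrib_right mult.assoc left_diff_distrib)
  also have "\<dots> = (\<integral>x. dunkl_op P k \<xi> ?F x * ?g x \<partial>lborel) + (\<integral>x. (\<Sum>\<alpha>\<in>P. ?c \<alpha> * (?S \<alpha> x * ?g x - reflection_quotient \<alpha> ?F x * ?g x)) \<partial>lborel)"
    by (intro Bochner_Integration.integral_add Bochner_Integration.integrable_sum integrable_mult_right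
        Bochner_Integration.integrable_diff gi tS tQ tT)
  also have "(\<integral>x. (\<Sum>\<alpha>\<in>P. ?c \<alpha> * (?S \<alpha> x * ?g x - reflection_quotient \<alpha> ?F x * ?g x)) \<partial>lborel)
     = (\<Sum>\<alpha>\<in>P. \<integral>x. ?c \<alpha> * (?S \<alpha> x * ?g x - reflection_quotient \<alpha> ?F x * ?g x) \<partial>lborel)"
    by (intro Bochner_Integration.integral_sum integrable_mult_right Bochner_Integration.integrable_diff gi tS tQ)
  also have "\<dots> = 0"
  proof (intro sum.neutral ballI)
    fix \<alpha> assume "\<alpha> \<in> P"
    then have a: "\<alpha> \<in> R" using P_subset by auto
    have "(\<integral>x. ?S \<alpha> x * ?g x - reflection_quotient \<alpha> ?F x * ?g x \<partial>lborel)
      = (\<integral>x. ?S \<alpha> x * ?g x \<partial>lborel) - (\<integral>x. reflection_quotient \<alpha> ?F x * ?g x \<partial>lborel)"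
      by (intro Bochner_Integration.integral_diff gi tS tQ)
    then show "(\<integral>x. ?c \<alpha> * (?S \<alpha> x * ?g x - reflection_quotient \<alpha> ?F x * ?g x) \<partial>lborel) = 0"
      by (simp add: reflection_quotient_product[OF a p q])
  qed
  finally have 1: "gpair (dunkl_op P k \<xi> p) q + gpair p (dunkl_op P k \<xi> q) = (\<integral>x. dunkl_op P k \<xi> ?F x * ?g x \<partial>lborel)" by simp
  have tx: "tempered (\<lambda>x. 2 * (complex_of_real (x \<bullet> \<xi>) * ?F x))"
    by (intro tempered_mult tempered_const tempered_linear_form tp)
  have "0 = (\<integral>x. dunkl_op P k \<xi> ?F x * ?g x \<partial>lborel) - (\<integral>x. (2 * (complex_of_real (x \<bullet> \<xi>) * ?F x)) * ?g x \<partial>lborel)"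
    unfolding gaussian_dunkl[OF F, of \<xi>, symmetric] left_diff_distrib
    by (intro Bochner_Integration.integral_diff gi tT tx)
  then show ?thesis unfolding 1 by (simp add: gpair_def mult.assoc)
qed

lemma gpair_reflection:
  assumes a: "\<alpha> \<in> R" and "tempered f" "tempered g"
  shows "gpair (\<lambda>x. f (root_reflection \<alpha> x)) g = gpair f (\<lambda>x. g (root_reflection \<alpha> x))"
proof -
  have m: "(\<lambda>x. (f x * g (root_reflection \<alpha> x)) * gauss weight x) \<in> borel_measurable borel"
    using assms(2,3)[THEN tempered_measurable] unfolding gauss_def by measurable
  have "gpair f (\<lambda>x. g (root_reflection \<alpha> x)) = (\<integral>x. (f (root_reflection \<alpha> x) * g (root_reflection \<alpha> (root_reflection \<alpha> x))) * gauss weight (root_reflection \<alpha> x) \<partial>lborel)"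
    unfolding gpair_def by (rule integral_root_reflection[OF m, symmetric])
  then show ?thesis by (simp add: gpair_def gauss_def weight_reflection[OF a])
qed

text \<open>Integration by parts of the Dirichlet form: \<open>\<Delta>\<^sub>k p = 0\<close> leaves the Euler operator of \<open>p\<close>.\<close>

lemma gpair_dunkl_gradient:
  assumes p: "p \<in> dunkl_harmonics P k m" and q: "hpoly n q"
  shows "(\<Sum>\<xi>\<in>Basis. gpair (dunkl_op P k \<xi> p) (dunkl_op P k \<xi> q)) = 2 * (of_nat m * gpair p q +
     (\<Sum>\<alpha>\<in>P. complex_of_real (k \<alpha>) * (gpair p q - gpair (\<lambda>x. p (root_reflection \<alpha> x)) q)))"
proof -
  have hp: "hpoly m p" and lap: "\<And>x. dunkl_laplacian P k p x = 0" using p by (auto simp: dunkl_harmonics_iff)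
  have tq: "tempered q" and tp: "tempered p" using tempered_hpoly hp q by auto
  have T: "hpoly (m - 1) (dunkl_op P k \<xi> p)" for \<xi> by (rule lower_hpoly[OF hpoly_dunkl_op[OF hp]])
  have TT: "tempered (dunkl_op P k \<xi> (dunkl_op P k \<xi> p))" for \<xi> by (rule tempered_hpoly[OF lower_hpoly[OF hpoly_dunkl_op[OF T]]])
  have xT: "tempered (\<lambda>x. complex_of_real (x \<bullet> \<xi>) * dunkl_op P k \<xi> p x)" for \<xi>
    by (intro tempered_mult tempered_linear_form tempered_hpoly[OF T])
  have tr: "tempered (\<lambda>x. p (root_reflection \<alpha> x))" for \<alpha> by (rule tempered_hpoly[OF hpoly_reflection[OF hp]])
  have "(\<Sum>\<xi>\<in>Basis. gpair (dunkl_op P k \<xi> (dunkl_op P k \<xi> p)) q) = gpair (\<lambda>x. 0) q"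
    using gpair_sum_left[of Basis "\<lambda>\<xi>. dunkl_op P k \<xi> (dunkl_op P k \<xi> p)" q] TT tq lap by (simp add: dunkl_laplacian_def)
  also have "\<dots> = 0" by (simp add: gpair_def)
  finally have 0: "(\<Sum>\<xi>\<in>Basis. gpair (dunkl_op P k \<xi> (dunkl_op P k \<xi> p)) q) = 0" .
  have "(\<Sum>\<xi>\<in>Basis. gpair (dunkl_op P k \<xi> (dunkl_op P k \<xi> p)) q) + (\<Sum>\<xi>\<in>Basis. gpair (dunkl_op P k \<xi> p) (dunkl_op P k \<xi> q))
     = 2 * (\<Sum>\<xi>\<in>Basis. gpair (\<lambda>x. complex_of_real (x \<bullet> \<xi>) * dunkl_op P k \<xi> p x) q)"
    unfolding sum.distrib[symmetric] dunkl_skew[OF T q] sum_distrib_left ..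
  also have "(\<Sum>\<xi>\<in>Basis. gpair (\<lambda>x. complex_of_real (x \<bullet> \<xi>) * dunkl_op P k \<xi> p x) q)
     = gpair (\<lambda>x. of_nat m * p x + (\<Sum>\<alpha>\<in>P. complex_of_real (k \<alpha>) * (p x + (-1) * p (root_reflection \<alpha> x)))) q"
    by (subst gpair_sum_left[OF xT tq, symmetric]) (simp add: sum_coordinate_dunkl_op[OF hp])
  also have "\<dots> = of_nat m * gpair p q + (\<Sum>\<alpha>\<in>P. complex_of_real (k \<alpha>) * (gpair p q + (-1) * gpair (\<lambda>x. p (root_reflection \<alpha> x)) q))"
    by (simp only: gpair_add_left gpair_scale_left gpair_sum_left tempered_mult tempered_const tempered_add tempered_sum tp tq tr)
  finally show ?thesis using 0 by simp
qed

text \<open>The Dirichlet form is symmetric, and so are the reflection terms in \<open>gpair_dunkl_gradient\<close>; the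
  difference of its two evaluations is a multiple of \<open>(m - n) gpair p q\<close>.\<close>

lemma gpair_harmonics_orthogonal:
  assumes p: "p \<in> dunkl_harmonics P k m" and q: "q \<in> dunkl_harmonics P k n" and mn: "m \<noteq> n"
  shows "gpair p q = 0"
proof -
  have hp: "hpoly m p" and hq: "hpoly n q" using p q by (auto simp: dunkl_harmonics_iff)
  have tq: "tempered q" and tp: "tempered p" using tempered_hpoly hp hq by auto
  have r: "gpair (\<lambda>x. q (root_reflection \<alpha> x)) p = gpair (\<lambda>x. p (root_reflection \<alpha> x)) q" if "\<alpha> \<in> P" for \<alpha>
    using gpair_reflection[of \<alpha> q p] that P_subset tp tq gpair_commute[of q] by auto
  have "2 * (of_nat m * gpair p q + (\<Sum>\<alpha>\<in>P. complex_of_real (k \<alpha>) * (gpair p q - gpair (\<lambda>x. p (root_reflection \<alpha> x)) q)))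
     = 2 * (of_nat n * gpair q p + (\<Sum>\<alpha>\<in>P. complex_of_real (k \<alpha>) * (gpair q p - gpair (\<lambda>x. q (root_reflection \<alpha> x)) p)))"
    unfolding gpair_dunkl_gradient[OF p hq, symmetric] gpair_dunkl_gradient[OF q hp, symmetric]
    by (rule sum.cong[OF refl]) (rule gpair_commute)
  then have "of_nat m * gpair p q = of_nat n * gpair p q"
    by (simp add: r gpair_commute[of q p])
  then show ?thesis using mn by simp
qed

text \<open>The constant vanishes for harmonics of different degrees because it does so for \<open>a = 2\<close> and the
  Gaussian, where the radial integral is a positive Gamma value.\<close>

lemma hpoly_product_radial:
  assumes p: "hpoly m p" and q: "hpoly n q"
  shows "\<exists>C. (p \<in> dunkl_harmonics P k m \<longrightarrow> q \<in> dunkl_harmonics P k n \<longrightarrow> m \<noteq> n \<longrightarrow> C = 0) \<and>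
   (\<forall>a>0. \<forall>G\<in>borel_measurable borel.
     integrable lborel (\<lambda>s. power_density ((real (m + n) + 2 * K + real CARD('n)) / a) s * G s) \<longrightarrow>
     has_bochner_integral lborel (\<lambda>x. p x * q x * complex_of_real (weight x) * complex_of_real (G (norm x powr a)))
       (C * complex_of_real (\<integral>s. power_density ((real (m + n) + 2 * K + real CARD('n)) / a) s * G s \<partial>lborel)))"
proof -
  let ?h = "\<lambda>x. p x * q x * complex_of_real (weight x)"
  let ?b = "(real (m + n) + 2 * K + real CARD('n)) / 2"
  note [measurable] = hpoly_measurable[OF p] hpoly_measurable[OF q]
  have "tempered ?h" by (intro tempered_mult tempered_hpoly[OF p] tempered_hpoly[OF q] tempered_weight)
  then obtain D N where D: "D \<ge> 0" "\<And>x. cmod (?h x) \<le> D * (1 + (norm x)\<^sup>2) ^ N" using tempered_bound by blast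
  have "\<exists>C. \<forall>a>0. \<forall>G\<in>borel_measurable borel.
     integrable lborel (\<lambda>s. power_density ((real (m + n) + 2 * K + real CARD('n)) / a) s * G s) \<longrightarrow>
     has_bochner_integral lborel (\<lambda>x. ?h x * complex_of_real (G (norm x powr a)))
       (C * complex_of_real (\<integral>s. power_density ((real (m + n) + 2 * K + real CARD('n)) / a) s * G s \<partial>lborel))"
  proof (rule radial_integral[where B="D * 2 ^ N"])
    show "?h \<in> borel_measurable borel" by measurable
    show "0 \<le> real (m + n) + 2 * K" using K_nonneg by simp
    fix x :: "real ^ 'n"
    show "?h (c *\<^sub>R x) = complex_of_real (c powr (real (m + n) + 2 * K)) * ?h x" if "c > 0" for c
      using that by (simp add: hpoly_homogeneous[OF p] hpoly_homogeneous[OF q] weight_scale powr_add powr_realpow)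
    assume "norm x \<le> 1"
    then have "(1 + (norm x)\<^sup>2) ^ N \<le> 2 ^ N" by (intro power_mono) (auto simp: power_le_one)
    then show "cmod (?h x) \<le> D * 2 ^ N" using order_trans[OF D(2) mult_left_mono[OF _ D(1)]] by blast
  qed
  then obtain C where C: "\<And>a G. a > 0 \<Longrightarrow> G \<in> borel_measurable borel \<Longrightarrow>
     integrable lborel (\<lambda>s. power_density ((real (m + n) + 2 * K + real CARD('n)) / a) s * G s) \<Longrightarrow>
     has_bochner_integral lborel (\<lambda>x. ?h x * complex_of_real (G (norm x powr a)))
       (C * complex_of_real (\<integral>s. power_density ((real (m + n) + 2 * K + real CARD('n)) / a) s * G s \<partial>lborel))" by blast
  have "C = 0" if h: "p \<in> dunkl_harmonics P k m" "q \<in> dunkl_harmonics P k n" "m \<noteq> n"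
  proof -
    have b: "?b > 0" using K_nonneg by (simp add: add_nonneg_pos)
    have pd: "power_density ?b s * exp (- s) = ?b * (indicator {0<..} s * (s powr (?b - 1) * exp (- s)) * poly 1 s)" for s
      by (simp add: power_density_def)
    have i: "integrable lborel (\<lambda>s. power_density ?b s * exp (- s))"
      unfolding pd using b by (intro integrable_mult_right gamma_functional_integrable) simp
    have "gpair p q = C * complex_of_real (\<integral>s. power_density ?b s * exp (- s) \<partial>lborel)"
      using has_bochner_integral_integral_eq[OF C[OF _ _ i]]
      by (simp add: gpair_def gauss_def powr_numeral mult.assoc)
    also have "(\<integral>s. power_density ?b s * exp (- s) \<partial>lborel) = ?b * gamma_functional (?b - 1) (monom 1 0)"
      unfolding pd gamma_functional_def by (simp add: poly_monom)
    also have "gamma_functional (?b - 1) (monom 1 0) = Gamma ?b"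
      using b by (subst gamma_functional_monom) auto
    finally have "C * complex_of_real (?b * Gamma ?b) = 0" using gpair_harmonics_orthogonal[OF h] by (simp only:)
    moreover have "?b * Gamma ?b \<noteq> 0" using mult_pos_pos[OF b Gamma_real_pos[OF b]] by (rule less_imp_neq[symmetric])
    ultimately show "C = 0" by (simp only: mult_eq_0_iff of_real_eq_0_iff) simp
  qed
  then show ?thesis using C by blast
qed

end

section \<open>The eigenfunctions in the weighted space\<close>

lemma borel_measurable_poly [measurable]: "poly (f :: real poly) \<in> borel_measurable borel"
  by (intro borel_measurable_continuous_onI continuous_intros)

lemma gamma_functional_scaled:
  fixes s c :: real
  assumes s: "s > -1" and c: "c > 0"
  shows "has_bochner_integral lborel (\<lambda>t. indicator {0<..} t * t powr s * (poly f (c * t) * exp (- (c * t)))) (gamma_functional s f / c powr (s + 1))"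
proof -
  let ?h = "\<lambda>t. indicator {0<..} t * (t powr s * exp (-t)) * poly f t"
  have "has_bochner_integral lborel ?h (gamma_functional s f)"
    unfolding gamma_functional_def by (rule has_bochner_integral_integrable[OF gamma_functional_integrable[OF s]])
  then have "has_bochner_integral lborel (\<lambda>t. ?h (0 + c * t)) (gamma_functional s f /\<^sub>R \<bar>c\<bar>)"
    using lborel_has_bochner_integral_real_affine_iff[of c ?h "gamma_functional s f" 0] c by simp
  then have "has_bochner_integral lborel (\<lambda>t. (1 / c powr s) * ?h (0 + c * t)) ((1 / c powr s) * (gamma_functional s f /\<^sub>R \<bar>c\<bar>))"
    by (rule has_bochner_integral_mult_right)
  moreover have "(1 / c powr s) * ?h (0 + c * t) = indicator {0<..} t * t powr s * (poly f (c * t) * exp (- (c * t)))" for t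
    using c by (auto simp: indicator_def powr_mult zero_less_mult_iff)
  moreover have "(1 / c powr s) * (gamma_functional s f /\<^sub>R \<bar>c\<bar>) = gamma_functional s f / c powr (s + 1)"
    using c by (simp add: powr_add field_simps)
  ultimately show ?thesis by simp
qed

locale dunkl_setting = dunkl_data R P k
  for R P :: "(real ^ 'n) set" and k :: "real ^ 'n \<Rightarrow> real" +
  fixes a :: real
  assumes a_pos: "0 < a" and a_bound: "2 * mult_index P k + real CARD('n) > 2 - a"
begin

abbreviation M :: "(real ^ 'n) measure" where "M \<equiv> dunkl_measure R k a"

abbreviation u :: "real ^ 'n \<Rightarrow> real" where "u x \<equiv> norm x powr a"

text \<open>The exponent of the radial density of \<open>p q\<close> in the variable \<open>|x|\<^bsup>a\<^esup>\<close>, for \<open>p\<close> and \<open>q\<close> of degrees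
  \<open>m\<close> and \<open>n\<close>. The assumption on \<open>a\<close> says that it exceeds \<open>-1\<close> even for constants.\<close>

definition expo :: "nat \<Rightarrow> nat \<Rightarrow> real" where
  "expo m n = (real (m + n) + 2 * K + real CARD('n) - 2) / a"

lemma expo_gt: "expo m n > -1"
proof -
  have "real (m + n) + 2 * K + real CARD('n) - 2 > - a" using a_bound by simp
  then show ?thesis unfolding expo_def using a_pos by (simp add: field_simps)
qed

lemma expo_lambda: "expo m m = lambda_kam P k a m"
  by (simp add: expo_def lambda_kam_def)

lemma dunkl_weight_eq: "dunkl_weight R k a x = (u x) powr (1 - 2 / a) * weight x"
proof -
  have "a * (1 - 2 / a) = a - 2" using a_pos by (simp add: field_simps)
  then show ?thesis unfolding dunkl_weight_def weight_def by (simp add: powr_powr)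
qed

lemma sets_M [simp, measurable_cong]: "sets M = sets borel" by (simp add: dunkl_measure_def)

lemma space_M [simp]: "space M = UNIV" by (simp add: dunkl_measure_def)

lemma dunkl_weight_measurable [measurable]: "dunkl_weight R k a \<in> borel_measurable borel"
  unfolding dunkl_weight_eq[abs_def] by measurable

lemma dunkl_weight_nonneg: "0 \<le> dunkl_weight R k a x"
  by (simp add: dunkl_weight_eq weight_nonneg)

lemma M_has_bochner_integral:
  fixes h :: "real ^ 'n \<Rightarrow> complex"
  assumes [measurable]: "h \<in> borel_measurable borel"
    and "has_bochner_integral lborel (\<lambda>x. complex_of_real (dunkl_weight R k a x) * h x) c"
  shows "has_bochner_integral M h c"
  using assms(2) dunkl_weight_nonneg unfolding has_bochner_integral_iff dunkl_measure_def
  by (subst integrable_density, simp, simp, simp, subst integral_density) (auto simp: scaleR_conv_of_real)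

lemma AE_M: "AE x in lborel. Q x \<Longrightarrow> AE x in M. Q x"
  unfolding dunkl_measure_def by (subst AE_density) (auto elim: eventually_mono)

lemma AE_M_nonzero: "AE x in M. x \<noteq> 0"
  using AE_M[OF AE_lborel_singleton[of 0]] .

theorem dunkl_pair_integral:
  assumes p: "hpoly m p" and q: "hpoly n q"
  shows "\<exists>C. (p \<in> dunkl_harmonics P k m \<longrightarrow> q \<in> dunkl_harmonics P k n \<longrightarrow> m \<noteq> n \<longrightarrow> C = 0) \<and>
   (\<forall>c>0. \<forall>f. has_bochner_integral M (\<lambda>x. p x * q x * complex_of_real (poly f (c * u x) * exp (- (c * u x))))
       (C * complex_of_real (gamma_functional (expo m n) f / c powr (expo m n + 1))))"
proof -
  let ?b = "(real (m + n) + 2 * K + real CARD('n)) / a"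
  note [measurable] = hpoly_measurable[OF p] hpoly_measurable[OF q]
  obtain C where C0: "p \<in> dunkl_harmonics P k m \<Longrightarrow> q \<in> dunkl_harmonics P k n \<Longrightarrow> m \<noteq> n \<Longrightarrow> C = 0"
    and C: "\<And>G. G \<in> borel_measurable borel \<Longrightarrow> integrable lborel (\<lambda>s. power_density ?b s * G s) \<Longrightarrow>
     has_bochner_integral lborel (\<lambda>x. p x * q x * complex_of_real (weight x) * complex_of_real (G (u x)))
       (C * complex_of_real (\<integral>s. power_density ?b s * G s \<partial>lborel))"
    using hpoly_product_radial[OF p q] a_pos by blast
  have "has_bochner_integral M (\<lambda>x. p x * q x * complex_of_real (poly f (c * u x) * exp (- (c * u x))))
       ((C * complex_of_real ?b) * complex_of_real (gamma_functional (expo m n) f / c powr (expo m n + 1)))"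
    if c: "c > 0" for c f
  proof (rule M_has_bochner_integral)
    let ?G = "\<lambda>s. s powr (1 - 2 / a) * (poly f (c * s) * exp (- (c * s)))"
    have G[measurable]: "?G \<in> borel_measurable borel" by measurable
    have e: "expo m n = ?b - 1 + (1 - 2 / a)" using a_pos by (simp add: expo_def field_simps)
    have pd: "power_density ?b s * ?G s = ?b * (indicator {0<..} s * s powr expo m n * (poly f (c * s) * exp (- (c * s))))" for s
      unfolding e powr_add power_density_def by simp
    have "has_bochner_integral lborel (\<lambda>s. power_density ?b s * ?G s) (?b * (gamma_functional (expo m n) f / c powr (expo m n + 1)))"
      unfolding pd by (intro has_bochner_integral_mult_right gamma_functional_scaled expo_gt c)
    then have i: "integrable lborel (\<lambda>s. power_density ?b s * ?G s)"
      and v: "(\<integral>s. power_density ?b s * ?G s \<partial>lborel) = ?b * (gamma_functional (expo m n) f / c powr (expo m n + 1))"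
      by (simp_all only: has_bochner_integral_iff)
    have "(\<lambda>x. p x * q x * complex_of_real (weight x) * complex_of_real (?G (u x))) =
      (\<lambda>x. complex_of_real (dunkl_weight R k a x) * (p x * q x * complex_of_real (poly f (c * u x) * exp (- (c * u x)))))"
      by (rule ext) (simp add: dunkl_weight_eq mult_ac)
    with C[OF G i] show "has_bochner_integral lborel (\<lambda>x. complex_of_real (dunkl_weight R k a x) * (p x * q x * complex_of_real (poly f (c * u x) * exp (- (c * u x)))))
        ((C * complex_of_real ?b) * complex_of_real (gamma_functional (expo m n) f / c powr (expo m n + 1)))"
      unfolding v by (simp only: of_real_mult mult.assoc)
  qed measurable
  then show ?thesis using C0 by (intro exI[of _ "C * complex_of_real ?b"]) auto
qed

definition radial_exp :: "(real ^ 'n \<Rightarrow> complex) \<Rightarrow> real poly \<Rightarrow> real \<Rightarrow> real ^ 'n \<Rightarrow> complex" where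
  "radial_exp p f c x = p x * complex_of_real (poly f (u x) * exp (- (c * u x)))"

lemma radial_exp_measurable: "hpoly m p \<Longrightarrow> radial_exp p f c \<in> borel_measurable borel"
  using hpoly_measurable[of m p] unfolding radial_exp_def by measurable

lemma radial_exp_l2:
  assumes p: "hpoly m p" and c: "c > 0"
  shows "radial_exp p f c \<in> l2 M"
proof -
  let ?g = "pcompose (f * f) [:0, 1 / (2 * c):]"
  obtain C where "\<And>c f. c > 0 \<Longrightarrow> has_bochner_integral M (\<lambda>x. p x * cnj (p x) * complex_of_real (poly f (c * u x) * exp (- (c * u x))))
       (C * complex_of_real (gamma_functional (expo m m) f / c powr (expo m m + 1)))"
    using dunkl_pair_integral[OF p hpoly_cnj[OF p]] by blast
  from this[of "2 * c" ?g] c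
  have i: "integrable M (\<lambda>x. p x * cnj (p x) * complex_of_real (poly ?g (2 * c * u x) * exp (- (2 * c * u x))))"
    by (simp add: has_bochner_integral_iff)
  have "(cmod (radial_exp p f c x))\<^sup>2 = Re (p x * cnj (p x) * complex_of_real (poly ?g (2 * c * u x) * exp (- (2 * c * u x))))" for x
  proof -
    have "exp (- (2 * c * u x)) = (exp (- (c * u x)))\<^sup>2" by (simp add: power2_eq_square flip: exp_add)
    moreover have "poly ?g (2 * c * u x) = (poly f (u x))\<^sup>2" using c by (simp add: poly_pcompose power2_eq_square)
    ultimately show ?thesis
      unfolding complex_norm_square[symmetric] radial_exp_def norm_mult norm_of_real power_mult_distrib power2_abs
      by (simp add: power_mult_distrib flip: of_real_power of_real_mult)
  qed
  then have "integrable M (\<lambda>x. (cmod (radial_exp p f c x))\<^sup>2)" using integrable_Re[OF i] by simp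
  moreover have "radial_exp p f c \<in> borel_measurable M" using radial_exp_measurable[OF p] by simp
  ultimately show ?thesis by (intro l2I)
qed

definition eigenfun :: "nat \<Rightarrow> nat \<Rightarrow> (real ^ 'n \<Rightarrow> complex) \<Rightarrow> real ^ 'n \<Rightarrow> complex" where
  "eigenfun l m p x = p x * complex_of_real
     (laguerre l (lambda_kam P k a m) (2 / a * norm x powr a) * exp (- (norm x powr a) / a))"

lemma laguerre_functions_eq: "laguerre_functions P k a = {eigenfun l m p | p l m. p \<in> dunkl_harmonics P k m}"
  unfolding laguerre_functions_def eigenfun_def[abs_def] ..

lemma eigenfun_radial_exp:
  "eigenfun l m p = radial_exp p (pcompose (laguerre_poly l (lambda_kam P k a m)) [:0, 2 / a:]) (1 / a)"
  by (simp add: fun_eq_iff eigenfun_def radial_exp_def poly_pcompose poly_laguerre_poly mult.commute)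

lemma eigenfun_l2: "p \<in> dunkl_harmonics P k m \<Longrightarrow> eigenfun l m p \<in> l2 M"
  unfolding eigenfun_radial_exp using a_pos by (intro radial_exp_l2) (auto simp: dunkl_harmonics_iff)

text \<open>Different degrees are separated by the angular constant and equal degrees by Laguerre
  orthogonality, the parameter \<open>expo m m\<close> being the one of the Laguerre polynomials.\<close>

lemma eigenfun_orthogonal:
  assumes p: "p \<in> dunkl_harmonics P k m" and q: "q \<in> dunkl_harmonics P k n" and ne: "(l, m) \<noteq> (j, n)"
  shows "l2_inner M (eigenfun l m p) (eigenfun j n q) = 0"
proof -
  let ?L = "laguerre_poly l (lambda_kam P k a m) * laguerre_poly j (lambda_kam P k a n)"
  have hp: "hpoly m p" and hq: "hpoly n (\<lambda>x. cnj (q x))" using p q by (auto simp: dunkl_harmonics_iff hpoly_cnj)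
  obtain C where C0: "m \<noteq> n \<Longrightarrow> C = 0"
    and C: "\<And>c f. c > 0 \<Longrightarrow> has_bochner_integral M (\<lambda>x. p x * cnj (q x) * complex_of_real (poly f (c * u x) * exp (- (c * u x))))
       (C * complex_of_real (gamma_functional (expo m n) f / c powr (expo m n + 1)))"
    using dunkl_pair_integral[OF hp hq] p dunkl_harmonics_cnj[OF q] by blast
  have "l2_inner M (eigenfun l m p) (eigenfun j n q) = (\<integral>x. p x * cnj (q x) * complex_of_real (poly ?L (2 / a * u x) * exp (- (2 / a * u x))) \<partial>M)"
    unfolding l2_inner_def
  proof (rule Bochner_Integration.integral_cong[OF refl])
    fix x
    have "exp (- (2 / a * u x)) = exp (- (u x) / a) * exp (- (u x) / a)" by (simp flip: exp_add)
    then show "eigenfun l m p x * cnj (eigenfun j n q x) = p x * cnj (q x) * complex_of_real (poly ?L (2 / a * u x) * exp (- (2 / a * u x)))"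
      by (simp add: eigenfun_def poly_laguerre_poly mult_ac)
  qed
  also have "\<dots> = C * complex_of_real (gamma_functional (expo m n) ?L / (2 / a) powr (expo m n + 1))"
    by (rule has_bochner_integral_integral_eq[OF C]) (use a_pos in simp)
  also have "\<dots> = 0"
  proof (cases "m = n")
    case True
    then have "gamma_functional (expo m n) ?L = 0"
      using laguerre_orthogonal[OF expo_gt[of m m], of l j] ne by (simp add: expo_lambda)
    then show ?thesis by simp
  qed (simp add: C0)
  finally show ?thesis .
qed

end

section \<open>The eigenvalue equation\<close>

text \<open>In the variable \<open>U = (2/a) r\<^bsup>a\<^esup>\<close>, for which \<open>r U' = a U\<close>, the radial equation becomes Laguerre's
  equation for the product with \<open>exp (-U/2)\<close>. The number \<open>D\<close> is \<open>2m + N + 2K\<close> in the application, where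
  \<open>s = \<lambda>\<^sub>m\<close>.\<close>

lemma radial_pair_laguerre:
  fixes a s :: real and l :: nat
  assumes a: "a > 0"
  defines "D \<equiv> a * s + 2"
  shows "\<exists>h1 h2. radial_pair (\<lambda>r. laguerre l s (2 / a * r powr a) * exp (- (r powr a) / a)) h1 \<and> radial_pair h1 h2 \<and>
    (\<forall>r>0. r powr (2 - a) * (h1 r * D + r\<^sup>2 * h2 r) - r powr a * (laguerre l s (2 / a * r powr a) * exp (- (r powr a) / a))
      = - a * (2 * real l + s + 1) * (laguerre l s (2 / a * r powr a) * exp (- (r powr a) / a)))"
proof -
  let ?A = "laguerre_poly l s"
  define U where "U r = 2 / a * r powr a" for r
  define Q0 where "Q0 u = poly ?A u * exp (- u / 2)" for u
  define Q1 where "Q1 u = (poly (pderiv ?A) u - poly ?A u / 2) * exp (- u / 2)" for u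
  define Q2 where "Q2 u = (poly (pderiv (pderiv ?A)) u - poly (pderiv ?A) u + poly ?A u / 4) * exp (- u / 2)" for u
  define h1 where "h1 r = a * U r * Q1 (U r) / r\<^sup>2" for r
  define h2 where "h2 r = (a * (a * U r) * Q1 (U r) + a * U r * (Q2 (U r) * (a * U r)) - 2 * (a * U r * Q1 (U r))) / r ^ 4" for r
  have h: "laguerre l s (2 / a * r powr a) * exp (- (r powr a) / a) = Q0 (U r)" for r
    by (simp add: Q0_def U_def poly_laguerre_poly)
  have dexp: "((\<lambda>u. exp (- u / 2)) has_real_derivative - exp (- u / 2) / 2) (at u)" for u :: real
    by (auto intro!: derivative_eq_intros)
  have dA: "((\<lambda>u. poly f u) has_real_derivative poly (pderiv f) u) (at u)" for f :: "real poly" and u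
    by (rule poly_DERIV)
  have Q0: "(Q0 has_real_derivative Q1 u) (at u)" for u
    using DERIV_mult[OF dA[of ?A u] dexp[of u]] unfolding Q0_def[abs_def] Q1_def by (simp add: algebra_simps)
  have Q1: "(Q1 has_real_derivative Q2 u) (at u)" for u
    using DERIV_mult[OF DERIV_diff[OF dA[of "pderiv ?A" u] DERIV_cdivide[OF dA[of ?A u], of 2]] dexp[of u]]
    unfolding Q1_def[abs_def] Q2_def by (simp add: algebra_simps)
  have U: "(U has_real_derivative a * U r / r) (at r)" if "r > 0" for r
  proof -
    have "(U has_real_derivative 2 / a * (a * r powr (a - 1))) (at r)"
      unfolding U_def[abs_def] by (rule DERIV_cmult[OF has_real_derivative_powr[OF that]])
    moreover have "2 / a * (a * r powr (a - 1)) = a * U r / r"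
      using that a by (simp add: U_def powr_diff)
    ultimately show ?thesis by simp
  qed
  have "radial_pair (\<lambda>r. Q0 (U r)) h1"
    unfolding radial_pair_def
  proof (intro allI impI)
    fix r :: real assume r: "r > 0"
    have "Q1 (U r) * (a * U r / r) = r * h1 r" using r by (simp add: h1_def power2_eq_square)
    with DERIV_chain2[OF Q0 U[OF r]] show "((\<lambda>r. Q0 (U r)) has_real_derivative r * h1 r) (at r)" by simp
  qed
  moreover have "radial_pair h1 h2"
    unfolding radial_pair_def
  proof (intro allI impI)
    fix r :: real assume r: "r > 0"
    let ?G = "\<lambda>r. a * U r * Q1 (U r)" and ?G' = "a * (a * U r / r) * Q1 (U r) + Q2 (U r) * (a * U r / r) * (a * U r)"
    have "(?G has_real_derivative ?G') (at r)"
      by (rule DERIV_mult[OF DERIV_cmult[OF U[OF r]] DERIV_chain2[OF Q1 U[OF r]]])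
    moreover have "((\<lambda>r. r\<^sup>2) has_real_derivative 2 * r) (at r)" by (auto intro!: derivative_eq_intros)
    ultimately have "(h1 has_real_derivative (?G' * r\<^sup>2 - ?G r * (2 * r)) / (r\<^sup>2 * r\<^sup>2)) (at r)"
      unfolding h1_def[abs_def] by (rule DERIV_divide) (use r in simp)
    moreover have "(?G' * r\<^sup>2 - ?G r * (2 * r)) / (r\<^sup>2 * r\<^sup>2) = r * h2 r"
      using r by (simp add: h2_def field_simps power2_eq_square power4_eq_xxxx)
    ultimately show "(h1 has_real_derivative r * h2 r) (at r)" by simp
  qed
  moreover have "r powr (2 - a) * (h1 r * D + r\<^sup>2 * h2 r) - r powr a * Q0 (U r) = - a * (2 * real l + s + 1) * Q0 (U r)"
    if r: "r > 0" for r
  proof -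
    have 1: "h1 r * D + r\<^sup>2 * h2 r = a\<^sup>2 * U r * ((s + 1) * Q1 (U r) + U r * Q2 (U r)) / r\<^sup>2"
      using r by (simp add: h1_def h2_def D_def field_simps power2_eq_square power4_eq_xxxx)
    have rU: "r powr (2 - a) * U r = 2 / a * r\<^sup>2"
    proof -
      have "r powr (2 - a) * r powr a = r\<^sup>2" using r by (simp add: powr_add[symmetric] powr_numeral)
      then show ?thesis unfolding U_def by (simp add: mult.left_commute)
    qed
    have "r powr (2 - a) * (h1 r * D + r\<^sup>2 * h2 r) = (r powr (2 - a) * U r) * (a\<^sup>2 * ((s + 1) * Q1 (U r) + U r * Q2 (U r)) / r\<^sup>2)"
      unfolding 1 by simp
    also have "\<dots> = 2 * a * ((s + 1) * Q1 (U r) + U r * Q2 (U r))"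
      unfolding rU using r a by (simp add: power2_eq_square)
    also have "(s + 1) * Q1 (U r) + U r * Q2 (U r) =
       (U r * poly (pderiv (pderiv ?A)) (U r) + (s + 1 - U r) * poly (pderiv ?A) (U r) - (s + 1) / 2 * poly ?A (U r) + U r / 4 * poly ?A (U r)) * exp (- U r / 2)"
      unfolding Q1_def Q2_def by (simp add: field_simps)
    also have "\<dots> = (- real l - (s + 1) / 2 + U r / 4) * Q0 (U r)"
      unfolding laguerre_ode Q0_def by (simp add: algebra_simps)
    finally have F: "r powr (2 - a) * (h1 r * D + r\<^sup>2 * h2 r) = 2 * a * ((- real l - (s + 1) / 2 + U r / 4) * Q0 (U r))" .
    have A: "r powr a = a / 2 * U r" using a by (simp add: U_def)
    show ?thesis unfolding F A by (simp add: field_simps)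
  qed
  ultimately show ?thesis unfolding h by blast
qed

context dunkl_setting
begin

definition eigenval :: "nat \<Rightarrow> nat \<Rightarrow> real" where
  "eigenval l m = - a * (2 * real l + lambda_kam P k a m + 1)"

text \<open>Enough regularity for \<open>\<Delta>\<^sub>k\<close> to be additive at a point. Nothing is asked at the origin, where
  \<open>|x|\<^bsup>a\<^esup>\<close> may fail to be differentiable.\<close>

definition twice_dunkl :: "(real ^ 'n \<Rightarrow> complex) \<Rightarrow> bool" where
  "twice_dunkl f \<longleftrightarrow> (\<forall>x. x \<noteq> 0 \<longrightarrow> f differentiable (at x) \<and> (\<forall>\<xi>. dunkl_op P k \<xi> f differentiable (at x)))"

lemma differentiable_transform_nonzero:
  fixes f g :: "real ^ 'n \<Rightarrow> complex"
  assumes "x \<noteq> 0" "f differentiable (at x)" "\<And>y. y \<noteq> 0 \<Longrightarrow> f y = g y"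
  shows "g differentiable (at x)"
proof -
  obtain f' where "(f has_derivative f') (at x)" using assms(2) by (auto simp: differentiable_def)
  then have "(g has_derivative f') (at x)"
    by (rule has_derivative_transform_within_open[of _ _ _ _ "- {0}"]) (use assms in auto)
  then show ?thesis by (auto simp: differentiable_def)
qed

lemma twice_dunkl_add:
  assumes "twice_dunkl f" "twice_dunkl g"
  shows "twice_dunkl (\<lambda>x. f x + g x)"
    and "x \<noteq> 0 \<Longrightarrow> dunkl_laplacian P k (\<lambda>x. f x + g x) x = dunkl_laplacian P k f x + dunkl_laplacian P k g x"
proof -
  have T: "dunkl_op P k \<xi> (\<lambda>x. f x + g x) y = dunkl_op P k \<xi> f y + dunkl_op P k \<xi> g y" if "y \<noteq> 0" for \<xi> y
    by (rule dunkl_op_add) (use assms that in \<open>auto simp: twice_dunkl_def\<close>)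
  show "twice_dunkl (\<lambda>x. f x + g x)"
    unfolding twice_dunkl_def
  proof (intro allI impI conjI)
    fix x :: "real ^ 'n" and \<xi> assume x: "x \<noteq> 0"
    show "(\<lambda>x. f x + g x) differentiable (at x)" using assms x by (auto simp: twice_dunkl_def)
    show "dunkl_op P k \<xi> (\<lambda>x. f x + g x) differentiable (at x)"
      by (rule differentiable_transform_nonzero[OF x, of "\<lambda>y. dunkl_op P k \<xi> f y + dunkl_op P k \<xi> g y"])
         (use assms x T in \<open>auto simp: twice_dunkl_def intro!: differentiable_add\<close>)
  qed
  assume x: "x \<noteq> 0"
  have "dunkl_op P k \<xi> (dunkl_op P k \<xi> (\<lambda>x. f x + g x)) x = dunkl_op P k \<xi> (dunkl_op P k \<xi> f) x + dunkl_op P k \<xi> (dunkl_op P k \<xi> g) x" for \<xi>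
  proof -
    have "dunkl_op P k \<xi> (dunkl_op P k \<xi> (\<lambda>x. f x + g x)) x = dunkl_op P k \<xi> (\<lambda>y. dunkl_op P k \<xi> f y + dunkl_op P k \<xi> g y) x"
      by (rule dunkl_op_cong_nonzero[OF x T])
    also have "\<dots> = dunkl_op P k \<xi> (dunkl_op P k \<xi> f) x + dunkl_op P k \<xi> (dunkl_op P k \<xi> g) x"
      by (rule dunkl_op_add) (use assms x in \<open>auto simp: twice_dunkl_def\<close>)
    finally show ?thesis .
  qed
  then show "dunkl_laplacian P k (\<lambda>x. f x + g x) x = dunkl_laplacian P k f x + dunkl_laplacian P k g x"
    by (simp add: dunkl_laplacian_def sum.distrib)
qed

lemma twice_dunkl_scale:
  assumes "twice_dunkl f"
  shows "twice_dunkl (\<lambda>x. c * f x)"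
    and "x \<noteq> 0 \<Longrightarrow> dunkl_laplacian P k (\<lambda>x. c * f x) x = c * dunkl_laplacian P k f x"
proof -
  have T: "dunkl_op P k \<xi> (\<lambda>x. c * f x) y = c * dunkl_op P k \<xi> f y" if "y \<noteq> 0" for \<xi> y
    by (rule dunkl_op_scale) (use assms that in \<open>auto simp: twice_dunkl_def\<close>)
  show "twice_dunkl (\<lambda>x. c * f x)"
    unfolding twice_dunkl_def
  proof (intro allI impI conjI)
    fix x :: "real ^ 'n" and \<xi> assume x: "x \<noteq> 0"
    show "(\<lambda>x. c * f x) differentiable (at x)" using assms x by (auto simp: twice_dunkl_def)
    show "dunkl_op P k \<xi> (\<lambda>x. c * f x) differentiable (at x)"
      by (rule differentiable_transform_nonzero[OF x, of "\<lambda>y. c * dunkl_op P k \<xi> f y"])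
         (use assms x T in \<open>auto simp: twice_dunkl_def intro!: differentiable_mult\<close>)
  qed
  assume x: "x \<noteq> 0"
  have "dunkl_op P k \<xi> (dunkl_op P k \<xi> (\<lambda>x. c * f x)) x = c * dunkl_op P k \<xi> (dunkl_op P k \<xi> f) x" for \<xi>
  proof -
    have "dunkl_op P k \<xi> (dunkl_op P k \<xi> (\<lambda>x. c * f x)) x = dunkl_op P k \<xi> (\<lambda>y. c * dunkl_op P k \<xi> f y) x"
      by (rule dunkl_op_cong_nonzero[OF x T])
    also have "\<dots> = c * dunkl_op P k \<xi> (dunkl_op P k \<xi> f) x"
      by (rule dunkl_op_scale) (use assms x in \<open>auto simp: twice_dunkl_def\<close>)
    finally show ?thesis .
  qed
  then show "dunkl_laplacian P k (\<lambda>x. c * f x) x = c * dunkl_laplacian P k f x"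
    by (simp add: dunkl_laplacian_def sum_distrib_left)
qed

lemma twice_dunkl_radial:
  assumes p: "hpoly m p" and h: "radial_pair h h1" "radial_pair h1 h2"
  shows "twice_dunkl (\<lambda>x. complex_of_real (h (norm x)) * p x)"
  unfolding twice_dunkl_def
proof (intro allI impI conjI)
  fix x :: "real ^ 'n" and \<xi> assume x: "x \<noteq> 0"
  have pd: "p differentiable (at y)" for y by (rule hpoly_differentiable[OF p])
  show "(\<lambda>x. complex_of_real (h (norm x)) * p x) differentiable (at x)" by (rule radial_differentiable[OF h(1) x pd])
  show "dunkl_op P k \<xi> (\<lambda>x. complex_of_real (h (norm x)) * p x) differentiable (at x)"
  proof (rule differentiable_transform_nonzero[OF x])
    show "(\<lambda>y. complex_of_real (h (norm y)) * dunkl_op P k \<xi> p y + complex_of_real (h1 (norm y)) * (complex_of_real (y \<bullet> \<xi>) * p y)) differentiable (at x)"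
      by (intro differentiable_add radial_differentiable[OF h(1) x] radial_differentiable[OF h(2) x]
          hpoly_differentiable[OF lower_hpoly[OF hpoly_dunkl_op[OF p]]] hpoly_differentiable[OF hpoly_linear[OF p]])
    show "complex_of_real (h (norm y)) * dunkl_op P k \<xi> p y + complex_of_real (h1 (norm y)) * (complex_of_real (y \<bullet> \<xi>) * p y)
       = dunkl_op P k \<xi> (\<lambda>x. complex_of_real (h (norm x)) * p x) y" if "y \<noteq> 0" for y
      by (simp add: dunkl_op_radial[OF h(1) that pd] mult.assoc)
  qed
qed

lemma eigenfun_hamiltonian:
  assumes "p \<in> dunkl_harmonics P k m"
  shows "twice_dunkl (eigenfun l m p)"
    and "x \<noteq> 0 \<Longrightarrow> dunkl_hamiltonian P k a (eigenfun l m p) x = complex_of_real (eigenval l m) * eigenfun l m p x"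
proof -
  have hp: "hpoly m p" and lap: "\<And>x. dunkl_laplacian P k p x = 0" using assms by (auto simp: dunkl_harmonics_iff)
  let ?s = "lambda_kam P k a m"
  let ?h = "\<lambda>r. laguerre l ?s (2 / a * r powr a) * exp (- (r powr a) / a)"
  obtain h1 h2 where h: "radial_pair ?h h1" "radial_pair h1 h2"
    "\<And>r. r > 0 \<Longrightarrow> r powr (2 - a) * (h1 r * (a * ?s + 2) + r\<^sup>2 * h2 r) - r powr a * ?h r = - a * (2 * real l + ?s + 1) * ?h r"
    using radial_pair_laguerre[OF a_pos, of l ?s] by blast
  have eq: "eigenfun l m p = (\<lambda>x. complex_of_real (?h (norm x)) * p x)" by (simp add: eigenfun_def fun_eq_iff)
  show "twice_dunkl (eigenfun l m p)" unfolding eq by (rule twice_dunkl_radial[OF hp h(1,2)])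
  assume x: "x \<noteq> 0"
  then have nx: "0 < norm x" by simp
  have D: "a * ?s + 2 = 2 * real m + real CARD('n) + 2 * K" using a_pos by (simp add: lambda_kam_def)
  have "dunkl_hamiltonian P k a (eigenfun l m p) x =
      complex_of_real (norm x powr (2 - a)) * (complex_of_real (h1 (norm x) * (a * ?s + 2) + (norm x)\<^sup>2 * h2 (norm x)) * p x)
      - complex_of_real (norm x powr a) * (complex_of_real (?h (norm x)) * p x)"
    unfolding dunkl_hamiltonian_def eq D dunkl_laplacian_radial[OF zero_notin_P hp h(1,2) x] lap
    by (simp only: mult_zero_right add_0)
  also have "\<dots> = complex_of_real (norm x powr (2 - a) * (h1 (norm x) * (a * ?s + 2) + (norm x)\<^sup>2 * h2 (norm x)) - norm x powr a * ?h (norm x)) * p x"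
    by (simp only: of_real_mult of_real_diff left_diff_distrib mult.assoc)
  also have "\<dots> = complex_of_real (eigenval l m) * eigenfun l m p x"
    unfolding h(3)[OF nx] eq eigenval_def by (simp only: of_real_mult mult.assoc)
  finally show "dunkl_hamiltonian P k a (eigenfun l m p) x = complex_of_real (eigenval l m) * eigenfun l m p x" .
qed

lemma hamiltonian_sum:
  assumes "finite I" "\<And>i. i \<in> I \<Longrightarrow> twice_dunkl (f i)"
  shows "twice_dunkl (\<lambda>x. \<Sum>i\<in>I. c i * f i x) \<and> (\<forall>x. x \<noteq> 0 \<longrightarrow>
      dunkl_hamiltonian P k a (\<lambda>x. \<Sum>i\<in>I. c i * f i x) x = (\<Sum>i\<in>I. c i * dunkl_hamiltonian P k a (f i) x))"
  using assms
proof (induction I)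
  case empty
  show ?case by (simp add: twice_dunkl_def dunkl_op_zero dunkl_hamiltonian_def dunkl_laplacian_def)
next
  case (insert i I)
  have IH: "twice_dunkl (\<lambda>x. \<Sum>i\<in>I. c i * f i x)"
    "\<And>x. x \<noteq> 0 \<Longrightarrow> dunkl_hamiltonian P k a (\<lambda>x. \<Sum>i\<in>I. c i * f i x) x = (\<Sum>i\<in>I. c i * dunkl_hamiltonian P k a (f i) x)"
    using insert by auto
  have fi: "twice_dunkl (f i)" using insert.prems by simp
  note add = twice_dunkl_add[OF twice_dunkl_scale(1)[OF fi, of "c i"] IH(1)]
  have eq: "(\<lambda>x. \<Sum>i\<in>insert i I. c i * f i x) = (\<lambda>x. c i * f i x + (\<Sum>i\<in>I. c i * f i x))" using insert.hyps by simp
  have "dunkl_hamiltonian P k a (\<lambda>x. c i * f i x + (\<Sum>i\<in>I. c i * f i x)) x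
      = c i * dunkl_hamiltonian P k a (f i) x + dunkl_hamiltonian P k a (\<lambda>x. \<Sum>i\<in>I. c i * f i x) x" if x: "x \<noteq> 0" for x
    unfolding dunkl_hamiltonian_def add(2)[OF x] twice_dunkl_scale(2)[OF fi x] by (simp add: algebra_simps)
  then show ?case unfolding eq using add(1) IH(2) insert.hyps by simp
qed

end

section \<open>Totality of the eigenfunctions\<close>

text \<open>Both kinds of exponents in the theorem are those with an integral quotient \<open>2/a\<close>; they differ in
  its parity.\<close>

locale dunkl_integral = dunkl_setting R P k a
  for R P :: "(real ^ 'n) set" and k :: "real ^ 'n \<Rightarrow> real" and a :: real +
  fixes N0 :: nat
  assumes N0: "a * real N0 = 2"
begin

lemma N0_pos: "N0 > 0" using N0 by (cases N0) auto

lemma u_power: "u x ^ (N0 * j) = norm x ^ (2 * j)"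
proof -
  have "u x ^ N0 = (norm x)\<^sup>2"
  proof (cases "x = 0")
    case False
    have "u x ^ N0 = u x powr real N0" using False by (simp add: powr_realpow)
    also have "\<dots> = norm x powr 2" by (simp add: powr_powr N0)
    finally show ?thesis by (simp add: powr_numeral)
  qed (use N0_pos in auto)
  then show ?thesis by (simp add: power_mult)
qed

lemma radial_exp_add: "radial_exp p (f + g) c x = radial_exp p f c x + radial_exp p g c x"
  by (simp add: radial_exp_def algebra_simps)

lemma radial_exp_smult: "radial_exp p (smult b f) c x = complex_of_real b * radial_exp p f c x"
  by (simp add: radial_exp_def algebra_simps)

text \<open>The Laguerre polynomials of degree below \<open>n\<close> span all polynomials of degree below \<open>n\<close>: the leading
  coefficient can be removed by a multiple of one of them.\<close>

lemma annihilates_laguerre_span: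
  assumes f: "f \<in> l2 M" and q: "q \<in> dunkl_harmonics P k m"
    and z: "\<And>l. l2_inner M f (eigenfun l m q) = 0"
  shows "l2_inner M f (radial_exp q g (1 / a)) = 0"
proof -
  have hq: "hpoly m q" using q by (simp add: dunkl_harmonics_iff)
  have c: "1 / a > 0" using a_pos by simp
  let ?s = "lambda_kam P k a m"
  let ?e = "\<lambda>g. radial_exp q (pcompose g [:0, 2 / a:]) (1 / a)"
  note l2 = radial_exp_l2[OF hq c]
  have add: "l2_inner M f (?e (g + smult b h)) = l2_inner M f (?e g) + complex_of_real b * l2_inner M f (?e h)" for g h b
  proof -
    have "?e (g + smult b h) = (\<lambda>x. ?e g x + complex_of_real b * ?e h x)"
      by (rule ext) (simp only: pcompose_add pcompose_smult radial_exp_add radial_exp_smult)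
    then show ?thesis by (simp add: l2_inner_add_right[OF l2 l2_scale[OF l2] f] l2_inner_scale_right)
  qed
  have L: "l2_inner M f (?e (laguerre_poly l ?s)) = 0" for l using z[of l] by (simp add: eigenfun_radial_exp)
  have main: "l2_inner M f (?e g) = 0" if "\<And>i. i \<ge> n \<Longrightarrow> coeff g i = 0" for n g
    using that
  proof (induction n arbitrary: g)
    case 0
    then have "g = 0" by (simp add: poly_eq_iff)
    then show ?case by (simp add: radial_exp_def l2_inner_zero)
  next
    case (Suc n)
    let ?b = "coeff g n / coeff (laguerre_poly n ?s) n"
    have nz: "coeff (laguerre_poly n ?s) n \<noteq> 0" by (simp add: coeff_laguerre_poly)
    have "l2_inner M f (?e (g + smult (- ?b) (laguerre_poly n ?s))) = 0"
    proof (rule Suc.IH)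
      fix i assume "n \<le> i"
      then show "coeff (g + smult (- ?b) (laguerre_poly n ?s)) i = 0"
        using Suc.prems[of i] nz by (cases "i = n") (auto simp: coeff_laguerre_poly)
    qed
    then show ?case unfolding add L by simp
  qed
  let ?g = "pcompose g [:0, a / 2:]"
  have "radial_exp q g (1 / a) = ?e ?g" using a_pos by (simp add: fun_eq_iff radial_exp_def poly_pcompose)
  moreover have "l2_inner M f (?e ?g) = 0"
    by (rule main[of "Suc (degree ?g)"]) (simp add: coeff_eq_0)
  ultimately show ?thesis by simp
qed

definition annihilates :: "(real ^ 'n \<Rightarrow> complex) \<Rightarrow> real \<Rightarrow> bool" where
  "annihilates f c \<longleftrightarrow> (\<forall>m p g. hpoly m p \<longrightarrow> l2_inner M f (radial_exp p g c) = 0)"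

definition harmonic_part :: "('n \<Rightarrow> nat) \<Rightarrow> nat \<Rightarrow> real ^ 'n \<Rightarrow> complex" where
  "harmonic_part \<beta> = (SOME H. (\<forall>j. H j \<in> dunkl_harmonics P k (sum \<beta> UNIV - 2 * j)) \<and>
     (\<forall>x. monomial \<beta> x = (\<Sum>j\<le>sum \<beta> UNIV. complex_of_real (norm x ^ (2 * j)) * H j x)))"

lemma harmonic_part:
  "harmonic_part \<beta> j \<in> dunkl_harmonics P k (sum \<beta> UNIV - 2 * j)"
  "monomial \<beta> x = (\<Sum>j\<le>sum \<beta> UNIV. complex_of_real (norm x ^ (2 * j)) * harmonic_part \<beta> j x)"
proof -
  have "\<exists>H. (\<forall>j. H j \<in> dunkl_harmonics P k (sum \<beta> UNIV - 2 * j)) \<and>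
     (\<forall>x. monomial \<beta> x = (\<Sum>j\<le>sum \<beta> UNIV. complex_of_real (norm x ^ (2 * j)) * H j x))"
    using harmonic_decomposition[OF zero_notin_P K_nonneg hpoly_monomial] by blast
  from someI_ex[OF this] show "harmonic_part \<beta> j \<in> dunkl_harmonics P k (sum \<beta> UNIV - 2 * j)"
    "monomial \<beta> x = (\<Sum>j\<le>sum \<beta> UNIV. complex_of_real (norm x ^ (2 * j)) * harmonic_part \<beta> j x)"
    unfolding harmonic_part_def by blast+
qed

text \<open>Even powers of the norm in the harmonic decomposition are polynomials in \<open>|x|\<^bsup>a\<^esup>\<close>, since \<open>2/a\<close> is an
  integer.\<close>

lemma annihilates_start:
  assumes f: "f \<in> l2 M"
    and z: "\<And>\<beta> j l. l2_inner M f (eigenfun l (sum \<beta> UNIV - 2 * j) (harmonic_part \<beta> j)) = 0"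
  shows "annihilates f (1 / a)"
  unfolding annihilates_def
proof (intro allI impI)
  fix m g and p :: "real ^ 'n \<Rightarrow> complex" assume p: "hpoly m p"
  have c: "1 / a > 0" using a_pos by simp
  have mono: "l2_inner M f (radial_exp (monomial \<beta>) g (1 / a)) = 0" for \<beta>
  proof -
    let ?r = "\<lambda>j. radial_exp (harmonic_part \<beta> j) (g * monom 1 (N0 * j)) (1 / a)"
    have "radial_exp (monomial \<beta>) g (1 / a) x = (\<Sum>j\<le>sum \<beta> UNIV. 1 * ?r j x)" for x
      unfolding radial_exp_def harmonic_part(2) sum_distrib_right
      by (rule sum.cong[OF refl])
         (simp only: poly_mult poly_monom u_power of_real_mult mult_1_left, simp only: mult_ac)
    then have eq: "radial_exp (monomial \<beta>) g (1 / a) = (\<lambda>x. \<Sum>j\<le>sum \<beta> UNIV. 1 * ?r j x)" by (rule ext)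
    have rl2: "?r j \<in> l2 M" for j
      by (rule radial_exp_l2[OF conjunct1[OF harmonic_part(1)[unfolded dunkl_harmonics_iff]] c])
    have "l2_inner M (\<lambda>x. \<Sum>j\<le>sum \<beta> UNIV. 1 * ?r j x) f = (\<Sum>j\<le>sum \<beta> UNIV. 1 * l2_inner M (?r j) f)"
      by (rule l2_inner_sum_left[OF rl2 f])
    also have "\<dots> = 0"
    proof (intro sum.neutral ballI)
      fix j
      have "l2_inner M f (?r j) = 0" by (rule annihilates_laguerre_span[OF f harmonic_part(1) z])
      from l2_inner_zero_commute[OF this] show "1 * l2_inner M (?r j) f = 0" by simp
    qed
    finally show ?thesis unfolding eq by (rule l2_inner_zero_commute)
  qed
  obtain b where b: "\<And>x. p x = (\<Sum>\<beta> | sum \<beta> UNIV = m. b \<beta> * monomial \<beta> x)"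
    using p unfolding homogeneous_poly_iff_hpoly[symmetric] homogeneous_poly_def monomial_def by blast
  have "radial_exp p g (1 / a) x = (\<Sum>\<beta> | sum \<beta> UNIV = m. b \<beta> * radial_exp (monomial \<beta>) g (1 / a) x)" for x
    unfolding radial_exp_def b sum_distrib_right by (simp add: mult.assoc)
  then have eq: "radial_exp p g (1 / a) = (\<lambda>x. \<Sum>\<beta> | sum \<beta> UNIV = m. b \<beta> * radial_exp (monomial \<beta>) g (1 / a) x)" by (rule ext)
  have "l2_inner M (radial_exp p g (1 / a)) f = (\<Sum>\<beta> | sum \<beta> UNIV = m. b \<beta> * l2_inner M (radial_exp (monomial \<beta>) g (1 / a)) f)"
    unfolding eq by (rule l2_inner_sum_left[OF radial_exp_l2[OF hpoly_monomial c] f])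
  also have "\<dots> = 0"
    using l2_inner_zero_commute[OF mono] by simp
  finally show "l2_inner M f (radial_exp p g (1 / a)) = 0" by (rule l2_inner_zero_commute)
qed

text \<open>Expand \<open>exp ((c - c') |x|\<^bsup>a\<^esup>)\<close>: its partial sums are polynomials and are dominated by
  \<open>exp (|c - c'| |x|\<^bsup>a\<^esup>)\<close>, which the factor \<open>exp (-c |x|\<^bsup>a\<^esup>)\<close> absorbs as long as \<open>0 < c' < 2 c\<close>.\<close>

lemma annihilates_extend:
  assumes f: "f \<in> l2 M" and A: "annihilates f c" and c: "0 < c" "0 < c'" "c' < 2 * c"
  shows "annihilates f c'"
  unfolding annihilates_def
proof (intro allI impI)
  fix m g and p :: "real ^ 'n \<Rightarrow> complex" assume p: "hpoly m p"
  define d where "d = c - c'"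
  have cd: "c - \<bar>d\<bar> > 0" using c by (auto simp: d_def abs_if)
  define S where "S n = g * (\<Sum>i<n. monom (d ^ i / fact i) i)" for n
  have S: "poly (S n) t = poly g t * (\<Sum>i<n. (d * t) ^ i / fact i)" for n t
    by (simp add: S_def poly_sum poly_monom power_mult_distrib)
  let ?s = "\<lambda>n. radial_exp p (S n) c" and ?l = "radial_exp p g c'" and ?w = "radial_exp p g (c - \<bar>d\<bar>)"
  have sl2: "?s n \<in> l2 M" for n by (rule radial_exp_l2[OF p c(1)])
  have ll2: "?l \<in> l2 M" by (rule radial_exp_l2[OF p c(2)])
  have wl2: "?w \<in> l2 M" by (rule radial_exp_l2[OF p cd])
  note [measurable] = l2D(1)[OF f] l2D(1)[OF sl2] l2D(1)[OF ll2]
  have conv: "(\<lambda>n. \<Sum>i<n. t ^ i / fact i) \<longlonglongrightarrow> exp t" for t :: real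
    using exp_converges[of t] by (simp add: sums_def divide_inverse mult.commute)
  have bound: "\<bar>\<Sum>i<n. t ^ i / fact i\<bar> \<le> exp \<bar>t\<bar>" for t :: real and n
  proof -
    have "\<bar>\<Sum>i<n. t ^ i / fact i\<bar> \<le> (\<Sum>i<n. \<bar>t ^ i / fact i\<bar>)" by (rule sum_abs)
    also have "\<dots> = (\<Sum>i<n. \<bar>t\<bar> ^ i / fact i)" by (simp add: power_abs)
    also have "\<dots> \<le> exp \<bar>t\<bar>"
    proof (rule LIMSEQ_le_const[OF conv], intro exI allI impI)
      fix N assume "n \<le> N"
      then show "(\<Sum>i<n. \<bar>t\<bar> ^ i / fact i) \<le> (\<Sum>i<N. \<bar>t\<bar> ^ i / fact i)" by (intro sum_mono2) auto
    qed
    finally show ?thesis .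
  qed
  have "(\<lambda>n. \<integral>x. f x * cnj (?s n x) \<partial>M) \<longlonglongrightarrow> (\<integral>x. f x * cnj (?l x) \<partial>M)"
  proof (rule integral_dominated_convergence[where w="\<lambda>x. cmod (f x * cnj (?w x))"])
    show "integrable M (\<lambda>x. cmod (f x * cnj (?w x)))" by (intro integrable_norm l2_prod_integrable f wl2)
    show "AE x in M. (\<lambda>n. f x * cnj (?s n x)) \<longlonglongrightarrow> f x * cnj (?l x)"
    proof (rule AE_I2)
      fix x
      have "(\<lambda>n. poly (S n) (u x) * exp (- (c * u x))) \<longlonglongrightarrow> poly g (u x) * exp (d * u x) * exp (- (c * u x))"
        unfolding S by (intro tendsto_intros conv)
      moreover have "poly g (u x) * exp (d * u x) * exp (- (c * u x)) = poly g (u x) * exp (- (c' * u x))"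
        by (simp add: d_def mult.assoc algebra_simps flip: exp_add)
      ultimately have "(\<lambda>n. poly (S n) (u x) * exp (- (c * u x))) \<longlonglongrightarrow> poly g (u x) * exp (- (c' * u x))" by (simp only:)
      from tendsto_of_real[OF this] show "(\<lambda>n. f x * cnj (?s n x)) \<longlonglongrightarrow> f x * cnj (?l x)"
        unfolding radial_exp_def by (intro tendsto_mult tendsto_const tendsto_cnj)
    qed
    show "AE x in M. norm (f x * cnj (?s n x)) \<le> cmod (f x * cnj (?w x))" for n
    proof (rule AE_I2)
      fix x
      have "\<bar>poly (S n) (u x) * exp (- (c * u x))\<bar> \<le> \<bar>poly g (u x) * exp (- ((c - \<bar>d\<bar>) * u x))\<bar>"
      proof -
        have "\<bar>\<Sum>i<n. (d * u x) ^ i / fact i\<bar> * exp (- (c * u x)) \<le> exp \<bar>d * u x\<bar> * exp (- (c * u x))"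
          by (intro mult_right_mono bound) simp
        also have "\<dots> = exp (- ((c - \<bar>d\<bar>) * u x))" by (simp add: abs_mult algebra_simps flip: exp_add)
        finally have "\<bar>poly g (u x)\<bar> * (\<bar>\<Sum>i<n. (d * u x) ^ i / fact i\<bar> * exp (- (c * u x))) \<le> \<bar>poly g (u x)\<bar> * exp (- ((c - \<bar>d\<bar>) * u x))"
          by (rule mult_left_mono) simp
        then show ?thesis unfolding S by (simp add: abs_mult mult.assoc)
      qed
      then have "cmod (?s n x) \<le> cmod (?w x)"
        unfolding radial_exp_def norm_mult norm_of_real by (intro mult_left_mono) auto
      then show "norm (f x * cnj (?s n x)) \<le> cmod (f x * cnj (?w x))"
        by (simp add: norm_mult mult_left_mono)
    qed
  qed measurable
  moreover have "(\<integral>x. f x * cnj (?s n x) \<partial>M) = 0" for n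
    using A p unfolding annihilates_def l2_inner_def by blast
  ultimately have "(\<lambda>n::nat. 0) \<longlonglongrightarrow> (\<integral>x. f x * cnj (?l x) \<partial>M)" by (simp only:)
  from LIMSEQ_unique[OF this tendsto_const] show "l2_inner M f ?l = 0" unfolding l2_inner_def .
qed

lemma annihilates_all:
  assumes f: "f \<in> l2 M" and A: "annihilates f c0" and c0: "0 < c0" and c: "0 < c"
  shows "annihilates f c"
proof -
  have up: "annihilates f (c0 * (3/2) ^ n)" for n
  proof (induction n)
    case (Suc n)
    show ?case by (rule annihilates_extend[OF f Suc.IH]) (use c0 in auto)
  qed (use A in simp)
  obtain n where "c / c0 < (3/2) ^ n" using real_arch_pow[of "3/2" "c / c0"] by auto
  then have "c < c0 * (3/2) ^ n" using c0 by (simp add: field_simps)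
  moreover have "0 < c0 * (3/2) ^ n" using c0 by simp
  ultimately show ?thesis by (intro annihilates_extend[OF f up[of n]]) (use c in linarith)+
qed

text \<open>The algebra generated by the components of \<open>exp (-|x|\<^bsup>a\<^esup>) x\<close> and by \<open>exp (-|x|\<^bsup>a\<^esup>)\<close> consists of such
  functions.\<close>

inductive exp_poly :: "(real ^ 'n \<Rightarrow> complex) \<Rightarrow> bool" where
  exp_poly_base: "hpoly m p \<Longrightarrow> exp_poly (\<lambda>x. p x * complex_of_real (exp (- (real n * u x))))"
| exp_poly_add: "exp_poly f \<Longrightarrow> exp_poly g \<Longrightarrow> exp_poly (\<lambda>x. f x + g x)"

lemma exp_poly_mult: "exp_poly f \<Longrightarrow> exp_poly g \<Longrightarrow> exp_poly (\<lambda>x. f x * g x)"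
proof (induction rule: exp_poly.induct)
  case (exp_poly_base m p n)
  note p = this(1)
  from exp_poly_base(2) show ?case
  proof (induction rule: exp_poly.induct)
    case (exp_poly_base m' q n')
    have "exp_poly (\<lambda>x. (p x * q x) * complex_of_real (exp (- (real (n + n') * u x))))"
      by (rule exp_poly.exp_poly_base[OF hpoly_mult[OF p exp_poly_base]])
    moreover have "exp (- (real (n + n') * u x)) = exp (- (real n * u x)) * exp (- (real n' * u x))" for x
      by (simp add: distrib_right flip: exp_add)
    ultimately show ?case by (simp only: of_real_mult mult_ac)
  next
    case (exp_poly_add f g)
    then show ?case using exp_poly.exp_poly_add by (simp add: distrib_left)
  qed
next
  case (exp_poly_add f g')
  then show ?case using exp_poly.exp_poly_add by (simp add: distrib_right)
qed

text \<open>A bounded injective map: \<open>x\<close> is the quotient of the components. Polynomials on its image can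
  therefore approximate continuous functions uniformly, although \<open>x\<close> itself is unbounded.\<close>

definition Phi :: "real ^ 'n \<Rightarrow> (real ^ 'n) \<times> real" where
  "Phi x = (exp (- u x) *\<^sub>R x, exp (- u x))"

lemma Phi_measurable [measurable]: "Phi \<in> borel_measurable borel"
  unfolding Phi_def[abs_def] by measurable

lemma exp_poly_Phi: "real_polynomial_function q \<Longrightarrow> exp_poly (\<lambda>x. complex_of_real (q (Phi x)))"
proof (induction rule: real_polynomial_function.induct)
  case (linear L)
  define w where "w = (\<Sum>b\<in>Basis. L b *\<^sub>R b)"
  have L: "L z = z \<bullet> w" for z
  proof -
    have "L z = L (\<Sum>b\<in>Basis. (z \<bullet> b) *\<^sub>R b)" by (simp add: euclidean_representation)
    also have "\<dots> = (\<Sum>b\<in>Basis. (z \<bullet> b) *\<^sub>R L b)"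
      using bounded_linear.linear[OF linear] by (simp add: linear_sum linear_cmul)
    finally show ?thesis by (simp add: w_def inner_sum_right mult.commute)
  qed
  have "exp_poly (\<lambda>x. (complex_of_real (x \<bullet> fst w) * 1) * complex_of_real (exp (- (real 1 * u x))) + complex_of_real (snd w) * complex_of_real (exp (- (real 1 * u x))))"
    by (rule exp_poly_add[OF exp_poly_base[OF hpoly_linear[OF hpoly_const]] exp_poly_base[OF hpoly_const]])
  then show ?case by (simp add: L Phi_def inner_prod_def algebra_simps)
next
  case (const c)
  have "exp_poly (\<lambda>x. complex_of_real c * complex_of_real (exp (- (real 0 * u x))))"
    by (rule exp_poly_base[OF hpoly_const])
  then show ?case by simp
qed (auto intro: exp_poly_add exp_poly_mult)

lemma Phi_bounded: "norm (Phi x) \<le> 2 + fact N0"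
proof -
  have e: "exp (- u x) \<le> 1" by simp
  have "norm x \<le> 1 + (norm x)\<^sup>2"
  proof -
    have "2 * norm x * 1 \<le> (norm x)\<^sup>2 + 1\<^sup>2" by (rule sum_squares_bound)
    moreover have "0 \<le> norm x" by simp
    ultimately show ?thesis by (simp only: one_power2)
  qed
  then have "exp (- u x) * norm x \<le> exp (- u x) * (1 + u x ^ N0)"
    using u_power[of x 1] by (intro mult_left_mono) auto
  also have "\<dots> \<le> 1 + fact N0"
  proof -
    have "(\<Sum>i\<in>{N0}. u x ^ i /\<^sub>R fact i) \<le> (\<Sum>i. u x ^ i /\<^sub>R fact i)"
      using exp_converges[of "u x"] by (intro sum_le_suminf) (auto simp: sums_iff)
    also have "\<dots> = exp (u x)" using exp_converges[of "u x"] by (simp add: sums_iff)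
    finally have "u x ^ N0 / fact N0 \<le> exp (u x)" by (simp add: divide_inverse mult.commute)
    then have "u x ^ N0 * exp (- u x) \<le> fact N0" by (simp add: exp_minus field_simps)
    from add_mono[OF e this] show ?thesis by (simp add: algebra_simps)
  qed
  finally have fin: "norm (exp (- u x) *\<^sub>R x) \<le> 1 + fact N0" by simp
  have "norm (Phi x) \<le> norm (exp (- u x) *\<^sub>R x) + exp (- u x)"
    using norm_Pair_le[of "exp (- u x) *\<^sub>R x" "exp (- u x)"] unfolding Phi_def by simp
  then show ?thesis using fin e by linarith
qed

text \<open>The complex measure with density \<open>F = f exp (-|x|\<^bsup>a\<^esup>)\<close> annihilates all polynomials in \<open>Phi\<close>, then by the
  Weierstrass theorem all continuous functions of \<open>Phi\<close>, then the indicators of preimages of closed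
  sets and of Borel sets. By injectivity of \<open>Phi\<close> these are all Borel sets, so \<open>F = 0\<close>.\<close>

theorem annihilates_imp_zero:
  assumes f: "f \<in> l2 M" and A: "\<And>c. c > 0 \<Longrightarrow> annihilates f c"
  shows "l2_eq M f (\<lambda>x. 0)"
proof -
  note [measurable] = l2D(1)[OF f]
  define F where "F x = f x * complex_of_real (exp (- u x))" for x
  have Fm[measurable]: "F \<in> borel_measurable M" unfolding F_def by measurable
  have base: "integrable M (\<lambda>x. F x * (p x * complex_of_real (exp (- (real n * u x))))) \<and>
      (\<integral>x. F x * (p x * complex_of_real (exp (- (real n * u x)))) \<partial>M) = 0" if p: "hpoly m p" for m p n
  proof -
    let ?r = "radial_exp (\<lambda>x. cnj (p x)) 1 (real n + 1)"
    have eq: "F x * (p x * complex_of_real (exp (- (real n * u x)))) = f x * cnj (?r x)" for x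
    proof -
      have "exp (- ((real n + 1) * u x)) = exp (- u x) * exp (- (real n * u x))"
        by (simp add: distrib_right flip: exp_add)
      then show ?thesis by (simp add: F_def radial_exp_def)
    qed
    have "?r \<in> l2 M" by (rule radial_exp_l2[OF hpoly_cnj[OF p]]) simp
    moreover have "l2_inner M f ?r = 0" using A[of "real n + 1"] hpoly_cnj[OF p] unfolding annihilates_def by simp
    ultimately show ?thesis unfolding eq l2_inner_def using l2_prod_integrable(2)[OF f] by blast
  qed
  have poly0: "integrable M (\<lambda>x. F x * g x) \<and> (\<integral>x. F x * g x \<partial>M) = 0" if "exp_poly g" for g
    using that
  proof (induction rule: exp_poly.induct)
    case (exp_poly_base m p n)
    then show ?case by (rule base)
  next
    case (exp_poly_add f g)
    then show ?case by (simp add: distrib_left)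
  qed
  have Fi: "integrable M F"
    using base[OF hpoly_const[of 1], of 0] by simp
  have bounded_integrable: "integrable M (\<lambda>x. F x * complex_of_real (g x))"
    if [measurable]: "g \<in> borel_measurable borel" and b: "\<And>x. \<bar>g x\<bar> \<le> B" for g :: "real ^ 'n \<Rightarrow> real" and B
  proof (rule Bochner_Integration.integrable_bound[OF integrable_mult_right[OF integrable_norm[OF Fi], of B]])
    show "AE x in M. norm (F x * complex_of_real (g x)) \<le> norm (B * norm (F x))"
    proof (rule AE_I2)
      fix x
      have "norm (F x) * \<bar>g x\<bar> \<le> norm (F x) * B" by (intro mult_left_mono b) simp
      also have "\<dots> \<le> norm (B * norm (F x))" by (simp add: abs_mult mult.commute) (simp add: mult_right_mono)
      finally show "norm (F x * complex_of_real (g x)) \<le> norm (B * norm (F x))" by (simp add: norm_mult)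
    qed
  qed measurable
  have cont0: "(\<integral>x. F x * complex_of_real (G (Phi x)) \<partial>M) = 0" if G: "continuous_on UNIV G" for G :: "(real ^ 'n) \<times> real \<Rightarrow> real"
  proof -
    let ?K = "cball (0 :: (real ^ 'n) \<times> real) (2 + fact N0)"
    have PK: "Phi x \<in> ?K" for x using Phi_bounded[of x] by simp
    have GK: "continuous_on ?K G" using G continuous_on_subset by blast
    have Gm[measurable]: "G \<in> borel_measurable borel" using G by (rule borel_measurable_continuous_onI)
    let ?I = "\<integral>x. F x * complex_of_real (G (Phi x)) \<partial>M" and ?N = "\<integral>x. norm (F x) \<partial>M"
    obtain B where B0: "\<forall>y\<in>G ` ?K. norm y \<le> B"
      using compact_imp_bounded[OF compact_continuous_image[OF GK compact_cball]] unfolding bounded_iff by blast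
    have B: "\<bar>G z\<bar> \<le> B" if "z \<in> ?K" for z using bspec[OF B0 imageI[OF that]] by simp
    have Gi: "integrable M (\<lambda>x. F x * complex_of_real (G (Phi x)))"
      by (rule bounded_integrable[where B=B], measurable) (rule B[OF PK])
    have "cmod ?I \<le> e * ?N" if "e > 0" for e
    proof -
      obtain q where q: "real_polynomial_function q" "\<And>z. z \<in> ?K \<Longrightarrow> \<bar>G z - q z\<bar> < e"
        using Stone_Weierstrass_real_polynomial_function[OF compact_cball GK \<open>e > 0\<close>] by blast
      note q0 = poly0[OF exp_poly_Phi[OF q(1)]]
      have "?I = (\<integral>x. F x * complex_of_real (G (Phi x)) - F x * complex_of_real (q (Phi x)) \<partial>M)"
        using q0 Gi by simp
      also have "cmod \<dots> \<le> (\<integral>x. e * norm (F x) \<partial>M)"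
      proof (rule order_trans[OF Bochner_Integration.integral_norm_bound], rule integral_mono)
        show "integrable M (\<lambda>x. norm (F x * complex_of_real (G (Phi x)) - F x * complex_of_real (q (Phi x))))"
          using q0 Gi by (intro integrable_norm) simp
        show "integrable M (\<lambda>x. e * norm (F x))" using Fi by simp
        fix x
        have "F x * complex_of_real (G (Phi x)) - F x * complex_of_real (q (Phi x)) = F x * complex_of_real (G (Phi x) - q (Phi x))"
          by (simp add: algebra_simps)
        then have "norm (F x * complex_of_real (G (Phi x)) - F x * complex_of_real (q (Phi x))) = norm (F x) * \<bar>G (Phi x) - q (Phi x)\<bar>"
          by (simp only: norm_mult norm_of_real)
        also have "\<dots> \<le> norm (F x) * e" by (rule mult_left_mono[OF less_imp_le[OF q(2)[OF PK]] norm_ge_zero])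
        finally show "norm (F x * complex_of_real (G (Phi x)) - F x * complex_of_real (q (Phi x))) \<le> e * norm (F x)"
          by (simp add: mult.commute)
      qed
      finally show ?thesis by simp
    qed
    note le = this
    have N: "0 \<le> ?N" by (rule Bochner_Integration.integral_nonneg) simp
    have "cmod ?I \<le> 0"
    proof (rule field_le_epsilon)
      fix e :: real assume "e > 0"
      have N1: "0 < ?N + 1" using N by linarith
      have "cmod ?I \<le> e / (?N + 1) * ?N" by (rule le[OF divide_pos_pos[OF \<open>e > 0\<close> N1]])
      also have "\<dots> \<le> e"
      proof -
        have "e * ?N \<le> e * (?N + 1)" using \<open>e > 0\<close> by (intro mult_left_mono) linarith+
        then have "e * ?N / (?N + 1) \<le> e" by (subst pos_divide_le_eq[OF N1])
        then show ?thesis by (simp only: times_divide_eq_left)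
      qed
      finally show "cmod ?I \<le> 0 + e" by simp
    qed
    then show ?thesis by simp
  qed
  (* The indicator of a closed set is a bounded limit of continuous functions of the distance. *)
  have closed0: "(\<integral>x. F x * complex_of_real (indicator D (Phi x)) \<partial>M) = 0" if D: "closed D" for D
  proof (cases "D = {}")
    case False
    define G where "G n z = max 0 (1 - real n * infdist z D)" for n z
    have Gc: "continuous_on UNIV (G n)" for n unfolding G_def[abs_def] by (intro continuous_intros)
    have [measurable]: "G n \<in> borel_measurable borel" for n by (rule borel_measurable_continuous_onI[OF Gc])
    have [measurable]: "D \<in> sets borel" using D by simp
    have G1: "\<bar>G n z\<bar> \<le> 1" for n z using infdist_nonneg[of z D] by (auto simp: G_def)
    have "(\<lambda>n. \<integral>x. F x * complex_of_real (G n (Phi x)) \<partial>M) \<longlonglongrightarrow> (\<integral>x. F x * complex_of_real (indicator D (Phi x)) \<partial>M)"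
    proof (rule integral_dominated_convergence[where w="\<lambda>x. norm (F x)"])
      show "AE x in M. (\<lambda>n. F x * complex_of_real (G n (Phi x))) \<longlonglongrightarrow> F x * complex_of_real (indicator D (Phi x))"
      proof (rule AE_I2)
        fix x
        have "(\<lambda>n. G n (Phi x)) \<longlonglongrightarrow> indicator D (Phi x)"
        proof (cases "Phi x \<in> D")
          case True
          then show ?thesis using False by (simp add: G_def infdist_zero)
        next
          case False
          then have pos: "infdist (Phi x) D > 0"
            using in_closed_iff_infdist_zero[OF D \<open>D \<noteq> {}\<close>, of "Phi x"] infdist_nonneg[of "Phi x" D] by linarith
          obtain n0 :: nat where n0: "1 / infdist (Phi x) D < real n0" using reals_Archimedean2 by blast
          have "G n (Phi x) = 0" if "n \<ge> n0" for n
          proof -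
            have "1 / infdist (Phi x) D < real n" using n0 that by linarith
            then have "1 < real n * infdist (Phi x) D" using pos by (simp add: field_simps)
            then show ?thesis by (simp add: G_def)
          qed
          then have "eventually (\<lambda>n. G n (Phi x) = indicator D (Phi x)) sequentially"
            using False unfolding eventually_sequentially by auto
          then show ?thesis by (rule tendsto_eventually)
        qed
        from tendsto_of_real[OF this] show "(\<lambda>n. F x * complex_of_real (G n (Phi x))) \<longlonglongrightarrow> F x * complex_of_real (indicator D (Phi x))"
          by (intro tendsto_mult tendsto_const)
      qed
      show "AE x in M. norm (F x * complex_of_real (G n (Phi x))) \<le> norm (F x)" for n
        using mult_left_mono[OF G1, of "norm (F _)"] by (auto simp: norm_mult)
    qed (use Fi in \<open>auto intro: integrable_norm\<close>)
    then have "(\<lambda>n::nat. 0) \<longlonglongrightarrow> (\<integral>x. F x * complex_of_real (indicator D (Phi x)) \<partial>M)"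
      by (simp only: cont0[OF Gc])
    from LIMSEQ_unique[OF this tendsto_const] show ?thesis .
  qed simp
  have Fi2: "integrable M (\<lambda>x. F x * complex_of_real (indicator D (Phi x)))" if [measurable]: "D \<in> sets borel" for D
    by (rule bounded_integrable[where B=1]) (auto simp: indicator_def)
  have borel0: "(\<integral>x. F x * complex_of_real (indicator D (Phi x)) \<partial>M) = 0" if "D \<in> sets borel" for D
  proof -
    have sb: "sets (borel :: ((real ^ 'n) \<times> real) measure) = sigma_sets UNIV (Collect closed)"
      by (subst borel_eq_closed) simp
    have "Int_stable (Collect closed :: ((real ^ 'n) \<times> real) set set)" by (auto simp: Int_stable_def)
    moreover have "Collect closed \<subseteq> Pow (UNIV :: ((real ^ 'n) \<times> real) set)" by simp
    moreover have "D \<in> sigma_sets UNIV (Collect closed)" using that unfolding sb .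
    ultimately show ?thesis
    proof (induction rule: sigma_sets_induct_disjoint[consumes 3, case_names basic empty compl union])
      case basic
      then show ?case by (simp add: closed0)
    next
      case empty
      show ?case by simp
    next
      case (compl D)
      then have D: "D \<in> sets borel" unfolding sb by simp
      have "(\<integral>x. F x * complex_of_real (indicator (UNIV - D) (Phi x)) \<partial>M)
         = (\<integral>x. F x * complex_of_real (indicator UNIV (Phi x)) - F x * complex_of_real (indicator D (Phi x)) \<partial>M)"
        by (rule Bochner_Integration.integral_cong) (auto simp: indicator_def)
      also have "\<dots> = 0" using compl.IH closed0[OF closed_UNIV] Fi2[OF D] Fi by simp
      finally show ?case .
    next
      case (union D)
      then have D[measurable]: "D i \<in> sets borel" for i unfolding sb by auto
      have part: "(\<integral>x. F x * complex_of_real (indicator (\<Union>i<n. D i) (Phi x)) \<partial>M) = 0" for n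
      proof -
        have "F x * complex_of_real (indicator (\<Union>i<n. D i) (Phi x)) = (\<Sum>i<n. F x * complex_of_real (indicator (D i) (Phi x)))" for x
        proof -
          have "(\<Sum>i<n. indicator (D i) (Phi x)) = (indicator (\<Union>i<n. D i) (Phi x) :: real)"
            by (rule indicator_UN_disjoint[symmetric]) (use union.hyps(1) in \<open>auto simp: disjoint_family_on_def\<close>)
          then show ?thesis by (simp flip: sum_distrib_left of_real_sum)
        qed
        then show ?thesis by (simp add: Bochner_Integration.integral_sum Fi2 union.IH)
      qed
      have "(\<lambda>n. \<integral>x. F x * complex_of_real (indicator (\<Union>i<n. D i) (Phi x)) \<partial>M) \<longlonglongrightarrow> (\<integral>x. F x * complex_of_real (indicator (\<Union>i. D i) (Phi x)) \<partial>M)"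
      proof (rule integral_dominated_convergence[where w="\<lambda>x. norm (F x)"])
        show "AE x in M. (\<lambda>n. F x * complex_of_real (indicator (\<Union>i<n. D i) (Phi x))) \<longlonglongrightarrow> F x * complex_of_real (indicator (\<Union>i. D i) (Phi x))"
        proof (rule AE_I2)
          fix x
          have "(\<lambda>n. indicator (\<Union>i<n. D i) (Phi x) :: real) \<longlonglongrightarrow> indicator (\<Union>i. D i) (Phi x)"
          proof (cases "Phi x \<in> (\<Union>i. D i)")
            case True
            then obtain i where i: "Phi x \<in> D i" by auto
            show ?thesis
              by (rule tendsto_eventually, rule eventually_mono[OF eventually_gt_at_top[of i]]) (use i in \<open>auto simp: indicator_def\<close>)
          next
            case False
            then show ?thesis by (auto simp: indicator_def)
          qed
          from tendsto_of_real[OF this] show "(\<lambda>n. F x * complex_of_real (indicator (\<Union>i<n. D i) (Phi x))) \<longlonglongrightarrow> F x * complex_of_real (indicator (\<Union>i. D i) (Phi x))"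
            by (intro tendsto_mult tendsto_const)
        qed
        show "AE x in M. norm (F x * complex_of_real (indicator (\<Union>i<n. D i) (Phi x))) \<le> norm (F x)" for n
          by (auto simp: indicator_def norm_mult)
        show "(\<lambda>x. F x * complex_of_real (indicator (\<Union>i. D i) (Phi x))) \<in> borel_measurable M"
          by (rule borel_measurable_integrable[OF Fi2[OF sets.countable_UN]]) (use D in auto)
        show "(\<lambda>x. F x * complex_of_real (indicator (\<Union>i<n. D i) (Phi x))) \<in> borel_measurable M" for n
          by (rule borel_measurable_integrable[OF Fi2[OF sets.finite_UN]]) (use D in auto)
      qed (rule integrable_norm[OF Fi])
      then have "(\<lambda>n::nat. 0) \<longlonglongrightarrow> (\<integral>x. F x * complex_of_real (indicator (\<Union>i. D i) (Phi x)) \<partial>M)" by (simp only: part)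
      from LIMSEQ_unique[OF this tendsto_const] show ?case .
    qed
  qed
  have set0: "(\<integral>x. complex_of_real (indicator A x) * F x \<partial>M) = 0" if [measurable]: "A \<in> sets borel" for A
  proof -
    (* The preimage of ?D under Phi is A, because fst / snd inverts Phi. *)
    let ?D = "(\<lambda>z :: (real ^ 'n) \<times> real. fst z /\<^sub>R snd z) -` A"
    have m: "(\<lambda>z :: (real ^ 'n) \<times> real. fst z /\<^sub>R snd z) \<in> borel_measurable borel"
      unfolding borel_prod[symmetric] by measurable
    have "?D \<in> sets borel" using measurable_sets[OF m, of A] by simp
    from borel0[OF this] show ?thesis by (simp add: Phi_def indicator_def mult.commute)
  qed
  have Fb[measurable]: "F \<in> borel_measurable borel" using Fm by simp
  let ?F1 = "\<lambda>x. dunkl_weight R k a x *\<^sub>R F x"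
  have "integrable lborel ?F1"
    using Fi dunkl_weight_nonneg unfolding dunkl_measure_def by (subst (asm) integrable_density) auto
  then have "AE x in lborel. ?F1 x = 0"
  proof (rule sigma_finite_measure.density_zero[OF lborel.sigma_finite_measure_axioms])
    fix A :: "(real ^ 'n) set" assume "A \<in> sets lborel"
    then have [measurable]: "A \<in> sets borel" by simp
    have "(\<integral>x. complex_of_real (indicator A x) * F x \<partial>M) = (\<integral>x. dunkl_weight R k a x *\<^sub>R (complex_of_real (indicator A x) * F x) \<partial>lborel)"
      unfolding dunkl_measure_def using dunkl_weight_nonneg by (subst integral_density) auto
    then show "set_lebesgue_integral lborel A ?F1 = 0"
      using set0[of A] by (simp add: set_lebesgue_integral_def scaleR_conv_of_real mult.left_commute)
  qed
  then have "AE x in M. F x = 0"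
    unfolding dunkl_measure_def by (subst AE_density) (auto elim: eventually_mono)
  then show ?thesis unfolding l2_eq_def F_def by (auto elim: eventually_mono)
qed

theorem eigenfunctions_total:
  assumes f: "f \<in> l2 M"
    and z: "\<And>\<beta> j l. l2_inner M f (eigenfun l (sum \<beta> UNIV - 2 * j) (harmonic_part \<beta> j)) = 0"
  shows "l2_eq M f (\<lambda>x. 0)"
  by (rule annihilates_imp_zero[OF f annihilates_all[OF f annihilates_start[OF f z]]]) (use a_pos in auto)

section \<open>Diagonalisation of the Hamiltonian\<close>

definition eigenspace :: "nat \<times> nat \<Rightarrow> (real ^ 'n \<Rightarrow> complex) set" where
  "eigenspace = (\<lambda>(l, m). {eigenfun l m p | p. p \<in> dunkl_harmonics P k m})"

definition total_index :: "nat \<Rightarrow> ('n \<Rightarrow> nat) \<times> nat \<times> nat" where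
  "total_index n = from_nat n"

definition degrees :: "nat \<Rightarrow> nat \<times> nat" where
  "degrees n = (case total_index n of (\<beta>, j, l) \<Rightarrow> (l, sum \<beta> UNIV - 2 * j))"

text \<open>An enumeration, over all multi-indices \<open>\<beta>\<close>, of the eigenfunctions belonging to the harmonic parts of
  the monomials; \<open>degrees\<close> records the pair \<open>(l, m)\<close>.\<close>

definition total_family :: "nat \<Rightarrow> real ^ 'n \<Rightarrow> complex" where
  "total_family n = (case total_index n of (\<beta>, j, l) \<Rightarrow> eigenfun l (sum \<beta> UNIV - 2 * j) (harmonic_part \<beta> j))"

definition basis :: "nat \<Rightarrow> real ^ 'n \<Rightarrow> complex" where
  "basis = gram_schmidt M total_family"

definition spectrum :: "nat \<Rightarrow> real" where
  "spectrum j = (case degrees j of (l, m) \<Rightarrow> eigenval l m)"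

lemma eigenspace_comb:
  assumes "f \<in> eigenspace c" "g \<in> eigenspace c"
  shows "(\<lambda>x. b * f x + d * g x) \<in> eigenspace c"
proof -
  obtain l m where c: "c = (l, m)" by (cases c)
  obtain p q where pq: "p \<in> dunkl_harmonics P k m" "q \<in> dunkl_harmonics P k m" "f = eigenfun l m p" "g = eigenfun l m q"
    using assms by (auto simp: eigenspace_def c)
  have "(\<lambda>x. b * f x + d * g x) = eigenfun l m (\<lambda>x. b * p x + d * q x)"
    by (simp add: pq eigenfun_def fun_eq_iff algebra_simps)
  then show ?thesis using dunkl_harmonics_comb[OF pq(1,2)] by (auto simp: eigenspace_def c)
qed

lemma eigenspace_l2: "eigenspace c \<subseteq> l2 M"
  by (cases c) (auto simp: eigenspace_def eigenfun_l2)

lemma eigenspace_zero: "(\<lambda>x. 0) \<in> eigenspace c"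
proof -
  obtain l m where c: "c = (l, m)" by (cases c)
  have "(\<lambda>x. 0) = eigenfun l m (\<lambda>x. 0)" by (simp add: eigenfun_def fun_eq_iff)
  then show ?thesis using dunkl_harmonics_zero by (auto simp: eigenspace_def c)
qed

lemma eigenspace_orthogonal: "c \<noteq> c' \<Longrightarrow> f \<in> eigenspace c \<Longrightarrow> g \<in> eigenspace c' \<Longrightarrow> l2_inner M f g = 0"
  by (cases c; cases c') (auto simp: eigenspace_def intro!: eigenfun_orthogonal)

lemma total_family_eigenspace: "total_family n \<in> eigenspace (degrees n)"
  by (auto simp: total_family_def degrees_def eigenspace_def split: prod.split intro: harmonic_part)

lemma
  shows basis_eigenspace: "basis n \<in> eigenspace (degrees n)"
    and basis_orthogonal: "i \<noteq> j \<Longrightarrow> l2_inner M (basis i) (basis j) = 0"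
    and basis_norm: "l2_inner M (basis j) (basis j) \<in> {0, 1}"
    and basis_spans: "f \<in> l2 M \<Longrightarrow> (\<And>j. l2_inner M f (basis j) = 0) \<Longrightarrow> l2_inner M f (total_family n) = 0"
proof -
  note graded = eigenspace_l2 eigenspace_zero eigenspace_comb eigenspace_orthogonal total_family_eigenspace
  show "basis n \<in> eigenspace (degrees n)"
    unfolding basis_def by (rule graded_gram_schmidt(1)[where S=eigenspace]) (rule graded; assumption)+
  show "l2_inner M (basis i) (basis j) = 0" if "i \<noteq> j"
    unfolding basis_def
    by (rule graded_gram_schmidt(2)[where S=eigenspace and cl=degrees and z=total_family]) (rule that graded; assumption)+
  show "l2_inner M (basis j) (basis j) \<in> {0, 1}"
    unfolding basis_def
    by (rule graded_gram_schmidt(3)[where S=eigenspace and cl=degrees and z=total_family]) (rule graded; assumption)+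
  show "l2_inner M f (total_family n) = 0" if f: "f \<in> l2 M" and "\<And>j. l2_inner M f (basis j) = 0"
  proof -
    have z: "l2_inner M f (gram_schmidt M total_family j) = 0" for j using that(2)[of j] by (simp add: basis_def)
    show ?thesis
      by (rule graded_gram_schmidt(4)[where S=eigenspace and cl=degrees and z=total_family]) (rule f z graded; assumption)+
  qed
qed

sublocale l2_system M basis
proof
  show "basis j \<in> l2 M" for j using basis_eigenspace eigenspace_l2 by blast
  show "l2_inner M (basis i) (basis j) = 0" if "i \<noteq> j" for i j using that by (rule basis_orthogonal)
  show "l2_inner M (basis j) (basis j) \<in> {0, 1}" for j by (rule basis_norm)
  fix f assume f: "f \<in> l2 M" "\<And>j. l2_inner M f (basis j) = 0"
  show "l2_eq M f (\<lambda>x. 0)"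
  proof (rule eigenfunctions_total[OF f(1)])
    fix \<beta> j l
    have "total_index (to_nat (\<beta>, j, l)) = (\<beta>, j, l)" by (simp add: total_index_def)
    then have "total_family (to_nat (\<beta>, j, l)) = eigenfun l (sum \<beta> UNIV - 2 * j) (harmonic_part \<beta> j)"
      by (simp add: total_family_def)
    then show "l2_inner M f (eigenfun l (sum \<beta> UNIV - 2 * j) (harmonic_part \<beta> j)) = 0"
      using basis_spans[OF f, of "to_nat (\<beta>, j, l)"] by simp
  qed
qed

lemma eigenspace_hamiltonian:
  assumes "f \<in> eigenspace c"
  shows "twice_dunkl f" "x \<noteq> 0 \<Longrightarrow> dunkl_hamiltonian P k a f x = complex_of_real (case c of (l, m) \<Rightarrow> eigenval l m) * f x"
  using assms eigenfun_hamiltonian by (cases c; auto simp: eigenspace_def)+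

text \<open>For classes different from that of \<open>basis j\<close> both sides vanish by orthogonality.\<close>

lemma eigenspace_coef:
  assumes "f \<in> eigenspace c"
  shows "complex_of_real (case c of (l, m) \<Rightarrow> eigenval l m) * coef f j = complex_of_real (spectrum j) * coef f j"
proof (cases "c = degrees j")
  case True then show ?thesis by (simp add: spectrum_def)
next
  case False
  then have "coef f j = 0" by (rule eigenspace_orthogonal[OF _ assms basis_eigenspace])
  then show ?thesis by simp
qed

lemma laguerre_functions_eigenspace: "laguerre_functions P k a = (\<Union>c. eigenspace c)"
  unfolding laguerre_functions_eq eigenspace_def by force

text \<open>The eigenvalue equation may fail at the origin, which is a null set; this is why it enters through
  equality almost everywhere.\<close>

theorem hamiltonian_closure: "l2_closure M (hamiltonian_graph P k a) = diag_graph spectrum"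
proof (rule l2_closure_diag)
  fix v g j assume vg: "(v, g) \<in> hamiltonian_graph P k a" "v \<in> l2 M" "g \<in> l2 M"
  then obtain B b where B: "finite B" "B \<subseteq> laguerre_functions P k a" and v: "v = (\<lambda>x. \<Sum>h\<in>B. b h * h x)"
    and g: "g = dunkl_hamiltonian P k a v"
    unfolding hamiltonian_graph_def complex_span_def by blast
  have "\<forall>h\<in>B. \<exists>c. h \<in> eigenspace c" using B(2) laguerre_functions_eigenspace by blast
  then obtain c where c: "\<And>h. h \<in> B \<Longrightarrow> h \<in> eigenspace (c h)" by metis
  define ev where "ev h = complex_of_real (case c h of (l, m) \<Rightarrow> eigenval l m)" for h
  have l2B: "h \<in> B \<Longrightarrow> h \<in> l2 M" for h using c eigenspace_l2 by blast
  have "g x = (\<Sum>h\<in>B. (b h * ev h) * h x)" if x: "x \<noteq> 0" for x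
  proof -
    have "g x = (\<Sum>h\<in>B. b h * dunkl_hamiltonian P k a h x)"
      unfolding g v using hamiltonian_sum[OF B(1), of "\<lambda>h. h" b] eigenspace_hamiltonian(1)[OF c] x by blast
    also have "\<dots> = (\<Sum>h\<in>B. (b h * ev h) * h x)"
      by (rule sum.cong) (auto simp: eigenspace_hamiltonian(2)[OF c x] ev_def)
    finally show ?thesis .
  qed
  then have "l2_eq M g (\<lambda>x. \<Sum>h\<in>B. (b h * ev h) * h x)"
    unfolding l2_eq_def using AE_M_nonzero by (auto elim!: eventually_mono)
  then have "coef g j = coef (\<lambda>x. \<Sum>h\<in>B. (b h * ev h) * h x) j"
    by (rule coef_cong[OF _ vg(3)]) (intro l2_sum l2_scale l2B)
  also have "\<dots> = (\<Sum>h\<in>B. (b h * ev h) * coef h j)" by (rule l2_inner_sum_left[OF l2B e_l2])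
  also have "\<dots> = (\<Sum>h\<in>B. complex_of_real (spectrum j) * (b h * coef h j))"
  proof (rule sum.cong[OF refl])
    fix h assume "h \<in> B"
    from eigenspace_coef[OF c[OF this], of j]
    show "(b h * ev h) * coef h j = complex_of_real (spectrum j) * (b h * coef h j)"
      unfolding ev_def by (simp add: mult.assoc mult.left_commute)
  qed
  also have "\<dots> = complex_of_real (spectrum j) * coef v j"
    unfolding v sum_distrib_left[symmetric] using l2_inner_sum_left[OF l2B e_l2, of B] by simp
  finally show "coef g j = complex_of_real (spectrum j) * coef v j" .
next
  fix n :: nat and c :: "nat \<Rightarrow> complex"
  let ?v = "\<lambda>x. \<Sum>j<n. c j * basis j x" and ?w = "\<lambda>x. \<Sum>j<n. complex_of_real (spectrum j) * c j * basis j x"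
  let ?g = "dunkl_hamiltonian P k a ?v"
  have "?v \<in> complex_span (laguerre_functions P k a)"
  proof (rule complex_span_sum)
    show "basis j \<in> laguerre_functions P k a" for j
      unfolding laguerre_functions_eigenspace using basis_eigenspace by blast
  qed simp
  then have graph: "(?v, ?g) \<in> hamiltonian_graph P k a" unfolding hamiltonian_graph_def by blast
  have eq: "?g x = ?w x" if x: "x \<noteq> 0" for x
  proof -
    have "?g x = (\<Sum>j<n. c j * dunkl_hamiltonian P k a (basis j) x)"
      using hamiltonian_sum[of "{..<n}" basis c] eigenspace_hamiltonian(1)[OF basis_eigenspace] x by blast
    then show ?thesis
      by (simp add: eigenspace_hamiltonian(2)[OF basis_eigenspace x] spectrum_def mult_ac)
  qed
  have AEeq: "l2_eq M ?g ?w" unfolding l2_eq_def using AE_M_nonzero eq by (auto elim!: eventually_mono)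
  have wl2: "?w \<in> l2 M" by (intro l2_sum l2_scale e_l2)
  note [measurable] = l2D(1)[OF wl2]
  have "?g = (\<lambda>x. if x = 0 then ?g 0 else ?w x)" using eq by auto
  moreover have "(\<lambda>x. if x = 0 then ?g 0 else ?w x) \<in> borel_measurable M" by measurable
  ultimately have "?g \<in> borel_measurable M" by simp
  then have "?g \<in> l2 M" using AEeq by (intro l2_cong_AE[OF wl2]) (auto simp: l2_eq_def elim: eventually_mono)
  then show "\<exists>g. (?v, g) \<in> hamiltonian_graph P k a \<and> g \<in> l2 M \<and> l2_eq M g ?w" using graph AEeq by blast
qed

section \<open>The inversion formula\<close>

definition phase :: "nat \<Rightarrow> complex" where
  "phase j = (case degrees j of (l, m) \<Rightarrow> (- \<i>) ^ (2 * l + N0 * m))"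

lemma norm_phase: "cmod (phase j) = 1"
  by (simp add: phase_def norm_power split: prod.split)

abbreviation F :: "(real ^ 'n \<Rightarrow> complex) \<Rightarrow> real ^ 'n \<Rightarrow> complex" where "F \<equiv> ka_fourier R P k a"

text \<open>The normalising phase cancels the part of the eigenvalue that does not depend on \<open>l\<close> and \<open>m\<close>.\<close>

lemma phase_eq:
  "exp (\<i> * complex_of_real (pi / 2 * ((2 * K + real CARD('n) + a - 2) / a))) *
   exp (\<i> * complex_of_real (pi / (2 * a) * spectrum j)) = phase j"
proof -
  obtain l m where d: "degrees j = (l, m)" by (cases "degrees j")
  have "real N0 = 2 / a" using N0 a_pos by (simp add: field_simps)
  then have "pi / 2 * ((2 * K + real CARD('n) + a - 2) / a) + pi / (2 * a) * spectrum j = - (pi / 2) * real (2 * l + N0 * m)"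
    using a_pos by (simp add: spectrum_def d eigenval_def lambda_kam_def field_simps)
  then have "exp (\<i> * complex_of_real (pi / 2 * ((2 * K + real CARD('n) + a - 2) / a))) *
      exp (\<i> * complex_of_real (pi / (2 * a) * spectrum j)) = exp (\<i> * complex_of_real (- (pi / 2) * real (2 * l + N0 * m)))"
    by (simp only: exp_add[symmetric] distrib_left[symmetric] of_real_add[symmetric])
  also have "\<dots> = exp (of_nat (2 * l + N0 * m) * (\<i> * complex_of_real (- (pi / 2))))"
    by (simp add: mult_ac)
  also have "\<dots> = exp (\<i> * complex_of_real (- (pi / 2))) ^ (2 * l + N0 * m)" by (rule exp_of_nat_mult)
  also have "exp (\<i> * complex_of_real (- (pi / 2))) = - \<i>"
    by (simp only: cis_conv_exp[symmetric]) (simp add: complex_eq_iff)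
  finally show ?thesis by (simp add: phase_def d)
qed

lemma fourier_diag:
  assumes "f \<in> l2 M"
  shows "F f \<in> l2 M" "coef (F f) j = phase j * coef f j"
proof -
  let ?\<phi> = "\<lambda>t. exp (\<i> * complex_of_real (pi / (2 * a) * t))"
  let ?U = "functional_calculus M (diag_graph spectrum) ?\<phi>"
  let ?c = "exp (\<i> * complex_of_real (pi / 2 * ((2 * K + real CARD('n) + a - 2) / a)))"
  have m: "?\<phi> \<in> borel_measurable borel" by (intro borel_measurable_continuous_onI continuous_intros)
  have b: "cmod (?\<phi> t) \<le> 1" for t by (simp add: norm_exp_i_times del: of_real_mult)
  note U = functional_calculus_diag[where \<mu>=spectrum, OF m b]
  have F: "F f = (\<lambda>x. ?c * ?U f x)" by (simp add: ka_fourier_def hamiltonian_closure fun_eq_iff)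
  have Ul2: "?U f \<in> l2 M" using U(1) assms by (simp add: l2_operator_def)
  then show "F f \<in> l2 M" unfolding F by (rule l2_scale)
  show "coef (F f) j = phase j * coef f j"
    unfolding F l2_inner_scale_left U(2)[OF assms] phase_eq[symmetric] by (simp only: mult.assoc)
qed

lemma M_minus: "distr M borel uminus = M"
proof -
  have u: "distr lborel borel uminus = (lborel :: (real ^ 'n) measure)"
    by (rule lborel_linear_isometry) (auto intro: linear_uminus)
  have w: "dunkl_weight R k a (- x) = dunkl_weight R k a x" for x by (simp add: dunkl_weight_eq weight_minus)
  have "density (distr lborel borel uminus) (\<lambda>x. ennreal (dunkl_weight R k a x))
     = distr (density lborel (\<lambda>x. ennreal (dunkl_weight R k a (- x)))) borel uminus"
    by (rule density_distr) auto
  then show ?thesis unfolding u w dunkl_measure_def by simp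
qed

text \<open>Members of the basis have the parity of their degree, and the measure is invariant under
  \<open>x \<mapsto> -x\<close>.\<close>

lemma minus_l2:
  assumes "f \<in> l2 M"
  shows "(\<lambda>x. f (- x)) \<in> l2 M" "coef (\<lambda>x. f (- x)) j = (- 1) ^ snd (degrees j) * coef f j"
proof -
  have fm[measurable]: "f \<in> borel_measurable borel" using l2D(1)[OF assms] by simp
  have "integrable (distr M borel uminus) (\<lambda>x. (cmod (f x))\<^sup>2)" using l2D(2)[OF assms] by (simp add: M_minus)
  then have "integrable M (\<lambda>x. (cmod (f (- x)))\<^sup>2)" by (subst (asm) integrable_distr_eq) auto
  then show "(\<lambda>x. f (- x)) \<in> l2 M" by (intro l2I) auto
  obtain l m where d: "degrees j = (l, m)" by (cases "degrees j")
  obtain p where p: "p \<in> dunkl_harmonics P k m" "basis j = eigenfun l m p"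
    using basis_eigenspace[of j] by (auto simp: eigenspace_def d)
  have bm: "basis j (- x) = (- 1) ^ m * basis j x" for x
    using hpoly_homogeneous[of m p "-1" x] p(1) by (simp add: p(2) eigenfun_def dunkl_harmonics_iff)
  have [measurable]: "basis j \<in> borel_measurable borel" using l2D(1)[OF e_l2[of j]] by simp
  have "coef (\<lambda>x. f (- x)) j = (\<integral>x. f (- x) * cnj (basis j x) \<partial>M)" by (simp add: l2_inner_def)
  also have "\<dots> = (\<integral>x. f (- x) * cnj (basis j x) \<partial>distr M borel uminus)" by (simp add: M_minus)
  also have "\<dots> = (\<integral>x. f (- (- x)) * cnj (basis j (- x)) \<partial>M)" by (rule integral_distr) auto
  also have "\<dots> = (\<integral>x. (- 1) ^ m * (f x * cnj (basis j x)) \<partial>M)" by (simp add: bm mult.left_commute)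
  also have "\<dots> = (- 1) ^ m * coef f j" by (simp only: l2_inner_def integral_mult_right_zero)
  finally show "coef (\<lambda>x. f (- x)) j = (- 1) ^ snd (degrees j) * coef f j" by (simp add: d)
qed

lemma phase_square: "phase j ^ 2 = (- 1) ^ (N0 * snd (degrees j))"
proof -
  obtain l m where d: "degrees j = (l, m)" by (cases "degrees j")
  have "phase j ^ 2 = ((- \<i>) ^ 2) ^ (2 * l + N0 * m)" by (simp only: phase_def d prod.case power_mult[symmetric] mult.commute)
  also have "(- \<i>) ^ 2 = (- 1 :: complex)" by simp
  also have "(- 1 :: complex) ^ (2 * l + N0 * m) = (- 1) ^ (N0 * m)" by (simp only: power_add power_mult) simp
  finally show ?thesis by (simp add: d)
qed

theorem fourier_unitary: "l2_unitary M F"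
  by (rule diag_unitary(1)[where F=F and \<omega>=phase, OF fourier_diag norm_phase])

lemma fourier_inverse:
  assumes "f \<in> l2 M"
  shows "l2_inverse M F f \<in> l2 M" "coef (l2_inverse M F f) j = cnj (phase j) * coef f j"
proof -
  show "l2_inverse M F f \<in> l2 M"
    by (rule diag_unitary(2)[where \<omega>=phase]) (rule assms norm_phase fourier_diag; assumption)+
  show "coef (l2_inverse M F f) j = cnj (phase j) * coef f j"
    by (rule diag_unitary(3)[where \<omega>=phase]) (rule assms norm_phase fourier_diag; assumption)+
qed

lemma fourier_power_identity_iff:
  "l2_is_identity M (F ^^ n) \<longleftrightarrow> (\<forall>f\<in>l2 M. \<forall>j. phase j ^ n * coef f j = coef f j)"
  by (rule diag_identity_iff[where \<omega>=phase]) (rule fourier_diag; assumption)+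

text \<open>The inverse of a phase is its cube, since its fourth power is \<open>1\<close>.\<close>

lemma cnj_phase: "cnj (phase j) = phase j * (- 1) ^ (N0 * snd (degrees j))"
proof -
  have 1: "cnj (phase j) * phase j = 1"
    using norm_phase[of j] by (simp add: complex_norm_square[symmetric] mult.commute)
  have 2: "phase j ^ 2 * phase j ^ 2 = 1"
    unfolding phase_square by (simp flip: power_add mult_2)
  have "cnj (phase j) = cnj (phase j) * (phase j ^ 2 * phase j ^ 2)" unfolding 2 by simp
  also have "\<dots> = (cnj (phase j) * phase j) * (phase j * phase j ^ 2)" by (simp only: power2_eq_square mult_ac)
  also have "\<dots> = phase j * phase j ^ 2" unfolding 1 by simp
  finally show ?thesis unfolding phase_square .
qed

theorem fourier_involutive:
  assumes "even N0"
  shows "l2_is_identity M (F \<circ> F)" "f \<in> l2 M \<Longrightarrow> AE x in M. l2_inverse M F f x = F f x"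
proof -
  have p2: "phase j ^ 2 = 1" for j unfolding phase_square using assms by simp
  have "l2_is_identity M (F ^^ 2)"
    unfolding fourier_power_identity_iff using p2 by simp
  then show "l2_is_identity M (F \<circ> F)" by (simp add: numeral_2_eq_2)
  assume f: "f \<in> l2 M"
  have "l2_eq M (l2_inverse M F f) (F f)"
    by (rule coef_eqI) (use f assms in \<open>auto simp: fourier_inverse fourier_diag cnj_phase\<close>)
  then show "AE x in M. l2_inverse M F f x = F f x" by (simp add: l2_eq_def)
qed

lemma AE_M_I:
  assumes "AE x in M. Q x" shows "AE x in lborel. Q x"
proof -
  have "AE x in lborel. 0 < ennreal (dunkl_weight R k a x) \<longrightarrow> Q x"
    using assms unfolding dunkl_measure_def by (subst (asm) AE_density) auto
  moreover have "AE x in lborel. x \<noteq> (0 :: real ^ 'n)" by (rule AE_lborel_singleton)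
  ultimately show ?thesis using AE_regular
  proof eventually_elim
    fix x assume x: "0 < ennreal (dunkl_weight R k a x) \<longrightarrow> Q x" "x \<noteq> 0" "\<forall>\<alpha>\<in>R. \<alpha> \<bullet> x \<noteq> 0"
    then have "0 < weight x" unfolding weight_def by (intro prod_pos) auto
    then have "0 < dunkl_weight R k a x" using x(2) unfolding dunkl_weight_eq by (intro mult_pos_pos) auto
    then show "Q x" using x(1) by simp
  qed
qed

text \<open>If the square were the identity, then all functions would be even almost everywhere; an odd function
  that vanishes only on a hyperplane refutes this. First and third powers reduce to the square.\<close>

theorem fourier_order_four:
  assumes "odd N0"
  shows "l2_has_order M F 4" "f \<in> l2 M \<Longrightarrow> AE x in M. l2_inverse M F f x = F f (- x)"
proof -
  have p2: "phase j ^ 2 = (- 1) ^ snd (degrees j)" for j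
    unfolding phase_square power_mult using assms by simp
  have p4: "phase j ^ 4 = 1" for j
  proof -
    have "phase j ^ 4 = (phase j ^ 2) ^ 2" by (simp flip: power_mult)
    then show ?thesis unfolding p2 by (simp flip: power_mult add: mult.commute)
  qed
  note id_iff = fourier_power_identity_iff
  have n2: "\<not> l2_is_identity M (F ^^ 2)"
  proof
    assume id2: "l2_is_identity M (F ^^ 2)"
    obtain \<xi> :: "real ^ 'n" where xi: "\<xi> \<noteq> 0" using nonempty_Basis nonzero_Basis by blast
    (* The factor 1 matches the shape in which linear forms are generated. *)
    let ?p = "\<lambda>x. complex_of_real (x \<bullet> \<xi>) * 1"
    let ?f = "radial_exp ?p 1 1"
    have f: "?f \<in> l2 M" by (rule radial_exp_l2[OF hpoly_linear[OF hpoly_const]]) simp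
    have odd: "?f (- x) = - ?f x" for x by (simp add: radial_exp_def)
    have "l2_eq M (\<lambda>x. ?f (- x)) ?f"
    proof (rule coef_eqI)
      fix j show "coef (\<lambda>x. ?f (- x)) j = coef ?f j"
        using id2 f unfolding id_iff p2 minus_l2(2)[OF f] by blast
    qed (use f minus_l2 in auto)
    then have "AE x in M. ?f x = 0" unfolding l2_eq_def odd by (auto elim!: eventually_mono)
    then have "AE x in lborel. ?f x = 0" by (rule AE_M_I)
    moreover have "AE x in lborel. \<xi> \<bullet> x \<noteq> 0" by (rule AE_inner_nonzero[OF xi])
    ultimately have "AE x in (lborel :: (real ^ 'n) measure). False"
      by eventually_elim (simp add: radial_exp_def inner_commute)
    then have "ae_filter (lborel :: (real ^ 'n) measure) = bot" by (simp only: trivial_limit_def)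
    then show False by (simp add: ae_filter_eq_bot_iff)
  qed
  have n1: "\<not> l2_is_identity M (F ^^ 1)"
  proof
    assume 1: "l2_is_identity M (F ^^ 1)"
    have "phase j ^ 2 * coef f j = coef f j" if "f \<in> l2 M" for f j
    proof -
      have *: "phase j * coef f j = coef f j" using 1 that unfolding id_iff power_one_right by blast
      show ?thesis by (simp only: power2_eq_square mult.assoc *)
    qed
    then show False using n2 unfolding id_iff by blast
  qed
  have n3: "\<not> l2_is_identity M (F ^^ 3)"
  proof
    assume 3: "l2_is_identity M (F ^^ 3)"
    have "phase j ^ 1 * coef f j = coef f j" if f: "f \<in> l2 M" for f j
    proof -
      have "phase j ^ 3 * coef f j = coef f j" using 3 f unfolding id_iff by blast
      then have "phase j * coef f j = phase j ^ 4 * coef f j" by (simp add: numeral_eq_Suc mult.assoc)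
      then show ?thesis by (simp add: p4)
    qed
    then show False using n1 unfolding id_iff by blast
  qed
  show "l2_has_order M F 4"
    unfolding l2_has_order_def
  proof (intro conjI allI impI)
    show "l2_is_identity M (F ^^ 4)" unfolding id_iff by (simp add: p4)
    fix j :: nat assume "0 < j \<and> j < 4"
    then have "j = 1 \<or> j = 2 \<or> j = 3" by auto
    then show "\<not> l2_is_identity M (F ^^ j)" using n1 n2 n3 by blast
  qed simp
  assume f: "f \<in> l2 M"
  have pow: "(- 1 :: complex) ^ (N0 * i) = (- 1) ^ i" for i unfolding power_mult using assms by simp
  have "l2_eq M (l2_inverse M F f) (\<lambda>x. F f (- x))"
    by (rule coef_eqI) (use f fourier_diag in \<open>auto simp: fourier_inverse minus_l2 cnj_phase pow\<close>)
  then show "AE x in M. l2_inverse M F f x = F f (- x)" by (simp add: l2_eq_def)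
qed

end

theorem theorem5p3:
  fixes R P :: "(real ^ 'n) set" and k :: "real ^ 'n \<Rightarrow> real"
  assumes "reduced_root_system R"
    and "positive_subsystem R P"
    and "multiplicity_function R k"
    and "\<forall>\<alpha>\<in>R. 0 \<le> k \<alpha>"
  shows
    "(\<forall>r::nat. 0 < r \<longrightarrow> 2 * mult_index P k + real CARD('n) > 2 - 1 / real r \<longrightarrow>
       (let a = 1 / real r; M = dunkl_measure R k a; F = ka_fourier R P k a in
          l2_unitary M F \<and> l2_is_identity M (F \<circ> F) \<and>
          (\<forall>f\<in>l2 M. AE x in M. l2_inverse M F f x = F f x))) \<and>
     (\<forall>r::nat. 2 * mult_index P k + real CARD('n) > 2 - 2 / (2 * real r + 1) \<longrightarrow>
       (let a = 2 / (2 * real r + 1); M = dunkl_measure R k a; F = ka_fourier R P k a in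
          l2_unitary M F \<and> l2_has_order M F 4 \<and>
          (\<forall>f\<in>l2 M. AE x in M. l2_inverse M F f x = F f (- x))))"
proof (intro conjI allI impI)
  fix r :: nat assume r: "0 < r" "2 * mult_index P k + real CARD('n) > 2 - 1 / real r"
  (* Here 2 / a = 2 * r is even. *)
  interpret dunkl_integral R P k "1 / real r" "2 * r"
    by unfold_locales (use assms r in auto)
  show "let a = 1 / real r; M = dunkl_measure R k a; F = ka_fourier R P k a in
          l2_unitary M F \<and> l2_is_identity M (F \<circ> F) \<and>
          (\<forall>f\<in>l2 M. AE x in M. l2_inverse M F f x = F f x)"
    unfolding Let_def using fourier_unitary fourier_involutive by simp
next
  fix r :: nat assume r: "2 * mult_index P k + real CARD('n) > 2 - 2 / (2 * real r + 1)"
  (* Here 2 / a = 2 * r + 1 is odd. *)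
  interpret dunkl_integral R P k "2 / (2 * real r + 1)" "2 * r + 1"
    by unfold_locales (use assms r in \<open>auto simp: field_simps add_pos_nonneg add_nonneg_pos\<close>)
  show "let a = 2 / (2 * real r + 1); M = dunkl_measure R k a; F = ka_fourier R P k a in
          l2_unitary M F \<and> l2_has_order M F 4 \<and>
          (\<forall>f\<in>l2 M. AE x in M. l2_inverse M F f x = F f (- x))"
    unfolding Let_def using fourier_unitary fourier_order_four by simp
qed

end
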